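(* Let $K$ be a convex body in $\mathbb{R}^n$ with centroid at the origin. (i) For all $p\ge 0$, $$as_p(K)\,as_p(K^\circ)\le n^2|K|\,|K^\circ|.$$ (ii) For $-n<p<0$, $$as_p(K)\,as_p(K^\circ)\ge n^2|K|\,|K^\circ|.$$ If $K$ is in addition in $C^2_+$, the inequality in (ii) holds for all $p<-n$.
   Context: Here $n\ge 2$ and $p$ is real. A convex body is a compact convex subset of $\mathbb{R}^n$ with nonempty interior. $|\cdot|$ denotes volume and $\langle\cdot,\cdot\rangle$ the standard inner product. $K\in C^2_+$ means that $\partial K$ is $C^2$ with everywhere strictly positive Gaussian curvature. The polar body is $K^\circ=\{y\in\mathbb{R}^n:\langle x,y\rangle\le 1\ \text{for all } x\in K\}$. For a convex body $L$ containing the origin in its interior, $N_L(x)$ is the outer unit normal to $\partial L$ at $x$, $\kappa_L(x)$ the (generalized) Gaussian curvature of $\partial L$ at $x$ (both exist for almost every $x\in\partial L$), and $\mu_L$ the usual surface area measure on $\partial L$. $L_p$ affine surface area: for real $p\neq -n$, $$as_p(L)=\int_{\partial L}\frac{\kappa_L(x)^{\frac{p}{n+p}}}{\langle x,N_L(x)\rangle^{\frac{n(p-1)}{n+p}}}\,d\mu_L(x),$$ where the integral of this nonnegative function may take the value $+\infty$ (with $0^{a}=+\infty$ for $a<0$, and $\kappa_L^0=1$). *)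

theory Defs
  imports "HOL-Analysis.Analysis"
begin

section \<open>Hausdorff measure and surface area measure\<close>

text \<open>
  Hausdorff measure of integer dimension \<open>k\<close> with the usual normalisation: on \<open>k\<close>-dimensional
  affine subspaces it is \<open>k\<close>-dimensional Lebesgue measure.  The empty set is treated separately
  because \<open>0 ^ 0 = 1\<close>, and unbounded sets must be excluded explicitly because their diameter is
  an unspecified real number.
\<close>

definition hausdorff_gauge :: "nat \<Rightarrow> 'a::metric_space set \<Rightarrow> ennreal" where
  "hausdorff_gauge k U =
     (if U = {} then 0 else ennreal (unit_ball_vol (real k) * (diameter U / 2) ^ k))"

definition hausdorff_pre :: "nat \<Rightarrow> real \<Rightarrow> 'a::metric_space set \<Rightarrow> ennreal" where
  "hausdorff_pre k \<delta> A =
     (INF U \<in> {U :: nat \<Rightarrow> 'a set. A \<subseteq> (\<Union>i. U i) \<and> (\<forall>i. bounded (U i) \<and> diameter (U i) \<le> \<delta>)}.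
        \<Sum>i. hausdorff_gauge k (U i))"

definition hausdorff_outer :: "nat \<Rightarrow> 'a::metric_space set \<Rightarrow> ennreal" where
  "hausdorff_outer k A = (SUP \<delta> \<in> {0<..}. hausdorff_pre k \<delta> A)"

definition hausdorff_measure :: "nat \<Rightarrow> 'a::metric_space measure" where
  "hausdorff_measure k = measure_of UNIV (sets borel) (hausdorff_outer k)"

text \<open>
  \<^const>\<open>measure_of\<close> yields the zero measure if the given set function is not a measure.  The
  lemma \<open>emeasure_hausdorff_measure\<close> below, which rests on Caratheodory's criterion, shows that
  this does not happen here.
\<close>

lemma hausdorff_pre_lower:
  assumes "A \<subseteq> (\<Union>i. U i)" "\<And>i. bounded (U i)" "\<And>i. diameter (U i) \<le> \<delta>"
  shows "hausdorff_pre k \<delta> A \<le> (\<Sum>i. hausdorff_gauge k (U i))"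
  unfolding hausdorff_pre_def using assms by (intro INF_lower) auto

lemma hausdorff_pre_empty:
  assumes "\<delta> > 0"
  shows "hausdorff_pre k \<delta> ({} :: 'a::metric_space set) = 0"
proof -
  have "hausdorff_pre k \<delta> ({} :: 'a set) \<le> (\<Sum>i::nat. hausdorff_gauge k ({} :: 'a set))"
    using assms by (intro hausdorff_pre_lower) (auto simp: diameter_def)
  then show ?thesis by (simp add: hausdorff_gauge_def)
qed

lemma hausdorff_pre_mono: "A \<subseteq> B \<Longrightarrow> hausdorff_pre k \<delta> A \<le> hausdorff_pre k \<delta> B"
  unfolding hausdorff_pre_def by (rule INF_superset_mono) auto

lemma hausdorff_pre_antimono: "\<delta> \<le> \<epsilon> \<Longrightarrow> hausdorff_pre k \<epsilon> A \<le> hausdorff_pre k \<delta> A"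
  unfolding hausdorff_pre_def by (rule INF_superset_mono) (auto intro: order_trans)

lemma hausdorff_pre_subadditive:
  fixes A :: "nat \<Rightarrow> 'a::metric_space set"
  shows "hausdorff_pre k \<delta> (\<Union>i. A i) \<le> (\<Sum>i. hausdorff_pre k \<delta> (A i))"
proof (rule ennreal_le_epsilon)
  fix e :: real assume top: "(\<Sum>i. hausdorff_pre k \<delta> (A i)) < top" and e: "0 < e"
  define c where "c n = ennreal (e * (1/2) ^ Suc n)" for n
  have "\<exists>U. A n \<subseteq> (\<Union>i. U i) \<and> (\<forall>i::nat. bounded (U i) \<and> diameter (U i) \<le> \<delta>) \<and>
           (\<Sum>i. hausdorff_gauge k (U i)) \<le> hausdorff_pre k \<delta> (A n) + c n" for n
  proof -
    have "hausdorff_pre k \<delta> (A n) < top"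
      using ennreal_suminf_lessD[OF top] .
    moreover have "0 < c n" using e by (simp add: c_def)
    ultimately have "hausdorff_pre k \<delta> (A n) < hausdorff_pre k \<delta> (A n) + c n"
      using ennreal_add_left_cancel_less[of "hausdorff_pre k \<delta> (A n)" 0 "c n"] by simp
    then obtain U where "U \<in> {U :: nat \<Rightarrow> 'a set. A n \<subseteq> (\<Union>i. U i) \<and> (\<forall>i. bounded (U i) \<and> diameter (U i) \<le> \<delta>)}"
        "(\<Sum>i. hausdorff_gauge k (U i)) < hausdorff_pre k \<delta> (A n) + c n"
      by (subst (asm) hausdorff_pre_def) (auto simp: INF_less_iff)
    then show ?thesis by (auto intro: less_imp_le)
  qed
  then obtain U where U: "\<And>n. A n \<subseteq> (\<Union>i. U n i)" "\<And>n (i::nat). bounded (U n i)"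
      "\<And>n i. diameter (U n i) \<le> \<delta>"
      "\<And>n. (\<Sum>i. hausdorff_gauge k (U n i)) \<le> hausdorff_pre k \<delta> (A n) + c n"
    by metis
  define V where "V m = (case prod_decode m of (n, i) \<Rightarrow> U n i)" for m
  have "(\<Union>n. A n) \<subseteq> (\<Union>m. V m)"
  proof
    fix x assume "x \<in> (\<Union>n. A n)"
    then obtain n i where "x \<in> U n i" using U(1) by blast
    then have "x \<in> V (prod_encode (n, i))" by (simp add: V_def)
    then show "x \<in> (\<Union>m. V m)" by blast
  qed
  then have "hausdorff_pre k \<delta> (\<Union>i. A i) \<le> (\<Sum>m. hausdorff_gauge k (V m))"
    by (intro hausdorff_pre_lower) (auto simp: V_def U split: prod.split)
  also have "\<dots> = (\<Sum>n. \<Sum>i. hausdorff_gauge k (U n i))"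
  proof -
    have "(\<lambda>m. hausdorff_gauge k (V m)) = (\<lambda>p. hausdorff_gauge k (U (fst p) (snd p))) \<circ> prod_decode"
      by (auto simp: V_def fun_eq_iff split: prod.split)
    moreover have "(\<Sum>m. (\<lambda>p. hausdorff_gauge k (U (fst p) (snd p))) (prod_decode m))
        = (\<Sum>n. \<Sum>i. hausdorff_gauge k (U n i))"
      by (rule suminf_ennreal_2dimen) simp
    ultimately show ?thesis by (simp only: o_def)
  qed
  also have "\<dots> \<le> (\<Sum>n. hausdorff_pre k \<delta> (A n) + c n)"
    by (intro suminf_le U) auto
  also have "\<dots> = (\<Sum>n. hausdorff_pre k \<delta> (A n)) + (\<Sum>n. c n)"
    by (rule suminf_add[symmetric]) auto
  also have "(\<Sum>n. c n) = ennreal e"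
  proof -
    have "(\<lambda>n. e * (1/2) ^ Suc n) sums (e * 1)"
      by (intro sums_mult power_half_series)
    then show ?thesis
      unfolding c_def using e by (subst suminf_ennreal_eq[where x = e]) auto
  qed
  finally show "hausdorff_pre k \<delta> (\<Union>i. A i) \<le> (\<Sum>i. hausdorff_pre k \<delta> (A i)) + ennreal e" .
qed

lemma hausdorff_outer_UN:
  fixes A :: "nat \<Rightarrow> 'a::metric_space set"
  shows "hausdorff_outer k (\<Union>i. A i) \<le> (\<Sum>i. hausdorff_outer k (A i))"
  unfolding hausdorff_outer_def[of k "\<Union>i. A i"]
proof (rule SUP_least)
  fix \<delta> :: real assume \<delta>: "\<delta> \<in> {0<..}"
  have "(\<Sum>i. hausdorff_pre k \<delta> (A i)) \<le> (\<Sum>i. hausdorff_outer k (A i))"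
    unfolding hausdorff_outer_def using \<delta> by (intro suminf_le SUP_upper) auto
  then show "hausdorff_pre k \<delta> (\<Union>i. A i) \<le> (\<Sum>i. hausdorff_outer k (A i))"
    using hausdorff_pre_subadditive order_trans by blast
qed

lemma outer_measure_space_hausdorff_outer: "outer_measure_space UNIV (hausdorff_outer k)"
  unfolding outer_measure_space_def
proof (intro conjI)
  show "positive UNIV (hausdorff_outer k)"
    by (simp add: positive_def hausdorff_outer_def hausdorff_pre_empty cong: SUP_cong_simp)
  show "increasing UNIV (hausdorff_outer k)"
    unfolding increasing_def hausdorff_outer_def
    by (intro ballI impI SUP_mono) (use hausdorff_pre_mono in blast)
  show "countably_subadditive UNIV (hausdorff_outer k)"
    unfolding countably_subadditive_def using hausdorff_outer_UN by blast
qed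

lemma hausdorff_outer_mono: "A \<subseteq> B \<Longrightarrow> hausdorff_outer k A \<le> hausdorff_outer k B"
  using outer_measure_space_hausdorff_outer[of k]
  unfolding outer_measure_space_def increasing_def by auto

lemma hausdorff_outer_empty: "hausdorff_outer k {} = 0"
  using outer_measure_space_hausdorff_outer[of k]
  unfolding outer_measure_space_def positive_def by auto

lemma hausdorff_outer_Un: "hausdorff_outer k (A \<union> B) \<le> hausdorff_outer k A + hausdorff_outer k B"
proof -
  have "hausdorff_outer k (A \<union> B) = hausdorff_outer k (\<Union>i. binaryset A B i)"
    by (simp add: UN_binaryset_eq)
  also have "\<dots> \<le> (\<Sum>i. hausdorff_outer k (binaryset A B i))"
    by (rule hausdorff_outer_UN)
  also have "\<dots> = hausdorff_outer k A + hausdorff_outer k B"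
    by (rule suminf_binaryset_eq) (rule hausdorff_outer_empty)
  finally show ?thesis .
qed

lemma hausdorff_outer_separated:
  fixes A B :: "'a::metric_space set"
  assumes r: "r > 0" and sep: "\<And>x y. x \<in> A \<Longrightarrow> y \<in> B \<Longrightarrow> r \<le> dist x y"
  shows "hausdorff_outer k A + hausdorff_outer k B \<le> hausdorff_outer k (A \<union> B)"
proof -
  have pre: "hausdorff_pre k \<delta> A + hausdorff_pre k \<delta> B \<le> hausdorff_pre k \<delta> (A \<union> B)"
    if \<delta>: "0 < \<delta>" "\<delta> < r" for \<delta>
    unfolding hausdorff_pre_def[of k \<delta> "A \<union> B"]
  proof (rule INF_greatest, clarify)
    fix U :: "nat \<Rightarrow> 'a set"
    assume cov: "A \<union> B \<subseteq> (\<Union>i. U i)" and U: "\<forall>i. bounded (U i) \<and> diameter (U i) \<le> \<delta>"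
    define V where "V i = (if U i \<inter> A = {} then {} else U i)" for i
    define W where "W i = (if U i \<inter> B = {} then {} else U i)" for i
    have disj: "U i \<inter> A = {} \<or> U i \<inter> B = {}" for i
    proof (rule ccontr)
      assume "\<not> ?thesis"
      then obtain x y where xy: "x \<in> U i" "x \<in> A" "y \<in> U i" "y \<in> B" by auto
      have "r \<le> dist x y" using xy sep by blast
      also have "\<dots> \<le> diameter (U i)" using U xy by (intro diameter_bounded_bound) auto
      finally show False using U \<delta> by (meson leD order_trans)
    qed
    have "A \<subseteq> (\<Union>i. V i)" "B \<subseteq> (\<Union>i. W i)"
      using cov by (fastforce simp: V_def W_def)+
    moreover have "bounded (V i)" "diameter (V i) \<le> \<delta>" "bounded (W i)" "diameter (W i) \<le> \<delta>" for i
      using U \<delta> by (simp_all add: V_def W_def)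
    ultimately have "hausdorff_pre k \<delta> A \<le> (\<Sum>i. hausdorff_gauge k (V i))"
        "hausdorff_pre k \<delta> B \<le> (\<Sum>i. hausdorff_gauge k (W i))"
      by (simp_all add: hausdorff_pre_lower)
    then have "hausdorff_pre k \<delta> A + hausdorff_pre k \<delta> B
        \<le> (\<Sum>i. hausdorff_gauge k (V i)) + (\<Sum>i. hausdorff_gauge k (W i))"
      by (rule add_mono)
    also have "\<dots> = (\<Sum>i. hausdorff_gauge k (V i) + hausdorff_gauge k (W i))"
      by (rule suminf_add) auto
    also have "\<dots> \<le> (\<Sum>i. hausdorff_gauge k (U i))"
      using disj by (intro suminf_le) (auto simp: V_def W_def hausdorff_gauge_def)
    finally show "hausdorff_pre k \<delta> A + hausdorff_pre k \<delta> B \<le> (\<Sum>i. hausdorff_gauge k (U i))" .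
  qed
  have "hausdorff_pre k \<delta> A + hausdorff_pre k \<epsilon> B \<le> hausdorff_outer k (A \<union> B)"
    if "0 < \<delta>" "0 < \<epsilon>" for \<delta> \<epsilon>
  proof -
    define \<eta> where "\<eta> = min (min \<delta> \<epsilon>) (r / 2)"
    have \<eta>: "0 < \<eta>" "\<eta> < r" "\<eta> \<le> \<delta>" "\<eta> \<le> \<epsilon>" using that r by (auto simp: \<eta>_def)
    have "hausdorff_pre k \<delta> A + hausdorff_pre k \<epsilon> B \<le> hausdorff_pre k \<eta> A + hausdorff_pre k \<eta> B"
      using \<eta> by (intro add_mono hausdorff_pre_antimono)
    also have "\<dots> \<le> hausdorff_pre k \<eta> (A \<union> B)" using pre \<eta> by blast
    also have "\<dots> \<le> hausdorff_outer k (A \<union> B)"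
      unfolding hausdorff_outer_def using \<eta> by (intro SUP_upper) auto
    finally show ?thesis .
  qed
  then show ?thesis
    unfolding hausdorff_outer_def[of k A] hausdorff_outer_def[of k B]
    by (auto simp: ennreal_SUP_add_left[symmetric] ennreal_SUP_add_right intro!: SUP_least)
qed

lemma hausdorff_outer_sum_separated:
  fixes R :: "nat \<Rightarrow> 'a::metric_space set"
  assumes "\<And>n. \<exists>r>0. \<forall>i<n. \<forall>x\<in>R i. \<forall>y\<in>R n. r \<le> dist x y"
  shows "(\<Sum>i<n. hausdorff_outer k (R i)) \<le> hausdorff_outer k (\<Union>i<n. R i)"
proof (induction n)
  case (Suc n)
  obtain r where r: "r > 0" "\<forall>i<n. \<forall>x\<in>R i. \<forall>y\<in>R n. r \<le> dist x y" using assms by blast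
  have "(\<Sum>i<Suc n. hausdorff_outer k (R i)) \<le> hausdorff_outer k (\<Union>i<n. R i) + hausdorff_outer k (R n)"
    using Suc by (simp add: add_mono)
  also have "\<dots> \<le> hausdorff_outer k ((\<Union>i<n. R i) \<union> R n)"
    using r by (intro hausdorff_outer_separated[of r]) auto
  also have "(\<Union>i<n. R i) \<union> R n = (\<Union>i<Suc n. R i)" by (auto simp: less_Suc_eq)
  finally show ?case .
qed auto

lemma hausdorff_outer_closed_split:
  fixes F A :: "'a::metric_space set"
  assumes F: "closed F"
  shows "hausdorff_outer k (A \<inter> F) + hausdorff_outer k (A - F) \<le> hausdorff_outer k A"
proof (cases "F = {} \<or> hausdorff_outer k A = top")
  case True
  then show ?thesis by (auto simp: hausdorff_outer_empty)
next
  case False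
  then have ne: "F \<noteq> {}" and fin: "hausdorff_outer k A < top" by (auto simp: less_top)
  let ?\<mu> = "hausdorff_outer k :: 'a set \<Rightarrow> ennreal"
  let ?d = "\<lambda>x. infdist x F"
  define C where "C n = {x \<in> A. 1 / real (Suc n) \<le> ?d x}" for n
  define R where "R n = {x \<in> A. 1 / real (Suc (Suc n)) \<le> ?d x \<and> ?d x < 1 / real (Suc n)}" for n
  have gap: "\<exists>r>0. \<forall>i<n. \<forall>x\<in>R (2*i+b). \<forall>y\<in>R (2*n+b). r \<le> dist x y" for n b
  proof (cases "n = 0")
    case False
    define s where "s = real (2*n+b)"
    have s: "s > 0" using False by (simp add: s_def)
    have "1 / s - 1 / (s+1) \<le> dist x y"
      if i: "i < n" and x: "x \<in> R (2*i+b)" and y: "y \<in> R (2*n+b)" for i x y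
    proof -
      have "1 / s \<le> 1 / real (Suc (Suc (2*i+b)))"
        using i by (intro divide_left_mono) (auto simp: s_def)
      also have "\<dots> \<le> ?d x" using x by (simp add: R_def)
      finally have "1 / s \<le> ?d x" .
      moreover have "?d y < 1 / (s+1)" using y by (simp add: R_def s_def add.commute)
      moreover have "\<bar>?d x - ?d y\<bar> \<le> dist x y" by (rule infdist_triangle_abs)
      ultimately show ?thesis by linarith
    qed
    moreover have "0 < 1 / s - 1 / (s+1)" using s by (simp add: divide_strict_left_mono)
    ultimately show ?thesis by blast
  qed (auto intro: exI[of _ 1])
  have part: "(\<Sum>i<n. ?\<mu> (R (2*i+b))) \<le> ?\<mu> A" for n b
  proof -
    have "(\<Sum>i<n. ?\<mu> (R (2*i+b))) \<le> ?\<mu> (\<Union>i<n. R (2*i+b))"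
      using gap by (intro hausdorff_outer_sum_separated) blast
    also have "\<dots> \<le> ?\<mu> A" by (intro hausdorff_outer_mono) (auto simp: R_def)
    finally show ?thesis .
  qed
  have "(\<Sum>i<n. ?\<mu> (R i)) \<le> ?\<mu> A + ?\<mu> A" for n
  proof -
    have "(\<Sum>i<n. ?\<mu> (R i)) \<le> (\<Sum>i<2*n. ?\<mu> (R i))" by (rule sum_mono2) auto
    also have "\<dots> = (\<Sum>i<n. ?\<mu> (R (2*i+0))) + (\<Sum>i<n. ?\<mu> (R (2*i+1)))"
      by (induction n) (auto simp: algebra_simps)
    also have "\<dots> \<le> ?\<mu> A + ?\<mu> A" by (intro add_mono part)
    finally show ?thesis .
  qed
  then have "(\<Sum>i. ?\<mu> (R i)) \<le> ?\<mu> A + ?\<mu> A" by (intro suminf_le_const) auto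
  also have "\<dots> < top" using fin by simp
  finally have sumfin: "(\<Sum>i. ?\<mu> (R i)) < top" .
  define g where "g i = enn2real (?\<mu> (R i))" for i
  have g: "?\<mu> (R i) = ennreal (g i)" for i
    unfolding g_def using ennreal_suminf_lessD[OF sumfin, of i] by simp
  have sg: "summable g"
    using sumfin unfolding g by (intro summable_suminf_not_top) (auto simp: g_def)
  show ?thesis
  proof (rule ennreal_le_epsilon)
    fix e :: real assume e: "0 < e"
    obtain m where m: "norm (\<Sum>i. g (i + m)) < e"
      using suminf_exist_split[OF e sg] by blast
    have "A - F \<subseteq> C m \<union> (\<Union>i. R (i + m))"
    proof
      fix x assume x: "x \<in> A - F"
      then have pos: "0 < ?d x"
        using in_closed_iff_infdist_zero[OF F ne, of x] infdist_nonneg[of x F] by fastforce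
      show "x \<in> C m \<union> (\<Union>i. R (i + m))"
      proof (cases "1 / real (Suc m) \<le> ?d x")
        case True
        then show ?thesis using x by (simp add: C_def)
      next
        case False
        define P where "P n \<longleftrightarrow> 1 / real (Suc n) \<le> ?d x" for n
        have "\<exists>n. P n"
          using reals_Archimedean[OF pos] by (auto simp: P_def inverse_eq_divide intro: less_imp_le)
        then have L: "P (LEAST n. P n)" by (rule LeastI_ex)
        have gt: "m < (LEAST n. P n)"
        proof (rule ccontr)
          assume "\<not> ?thesis"
          then have "1 / real (Suc m) \<le> 1 / real (Suc (LEAST n. P n))"
            by (intro divide_left_mono) auto
          then show False using L False by (simp add: P_def)
        qed
        then obtain j where j: "(LEAST n. P n) = Suc (j + m)"
          by (metis add.commute less_imp_Suc_add)
        have "\<not> P (j + m)" using not_less_Least[of "j + m" P] j by simp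
        then have "x \<in> R (j + m)" using L x unfolding j by (auto simp: R_def P_def not_le)
        then show ?thesis by blast
      qed
    qed
    then have "?\<mu> (A - F) \<le> ?\<mu> (C m \<union> (\<Union>i. R (i + m)))" by (rule hausdorff_outer_mono)
    also have "\<dots> \<le> ?\<mu> (C m) + ?\<mu> (\<Union>i. R (i + m))" by (rule hausdorff_outer_Un)
    also have "?\<mu> (\<Union>i. R (i + m)) \<le> (\<Sum>i. ?\<mu> (R (i + m)))" by (rule hausdorff_outer_UN)
    also have "(\<Sum>i. ?\<mu> (R (i + m))) = ennreal (\<Sum>i. g (i + m))"
      unfolding g using sg by (intro suminf_ennreal2) (simp_all add: summable_iff_shift, simp add: g_def)
    also have "\<dots> \<le> ennreal e" using m by (intro ennreal_leI) auto
    finally have "?\<mu> (A - F) \<le> ?\<mu> (C m) + ennreal e" by (simp add: add_left_mono)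
    then have "?\<mu> (A \<inter> F) + ?\<mu> (A - F) \<le> (?\<mu> (C m) + ?\<mu> (A \<inter> F)) + ennreal e"
      by (metis add.commute add.left_commute add_left_mono)
    also have "?\<mu> (C m) + ?\<mu> (A \<inter> F) \<le> ?\<mu> (C m \<union> A \<inter> F)"
    proof (rule hausdorff_outer_separated)
      fix x y assume "x \<in> C m" "y \<in> A \<inter> F"
      then have "1 / real (Suc m) \<le> ?d x" "?d x \<le> dist x y"
        by (auto simp: C_def intro: infdist_le)
      then show "1 / real (Suc m) \<le> dist x y" by linarith
    qed simp
    also have "?\<mu> (C m \<union> A \<inter> F) \<le> ?\<mu> A" by (intro hausdorff_outer_mono) (auto simp: C_def)
    finally show "?\<mu> (A \<inter> F) + ?\<mu> (A - F) \<le> ?\<mu> A + ennreal e" by (simp add: add_right_mono)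
  qed
qed

lemma measure_space_hausdorff:
  "measure_space UNIV (sets borel) (hausdorff_outer k :: 'a::metric_space set \<Rightarrow> ennreal)"
proof -
  let ?L = "lambda_system UNIV UNIV (hausdorff_outer k :: 'a set \<Rightarrow> ennreal)"
  interpret S: sigma_algebra "UNIV :: 'a set" UNIV
    using sigma_algebra_Pow[of "UNIV :: 'a set"] by simp
  have ms: "measure_space UNIV ?L (hausdorff_outer k :: 'a set \<Rightarrow> ennreal)"
    by (rule S.caratheodory_lemma[OF outer_measure_space_hausdorff_outer])
  then have sa: "sigma_algebra UNIV ?L" by (simp add: measure_space_def)
  have "F \<in> ?L" if "closed F" for F :: "'a set"
  proof -
    have "hausdorff_outer k (A \<inter> F) + hausdorff_outer k (A - F) = hausdorff_outer k A" for A :: "'a set"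
    proof (rule antisym)
      have "hausdorff_outer k ((A \<inter> F) \<union> (A - F)) \<le> hausdorff_outer k (A \<inter> F) + hausdorff_outer k (A - F)"
        by (rule hausdorff_outer_Un)
      then show "hausdorff_outer k A \<le> hausdorff_outer k (A \<inter> F) + hausdorff_outer k (A - F)"
        by (simp add: Int_Diff_Un)
    qed (rule hausdorff_outer_closed_split[OF that])
    then show ?thesis by (simp add: S.lambda_system_eq)
  qed
  then have "sigma_sets UNIV {F. closed F} \<subseteq> ?L"
    by (intro sigma_algebra.sigma_sets_subset[OF sa]) auto
  then have sub: "sets borel \<subseteq> ?L"
    by (simp add: borel_eq_closed)
  have "countably_additive (sets borel) (hausdorff_outer k :: 'a set \<Rightarrow> ennreal)"
    using ms sub unfolding measure_space_def countably_additive_def by blast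
  then show ?thesis
    using ms sets.sigma_algebra_axioms[of "borel :: 'a measure"]
    by (auto simp: measure_space_def positive_def)
qed

lemma sets_hausdorff_measure [simp, measurable_cong]: "sets (hausdorff_measure k) = sets borel"
  using sets.sigma_sets_eq[of borel] by (simp add: hausdorff_measure_def sets_measure_of)

lemma space_hausdorff_measure [simp]: "space (hausdorff_measure k) = UNIV"
  using sets_eq_imp_space_eq[OF sets_hausdorff_measure] by simp

lemma emeasure_hausdorff_measure:
  assumes "A \<in> sets borel"
  shows "emeasure (hausdorff_measure k) A = hausdorff_outer k A"
  using measure_space_hausdorff[of k] assms unfolding hausdorff_measure_def
  by (intro emeasure_measure_of_sigma) (auto simp: measure_space_def)

definition surface_area_measure :: "(real^'n) set \<Rightarrow> (real^'n) measure" where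
  "surface_area_measure L = restrict_space (hausdorff_measure (CARD('n) - 1)) (frontier L)"


section \<open>Convex bodies, polarity, curvature\<close>

definition convex_body :: "(real^'n) set \<Rightarrow> bool" where
  "convex_body K \<longleftrightarrow> compact K \<and> convex K \<and> interior K \<noteq> {}"

definition centroid :: "(real^'n) set \<Rightarrow> real^'n" where
  "centroid K = (1 / measure lborel K) *\<^sub>R set_lebesgue_integral lborel K (\<lambda>x. x)"

definition polar_body :: "(real^'n) set \<Rightarrow> (real^'n) set" where
  "polar_body K = {y. \<forall>x\<in>K. x \<bullet> y \<le> 1}"

definition is_outer_normal :: "(real^'n) set \<Rightarrow> real^'n \<Rightarrow> real^'n \<Rightarrow> bool" where
  "is_outer_normal L x u \<longleftrightarrow> norm u = 1 \<and> (\<forall>y\<in>L. u \<bullet> (y - x) \<le> 0)"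

text \<open>
  The outer unit normal of a convex body is unique at almost every boundary point; at the remaining
  ones some outer unit normal is chosen.
\<close>

definition outer_normal :: "(real^'n) set \<Rightarrow> real^'n \<Rightarrow> real^'n" where
  "outer_normal L x = (SOME u. is_outer_normal L x u)"

text \<open>
  Let \<open>u\<close> be the outer unit normal of \<open>L\<close> at \<open>x\<close>.  Near \<open>x\<close> the boundary is the graph of a convex
  function over the tangent hyperplane: for small \<open>h\<close> orthogonal to \<open>u\<close>, \<open>f h\<close> is the least \<open>t\<close>
  with \<open>x + h - t u \<in> L\<close>.  The boundary is twice differentiable at \<open>x\<close> in the generalised sense of
  Aleksandrov if \<open>f h = \<langle>A h, h\<rangle> / 2 + o(|h|\<^sup>2)\<close> for a symmetric linear map \<open>A\<close> of the tangent
  hyperplane, and the generalised Gaussian curvature is then the determinant of \<open>A\<close>.  In order to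
  express the latter as the determinant of an \<open>n \<times> n\<close> matrix, \<open>A\<close> is extended to \<open>\<real>\<^sup>n\<close> by
  \<open>A u = u\<close>; this changes neither symmetry nor determinant, and determines \<open>A\<close> uniquely.
\<close>

definition is_curvature_matrix :: "(real^'n) set \<Rightarrow> real^'n \<Rightarrow> real^'n^'n \<Rightarrow> bool" where
  "is_curvature_matrix L x A \<longleftrightarrow>
     (let u = outer_normal L x; T = at 0 within {h. u \<bullet> h = 0} in
      transpose A = A \<and> A *v u = u \<and>
      (\<exists>f. (\<forall>\<^sub>F h in T. x + h - f h *\<^sub>R u \<in> L \<and> (\<forall>t < f h. x + h - t *\<^sub>R u \<notin> L)) \<and>
           ((\<lambda>h. (f h - (A *v h) \<bullet> h / 2) / (norm h)\<^sup>2) \<longlongrightarrow> 0) T))"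

text \<open>
  By Aleksandrov's theorem a curvature matrix exists at almost every boundary point; the curvature
  is set to \<open>0\<close> at the others.
\<close>

definition gauss_curvature :: "(real^'n) set \<Rightarrow> real^'n \<Rightarrow> real" where
  "gauss_curvature L x =
     (if \<exists>A. is_curvature_matrix L x A then det (THE A. is_curvature_matrix L x A) else 0)"

text \<open>The boundary is a hypersurface of class \<open>C\<^sup>2\<close>; \<open>G\<close> is the gradient and \<open>H\<close> the Hessian of \<open>g\<close>.\<close>

definition C2_boundary :: "(real^'n) set \<Rightarrow> bool" where
  "C2_boundary K \<longleftrightarrow>
     (\<forall>x \<in> frontier K. \<exists>U (g :: real^'n \<Rightarrow> real) (G :: real^'n \<Rightarrow> real^'n) (H :: real^'n \<Rightarrow> real^'n^'n).
        open U \<and> x \<in> U \<and> frontier K \<inter> U = {y \<in> U. g y = 0} \<and>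
        (\<forall>y \<in> U. (g has_derivative (\<lambda>h. G y \<bullet> h)) (at y) \<and>
                 (G has_derivative (\<lambda>h. H y *v h)) (at y) \<and> G y \<noteq> 0) \<and>
        continuous_on U H)"

text \<open>
  Since \<^const>\<open>gauss_curvature\<close> vanishes where the generalised curvature does not exist, positivity
  includes existence; on a \<open>C\<^sup>2\<close> boundary it is the classical Gaussian curvature.
\<close>

definition C2_plus :: "(real^'n) set \<Rightarrow> bool" where
  "C2_plus K \<longleftrightarrow> C2_boundary K \<and> (\<forall>x \<in> frontier K. gauss_curvature K x > 0)"


section \<open>Affine surface area\<close>

text \<open>
  Powers of a nonnegative real with values in \<open>[0, \<infinity>]\<close>, where \<open>0\<^sup>a = \<infinity>\<close> for \<open>a < 0\<close> and
  \<open>0\<^sup>0 = 1\<close>; in contrast, the library has \<^prop>\<open>(0::real) powr a = 0\<close> for all \<open>a\<close>.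
\<close>

definition epowr :: "real \<Rightarrow> real \<Rightarrow> ennreal" where
  "epowr x a = (if x = 0 then (if a < 0 then \<infinity> else if a = 0 then 1 else 0) else ennreal (x powr a))"

text \<open>
  The denominator below is a positive real: \<open>\<langle>x, u\<rangle> > 0\<close> for every outer normal \<open>u\<close> at a boundary
  point \<open>x\<close> of \<open>L\<close>, because the origin is interior to \<open>L\<close>.
\<close>

definition affine_surface_area :: "real \<Rightarrow> (real^'n) set \<Rightarrow> ennreal" where
  "affine_surface_area p L =
     (let n = real CARD('n) in
      \<integral>\<^sup>+ x. epowr (gauss_curvature L x) (p / (n + p)) /
            epowr (x \<bullet> outer_normal L x) (n * (p - 1) / (n + p)) \<partial>surface_area_measure L)"

end

theory Submission
  imports Defs
begin

text \<open>
  Write \<open>J\<close> for the polar body, \<open>\<rho>\<close> for the gauge of \<open>K\<close> and \<open>\<phi> = \<rho>\<^sup>2 / 2\<close>.  The subdifferential of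
  \<open>\<phi>\<close> is a homogeneous multivalued map from \<open>K\<close> onto \<open>J\<close>.  At a boundary point \<open>x\<close> with normal \<open>u\<close>
  and curvature \<open>\<kappa>\<close>, the Hessian of \<open>\<phi>\<close> has determinant \<open>f x = \<kappa> / \<langle>x, u\<rangle> ^ (n + 1)\<close>,
  and the integrand of the affine surface area is \<open>(f x) powr (p / (n + p)) * \<langle>x, u\<rangle>\<close>.

  As \<open>\<langle>x, u\<rangle> d\<mu>\<close> is \<open>n\<close> times the cone measure of \<open>K\<close>, the integral of \<open>f \<langle>x, u\<rangle>\<close> is
  \<open>n\<close> times the integral of the Jacobian of the map \<open>K \<rightarrow> J\<close>, hence at most \<open>n |J|\<close>, with equality if the
  curvature is positive everywhere, because then the map is a differentiable bijection with
  differentiable inverse.  Replacing \<open>t powr a\<close> by its tangent at \<open>t = |J| / |K|\<close> bounds the affine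
  surface area of \<open>K\<close> by \<open>n |K| (|J| / |K|) powr a\<close>, from above if \<open>0 \<le> a \<le> 1\<close> and from below otherwise.
  The bound for \<open>J\<close> has the same shape with \<open>K\<close> and \<open>J\<close> exchanged, and the powers cancel in the product.
\<close>

section \<open>Volume under linear and differentiable maps\<close>

text \<open>Put \<open>a = p / (n + p)\<close>. For \<open>0 \<le> a \<le> 1\<close> the power
  \<open>t powr a\<close> lies below an increasing tangent, for \<open>a < 0\<close> above a
  decreasing one; in both cases an upper bound for the integral of \<open>f\<close> suffices, and
  that bound holds for every convex body with the origin inside. For \<open>a > 1\<close> the
  tangent is increasing and lies below the power, so a lower bound is required. It fails for a
  polytope, where \<open>f\<close> vanishes almost everywhere; this is why that range asks for
  positive curvature.

  Two obstacles shape the rest. Surface area is a Hausdorff measure, while the map from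
  \<open>K\<close> to \<open>J\<close> is studied with Lebesgue measure; the bridge is a comparison
  of densities, using the isodiametric inequality for arbitrary covering sets and Vitali coverings
  by balls. Moreover \<open>f\<close> is known only through second-order expansions at single points
  and is zero where there is none, so it is dominated by a Borel limit of volume ratios of images of
  small balls. For \<open>p < - n\<close> the expansions for the polar body come from those of
  \<open>K\<close> by Legendre duality.\<close>

lemma outer_matrix_vector:
  fixes a b x :: "real^'n"
  shows "(\<chi> i j. (if i = j then 1 else 0) + a $ i * b $ j) *v x = x + (b \<bullet> x) *\<^sub>R a"
  by (simp add: vec_eq_iff matrix_vector_mult_def inner_vec_def algebra_simps sum.distrib
       sum_distrib_left if_distrib[of "\<lambda>t. _ * t"] cong: if_cong)

text \<open>Rotating by \<open>P\<close> makes \<open>b\<close> a multiple of the axis vector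
  \<open>e\<close>, so that the rank-one term changes a single column of the identity and Cramer's
  rule reads off the determinant. The formula serves the volume-preserving shear of cones and the
  passage from a curvature matrix to the Hessian of \<open>energy\<close>.\<close>

lemma det_matrix_one_plus_outer:
  fixes a b :: "real^'n"
  shows "det (\<chi> i j. (if i = j then 1 else 0) + a $ i * b $ j) = 1 + a \<bullet> b"
proof -
  obtain k :: 'n where True by simp
  define e :: "real^'n" where "e = axis k 1"
  have ne: "norm (norm b *\<^sub>R e) = norm b" by (simp add: e_def)
  obtain Q where Q: "orthogonal_transformation Q" "Q (norm b *\<^sub>R e) = b"
    using orthogonal_transformation_exists[OF ne] by blast
  define P where "P = matrix Q"
  have P: "orthogonal_matrix P" using Q(1) by (simp add: P_def orthogonal_transformation_matrix)
  have Qx: "Q x = P *v x" for x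
    using Q(1) by (simp add: P_def matrix_works orthogonal_transformation_linear)
  define c where "c = transpose P *v a"
  have PT: "transpose P ** P = mat 1" "P ** transpose P = mat 1"
    using P by (simp_all add: orthogonal_matrix_def)
  have bP: "P *v (norm b *\<^sub>R e) = b" using Q(2) Qx by simp
  have aP: "P *v c = a" by (simp add: c_def matrix_vector_mul_assoc PT del: transpose_matrix_vector)
  \<comment> \<open>The shape of \<open>cramer_lemma\<close> for the identity matrix: column
    \<open>k\<close> is replaced by the vector \<open>e + norm b *\<^sub>R c\<close>.\<close>
  let ?N = "(\<chi> i j. if j = k then (mat 1 *v (e + norm b *\<^sub>R c)) $ i else (mat 1 :: real^'n^'n) $ i $ j) :: real^'n^'n"
  have N: "?N = (\<chi> i j. (if i = j then 1 else 0) + c $ i * (norm b *\<^sub>R e) $ j)"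
    by (subst matrix_vector_mul_lid) (auto simp: vec_eq_iff mat_def e_def axis_def)
  have "(\<chi> i j. (if i = j then 1 else 0) + a $ i * b $ j) = P ** ?N ** transpose P"
  proof -
    have "(\<chi> i j. (if i = j then 1 else 0) + a $ i * b $ j) *v x = (P ** ?N ** transpose P) *v x" for x
    proof -
      have "b \<bullet> x = (P *v (norm b *\<^sub>R e)) \<bullet> x" by (simp add: bP)
      also have "\<dots> = (norm b *\<^sub>R e) \<bullet> (transpose P *v x)" by (metis dot_lmul_matrix inner_commute transpose_matrix_vector)
      finally have bx: "(norm b *\<^sub>R e) \<bullet> (transpose P *v x) = b \<bullet> x" ..
      have "(P ** ?N ** transpose P) *v x = P *v (?N *v (transpose P *v x))"
        by (simp only: matrix_vector_mul_assoc matrix_mul_assoc)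
      also have "\<dots> = P *v (transpose P *v x) + (b \<bullet> x) *\<^sub>R (P *v c)"
        unfolding N outer_matrix_vector bx by (simp add: matrix_vector_right_distrib matrix_vector_mult_scaleR)
      also have "P *v (transpose P *v x) = x" by (simp only: matrix_vector_mul_assoc PT matrix_vector_mul_lid)
      finally show ?thesis by (simp add: outer_matrix_vector aP)
    qed
    then show ?thesis by (simp add: matrix_eq)
  qed
  moreover have "det (transpose P) * det P = 1" using PT by (metis det_I det_mul)
  ultimately have "det (\<chi> i j. (if i = j then 1 else 0) + a $ i * b $ j) = det ?N"
    by (simp add: det_mul)
  also have "\<dots> = (e + norm b *\<^sub>R c) $ k" by (subst cramer_lemma) simp
  also have "\<dots> = 1 + norm b * (e \<bullet> c)" using inner_axis'[of k 1 c] by (simp add: e_def axis_def)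
  also have "norm b * (e \<bullet> c) = (P *v (norm b *\<^sub>R e)) \<bullet> a"
    by (metis c_def dot_lmul_matrix inner_commute inner_scaleR_left transpose_matrix_vector)
  finally show ?thesis by (simp add: bP inner_commute)
qed

text \<open>
  The change of variables theorems of the library need a well-ordered index type.
\<close>

typedef (overloaded) ('a::finite) idx = "{..<CARD('a)}"
  morphisms idx_nat nat_idx by (rule exI[of _ 0]) simp

instantiation idx :: (finite) wellorder begin
definition less_eq_idx :: "'a idx \<Rightarrow> 'a idx \<Rightarrow> bool" where "x \<le> y \<longleftrightarrow> idx_nat x \<le> idx_nat y"
definition less_idx :: "'a idx \<Rightarrow> 'a idx \<Rightarrow> bool" where "x < y \<longleftrightarrow> idx_nat x < idx_nat y"
instance
proof
  fix P :: "'a idx \<Rightarrow> bool" and a assume step: "\<And>x. (\<And>y. y < x \<Longrightarrow> P y) \<Longrightarrow> P x"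
  show "P a"
  proof (induction "idx_nat a" arbitrary: a rule: less_induct)
    case less
    show ?case by (rule step, rule less) (simp add: less_idx_def)
  qed
qed (auto simp: less_eq_idx_def less_idx_def idx_nat_inject)
end

lemma bij_idx_nat: "bij_betw idx_nat (UNIV :: 'a::finite idx set) {..<CARD('a)}"
  by (rule bij_betw_imageI) (simp add: inj_on_def idx_nat_inject, rule type_definition.Rep_range[OF type_definition_idx])

instance idx :: (finite) finite
  by standard (use bij_betw_finite[OF bij_idx_nat] in simp)

definition idx_elem :: "'a::finite idx \<Rightarrow> 'a" where
  "idx_elem = (SOME b. bij b)"

lemma bij_idx_elem: "bij (idx_elem :: 'a::finite idx \<Rightarrow> 'a)"
proof -
  have "card (UNIV :: 'a idx set) = card (UNIV :: 'a set)"
    using bij_betw_same_card[OF bij_idx_nat] by simp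
  then have "\<exists>b :: 'a idx \<Rightarrow> 'a. bij b" by (intro finite_same_card_bij) auto
  then show ?thesis unfolding idx_elem_def by (rule someI_ex)
qed

lemma idx_elem_inv [simp]: "idx_elem (inv idx_elem x) = x" "inv idx_elem (idx_elem i) = i"
  using bij_inv_eq_iff[OF bij_idx_elem, of "inv idx_elem x" x] bij_inv_eq_iff[OF bij_idx_elem, of i "idx_elem i"]
  by simp_all

definition reindex :: "real^'n \<Rightarrow> real^('n idx)" where
  "reindex x = (\<chi> i. x $ idx_elem i)"
definition reindex' :: "real^('n idx) \<Rightarrow> real^'n" where
  "reindex' x = (\<chi> i. x $ inv idx_elem i)"

lemma reindex_inv [simp]: "reindex' (reindex x) = x" "reindex (reindex' y) = y"
  by (simp_all add: reindex_def reindex'_def vec_eq_iff)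

lemma reindex_image_eq_vimage: "reindex ` S = reindex' -` S"
proof (intro set_eqI iffI)
  fix y assume "y \<in> reindex' -` S"
  then have "reindex (reindex' y) \<in> reindex ` S" by blast
  then show "y \<in> reindex ` S" by simp
qed auto

lemma linear_reindex: "linear reindex" "linear reindex'"
  by (auto intro!: linearI simp: reindex_def reindex'_def vec_eq_iff)

lemma continuous_on_reindex [continuous_intros]:
  "continuous_on S f \<Longrightarrow> continuous_on S (\<lambda>x. reindex (f x))"
  by (rule bounded_linear.continuous_on[OF linear_conv_bounded_linear[THEN iffD1, OF linear_reindex(1)]])

lemma continuous_on_reindex' [continuous_intros]:
  "continuous_on S g \<Longrightarrow> continuous_on S (\<lambda>x. reindex' (g x))"
  by (rule bounded_linear.continuous_on[OF linear_conv_bounded_linear[THEN iffD1, OF linear_reindex(2)]])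

lemma borel_measurable_reindex [measurable]:
  "reindex \<in> borel_measurable borel" "reindex' \<in> borel_measurable borel"
  by (intro borel_measurable_continuous_onI continuous_intros)+

lemma prod_Basis_vec: "(\<Prod>b\<in>Basis. (v::real^'m) \<bullet> b) = (\<Prod>i\<in>UNIV. v $ i)"
proof -
  have i: "inj (\<lambda>i::'m. axis i (1::real))" by (auto simp: inj_on_def axis_eq_axis)
  have "(Basis :: (real^'m) set) = range (\<lambda>i. axis i 1)" by (auto simp: Basis_vec_def)
  then have "(\<Prod>b\<in>Basis. v \<bullet> b) = (\<Prod>b\<in>range (\<lambda>i. axis i 1). v \<bullet> b)" by simp
  also have "\<dots> = (\<Prod>i\<in>UNIV. v $ i)" using i by (subst prod.reindex) (auto simp: inner_axis)
  finally show ?thesis .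
qed

lemma lborel_reindex: "distr lborel borel reindex = (lborel :: (real^('n::finite) idx) measure)"
proof (rule lborel_eqI[symmetric])
  fix l u :: "real^('n::finite) idx" assume le: "\<And>b. b \<in> Basis \<Longrightarrow> l \<bullet> b \<le> u \<bullet> b"
  have le': "l $ i \<le> u $ i" for i using le[of "axis i 1"] by (simp add: inner_axis)
  have *: "reindex -` box l u = box (reindex' l) (reindex' u)"
  proof (intro set_eqI iffI)
    fix x assume "x \<in> box (reindex' l) (reindex' u)"
    then have "l $ inv idx_elem j < x $ j \<and> x $ j < u $ inv idx_elem j" for j
      by (simp add: mem_box_cart reindex'_def)
    from this[of "idx_elem i" for i] show "x \<in> reindex -` box l u"
      by (simp add: mem_box_cart reindex_def)
  next
    fix x assume "x \<in> reindex -` box l u"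
    then have "l $ i < x $ idx_elem i \<and> x $ idx_elem i < u $ i" for i
      by (simp add: mem_box_cart reindex_def)
    from this[of "inv idx_elem j" for j] show "x \<in> box (reindex' l) (reindex' u)"
      by (simp add: mem_box_cart reindex'_def)
  qed
  have "emeasure (distr lborel borel reindex) (box l u) = emeasure lborel (box (reindex' l) (reindex' u))"
    by (subst emeasure_distr) (auto simp: *)
  also have "\<dots> = ennreal (\<Prod>b\<in>Basis. (reindex' u - reindex' l) \<bullet> b)"
    using le' by (subst emeasure_lborel_box) (auto simp: Basis_vec_def reindex'_def inner_axis)
  also have "(\<Prod>b\<in>Basis. (reindex' u - reindex' l) \<bullet> b) = (\<Prod>i\<in>UNIV. (reindex' u - reindex' l) $ i)"
    by (rule prod_Basis_vec)
  also have "\<dots> = (\<Prod>i\<in>UNIV. (reindex' u - reindex' l) $ idx_elem i)"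
    by (rule prod.reindex_bij_betw[OF bij_idx_elem, symmetric])
  also have "\<dots> = (\<Prod>i\<in>UNIV. (u - l) $ i)" by (simp add: reindex'_def)
  also have "\<dots> = (\<Prod>b\<in>Basis. (u - l) \<bullet> b)" by (rule prod_Basis_vec[symmetric])
  finally show "emeasure (distr lborel borel reindex) (box l u) = ennreal (\<Prod>b\<in>Basis. (u - l) \<bullet> b)" .
qed simp

lemma emeasure_reindex_image:
  assumes "S \<in> sets borel"
  shows "emeasure lborel (reindex ` S) = emeasure lborel S"
proof -
  note * = reindex_image_eq_vimage[of S]
  have S: "reindex ` S \<in> sets borel" unfolding *
    using measurable_sets[OF borel_measurable_reindex(2) assms] by simp
  have "emeasure lborel (reindex ` S) = emeasure (distr lborel borel reindex) (reindex ` S)"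
    by (simp add: lborel_reindex)
  also have "\<dots> = emeasure lborel (reindex -` (reindex ` S))" using S by (subst emeasure_distr) auto
  also have "reindex -` (reindex ` S) = S" unfolding set_eq_iff image_iff vimage_eq by (metis reindex_inv(1))
  finally show ?thesis .
qed

text \<open>Conjugation by \<open>idx_elem\<close> is a sign-preserving bijection between the
  permutations of the two index types, so the Leibniz sums agree term by term.\<close>

lemma det_reindex:
  fixes A :: "real^'n^'n"
  shows "det (\<chi> i j. A $ idx_elem i $ idx_elem j :: real^('n idx)^('n idx)) = det A"
proof -
  let ?b = "idx_elem :: 'n idx \<Rightarrow> 'n"
  have b: "bij ?b" by (rule bij_idx_elem)
  have ib: "bij (inv ?b)" using b by (rule bij_imp_bij_inv)
  let ?F = "\<lambda>p. ?b \<circ> p \<circ> inv ?b"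
  have perm: "?F p permutes UNIV" if "p permutes UNIV" for p
    by (intro bij_imp_permutes bij_comp b ib permutes_bij[OF that]) simp
  have perm': "inv ?b \<circ> q \<circ> ?b permutes UNIV" if "q permutes UNIV" for q
    by (intro bij_imp_permutes bij_comp b ib permutes_bij[OF that]) simp
  have bij: "bij_betw ?F {p. p permutes UNIV} {p. p permutes UNIV}"
    by (rule bij_betwI[of _ _ _ "\<lambda>q. inv ?b \<circ> q \<circ> ?b"]) (use perm perm' in \<open>auto simp: fun_eq_iff\<close>)
  have sg: "sign (?F p) = sign p" if "p permutes UNIV" for p :: "'n idx \<Rightarrow> 'n idx"
  proof -
    have "map_permutation UNIV ?b p = ?F p"
      by (simp add: map_permutation_def o_def restrict_id_def inv_def bij_is_surj[OF b])
    then show ?thesis using sign_map_permutation[OF bij_is_inj[OF b] that] by simp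
  qed
  show ?thesis
    unfolding det_def sum.reindex_bij_betw[OF bij, symmetric]
  proof (rule sum.cong[OF refl], goal_cases)
    case (1 p)
    have "(\<Prod>i\<in>UNIV. A $ i $ ?F p i) = (\<Prod>i\<in>UNIV. A $ ?b i $ ?F p (?b i))"
      by (rule prod.reindex_bij_betw[OF b, symmetric])
    then show ?case using 1 sg[of p] by simp
  qed
qed

lemma reindex_matrix_vector:
  fixes A :: "real^'n^'n"
  shows "reindex (A *v x) = (\<chi> i j. A $ idx_elem i $ idx_elem j) *v reindex x"
proof -
  have "(\<Sum>j\<in>UNIV. A $ idx_elem i $ j * x $ j)
      = (\<Sum>j\<in>UNIV. A $ idx_elem i $ idx_elem j * x $ idx_elem j)" for i
    by (rule sum.reindex_bij_betw[OF bij_idx_elem, symmetric])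
  then show ?thesis by (simp add: reindex_def matrix_vector_mult_def vec_eq_iff)
qed

lemma emeasure_lborel_compact_eq_measure:
  "compact S \<Longrightarrow> emeasure lborel S = ennreal (measure lebesgue (S :: 'a::euclidean_space set))"
  using emeasure_compact_finite[of S]
  by (subst emeasure_eq_ennreal_measure) (auto simp: borel_compact)

lemma emeasure_matrix_image:
  fixes A :: "real^'n^'n"
  assumes S: "compact S"
  shows "emeasure lborel ((*v) A ` S) = ennreal \<bar>det A\<bar> * emeasure lborel S"
proof -
  let ?A = "\<chi> i j. A $ idx_elem i $ idx_elem j :: real^('n idx)^('n idx)"
  have cA: "compact ((*v) A ` S)"
    by (intro compact_continuous_image S matrix_vector_mult_linear_continuous_on)
  have cS: "compact (reindex ` S)" by (intro compact_continuous_image S continuous_intros)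
  have cAS: "compact ((*v) ?A ` reindex ` S)"
    by (intro compact_continuous_image cS matrix_vector_mult_linear_continuous_on)
  have "emeasure lborel ((*v) A ` S) = emeasure lborel (reindex ` (*v) A ` S)"
    using cA by (simp add: emeasure_reindex_image borel_compact)
  also have "reindex ` (*v) A ` S = (*v) ?A ` reindex ` S"
    by (simp add: image_image reindex_matrix_vector)
  also have "emeasure lborel \<dots> = ennreal (\<bar>det ?A\<bar> * measure lebesgue (reindex ` S))"
    using measure_linear_image[of "(*v) ?A" "reindex ` S"] cS cAS
    by (simp add: emeasure_lborel_compact_eq_measure lmeasurable_compact)
  also have "\<dots> = ennreal \<bar>det A\<bar> * emeasure lborel (reindex ` S)"
    using cS by (simp add: det_reindex ennreal_mult emeasure_lborel_compact_eq_measure)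
  finally show ?thesis using S by (simp add: emeasure_reindex_image borel_compact)
qed

text \<open>If the right-hand side is finite, it is the value of a gauge integral, and the bound for
  images under differentiable maps applies to that.\<close>

lemma emeasure_differentiable_image_wellorder:
  fixes f :: "real^'n::{finite,wellorder} \<Rightarrow> real^'n::_"
  assumes S [measurable]: "S \<in> sets borel"
    and f': "\<And>x. x \<in> S \<Longrightarrow> (f has_derivative f' x) (at x)"
    and m [measurable]: "(\<lambda>x. det (matrix (f' x))) \<in> borel_measurable borel"
    and fS: "f ` S \<in> sets borel"
  shows "emeasure lborel (f ` S) \<le> (\<integral>\<^sup>+x. indicator S x * ennreal \<bar>det (matrix (f' x))\<bar> \<partial>lborel)" (is "_ \<le> ?I")
proof (cases "?I = \<infinity>")
  case False
  then obtain r where r: "?I = ennreal r" "0 \<le> r" by (cases ?I) auto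
  let ?g = "\<lambda>x. indicator S x * \<bar>det (matrix (f' x))\<bar>"
  have "(?g has_integral r) UNIV"
  proof (rule nn_integral_has_integral)
    have "(\<integral>\<^sup>+x. ennreal (?g x) \<partial>lborel) = ?I"
      by (intro nn_integral_cong) (auto simp: indicator_def)
    then show "(\<integral>\<^sup>+x. ennreal (?g x) \<partial>lborel) = ennreal r" using r by simp
  qed (use r in auto)
  then have "((\<lambda>x. if x \<in> S then \<bar>det (matrix (f' x))\<bar> else 0) has_integral r) UNIV"
    by (rule has_integral_eq[rotated]) (auto simp: indicator_def)
  then have hi: "((\<lambda>x. \<bar>det (matrix (f' x))\<bar>) has_integral r) S"
    by (simp only: has_integral_restrict_UNIV)
  have SL: "S \<in> sets lebesgue" by simp
  have d: "(f has_derivative f' x) (at x within S)" if "x \<in> S" for x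
    using f'[OF that] by (rule has_derivative_at_withinI)
  have lm: "f ` S \<in> lmeasurable" and le: "measure lebesgue (f ` S) \<le> r"
    using measurable_differentiable_image[OF SL d has_integral_integrable[OF hi]]
      measure_differentiable_image[OF SL d has_integral_integrable[OF hi]] integral_unique[OF hi] by auto
  have "emeasure lborel (f ` S) = emeasure lebesgue (f ` S)" using fS by simp
  also have "\<dots> = ennreal (measure lebesgue (f ` S))" using lm by (rule emeasure_eq_measure2)
  also have "\<dots> \<le> ennreal r" using le by (rule ennreal_leI)
  finally show ?thesis using r by simp
qed simp

lemma matrix_conj_reindex:
  fixes g :: "real^'n \<Rightarrow> real^'n"
  assumes "linear g"
  shows "matrix (\<lambda>h. reindex (g (reindex' h))) = (\<chi> i j. matrix g $ idx_elem i $ idx_elem j)"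
proof -
  have "(\<lambda>h. reindex (g (reindex' h))) = (*v) (\<chi> i j. matrix g $ idx_elem i $ idx_elem j)"
  proof
    fix h
    have "reindex (g (reindex' h)) = reindex (matrix g *v reindex' h)"
      using assms by (simp add: matrix_works)
    then show "reindex (g (reindex' h)) = (\<chi> i j. matrix g $ idx_elem i $ idx_elem j) *v h"
      by (simp add: reindex_matrix_vector)
  qed
  from arg_cong[OF this, of matrix] show ?thesis by (simp only: matrix_of_matrix_vector_mul)
qed

lemma emeasure_differentiable_image:
  fixes f :: "real^'n \<Rightarrow> real^'n"
  assumes S: "S \<in> sets borel"
    and f': "\<And>x. x \<in> S \<Longrightarrow> (f has_derivative f' x) (at x)"
    and m: "(\<lambda>x. indicator S x * det (matrix (f' x))) \<in> borel_measurable borel"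
    and fS: "f ` S \<in> sets borel"
  shows "emeasure lborel (f ` S) \<le> (\<integral>\<^sup>+x. indicator S x * ennreal \<bar>det (matrix (f' x))\<bar> \<partial>lborel)"
proof -
  define G where "G x = indicator S x * det (matrix (f' x))" for x
  have [measurable]: "G \<in> borel_measurable borel" using m by (simp add: G_def[abs_def])
  let ?g = "\<lambda>x. reindex (f (reindex' x))"
  \<comment> \<open>Off the image of \<open>S\<close> the derivative is replaced by 0. Its
    determinant is then the function of hypothesis \<open>m\<close> in the new coordinates, hence
    Borel on the whole space.\<close>
  let ?g' = "\<lambda>x h. if reindex' x \<in> S then reindex (f' (reindex' x) (reindex' h)) else 0"
  note im = reindex_image_eq_vimage[of S]
  have RS: "reindex ` S \<in> sets borel" unfolding im
    using measurable_sets[OF borel_measurable_reindex(2) S] by simp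
  have gim: "?g ` (reindex ` S) = reindex ` (f ` S)" by (simp add: image_image)
  note im2 = reindex_image_eq_vimage[of "f ` S"]
  have gS: "?g ` (reindex ` S) \<in> sets borel" unfolding gim im2
    using measurable_sets[OF borel_measurable_reindex(2) fS] by simp
  have d: "det (matrix (?g' x)) = indicator S (reindex' x) * det (matrix (f' (reindex' x)))" for x
  proof (cases "reindex' x \<in> S")
    case True
    have "linear (f' (reindex' x))" using f'[OF True] by (simp add: has_derivative_linear)
    from matrix_conj_reindex[OF this] show ?thesis using True by (simp only: if_True det_reindex indicator_simps mult_1)
  next
    case False
    have "matrix (\<lambda>h::real^'n idx. 0 :: real^'n idx) = mat 0" by (simp add: matrix_def vec_eq_iff)
    then show ?thesis using False by (simp only: if_False det_0) (simp add: indicator_def)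
  qed
  have m2: "(\<lambda>x. det (matrix (?g' x))) \<in> borel_measurable borel"
    unfolding d by (rule measurable_compose[OF borel_measurable_reindex(2) m])
  have der: "(?g has_derivative ?g' x) (at x)" if "x \<in> reindex ` S" for x
  proof -
    have x: "reindex' x \<in> S" using that im by auto
    have d1: "(reindex' has_derivative reindex') (at x)"
      and d2: "(reindex has_derivative reindex) (at (f (reindex' x)))"
      by (simp_all add: linear_imp_has_derivative linear_reindex)
    have "((\<lambda>y. f (reindex' y)) has_derivative (\<lambda>h. f' (reindex' x) (reindex' h))) (at x)"
      by (rule has_derivative_compose[OF d1 f'[OF x]])
    from has_derivative_compose[OF this d2]
    show ?thesis using x by simp
  qed
  have "emeasure lborel (f ` S) = emeasure lborel (?g ` (reindex ` S))"
    unfolding gim using emeasure_reindex_image[OF fS] by simp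
  also have "\<dots> \<le> (\<integral>\<^sup>+x. indicator (reindex ` S) x * ennreal \<bar>det (matrix (?g' x))\<bar> \<partial>lborel)"
    by (rule emeasure_differentiable_image_wellorder[where f = ?g and f' = ?g', OF RS _ m2 gS]) (rule der)
  also have "\<dots> = (\<integral>\<^sup>+x. ennreal \<bar>G (reindex' x)\<bar> \<partial>distr lborel borel (reindex :: real^'n \<Rightarrow> _))"
    unfolding d lborel_reindex G_def by (intro nn_integral_cong) (auto simp: indicator_def im)
  also have "\<dots> = (\<integral>\<^sup>+x. ennreal \<bar>G x\<bar> \<partial>lborel)"
    by (subst nn_integral_distr) simp_all
  also have "\<dots> = (\<integral>\<^sup>+x. indicator S x * ennreal \<bar>det (matrix (f' x))\<bar> \<partial>lborel)"
    unfolding G_def by (intro nn_integral_cong) (auto simp: indicator_def)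
  finally show ?thesis .
qed

section \<open>Isodiametric inequality and cones over hyperplane sections\<close>

lemma slice_measurable:
  assumes X [measurable]: "X \<in> sets (Pi\<^sub>M A (\<lambda>_. lborel :: real measure))" and i: "i \<in> A"
  shows "(\<lambda>f. emeasure lborel {y. f(i := y) \<in> X}) \<in> borel_measurable (Pi\<^sub>M (A - {i}) (\<lambda>_. lborel))"
    and "(\<lambda>f. emeasure lborel {y. f(i := y) \<in> X}) \<in> borel_measurable (Pi\<^sub>M A (\<lambda>_. lborel))"
    and "f \<in> space (Pi\<^sub>M (A - {i}) (\<lambda>_. lborel :: real measure)) \<Longrightarrow> {y. f(i := y) \<in> X} \<in> sets borel"
proof -
  have A: "insert i (A - {i}) = A" "insert i A = A" using i by auto
  \<comment> \<open>This version, over the remaining coordinates, serves Fubini; the next one, over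
    all coordinates, serves the measurability of \<open>steiner\<close>.\<close>
  have upd: "(\<lambda>(f, y). f(i := y)) \<in> Pi\<^sub>M (A - {i}) (\<lambda>_. lborel) \<Otimes>\<^sub>M lborel \<rightarrow>\<^sub>M Pi\<^sub>M A (\<lambda>_. lborel :: real measure)"
    using measurable_add_dim[of i "A - {i}" "\<lambda>_. lborel"] by (simp add: A)
  have upd2: "(\<lambda>(f, y). f(i := y)) \<in> Pi\<^sub>M A (\<lambda>_. lborel) \<Otimes>\<^sub>M lborel \<rightarrow>\<^sub>M Pi\<^sub>M A (\<lambda>_. lborel :: real measure)"
    using measurable_add_dim[of i A "\<lambda>_. lborel"] by (simp add: A)
  have eq: "Pair f -` ((\<lambda>(f, y). f(i := y)) -` X \<inter> space (N \<Otimes>\<^sub>M lborel)) = {y. f(i := y) \<in> X}"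
    if "f \<in> space N" for f and N :: "('a \<Rightarrow> real) measure"
    using that by (auto simp: space_pair_measure)
  show "(\<lambda>f. emeasure lborel {y. f(i := y) \<in> X}) \<in> borel_measurable (Pi\<^sub>M (A - {i}) (\<lambda>_. lborel))"
    using lborel.measurable_emeasure_Pair[OF measurable_sets[OF upd X]]
    by (rule measurable_cong[THEN iffD1, rotated]) (simp add: eq del: vimage_Int)
  show "(\<lambda>f. emeasure lborel {y. f(i := y) \<in> X}) \<in> borel_measurable (Pi\<^sub>M A (\<lambda>_. lborel))"
    using lborel.measurable_emeasure_Pair[OF measurable_sets[OF upd2 X]]
    by (rule measurable_cong[THEN iffD1, rotated]) (simp add: eq del: vimage_Int)
  show "{y. f(i := y) \<in> X} \<in> sets borel" if "f \<in> space (Pi\<^sub>M (A - {i}) (\<lambda>_. lborel :: real measure))"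
    using sets_Pair1[OF measurable_sets[OF upd X], of f] that by (simp add: eq del: vimage_Int)
qed

text \<open>
  Strict inequality: empty slices stay empty, so the diameter does not grow.
\<close>

definition steiner :: "'a set \<Rightarrow> 'a \<Rightarrow> ('a \<Rightarrow> real) set \<Rightarrow> ('a \<Rightarrow> real) set" where
  "steiner A i X = {f \<in> space (Pi\<^sub>M A (\<lambda>_. lborel)). ennreal (2 * \<bar>f i\<bar>) < emeasure lborel {y. f(i := y) \<in> X}}"

lemma steiner_sets:
  assumes X: "X \<in> sets (Pi\<^sub>M A (\<lambda>_. lborel :: real measure))" and i: "i \<in> A"
  shows "steiner A i X \<in> sets (Pi\<^sub>M A (\<lambda>_. lborel))"
proof -
  define L where "L f = emeasure lborel {y. f(i := y) \<in> X}" for f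
  have [measurable]: "L \<in> borel_measurable (Pi\<^sub>M A (\<lambda>_. lborel))"
    using slice_measurable(2)[OF X i] by (simp add: L_def[abs_def])
  have [measurable]: "(\<lambda>f. f i) \<in> Pi\<^sub>M A (\<lambda>_. lborel) \<rightarrow>\<^sub>M (lborel :: real measure)"
    by (rule measurable_component_singleton[OF i])
  show ?thesis unfolding steiner_def L_def[symmetric] using i by measurable
qed

text \<open>A symmetrized slice is the open interval of half-length \<open>L / 2\<close>; it is
  empty for \<open>L = 0\<close> and the whole line for \<open>L = top\<close>.\<close>

lemma emeasure_symmetric_interval: "emeasure lborel {y::real. ennreal (2 * \<bar>y\<bar>) < L} = L"
proof (cases L)
  case (real r)
  have "{y::real. ennreal (2 * \<bar>y\<bar>) < L} = {- (r/2)<..<r/2}"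
    using real by (auto simp: ennreal_less_iff)
  then show ?thesis using real by simp
next
  case top
  then show ?thesis by (simp add: less_top[symmetric])
qed

lemma emeasure_PiM_slices:
  assumes A: "finite A" and i: "i \<in> A" and X: "X \<in> sets (Pi\<^sub>M A (\<lambda>_. lborel :: real measure))"
  shows "emeasure (Pi\<^sub>M A (\<lambda>_. lborel)) X
    = (\<integral>\<^sup>+f. emeasure lborel {y. f(i := y) \<in> X} \<partial>Pi\<^sub>M (A - {i}) (\<lambda>_. lborel))"
proof -
  interpret product_sigma_finite "\<lambda>_. lborel :: real measure" by standard
  have A': "insert i (A - {i}) = A" using i by auto
  have "emeasure (Pi\<^sub>M A (\<lambda>_. lborel)) X = (\<integral>\<^sup>+f. indicator X f \<partial>Pi\<^sub>M (insert i (A - {i})) (\<lambda>_. lborel))"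
    using X by (simp only: A' nn_integral_indicator)
  also have "\<dots> = (\<integral>\<^sup>+f. \<integral>\<^sup>+y. indicator X (f(i := y)) \<partial>lborel \<partial>Pi\<^sub>M (A - {i}) (\<lambda>_. lborel))"
    using A X by (subst product_nn_integral_insert) (simp_all only: A' finite_Diff Diff_iff singletonI borel_measurable_indicator not_True_eq_False simp_thms)
  also have "\<dots> = (\<integral>\<^sup>+f. emeasure lborel {y. f(i := y) \<in> X} \<partial>Pi\<^sub>M (A - {i}) (\<lambda>_. lborel))"
  proof (rule nn_integral_cong)
    fix f assume "f \<in> space (Pi\<^sub>M (A - {i}) (\<lambda>_. lborel :: real measure))"
    then have "{y. f(i := y) \<in> X} \<in> sets lborel" using slice_measurable(3)[OF X i] by simp
    then have "(\<integral>\<^sup>+y. indicator {y. f(i := y) \<in> X} y \<partial>lborel) = emeasure lborel {y. f(i := y) \<in> X}"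
      by (rule nn_integral_indicator)
    then show "(\<integral>\<^sup>+y. indicator X (f(i := y)) \<partial>lborel) = emeasure lborel {y. f(i := y) \<in> X}"
      by (simp add: indicator_def)
  qed
  finally show ?thesis .
qed

lemma emeasure_steiner:
  assumes A: "finite A" and i: "i \<in> A" and X: "X \<in> sets (Pi\<^sub>M A (\<lambda>_. lborel :: real measure))"
  shows "emeasure (Pi\<^sub>M A (\<lambda>_. lborel)) (steiner A i X) = emeasure (Pi\<^sub>M A (\<lambda>_. lborel)) X"
  unfolding emeasure_PiM_slices[OF A i X] emeasure_PiM_slices[OF A i steiner_sets[OF X i]]
proof (rule nn_integral_cong)
  fix f assume f: "f \<in> space (Pi\<^sub>M (A - {i}) (\<lambda>_. lborel :: real measure))"
  have "f(i := y) \<in> space (Pi\<^sub>M A (\<lambda>_. lborel :: real measure))" for y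
    using f i by (auto simp: space_PiM PiE_iff extensional_def)
  then have "{y. f(i := y) \<in> steiner A i X} = {y. ennreal (2 * \<bar>y\<bar>) < emeasure lborel {z. f(i := z) \<in> X}}"
    by (simp add: steiner_def)
  then show "emeasure lborel {y. f(i := y) \<in> steiner A i X} = emeasure lborel {y. f(i := y) \<in> X}"
    by (simp add: emeasure_symmetric_interval)
qed

text \<open>\<open>S\<close> lies in \<open>{Inf S..Sup S}\<close>, and the gap condition confines
  \<open>T\<close> to \<open>{Sup S - c..Inf S + c}\<close>; the two lengths add up to
  \<open>2 * c\<close>.\<close>

lemma emeasure_add_le_of_gap:
  fixes S T :: "real set"
  assumes gap: "\<And>a b. a \<in> S \<Longrightarrow> b \<in> T \<Longrightarrow> \<bar>a - b\<bar> \<le> c" and ne: "S \<noteq> {}" "T \<noteq> {}"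
  shows "emeasure lborel S + emeasure lborel T \<le> ennreal (2 * c)"
proof -
  obtain b0 where b0: "b0 \<in> T" using ne by blast
  have bdd: "bdd_above S" "bdd_below S"
    using gap[OF _ b0] by (intro bdd_aboveI[of _ "b0 + c"] bdd_belowI[of _ "b0 - c"], force)+
  have S: "S \<subseteq> {Inf S..Sup S}" using bdd by (auto intro: cInf_lower cSup_upper)
  have T: "T \<subseteq> {Sup S - c..Inf S + c}"
  proof
    fix b assume b: "b \<in> T"
    have "a \<le> b + c" "b - c \<le> a" if "a \<in> S" for a using gap[OF that b] by (auto simp: abs_le_iff)
    then have "Sup S \<le> b + c" "b - c \<le> Inf S" using ne by (auto intro: cSup_least cInf_greatest)
    then show "b \<in> {Sup S - c..Inf S + c}" by auto
  qed
  have le: "Inf S \<le> Sup S" using ne(1) bdd by (metis cInf_le_cSup)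
  have le2: "Sup S - c \<le> Inf S + c" using T b0 by auto
  have "emeasure lborel S + emeasure lborel T
      \<le> emeasure lborel {Inf S..Sup S} + emeasure lborel {Sup S - c..Inf S + c}"
    by (intro add_mono emeasure_mono S T) auto
  also have "\<dots> = ennreal (2 * c)"
    using le le2 by (simp add: ennreal_plus[symmetric] del: ennreal_plus)
  finally show ?thesis .
qed

lemma steiner_diameter:
  assumes A: "finite A" and i: "i \<in> A"
    and d: "\<And>f g. f \<in> X \<Longrightarrow> g \<in> X \<Longrightarrow> (\<Sum>j\<in>A. (f j - g j)\<^sup>2) \<le> D"
    and f: "f \<in> steiner A i X" and g: "g \<in> steiner A i X"
  shows "(\<Sum>j\<in>A. (f j - g j)\<^sup>2) \<le> D"
proof -
  let ?S = "{y. f(i := y) \<in> X}" and ?T = "{y. g(i := y) \<in> X}"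
  \<comment> \<open>The contribution of the coordinates that symmetrization leaves alone. What
    remains is a statement on the two slices: all their mutual distances are at most
    \<open>sqrt (D - ?s)\<close>, so their half-lengths, and with them \<open>f i\<close> and
    \<open>g i\<close>, are controlled.\<close>
  let ?s = "\<Sum>j\<in>A-{i}. (f j - g j)\<^sup>2"
  have lt: "ennreal (2 * \<bar>f i\<bar>) < emeasure lborel ?S" "ennreal (2 * \<bar>g i\<bar>) < emeasure lborel ?T"
    using f g by (auto simp: steiner_def)
  then have ne: "?S \<noteq> {}" "?T \<noteq> {}" by (metis emeasure_empty not_less_zero)+
  have eq: "(\<Sum>j\<in>A. ((f(i := a)) j - (g(i := b)) j)\<^sup>2) = (a - b)\<^sup>2 + ?s" for a b
    using A i by (subst sum.remove[of _ i]) (auto intro!: sum.cong)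
  have ab: "(a - b)\<^sup>2 \<le> D - ?s" if "a \<in> ?S" "b \<in> ?T" for a b
    using d[of "f(i := a)" "g(i := b)"] that eq[of a b] by simp
  have nn: "0 \<le> D - ?s" using ne ab by (smt (verit) all_not_in_conv zero_le_power2)
  have "emeasure lborel ?S + emeasure lborel ?T \<le> ennreal (2 * sqrt (D - ?s))"
    using ne ab by (intro emeasure_add_le_of_gap) (auto intro: real_le_rsqrt)
  moreover have "ennreal (2 * \<bar>f i\<bar>) + ennreal (2 * \<bar>g i\<bar>) < emeasure lborel ?S + emeasure lborel ?T"
    using lt by (rule add_strict_mono)
  ultimately have "ennreal (2 * \<bar>f i\<bar> + 2 * \<bar>g i\<bar>) < ennreal (2 * sqrt (D - ?s))"
    by (simp add: ennreal_plus[symmetric] del: ennreal_plus)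
  then have "2 * \<bar>f i\<bar> + 2 * \<bar>g i\<bar> < 2 * sqrt (D - ?s)" by (simp add: ennreal_less_iff del: ennreal_plus)
  then have "\<bar>f i - g i\<bar> \<le> sqrt (D - ?s)" by linarith
  then have "(f i - g i)\<^sup>2 \<le> D - ?s"
    using nn by (metis abs_ge_zero power2_abs power_mono real_sqrt_pow2)
  then show ?thesis using eq[of "f i" "g i"] by simp
qed

definition reflection_invariant :: "'a \<Rightarrow> ('a \<Rightarrow> real) set \<Rightarrow> bool" where
  "reflection_invariant j X \<longleftrightarrow> (\<forall>f\<in>X. f(j := - f j) \<in> X)"

lemma reflection_invariant_steiner_same:
  assumes "i \<in> A" shows "reflection_invariant i (steiner A i X)"
  using assms unfolding reflection_invariant_def steiner_def
  by (auto simp: space_PiM PiE_iff extensional_def)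

text \<open>Reflecting coordinate \<open>j\<close> does not change the slices in direction
  \<open>i\<close>, so a symmetry once gained survives the later symmetrizations.\<close>

lemma reflection_invariant_steiner_other:
  assumes "i \<in> A" "j \<in> A" "i \<noteq> j" and X: "reflection_invariant j X"
  shows "reflection_invariant j (steiner A i X)"
  unfolding reflection_invariant_def
proof
  fix f assume f: "f \<in> steiner A i X"
  have "(f(j := - f j))(i := y) \<in> X \<longleftrightarrow> f(i := y) \<in> X" for y
  proof
    assume "f(i := y) \<in> X"
    then have "(f(i := y))(j := - (f(i := y)) j) \<in> X" using X by (auto simp: reflection_invariant_def)
    then show "(f(j := - f j))(i := y) \<in> X" using assms by (simp add: fun_upd_twist)
  next
    assume "(f(j := - f j))(i := y) \<in> X"
    then have "((f(j := - f j))(i := y))(j := - ((f(j := - f j))(i := y)) j) \<in> X"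
      using X by (auto simp: reflection_invariant_def)
    also have "((f(j := - f j))(i := y))(j := - ((f(j := - f j))(i := y)) j) = f(i := y)"
      using assms by auto
    finally show "f(i := y) \<in> X" .
  qed
  then show "f(j := - f j) \<in> steiner A i X"
    using f assms by (auto simp: steiner_def space_PiM PiE_iff extensional_def)
qed

lemma symmetrization:
  assumes A: "finite A" and X: "X \<in> sets (Pi\<^sub>M A (\<lambda>_. lborel :: real measure))"
    and d: "\<And>f g. f \<in> X \<Longrightarrow> g \<in> X \<Longrightarrow> (\<Sum>j\<in>A. (f j - g j)\<^sup>2) \<le> D"
    and C: "C \<subseteq> A"
  shows "\<exists>Y\<in>sets (Pi\<^sub>M A (\<lambda>_. lborel)). emeasure (Pi\<^sub>M A (\<lambda>_. lborel)) Y = emeasure (Pi\<^sub>M A (\<lambda>_. lborel)) X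
    \<and> (\<forall>f\<in>Y. \<forall>g\<in>Y. (\<Sum>j\<in>A. (f j - g j)\<^sup>2) \<le> D) \<and> (\<forall>j\<in>C. reflection_invariant j Y)"
  using finite_subset[OF C A] C
proof (induction C rule: finite_induct)
  case empty
  then show ?case using X d by blast
next
  case (insert i C)
  then obtain Y where Y: "Y \<in> sets (Pi\<^sub>M A (\<lambda>_. lborel))"
      "emeasure (Pi\<^sub>M A (\<lambda>_. lborel)) Y = emeasure (Pi\<^sub>M A (\<lambda>_. lborel)) X"
      "\<And>f g. f \<in> Y \<Longrightarrow> g \<in> Y \<Longrightarrow> (\<Sum>j\<in>A. (f j - g j)\<^sup>2) \<le> D" "\<forall>j\<in>C. reflection_invariant j Y"
    by auto
  have i: "i \<in> A" using insert by auto
  show ?case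
  proof (intro bexI[of _ "steiner A i Y"] conjI ballI)
    show "steiner A i Y \<in> sets (Pi\<^sub>M A (\<lambda>_. lborel))" by (rule steiner_sets[OF Y(1) i])
    show "emeasure (Pi\<^sub>M A (\<lambda>_. lborel)) (steiner A i Y) = emeasure (Pi\<^sub>M A (\<lambda>_. lborel)) X"
      using emeasure_steiner[OF A i Y(1)] Y(2) by simp
    show "(\<Sum>j\<in>A. (f j - g j)\<^sup>2) \<le> D" if "f \<in> steiner A i Y" "g \<in> steiner A i Y" for f g
      using steiner_diameter[OF A i Y(3) that] by blast
    show "reflection_invariant j (steiner A i Y)" if "j \<in> insert i C" for j
      using that Y(4) i insert.prems insert.hyps
      by (cases "j = i") (auto intro: reflection_invariant_steiner_same reflection_invariant_steiner_other)
  qed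
qed

text \<open>Symmetrizing in every coordinate keeps volume and diameter bound and produces a set
  \<open>Y\<close> with \<open>- f \<in> Y\<close> for each \<open>f \<in> Y\<close>. The distance
  from \<open>f\<close> to \<open>- f\<close> is twice the norm of \<open>f\<close>, so
  \<open>Y\<close> lies in the ball of radius \<open>d / 2\<close>.\<close>

lemma isodiametric_PiM_pos:
  assumes A: "finite A" and X: "X \<in> sets (Pi\<^sub>M A (\<lambda>_. lborel :: real measure))"
    and d: "\<And>f g. f \<in> X \<Longrightarrow> g \<in> X \<Longrightarrow> (\<Sum>j\<in>A. (f j - g j)\<^sup>2) \<le> d\<^sup>2" and d0: "d > 0"
  shows "emeasure (Pi\<^sub>M A (\<lambda>_. lborel)) X \<le> ennreal (unit_ball_vol (real (card A)) * (d / 2) ^ card A)"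
proof -
  obtain Y where Y: "Y \<in> sets (Pi\<^sub>M A (\<lambda>_. lborel))"
      "emeasure (Pi\<^sub>M A (\<lambda>_. lborel)) Y = emeasure (Pi\<^sub>M A (\<lambda>_. lborel)) X"
      "\<And>f g. f \<in> Y \<Longrightarrow> g \<in> Y \<Longrightarrow> (\<Sum>j\<in>A. (f j - g j)\<^sup>2) \<le> d\<^sup>2" "\<And>j. j \<in> A \<Longrightarrow> reflection_invariant j Y"
    using symmetrization[OF A X d order_refl] by blast
  \<comment> \<open>Reflections of single coordinates compose; for \<open>C = A\<close> this is the
    reflection in the origin.\<close>
  have flip: "(\<lambda>j. if j \<in> C then - f j else f j) \<in> Y" if "f \<in> Y" "C \<subseteq> A" for f C
    using finite_subset[OF that(2) A] that(2)
  proof (induction C rule: finite_induct)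
    case (insert i C)
    let ?h = "\<lambda>j. if j \<in> C then - f j else f j"
    have "?h(i := - ?h i) \<in> Y" using insert Y(4)[of i] by (auto simp: reflection_invariant_def)
    also have "?h(i := - ?h i) = (\<lambda>j. if j \<in> insert i C then - f j else f j)"
      using insert by auto
    finally show ?case .
  qed (use that in simp)
  have "Y \<subseteq> {f. sqrt (\<Sum>i\<in>A. (f i)\<^sup>2) \<le> d / 2} \<inter> space (Pi\<^sub>M A (\<lambda>_. lborel))"
  proof
    fix f assume f: "f \<in> Y"
    have "(\<Sum>j\<in>A. (f j - (if j \<in> A then - f j else f j))\<^sup>2) \<le> d\<^sup>2"
      using Y(3)[OF f flip[OF f order_refl]] .
    also have "(\<Sum>j\<in>A. (f j - (if j \<in> A then - f j else f j))\<^sup>2) = 4 * (\<Sum>j\<in>A. (f j)\<^sup>2)"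
      by (simp add: sum_distrib_left power2_eq_square)
    finally have "(\<Sum>j\<in>A. (f j)\<^sup>2) \<le> (d / 2)\<^sup>2" by (simp add: power_divide)
    then have "sqrt (\<Sum>j\<in>A. (f j)\<^sup>2) \<le> d / 2" using d0 by (intro real_le_lsqrt sum_nonneg) auto
    then show "f \<in> {f. sqrt (\<Sum>i\<in>A. (f i)\<^sup>2) \<le> d / 2} \<inter> space (Pi\<^sub>M A (\<lambda>_. lborel))"
      using f Y(1) sets.sets_into_space by blast
  qed
  then have "emeasure (Pi\<^sub>M A (\<lambda>_. lborel)) Y
      \<le> emeasure (Pi\<^sub>M A (\<lambda>_. lborel)) ({f. sqrt (\<Sum>i\<in>A. (f i)\<^sup>2) \<le> d / 2} \<inter> space (Pi\<^sub>M A (\<lambda>_. lborel)))"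
    by (rule emeasure_mono) measurable
  also have "\<dots> = ennreal (unit_ball_vol (real (card A)) * (d / 2) ^ card A)"
    using d0 A by (intro emeasure_cball_aux) auto
  finally show ?thesis using Y(2) by simp
qed

text \<open>The formula for the volume of a ball asks for a positive radius, so \<open>d = 0\<close>
  is reached by letting the bound decrease to \<open>d\<close>.\<close>

lemma isodiametric_PiM:
  assumes A: "finite A" and X: "X \<in> sets (Pi\<^sub>M A (\<lambda>_. lborel :: real measure))"
    and d: "\<And>f g. f \<in> X \<Longrightarrow> g \<in> X \<Longrightarrow> (\<Sum>j\<in>A. (f j - g j)\<^sup>2) \<le> d\<^sup>2" and d0: "d \<ge> 0"
  shows "emeasure (Pi\<^sub>M A (\<lambda>_. lborel)) X \<le> ennreal (unit_ball_vol (real (card A)) * (d / 2) ^ card A)"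
proof -
  have "emeasure (Pi\<^sub>M A (\<lambda>_. lborel)) X \<le> ennreal (unit_ball_vol (real (card A)) * (e / 2) ^ card A)"
    if "d < e" for e
  proof (rule isodiametric_PiM_pos[OF A X])
    fix f g assume "f \<in> X" "g \<in> X"
    then have "(\<Sum>j\<in>A. (f j - g j)\<^sup>2) \<le> d\<^sup>2" by (rule d)
    also have "d\<^sup>2 \<le> e\<^sup>2" using that d0 by (intro power_mono) auto
    finally show "(\<Sum>j\<in>A. (f j - g j)\<^sup>2) \<le> e\<^sup>2" .
  qed (use that d0 in auto)
  then have "\<forall>\<^sub>F e in at_right d. emeasure (Pi\<^sub>M A (\<lambda>_. lborel)) X
      \<le> ennreal (unit_ball_vol (real (card A)) * (e / 2) ^ card A)"
    by (auto simp: eventually_at_right_field intro!: exI[of _ "d + 1"])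
  moreover have "((\<lambda>e. ennreal (unit_ball_vol (real (card A)) * (e / 2) ^ card A))
      \<longlongrightarrow> ennreal (unit_ball_vol (real (card A)) * (d / 2) ^ card A)) (at_right d)"
    by (intro tendsto_ennrealI tendsto_intros) simp
  ultimately show ?thesis by (intro tendsto_lowerbound) auto
qed

section \<open>Volumes of cones by slicing orthogonally to a coordinate direction\<close>

lemma emeasure_lborel_hyperplane_slices:
  fixes E :: "'a::euclidean_space set"
  assumes b: "b \<in> Basis" and E: "E \<in> sets borel"
  shows "emeasure lborel E = (\<integral>\<^sup>+t. emeasure (Pi\<^sub>M (Basis - {b}) (\<lambda>_. lborel))
      {f \<in> space (Pi\<^sub>M (Basis - {b}) (\<lambda>_. lborel)). (\<Sum>c\<in>Basis-{b}. f c *\<^sub>R c) + t *\<^sub>R b \<in> E} \<partial>lborel)"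
    and "{f \<in> space (Pi\<^sub>M (Basis - {b}) (\<lambda>_. lborel :: real measure)). (\<Sum>c\<in>Basis-{b}. f c *\<^sub>R c) + t *\<^sub>R b \<in> E}
      \<in> sets (Pi\<^sub>M (Basis - {b}) (\<lambda>_. lborel))"
proof -
  interpret product_sigma_finite "\<lambda>_. lborel :: real measure" by standard
  let ?P = "\<lambda>A. Pi\<^sub>M A (\<lambda>_. lborel :: real measure)" and ?B = "Basis - {b}"
  let ?h = "\<lambda>f. \<Sum>c\<in>Basis. f c *\<^sub>R c"
  have B: "insert b ?B = Basis" using b by auto
  have sl: "{f \<in> space (?P ?B). (\<Sum>c\<in>?B. f c *\<^sub>R c) + t *\<^sub>R b \<in> E} \<in> sets (?P ?B)" for t
  proof -
    have [measurable]: "(\<lambda>f. \<Sum>c\<in>?B. f c *\<^sub>R c) \<in> borel_measurable (?P ?B)" by measurable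
    show ?thesis using E by measurable
  qed
  then show "{f \<in> space (?P ?B). (\<Sum>c\<in>?B. f c *\<^sub>R c) + t *\<^sub>R b \<in> E} \<in> sets (?P ?B)" .
  have m: "?h \<in> borel_measurable (?P Basis)" by measurable
  have X: "?h -` E \<inter> space (?P Basis) \<in> sets (?P Basis)" by (rule measurable_sets[OF m E])
  have "emeasure lborel E = emeasure (?P Basis) (?h -` E \<inter> space (?P Basis))"
    by (subst lborel_eq) (rule emeasure_distr[OF m E])
  also have "\<dots> = (\<integral>\<^sup>+f. indicator (?h -` E \<inter> space (?P Basis)) f \<partial>?P (insert b ?B))"
    using X by (simp only: B nn_integral_indicator)
  also have "\<dots> = (\<integral>\<^sup>+t. \<integral>\<^sup>+f. indicator (?h -` E \<inter> space (?P Basis)) (f(b := t)) \<partial>?P ?B \<partial>lborel)"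
    using X by (subst product_nn_integral_insert_rev)
      (simp_all only: B finite_Diff finite_Basis Diff_iff singletonI borel_measurable_indicator not_True_eq_False simp_thms)
  also have "\<dots> = (\<integral>\<^sup>+t. emeasure (?P ?B) {f \<in> space (?P ?B). (\<Sum>c\<in>?B. f c *\<^sub>R c) + t *\<^sub>R b \<in> E} \<partial>lborel)"
  proof (rule nn_integral_cong)
    fix t :: real
    have "(\<integral>\<^sup>+f. indicator (?h -` E \<inter> space (?P Basis)) (f(b := t)) \<partial>?P ?B)
      = (\<integral>\<^sup>+f. indicator {f \<in> space (?P ?B). (\<Sum>c\<in>?B. f c *\<^sub>R c) + t *\<^sub>R b \<in> E} f \<partial>?P ?B)"
    proof (rule nn_integral_cong)
      fix f assume f: "f \<in> space (?P ?B)"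
      have "?h (f(b := t)) = (\<Sum>c\<in>?B. f c *\<^sub>R c) + t *\<^sub>R b"
        using b by (subst sum.remove[of _ b]) (auto simp: add.commute intro!: sum.cong)
      moreover have "f(b := t) \<in> space (?P Basis)"
        using f b by (auto simp: space_PiM PiE_iff extensional_def)
      ultimately show "(indicator (?h -` E \<inter> space (?P Basis)) (f(b := t)) :: ennreal)
          = indicator {f \<in> space (?P ?B). (\<Sum>c\<in>?B. f c *\<^sub>R c) + t *\<^sub>R b \<in> E} f"
        using f by (simp add: indicator_def)
    qed
    then show "(\<integral>\<^sup>+f. indicator (?h -` E \<inter> space (?P Basis)) (f(b := t)) \<partial>?P ?B)
      = emeasure (?P ?B) {f \<in> space (?P ?B). (\<Sum>c\<in>?B. f c *\<^sub>R c) + t *\<^sub>R b \<in> E}"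
      using sl by simp
  qed
  finally show "emeasure lborel E = (\<integral>\<^sup>+t. emeasure (?P ?B) {f \<in> space (?P ?B). (\<Sum>c\<in>?B. f c *\<^sub>R c) + t *\<^sub>R b \<in> E} \<partial>lborel)" .
qed

lemma norm_sum_Basis_squared:
  fixes f :: "'a::euclidean_space \<Rightarrow> real"
  assumes "A \<subseteq> Basis"
  shows "(norm (\<Sum>c\<in>A. f c *\<^sub>R c))\<^sup>2 = (\<Sum>c\<in>A. (f c)\<^sup>2)"
proof -
  have fin: "finite A" using assms finite_subset finite_Basis by blast
  have "(norm (\<Sum>c\<in>A. f c *\<^sub>R c))\<^sup>2 = (\<Sum>c\<in>A. (norm (f c *\<^sub>R c))\<^sup>2)"
  proof (rule norm_sum_Pythagorean[OF fin], unfold pairwise_def orthogonal_def, intro ballI impI)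
    fix i j assume "i \<in> A" "j \<in> A" "i \<noteq> j"
    then have "i \<bullet> j = 0" using assms by (intro inner_not_same_Basis) auto
    then show "f i *\<^sub>R i \<bullet> f j *\<^sub>R j = 0" by simp
  qed
  also have "\<dots> = (\<Sum>c\<in>A. (f c)\<^sup>2)" using assms by (intro sum.cong) (auto simp: norm_Basis)
  finally show ?thesis .
qed

lemma nn_integral_power_Icc:
  assumes "0 \<le> c" "0 \<le> s" "k \<ge> 1"
  shows "(\<integral>\<^sup>+t. ennreal (c * t ^ (k - 1)) * indicator {0..s} t \<partial>lborel) = ennreal (c * s ^ k / k)"
proof -
  obtain m where k: "k = Suc m" using assms(3) by (cases k) auto
  have "(\<integral>\<^sup>+t. ennreal (c * t ^ m) * indicator {0..s} t \<partial>lborel)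
      = ennreal (c * s ^ Suc m / Suc m - c * 0 ^ Suc m / Suc m)"
  proof (rule nn_integral_FTC_Icc)
    show "((\<lambda>x. c * x ^ Suc m / Suc m) has_real_derivative c * t ^ m) (at t)" for t
      using DERIV_cdivide[OF DERIV_cmult[OF DERIV_pow[of "Suc m" t UNIV]], of c "Suc m"]
      by (simp del: of_nat_Suc power_Suc)
  qed (use assms in auto)
  then show ?thesis by (simp add: k)
qed

text \<open>The slice at height \<open>t\<close> has diameter at most \<open>t * d\<close>, so by
  the isodiametric inequality its area is at most a constant times \<open>t ^ (n - 1)\<close>;
  integration over \<open>0 \<le> t \<le> s\<close> gives the factor
  \<open>s ^ n / n\<close>.\<close>

lemma emeasure_slices_le:
  fixes E :: "(real^'n) set"
  assumes b: "b \<in> Basis" and E: "E \<in> sets borel" and s: "0 \<le> s" and d: "0 \<le> d"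
    and sub: "\<And>x. x \<in> E \<Longrightarrow> 0 \<le> x \<bullet> b \<and> x \<bullet> b \<le> s"
    and diam: "\<And>x y. x \<in> E \<Longrightarrow> y \<in> E \<Longrightarrow> x \<bullet> b = y \<bullet> b \<Longrightarrow> norm (x - y) \<le> (x \<bullet> b) * d"
  shows "emeasure lborel E
    \<le> ennreal (unit_ball_vol (real (CARD('n) - 1)) * (d / 2) ^ (CARD('n) - 1) * s ^ CARD('n) / CARD('n))"
proof -
  let ?P = "\<lambda>A. Pi\<^sub>M A (\<lambda>_. lborel :: real measure)" and ?B = "Basis - {b}" and ?k = "CARD('n) - 1"
  let ?c = "unit_ball_vol (real ?k) * (d / 2) ^ ?k"
  let ?p = "\<lambda>f t. (\<Sum>c\<in>?B. f c *\<^sub>R c) + t *\<^sub>R b"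
  have pb: "?p f t \<bullet> b = t" for f t
    using b by (simp add: inner_add_left inner_sum_left inner_Basis sum.delta if_distrib cong: if_cong)
  have card: "card ?B = ?k" using b by (simp add: card_Diff_singleton)
  have "emeasure (?P ?B) {f \<in> space (?P ?B). ?p f t \<in> E} \<le> ennreal (?c * t ^ ?k) * indicator {0..s} t" for t
  proof (cases "t \<in> {0..s}")
    case True
    have "emeasure (?P ?B) {f \<in> space (?P ?B). ?p f t \<in> E}
        \<le> ennreal (unit_ball_vol (real (card ?B)) * ((t * d) / 2) ^ card ?B)"
    proof (rule isodiametric_PiM)
      fix f g assume "f \<in> {f \<in> space (?P ?B). ?p f t \<in> E}" "g \<in> {f \<in> space (?P ?B). ?p f t \<in> E}"
      then have "norm (?p f t - ?p g t) \<le> t * d" using diam[of "?p f t" "?p g t"] by (simp add: pb)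
      moreover have "?p f t - ?p g t = (\<Sum>c\<in>?B. (f c - g c) *\<^sub>R c)"
        by (simp add: scaleR_diff_left sum_subtractf)
      ultimately have "(norm (\<Sum>c\<in>?B. (f c - g c) *\<^sub>R c))\<^sup>2 \<le> (t * d)\<^sup>2"
        by (intro power_mono) auto
      then show "(\<Sum>c\<in>?B. (f c - g c)\<^sup>2) \<le> (t * d)\<^sup>2" by (simp add: norm_sum_Basis_squared)
    qed (use emeasure_lborel_hyperplane_slices(2)[OF b E] True d in auto)
    then show ?thesis using True by (simp add: card power_mult_distrib power_divide mult_ac)
  next
    case False
    then have "{f \<in> space (?P ?B). ?p f t \<in> E} = {}" using sub pb by fastforce
    then show ?thesis by (simp only: emeasure_empty zero_le)
  qed
  then have "emeasure lborel E \<le> (\<integral>\<^sup>+t. ennreal (?c * t ^ ?k) * indicator {0..s} t \<partial>lborel)"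
    unfolding emeasure_lborel_hyperplane_slices(1)[OF b E] by (intro nn_integral_mono)
  also have "\<dots> = ennreal (?c * s ^ CARD('n) / CARD('n))"
    using d s by (intro nn_integral_power_Icc) (auto simp: Suc_le_eq)
  finally show ?thesis .
qed

lemma emeasure_circular_cone:
  fixes b :: "real^'n"
  assumes b: "b \<in> Basis" and s: "0 \<le> s" and R: "0 < R"
  defines "E \<equiv> {x. 0 \<le> x \<bullet> b \<and> x \<bullet> b \<le> s \<and> norm (x - (x \<bullet> b) *\<^sub>R b) \<le> (x \<bullet> b) * R}"
  shows "emeasure lborel E
    = ennreal (unit_ball_vol (real (CARD('n) - 1)) * R ^ (CARD('n) - 1) * s ^ CARD('n) / CARD('n))"
proof -
  let ?P = "\<lambda>A. Pi\<^sub>M A (\<lambda>_. lborel :: real measure)" and ?B = "Basis - {b}" and ?k = "CARD('n) - 1"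
  let ?c = "unit_ball_vol (real ?k) * R ^ ?k"
  let ?p = "\<lambda>f t. (\<Sum>c\<in>?B. f c *\<^sub>R c) + t *\<^sub>R b"
  have pb: "?p f t \<bullet> b = t" for f t
    using b by (simp add: inner_add_left inner_sum_left inner_Basis sum.delta if_distrib cong: if_cong)
  have card: "card ?B = ?k" using b by (simp add: card_Diff_singleton)
  have E: "E \<in> sets borel" unfolding E_def
    by (intro borel_closed closed_Collect_conj closed_Collect_le continuous_intros)
  \<comment> \<open>Height 0 is left out because the disc degenerates to a point there; one height
    does not affect the integral.\<close>
  have "emeasure (?P ?B) {f \<in> space (?P ?B). ?p f t \<in> E} = ennreal (?c * t ^ ?k) * indicator {0..s} t"
    if t: "t \<noteq> 0" for t
  proof (cases "t \<in> {0..s}")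
    case True
    have "{f \<in> space (?P ?B). ?p f t \<in> E} = {f. sqrt (\<Sum>i\<in>?B. (f i)\<^sup>2) \<le> t * R} \<inter> space (?P ?B)"
    proof -
      have "sqrt (\<Sum>i\<in>?B. (f i)\<^sup>2) = norm (\<Sum>c\<in>?B. f c *\<^sub>R c)" for f
        using norm_sum_Basis_squared[of ?B f, OF Diff_subset, symmetric] by simp
      then have "?p f t \<in> E \<longleftrightarrow> sqrt (\<Sum>i\<in>?B. (f i)\<^sup>2) \<le> t * R" for f
        using True unfolding E_def mem_Collect_eq pb by simp
      then show ?thesis by (simp only: Collect_conj_eq Collect_mem_eq Int_commute)
    qed
    then show ?thesis
      using emeasure_cball_aux[of ?B "t * R"] True t R by (simp add: card power_mult_distrib mult_ac)
  next
    case False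
    then have "{f \<in> space (?P ?B). ?p f t \<in> E} = {}" unfolding E_def by (auto simp: pb)
    then show ?thesis using False by (simp only: emeasure_empty) simp
  qed
  then have "AE t in lborel. emeasure (?P ?B) {f \<in> space (?P ?B). ?p f t \<in> E}
      = ennreal (?c * t ^ ?k) * indicator {0..s} t"
    by (intro eventually_mono[OF AE_lborel_singleton[of 0]])
  then have "emeasure lborel E = (\<integral>\<^sup>+t. ennreal (?c * t ^ ?k) * indicator {0..s} t \<partial>lborel)"
    unfolding emeasure_lborel_hyperplane_slices(1)[OF b E] by (rule nn_integral_cong_AE)
  also have "\<dots> = ennreal (?c * s ^ CARD('n) / CARD('n))"
    using R s by (intro nn_integral_power_Icc) (auto simp: Suc_le_eq)
  finally show ?thesis .
qed

definition coneset :: "'a::real_vector set \<Rightarrow> 'a set" where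
  "coneset D = (\<lambda>(t, z). t *\<^sub>R z) ` ({0..1} \<times> D)"

lemma compact_coneset: "compact D \<Longrightarrow> compact (coneset (D :: 'a::real_normed_vector set))"
  unfolding coneset_def by (intro compact_continuous_image compact_Times)
    (auto simp: case_prod_unfold intro!: continuous_intros)

lemma exists_rotation:
  fixes u :: "real^'n"
  assumes "norm u = 1"
  obtains P :: "real^'n^'n" and b where "b \<in> Basis" "P *v b = u" "orthogonal_matrix P"
    "\<And>x y. (P *v x) \<bullet> (P *v y) = x \<bullet> y" "\<And>x. norm (P *v x) = norm x"
proof -
  obtain k :: 'n where True by simp
  define b :: "real^'n" where "b = axis k 1"
  have b: "b \<in> Basis" "norm b = norm u" using assms by (auto simp: b_def)
  obtain Q where Q: "orthogonal_transformation Q" "Q b = u"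
    using orthogonal_transformation_exists[OF b(2)] by blast
  have QP: "Q = (*v) (matrix Q)"
    using Q(1) by (simp add: fun_eq_iff matrix_works orthogonal_transformation_linear)
  show ?thesis
  proof (rule that[of b "matrix Q"])
    show "matrix Q *v b = u" using Q(2) QP by metis
    show "orthogonal_matrix (matrix Q)" using Q(1) by (simp add: orthogonal_transformation_matrix)
    show "(matrix Q *v x) \<bullet> (matrix Q *v y) = x \<bullet> y" for x y
      using Q(1) QP unfolding orthogonal_transformation_def by metis
    show "norm (matrix Q *v x) = norm x" for x
      using orthogonal_transformation_norm[OF Q(1), of x] QP by metis
  qed (use b in auto)
qed

lemma power_card_rescale:
  assumes "0 < (s::real)"
  shows "(r / s) ^ (CARD('n::finite) - 1) * s ^ CARD('n) = s * r ^ (CARD('n) - 1)"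
proof -
  obtain m where m: "CARD('n) = Suc m" using zero_less_card_finite gr0_implies_Suc by blast
  show ?thesis unfolding m using assms by (simp add: power_divide)
qed

text \<open>A rotation turns \<open>u\<close> into a basis vector. The slice at height
  \<open>t * s\<close> is then congruent to \<open>D\<close> scaled by \<open>t\<close>, so
  diameters grow by \<open>d / s\<close> per unit of height. The bound is height times area divided
  by \<open>n\<close>, with the area of a disc of diameter \<open>d\<close>.\<close>

lemma emeasure_coneset_le:
  fixes D :: "(real^'n) set"
  assumes D: "compact D" and u: "norm u = 1" and s: "0 < s" and d: "0 \<le> d"
    and plane: "\<And>z. z \<in> D \<Longrightarrow> z \<bullet> u = s" and diam: "\<And>y z. y \<in> D \<Longrightarrow> z \<in> D \<Longrightarrow> norm (y - z) \<le> d"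
  shows "emeasure lborel (coneset D)
    \<le> ennreal (s * unit_ball_vol (real (CARD('n) - 1)) * (d / 2) ^ (CARD('n) - 1) / CARD('n))"
proof -
  obtain P b where P: "b \<in> Basis" "P *v b = u" "orthogonal_matrix P"
    "\<And>x y. (P *v x) \<bullet> (P *v y) = x \<bullet> y" "\<And>x. norm (P *v x) = norm x"
    using exists_rotation[OF u] by blast
  define E where "E = {x. P *v x \<in> coneset D}"
  have PT: "P *v (transpose P *v x) = x" for x
    using P(3) by (simp add: orthogonal_matrix_def matrix_vector_mul_assoc del: transpose_matrix_vector)
  have surj: "(*v) P ` E = coneset D"
  proof (intro set_eqI iffI)
    fix y assume "y \<in> coneset D"
    then have "transpose P *v y \<in> E" by (simp only: E_def mem_Collect_eq PT)
    then have "P *v (transpose P *v y) \<in> (*v) P ` E" by (rule imageI)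
    then show "y \<in> (*v) P ` E" by (simp only: PT)
  qed (auto simp: E_def)
  have TP: "transpose P *v (P *v x) = x" for x
    using P(3) by (simp add: orthogonal_matrix_def matrix_vector_mul_assoc del: transpose_matrix_vector)
  have "E = (*v) (transpose P) ` coneset D"
    unfolding surj[symmetric] image_image TP by simp
  then have cE: "compact E"
    by (simp only:) (intro compact_continuous_image compact_coneset D matrix_vector_mult_linear_continuous_on)
  have "\<bar>det P\<bar> = 1" using det_orthogonal_matrix[OF P(3)] by auto
  then have eq: "emeasure lborel (coneset D) = emeasure lborel E"
    using emeasure_matrix_image[OF cE, of P] surj by simp
  have inE: "\<exists>t z. 0 \<le> t \<and> t \<le> 1 \<and> z \<in> D \<and> P *v x = t *\<^sub>R z \<and> x \<bullet> b = t * s" if "x \<in> E" for x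
  proof -
    obtain t z where tz: "0 \<le> t" "t \<le> 1" "z \<in> D" "P *v x = t *\<^sub>R z"
      using \<open>x \<in> E\<close> by (auto simp: E_def coneset_def)
    have "x \<bullet> b = t * s" using P(4)[of x b] tz(4) plane[OF tz(3)] P(2) by simp
    with tz show ?thesis by blast
  qed
  have "emeasure lborel E \<le> ennreal (unit_ball_vol (real (CARD('n) - 1)) * ((d / s) / 2) ^ (CARD('n) - 1) * s ^ CARD('n) / CARD('n))"
  proof (rule emeasure_slices_le[OF P(1)])
    show "E \<in> sets borel" using cE by (simp add: borel_compact)
    show "0 \<le> x \<bullet> b \<and> x \<bullet> b \<le> s" if "x \<in> E" for x
      using inE[OF that] s by (auto intro: mult_left_le_one_le)
    show "norm (x - y) \<le> (x \<bullet> b) * (d / s)" if xy: "x \<in> E" "y \<in> E" "x \<bullet> b = y \<bullet> b" for x y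
    proof -
      obtain t z where 1: "0 \<le> t" "t \<le> 1" "z \<in> D" "P *v x = t *\<^sub>R z" "x \<bullet> b = t * s"
        using inE[OF xy(1)] by blast
      obtain t' z' where 2: "0 \<le> t'" "t' \<le> 1" "z' \<in> D" "P *v y = t' *\<^sub>R z'" "y \<bullet> b = t' * s"
        using inE[OF xy(2)] by blast
      have "t' = t" using 1 2 xy s by simp
      then have "norm (x - y) = norm (t *\<^sub>R (z - z'))"
        using P(5)[of "x - y"] 1 2 by (simp add: matrix_vector_mult_diff_distrib scaleR_diff_right)
      also have "\<dots> \<le> t * d" using diam[OF 1(3) 2(3)] 1 by (simp add: mult_left_mono)
      finally show ?thesis using 1 s by simp
    qed
  qed (use s d in auto)
  also have "unit_ball_vol (real (CARD('n) - 1)) * ((d / s) / 2) ^ (CARD('n) - 1) * s ^ CARD('n) / CARD('n)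
      = s * unit_ball_vol (real (CARD('n) - 1)) * (d / 2) ^ (CARD('n) - 1) / CARD('n)"
    using power_card_rescale[OF s, of "d / 2", where 'n = 'n] by (simp add: mult_ac)
  finally show ?thesis unfolding eq .
qed

text \<open>An oblique cone is a sheared right circular cone, and shears preserve volume. The disc
  is centred at \<open>x\<^sub>0\<close>, not at the foot of the perpendicular from the origin,
  because in the application \<open>x\<^sub>0\<close> is the point where the plane touches the
  body.\<close>

lemma emeasure_coneset_disc_ge:
  fixes x\<^sub>0 u :: "real^'n"
  assumes u: "norm u = 1" and s: "0 < s" "x\<^sub>0 \<bullet> u = s" and R: "0 < R"
  shows "ennreal (s * unit_ball_vol (real (CARD('n) - 1)) * R ^ (CARD('n) - 1) / CARD('n))
    \<le> emeasure lborel (coneset {z. z \<bullet> u = s \<and> norm (z - x\<^sub>0) \<le> R})"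
proof -
  obtain P b where P: "b \<in> Basis" "P *v b = u" "orthogonal_matrix P"
    "\<And>x y. (P *v x) \<bullet> (P *v y) = x \<bullet> y" "\<And>x. norm (P *v x) = norm x"
    using exists_rotation[OF u] by blast
  let ?D = "{z. z \<bullet> u = s \<and> norm (z - x\<^sub>0) \<le> R}"
  let ?a = "(1 / s) *\<^sub>R x\<^sub>0 - u"
  \<comment> \<open>The shear fixes the hyperplane orthogonal to \<open>u\<close> and carries
    \<open>s *\<^sub>R u\<close> to \<open>x\<^sub>0\<close>; its determinant is
    \<open>1 + ?a \<bullet> u = 1\<close>.\<close>
  let ?S = "\<chi> i j. (if i = j then 1 else 0) + ?a $ i * u $ j"
  let ?E = "{x. 0 \<le> x \<bullet> b \<and> x \<bullet> b \<le> s \<and> norm (x - (x \<bullet> b) *\<^sub>R b) \<le> (x \<bullet> b) * (R / s)}"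
  have uu: "u \<bullet> u = 1" using u by (simp add: norm_eq_1)
  have "det ?S = 1" unfolding det_matrix_one_plus_outer using s uu by (simp add: inner_diff_left)
  moreover have "\<bar>det P\<bar> = 1" using det_orthogonal_matrix[OF P(3)] by auto
  ultimately have det: "\<bar>det (?S ** P)\<bar> = 1" by (simp add: det_mul)
  have nb: "norm b = 1" using P(1) by simp
  have cE: "compact ?E"
  proof (rule compact_eq_bounded_closed[THEN iffD2], intro conjI)
    show "bounded ?E" unfolding bounded_iff
    proof (intro exI ballI)
      fix x assume x: "x \<in> ?E"
      have "norm x \<le> norm (x - (x \<bullet> b) *\<^sub>R b) + norm ((x \<bullet> b) *\<^sub>R b)"
        by (metis diff_add_cancel norm_triangle_ineq)
      also have "\<dots> \<le> (x \<bullet> b) * (R / s) + \<bar>x \<bullet> b\<bar>" using x nb by simp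
      also have "(x \<bullet> b) * (R / s) \<le> s * (R / s)" using x s R by (intro mult_right_mono) auto
      finally show "norm x \<le> R + s" using x s by simp
    qed
    show "closed ?E" by (intro closed_Collect_conj closed_Collect_le continuous_intros)
  qed
  have cD: "compact ?D"
  proof (rule compact_eq_bounded_closed[THEN iffD2], intro conjI)
    have "?D \<subseteq> cball x\<^sub>0 R" by (auto simp: dist_norm norm_minus_commute)
    then show "bounded ?D" using bounded_cball bounded_subset by blast
    show "closed ?D" by (intro closed_Collect_conj closed_Collect_le closed_Collect_eq continuous_intros)
  qed
  have sub: "(*v) (?S ** P) ` ?E \<subseteq> coneset ?D"
  proof clarify
    fix x assume x: "0 \<le> x \<bullet> b" "x \<bullet> b \<le> s" "norm (x - (x \<bullet> b) *\<^sub>R b) \<le> (x \<bullet> b) * (R / s)"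
    let ?t = "x \<bullet> b"
    have ub: "u \<bullet> (P *v x) = ?t" using P(4)[of b x] P(2) by (simp add: inner_commute)
    have eq: "(?S ** P) *v x = P *v x + ?t *\<^sub>R ?a"
      unfolding matrix_vector_mul_assoc[symmetric] outer_matrix_vector ub ..
    also have "\<dots> = P *v (x - ?t *\<^sub>R b) + (?t / s) *\<^sub>R x\<^sub>0"
      using P(2) by (simp add: matrix_vector_mult_diff_distrib matrix_vector_mult_scaleR scaleR_diff_right)
    finally have eq: "(?S ** P) *v x = P *v (x - ?t *\<^sub>R b) + (?t / s) *\<^sub>R x\<^sub>0" .
    show "(?S ** P) *v x \<in> coneset ?D"
    proof (cases "?t = 0")
      case True
      then have "x = 0" using x by simp
      moreover have "x\<^sub>0 \<in> ?D" using s R by simp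
      ultimately show ?thesis unfolding coneset_def by (intro image_eqI[of _ _ "(0, x\<^sub>0)"]) auto
    next
      case False
      then have t: "?t > 0" using x by simp
      \<comment> \<open>The point where the ray through the image of \<open>x\<close> meets the
        plane of the disc.\<close>
      let ?z = "x\<^sub>0 + (s / ?t) *\<^sub>R (P *v (x - ?t *\<^sub>R b))"
      have "(P *v (x - ?t *\<^sub>R b)) \<bullet> u = 0"
        using P(4)[of "x - ?t *\<^sub>R b" b] P(2) nb by (simp add: inner_diff_left norm_eq_1)
      moreover have "norm (?z - x\<^sub>0) = (s / ?t) * norm (x - ?t *\<^sub>R b)" using t s P(5) by simp
      moreover have "\<dots> \<le> (s / ?t) * (?t * (R / s))" using x t s by (intro mult_left_mono) auto
      ultimately have "?z \<in> ?D" using t s by (simp add: inner_add_left)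
      then show ?thesis unfolding coneset_def eq using t s x
        by (intro image_eqI[of _ _ "(?t / s, ?z)"]) (auto simp: scaleR_add_right)
    qed
  qed
  have "emeasure lborel ((*v) (?S ** P) ` ?E) = emeasure lborel ?E"
    using emeasure_matrix_image[OF cE, of "?S ** P"] det by simp
  also have "\<dots> = ennreal (unit_ball_vol (real (CARD('n) - 1)) * (R / s) ^ (CARD('n) - 1) * s ^ CARD('n) / CARD('n))"
    using s R by (intro emeasure_circular_cone P(1)) auto
  also have "unit_ball_vol (real (CARD('n) - 1)) * (R / s) ^ (CARD('n) - 1) * s ^ CARD('n) / CARD('n)
      = s * unit_ball_vol (real (CARD('n) - 1)) * R ^ (CARD('n) - 1) / CARD('n)"
    using power_card_rescale[OF s(1), of R, where 'n = 'n] by (simp add: mult_ac)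
  finally have "ennreal (s * unit_ball_vol (real (CARD('n) - 1)) * R ^ (CARD('n) - 1) / CARD('n))
      = emeasure lborel ((*v) (?S ** P) ` ?E)" ..
  also have "\<dots> \<le> emeasure lborel (coneset ?D)"
    using sub compact_coneset[OF cD] by (intro emeasure_mono) (auto simp: borel_compact)
  finally show ?thesis .
qed

section \<open>Polar pairs and the duality relation\<close>

text \<open>For a polar pair this support function of \<open>J\<close> is also the gauge of
  \<open>K\<close>, see \<open>mem_K_iff\<close>. As a supremum of linear functions it is visibly
  sublinear and Lipschitz.\<close>

definition supp :: "'a::real_inner set \<Rightarrow> 'a \<Rightarrow> real" where
  "supp J x = (SUP y\<in>J. x \<bullet> y)"

text \<open>
  For polar bodies, \<open>dual_rel K J x y\<close> says that \<open>y\<close> is a subgradient at \<open>x\<close> of half the squared gauge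
  of \<open>K\<close>; unlike the gradient this is symmetric under exchanging \<open>K\<close> and \<open>J\<close>.
\<close>

definition dual_rel :: "'a::real_inner set \<Rightarrow> 'a set \<Rightarrow> 'a \<Rightarrow> 'a \<Rightarrow> bool" where
  "dual_rel K J x y \<longleftrightarrow> supp J x = supp K y \<and> x \<bullet> y = (supp J x)\<^sup>2"

text \<open>The conditions are symmetric in the two bodies, so whatever is proved for
  \<open>K\<close> is available for \<open>J\<close> through the interpretation
  \<open>dual\<close>.\<close>

locale polar_pair =
  fixes K J :: "(real^'n) set"
  assumes compact_K: "compact K" and compact_J: "compact J"
    and interior_K: "0 \<in> interior K" and interior_J: "0 \<in> interior J"
    and J_eq: "J = polar_body K" and K_eq: "K = polar_body J"

lemma polar_pair_sym: "polar_pair K J \<Longrightarrow> polar_pair J K"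
  unfolding polar_pair_def by blast

context polar_pair
begin

lemma zero_mem: "0 \<in> K" "0 \<in> J"
  using interior_K interior_J interior_subset[of K] interior_subset[of J] by auto

lemma bdd_inner: "bdd_above ((\<lambda>y. x \<bullet> y) ` J)"
  by (intro bounded_imp_bdd_above compact_imp_bounded compact_continuous_image compact_J continuous_intros)

lemma inner_le_supp: "y \<in> J \<Longrightarrow> x \<bullet> y \<le> supp J x"
  unfolding supp_def by (intro cSUP_upper bdd_inner)

lemma supp_attained: "\<exists>y\<in>J. x \<bullet> y = supp J x"
proof -
  have ne: "J \<noteq> {}" using zero_mem by blast
  have "continuous_on J (\<lambda>y. x \<bullet> y)" by (intro continuous_intros)
  from continuous_attains_sup[OF compact_J ne this]
  obtain y where y: "y \<in> J" "\<And>z. z \<in> J \<Longrightarrow> x \<bullet> z \<le> x \<bullet> y" by blast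
  have "supp J x \<le> x \<bullet> y" unfolding supp_def by (rule cSUP_least[OF ne y(2)])
  then show ?thesis using inner_le_supp[OF y(1), of x] by (intro bexI[OF _ y(1)] antisym)
qed

lemma supp_le: "(\<And>y. y \<in> J \<Longrightarrow> x \<bullet> y \<le> c) \<Longrightarrow> supp J x \<le> c"
  unfolding supp_def by (rule cSUP_least) (use zero_mem in blast)

lemma supp_nonneg: "0 \<le> supp J x"
  using inner_le_supp[OF zero_mem(2), of x] by simp

lemma supp_scale: assumes "0 \<le> t" shows "supp J (t *\<^sub>R x) = t * supp J x"
proof (rule antisym)
  show "supp J (t *\<^sub>R x) \<le> t * supp J x"
    using assms by (intro supp_le) (simp add: inner_le_supp mult_left_mono)
  obtain y where "y \<in> J" "x \<bullet> y = supp J x" using supp_attained by blast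
  then show "t * supp J x \<le> supp J (t *\<^sub>R x)" using inner_le_supp[of y "t *\<^sub>R x"] by simp
qed

lemma supp_zero [simp]: "supp J 0 = 0"
  using supp_scale[of 0 0] by simp

lemma supp_add: "supp J (x + z) \<le> supp J x + supp J z"
  by (intro supp_le) (simp add: inner_add_left add_mono inner_le_supp)

lemma mem_K_iff: "x \<in> K \<longleftrightarrow> supp J x \<le> 1"
proof
  assume "x \<in> K"
  then show "supp J x \<le> 1"
    by (intro supp_le) (simp add: K_eq polar_body_def inner_commute)
next
  assume "supp J x \<le> 1"
  then have "y \<bullet> x \<le> 1" if "y \<in> J" for y using inner_le_supp[OF that, of x] by (simp add: inner_commute)
  then show "x \<in> K" by (subst K_eq) (simp add: polar_body_def)
qed

lemma J_bound: "\<exists>C>0. \<forall>y\<in>J. norm y \<le> C"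
  using compact_imp_bounded[OF compact_J] unfolding bounded_pos by blast

lemma supp_bounds:
  "\<exists>c C. 0 < c \<and> 0 < C \<and> (\<forall>x. c * norm x \<le> supp J x) \<and> (\<forall>x. supp J x \<le> C * norm x)"
proof -
  obtain C where C: "C > 0" "\<And>y. y \<in> J \<Longrightarrow> norm y \<le> C" using J_bound by blast
  obtain c where c: "c > 0" "cball 0 c \<subseteq> J"
    using interior_J by (meson mem_interior_cball)
  show ?thesis
  proof (intro exI conjI allI)
    show "0 < c" "0 < C" by fact+
    fix x
    show "c * norm x \<le> supp J x"
    proof (cases "x = 0")
      case False
      then have "(c / norm x) *\<^sub>R x \<in> J" using c by auto
      from inner_le_supp[OF this, of x] False show ?thesis
        by (simp add: power2_norm_eq_inner[symmetric] power2_eq_square)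
    qed simp
    show "supp J x \<le> C * norm x"
    proof (rule supp_le)
      fix y assume "y \<in> J"
      have "x \<bullet> y \<le> norm x * norm y" by (rule norm_cauchy_schwarz)
      also have "\<dots> \<le> norm x * C" using C(2)[OF \<open>y \<in> J\<close>] by (rule mult_left_mono) simp
      finally show "x \<bullet> y \<le> C * norm x" by (simp add: mult.commute)
    qed
  qed
qed

lemma supp_eq_0_iff [simp]: "supp J x = 0 \<longleftrightarrow> x = 0"
proof -
  obtain c C where c: "0 < c" "0 < C" "\<And>x. c * norm x \<le> supp J x" "\<And>x. supp J x \<le> C * norm x"
    using supp_bounds by blast
  have "x = 0" if "supp J x = 0" using c(3)[of x] c(1) that by (simp add: mult_le_0_iff)
  then show ?thesis by auto
qed

lemma supp_pos_iff [simp]: "0 < supp J x \<longleftrightarrow> x \<noteq> 0"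
  using supp_nonneg[of x] supp_eq_0_iff[of x] by linarith

lemma supp_lipschitz: "\<exists>C>0. \<forall>x z. \<bar>supp J x - supp J z\<bar> \<le> C * norm (x - z)"
proof -
  obtain c C where C: "0 < c" "0 < C" "\<And>x. c * norm x \<le> supp J x" "\<And>x. supp J x \<le> C * norm x"
    using supp_bounds by blast
  have *: "supp J x - supp J z \<le> C * norm (x - z)" for x z
    using supp_add[of "x - z" z] C(4)[of "x - z"] by simp
  show ?thesis
  proof (intro exI conjI allI)
    show "0 < C" by fact
    show "\<bar>supp J x - supp J z\<bar> \<le> C * norm (x - z)" for x z
      using *[of x z] *[of z x] by (simp add: abs_le_iff norm_minus_commute)
  qed
qed

lemma continuous_on_supp: "continuous_on S (supp J)"
proof -
  obtain C where C: "0 < C" "\<And>x z. \<bar>supp J x - supp J z\<bar> \<le> C * norm (x - z)"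
    using supp_lipschitz by blast
  have "C-lipschitz_on S (supp J)"
    using C by (intro lipschitz_onI) (auto simp: dist_norm)
  then show ?thesis by (rule lipschitz_on_continuous_on)
qed

lemma continuous_on_supp' [continuous_intros]:
  "continuous_on S f \<Longrightarrow> continuous_on S (\<lambda>x. supp J (f x))"
  by (rule continuous_on_compose2[OF continuous_on_supp[of UNIV]]) auto

lemma supp_measurable [measurable]: "supp J \<in> borel_measurable borel"
  by (intro borel_measurable_continuous_onI continuous_on_supp)

lemma frontier_K_iff: "x \<in> frontier K \<longleftrightarrow> supp J x = 1"
proof -
  have cl: "closure K = K" using compact_K by (simp add: compact_imp_closed)
  have "x \<in> interior K \<longleftrightarrow> supp J x < 1"
  proof
    assume "supp J x < 1"
    moreover have "open {x. supp J x < 1}" by (intro open_Collect_less continuous_intros)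
    moreover have "{x. supp J x < 1} \<subseteq> K" by (auto simp: mem_K_iff)
    ultimately show "x \<in> interior K" by (meson interiorI mem_Collect_eq)
  next
    assume "x \<in> interior K"
    then obtain e where e: "e > 0" "cball x e \<subseteq> K" by (meson mem_interior_cball)
    show "supp J x < 1"
    proof (cases "x = 0")
      case False
      have "x + (e / norm x) *\<^sub>R x \<in> K" using e False by (auto simp: dist_norm)
      then have "supp J ((1 + e / norm x) *\<^sub>R x) \<le> 1" by (simp add: mem_K_iff scaleR_add_left)
      then have "(1 + e / norm x) * supp J x \<le> 1" using e by (subst (asm) supp_scale) auto
      moreover have "supp J x < (1 + e / norm x) * supp J x"
        using False e by (simp add: divide_pos_pos)
      ultimately show ?thesis by linarith
    qed simp
  qed
  then show ?thesis by (auto simp: frontier_def cl mem_K_iff)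
qed

lemma frontier_sub: "x \<in> frontier K \<Longrightarrow> x \<in> K" "x \<in> frontier K \<Longrightarrow> x \<noteq> 0"
  by (auto simp: frontier_K_iff mem_K_iff)

lemma convex_K: "convex K"
proof -
  have "x *\<^sub>R a + y *\<^sub>R b \<in> K" if "a \<in> K" "b \<in> K" "0 \<le> x" "0 \<le> y" "x + y = 1" for a b x y
  proof -
    have "supp J (x *\<^sub>R a + y *\<^sub>R b) \<le> x * supp J a + y * supp J b"
      using supp_add[of "x *\<^sub>R a" "y *\<^sub>R b"] that by (simp add: supp_scale)
    also have "\<dots> \<le> x * 1 + y * 1" using that by (intro add_mono mult_left_mono) (auto simp: mem_K_iff)
    finally show ?thesis using that by (simp add: mem_K_iff)
  qed
  then show ?thesis by (auto simp: convex_def)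
qed

end

context polar_pair
begin

interpretation dual: polar_pair J K
  by (rule polar_pair_sym) (rule polar_pair_axioms)

text \<open>Cauchy-Schwarz for the gauge of \<open>K\<close> and the gauge of \<open>J\<close>.
  Equality, together with equality of the two gauges, is exactly \<open>dual_rel\<close>.\<close>

lemma inner_le_supp_mult: "x \<bullet> y \<le> supp J x * supp K y"
proof (cases "x = 0")
  case False
  then have "(1 / supp J x) *\<^sub>R x \<in> K" by (simp add: mem_K_iff supp_scale supp_nonneg)
  from dual.inner_le_supp[OF this, of y] False show ?thesis
    by (simp add: field_simps inner_commute supp_pos_iff[THEN iffD2])
qed simp

lemma dual_rel_sym: "dual_rel J K y x \<longleftrightarrow> dual_rel K J x y"
  by (auto simp: dual_rel_def inner_commute)

lemma dual_rel_exists: "\<exists>y. dual_rel K J x y"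
proof (cases "x = 0")
  case True
  then show ?thesis by (intro exI[of _ 0]) (simp add: dual_rel_def)
next
  case False
  \<comment> \<open>\<open>y\<close> has gauge 1 in \<open>J\<close>; after multiplication by
    \<open>supp J x\<close> both gauges equal \<open>supp J x\<close> and the inner product is its
    square.\<close>
  obtain y where y: "y \<in> J" "x \<bullet> y = supp J x" using supp_attained by blast
  have "supp J x \<le> supp J x * supp K y" using inner_le_supp_mult[of x y] y by simp
  then have "1 \<le> supp K y" using False by simp
  then have "supp K y = 1" using y dual.mem_K_iff by force
  then show ?thesis
    by (intro exI[of _ "supp J x *\<^sub>R y"])
      (simp add: dual_rel_def dual.supp_scale supp_nonneg y power2_eq_square)
qed

lemma dual_rel_scale: assumes "dual_rel K J x y" "0 \<le> t" shows "dual_rel K J (t *\<^sub>R x) (t *\<^sub>R y)"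
  using assms by (simp add: dual_rel_def supp_scale dual.supp_scale power2_eq_square)

lemma fenchel_young: "x \<bullet> y \<le> (supp J x)\<^sup>2 / 2 + (supp K y)\<^sup>2 / 2"
proof -
  have "0 \<le> (supp J x - supp K y)\<^sup>2" by simp
  then show ?thesis using inner_le_supp_mult[of x y] by (simp add: power2_diff)
qed

lemma dual_rel_iff_fenchel: "dual_rel K J x y \<longleftrightarrow> x \<bullet> y = (supp J x)\<^sup>2 / 2 + (supp K y)\<^sup>2 / 2"
proof
  assume "x \<bullet> y = (supp J x)\<^sup>2 / 2 + (supp K y)\<^sup>2 / 2"
  then have "(supp J x - supp K y)\<^sup>2 \<le> 0" using inner_le_supp_mult[of x y] by (simp add: power2_diff)
  then have "supp J x = supp K y" by simp
  then show "dual_rel K J x y" using \<open>x \<bullet> y = _\<close> by (simp add: dual_rel_def)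
qed (auto simp: dual_rel_def)

lemma dual_rel_subgradient:
  assumes "dual_rel K J x y"
  shows "(supp J x)\<^sup>2 / 2 + y \<bullet> (z - x) \<le> (supp J z)\<^sup>2 / 2"
  using assms fenchel_young[of z y] unfolding dual_rel_iff_fenchel
  by (simp add: inner_diff_right inner_commute)

lemma subgradient_dual_rel:
  assumes "\<And>z. (supp J x)\<^sup>2 / 2 + y \<bullet> (z - x) \<le> (supp J z)\<^sup>2 / 2"
  shows "dual_rel K J x y"
proof -
  \<comment> \<open>The multiple \<open>supp K y *\<^sub>R q\<close> maximises
    \<open>y \<bullet> z - (supp J z)\<^sup>2 / 2\<close>, so testing there makes the subgradient
    inequality into the equality case of Fenchel-Young.\<close>
  obtain q where q: "q \<in> K" "y \<bullet> q = supp K y" using dual.supp_attained by blast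
  let ?z = "supp K y *\<^sub>R q"
  have "supp J ?z = supp K y * supp J q" by (simp add: supp_scale dual.supp_nonneg)
  also have "\<dots> \<le> supp K y * 1" using q by (intro mult_left_mono dual.supp_nonneg) (simp add: mem_K_iff)
  finally have "(supp J ?z)\<^sup>2 \<le> (supp K y)\<^sup>2" using supp_nonneg[of ?z] by (intro power_mono) auto
  moreover have "y \<bullet> ?z = (supp K y)\<^sup>2" using q by (simp add: power2_eq_square)
  ultimately have "(supp J x)\<^sup>2 / 2 + (supp K y)\<^sup>2 / 2 \<le> x \<bullet> y"
    using assms[of ?z] by (simp add: inner_diff_right inner_commute)
  then show ?thesis using fenchel_young[of x y] by (simp add: dual_rel_iff_fenchel)
qed

lemma dual_rel_monotone:
  assumes "dual_rel K J x y" "dual_rel K J x' y'"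
  shows "0 \<le> (x - x') \<bullet> (y - y')"
  using dual_rel_subgradient[OF assms(1), of x'] dual_rel_subgradient[OF assms(2), of x]
  by (simp add: inner_diff_left inner_diff_right inner_commute)

lemma closed_dual_rel: "closed {(x, y). dual_rel K J x y}"
  unfolding dual_rel_def case_prod_unfold
  by (intro closed_Collect_conj closed_Collect_eq continuous_intros dual.continuous_on_supp')

text \<open>A unit normal \<open>u\<close> at \<open>x\<close> corresponds to the subgradient
  \<open>u / \<langle>x, u\<rangle>\<close>, whose norm is the reciprocal of
  \<open>\<langle>x, u\<rangle>\<close>. The support number of the affine surface area is thus
  recovered from the dual point.\<close>

lemma outer_normal_dual_rel:
  assumes x: "x \<in> frontier K" and u: "is_outer_normal K x u"
  shows "0 < x \<bullet> u" "dual_rel K J x ((1 / (x \<bullet> u)) *\<^sub>R u)"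
proof -
  have nu: "norm u = 1" and le: "\<And>y. y \<in> K \<Longrightarrow> u \<bullet> y \<le> u \<bullet> x"
    using u by (auto simp: is_outer_normal_def inner_diff_right)
  obtain e where e: "e > 0" "cball 0 e \<subseteq> K" using interior_K by (meson mem_interior_cball)
  have "e *\<^sub>R u \<in> K" using e nu by auto
  from le[OF this] have "e \<le> x \<bullet> u" using nu by (simp add: inner_commute norm_eq_1)
  then show pos: "0 < x \<bullet> u" using e by simp
  have sx: "supp J x = 1" using x by (simp add: frontier_K_iff)
  let ?y = "(1 / (x \<bullet> u)) *\<^sub>R u"
  have "supp K ?y \<le> 1"
    using le pos by (intro dual.supp_le) (simp add: inner_commute)
  moreover have "x \<bullet> ?y = 1" using pos by simp
  moreover have "1 \<le> supp K ?y" using inner_le_supp_mult[of x ?y] sx \<open>x \<bullet> ?y = 1\<close> by simp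
  ultimately show "dual_rel K J x ?y" using sx by (simp add: dual_rel_def)
qed

lemma dual_rel_outer_normal:
  assumes x: "x \<in> frontier K" and y: "dual_rel K J x y"
  shows "is_outer_normal K x ((1 / norm y) *\<^sub>R y)"
proof -
  have sx: "supp J x = 1" using x by (simp add: frontier_K_iff)
  then have sy: "supp K y = 1" "x \<bullet> y = 1" using y by (auto simp: dual_rel_def)
  then have y0: "y \<noteq> 0" by auto
  have "y \<bullet> (z - x) \<le> 0" if "z \<in> K" for z
    using dual.inner_le_supp[OF that, of y] sy by (simp add: inner_diff_right inner_commute)
  then show ?thesis using y0 by (auto simp: is_outer_normal_def divide_nonpos_nonneg)
qed

lemma outer_normal_spec:
  assumes "x \<in> frontier K" shows "is_outer_normal K x (outer_normal K x)"
proof -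
  obtain y where "dual_rel K J x y" using dual_rel_exists by blast
  from dual_rel_outer_normal[OF assms this] show ?thesis
    unfolding outer_normal_def by (rule someI)
qed

lemma dual_rel_zero: "dual_rel K J 0 y \<longleftrightarrow> y = 0" "dual_rel K J x 0 \<longleftrightarrow> x = 0"
  by (auto simp: dual_rel_def)

end

lemma polar_pair_polar_body:
  assumes K: "convex_body K" and 0: "0 \<in> interior (K :: (real^'n) set)"
  shows "polar_pair K (polar_body K)"
proof
  show cK: "compact K" using K by (simp add: convex_body_def)
  obtain e where e: "e > 0" "cball 0 e \<subseteq> K" using 0 by (meson mem_interior_cball)
  obtain C where C: "C > 0" "\<And>x. x \<in> K \<Longrightarrow> norm x \<le> C"
    using compact_imp_bounded[OF cK] unfolding bounded_pos by blast
  have "polar_body K = (\<Inter>x\<in>K. {y. x \<bullet> y \<le> 1})" by (auto simp: polar_body_def)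
  then have "closed (polar_body K)" by (auto intro!: closed_INT closed_Collect_le continuous_intros)
  moreover have "bounded (polar_body K)"
    unfolding bounded_iff
  proof (intro exI ballI)
    fix y assume y: "y \<in> polar_body K"
    show "norm y \<le> 1 / e"
    proof (cases "y = 0")
      case False
      then have "(e / norm y) *\<^sub>R y \<in> K" using e by auto
      then have "(e / norm y) *\<^sub>R y \<bullet> y \<le> 1" using y by (auto simp: polar_body_def)
      then show ?thesis using False e
        by (simp add: power2_norm_eq_inner[symmetric] power2_eq_square field_simps)
    qed (use e in simp)
  qed
  ultimately show "compact (polar_body K)" by (simp add: compact_eq_bounded_closed)
  show "0 \<in> interior K" by fact
  have "ball 0 (1 / C) \<subseteq> polar_body K"
  proof
    fix y :: "real^'n" assume "y \<in> ball 0 (1 / C)"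
    then have ny: "norm y \<le> 1 / C" by simp
    have "x \<bullet> y \<le> 1" if "x \<in> K" for x
    proof -
      have "x \<bullet> y \<le> norm x * norm y" by (rule norm_cauchy_schwarz)
      also have "\<dots> \<le> C * (1 / C)" using C that ny by (intro mult_mono) auto
      finally show ?thesis using C by simp
    qed
    then show "y \<in> polar_body K" by (simp add: polar_body_def)
  qed
  then show "0 \<in> interior (polar_body K)" using C
    by (meson centre_in_ball divide_pos_pos interiorI open_ball zero_less_one)
  show "polar_body K = polar_body K" ..
  show "K = polar_body (polar_body K)"
  proof (intro set_eqI iffI)
    fix x assume "x \<in> polar_body (polar_body K)"
    then have x: "\<And>y. y \<in> polar_body K \<Longrightarrow> y \<bullet> x \<le> 1" by (auto simp: polar_body_def)
    show "x \<in> K"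
    proof (rule ccontr)
      assume "x \<notin> K"
      then obtain a b where ab: "a \<bullet> x < b" "\<And>z. z \<in> K \<Longrightarrow> a \<bullet> z > b"
        using separating_hyperplane_closed_point[of K x] K cK
        by (auto simp: convex_body_def compact_imp_closed)
      \<comment> \<open>The origin lies in \<open>K\<close>, so the separating level is negative;
        dividing by it turns the separating functional into an element of the polar body.\<close>
      have "b < 0" using ab(2)[of 0] 0 interior_subset by force
      let ?y = "(1 / b) *\<^sub>R a"
      have "?y \<in> polar_body K"
        using ab(2) \<open>b < 0\<close> by (auto simp: polar_body_def inner_commute field_simps intro: less_imp_le)
      from x[OF this] ab(1) \<open>b < 0\<close> show False by (simp add: field_simps)
    qed
  qed (auto simp: polar_body_def inner_commute)
qed

text \<open>
  The translates of \<open>N\<close> by \<open>e / (k + 1)\<close> are disjoint, bounded and of equal measure.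
\<close>

lemma null_of_unique_on_lines:
  fixes N :: "'a::euclidean_space set"
  assumes N: "compact N" and uniq: "\<And>y t. y \<in> N \<Longrightarrow> y + t *\<^sub>R e \<in> N \<Longrightarrow> t = 0"
  shows "emeasure lborel N = 0"
proof -
  define T where "T k = (+) ((1 / real (Suc k)) *\<^sub>R e) ` N" for k
  obtain C where C: "\<And>y. y \<in> N \<Longrightarrow> norm y \<le> C"
    using compact_imp_bounded[OF N] unfolding bounded_iff by blast
  have cT: "compact (T k)" for k unfolding T_def by (rule compact_translation[OF N])
  have eT: "emeasure lborel (T k) = emeasure lborel N" for k
    using emeasure_lborel_compact_eq_measure[OF cT] emeasure_lborel_compact_eq_measure[OF N]
    by (simp add: T_def measure_translation)
  have disj: "disjoint_family T"
    unfolding disjoint_family_on_def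
  proof (intro ballI impI)
    fix j k :: nat assume "j \<noteq> k"
    show "T j \<inter> T k = {}"
    proof (rule ccontr)
      assume "T j \<inter> T k \<noteq> {}"
      then obtain y z where yz: "y \<in> N" "z \<in> N"
          "(1 / real (Suc j)) *\<^sub>R e + y = (1 / real (Suc k)) *\<^sub>R e + z"
        unfolding T_def by blast
      then have z: "z = y + (1 / real (Suc j) - 1 / real (Suc k)) *\<^sub>R e"
        by (simp add: algebra_simps)
      have "1 / real (Suc j) - 1 / real (Suc k) = 0"
        by (rule uniq[OF yz(1)]) (use yz(2) z in simp)
      then have "real (Suc j) = real (Suc k)"
        by (simp only: inverse_eq_divide[symmetric] right_minus_eq inverse_eq_iff_eq)
      then show False using \<open>j \<noteq> k\<close> by simp
    qed
  qed
  have sub: "(\<Union>k. T k) \<subseteq> cball 0 (C + norm e)"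
  proof (rule UN_least, rule subsetI)
    fix k y assume "y \<in> T k"
    then obtain z where z: "z \<in> N" "y = (1 / real (Suc k)) *\<^sub>R e + z" unfolding T_def by blast
    have "norm y \<le> norm ((1 / real (Suc k)) *\<^sub>R e) + norm z" unfolding z(2) by (rule norm_triangle_ineq)
    also have "norm ((1 / real (Suc k)) *\<^sub>R e) \<le> norm e" by (simp add: divide_le_eq mult_left_le field_simps)
    finally show "y \<in> cball 0 (C + norm e)" using C[OF z(1)] by simp
  qed
  let ?a = "measure lebesgue N"
  have "(\<Sum>k::nat. ennreal ?a) = (\<Sum>k. emeasure lborel (T k))"
    unfolding eT emeasure_lborel_compact_eq_measure[OF N] ..
  also have "\<dots> = emeasure lborel (\<Union>k. T k)"
    using disj cT by (intro suminf_emeasure) (auto simp: borel_compact)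
  also have "\<dots> \<le> emeasure lborel (cball (0::'a) (C + norm e))"
    by (rule emeasure_mono[OF sub]) simp
  also have "\<dots> < \<infinity>" by (intro emeasure_compact_finite) simp
  finally have "summable (\<lambda>k::nat. ?a)"
    by (intro summable_suminf_not_top) auto
  then have "?a = 0" by (simp add: summable_const_iff)
  then show ?thesis using emeasure_lborel_compact_eq_measure[OF N] by simp
qed

section \<open>Almost every point has a unique partner under the duality relation\<close>

context polar_pair
begin

interpretation dual: polar_pair J K
  by (rule polar_pair_sym) (rule polar_pair_axioms)

lemma dual_rel_norm_bound: "\<exists>C>0. \<forall>x y. dual_rel K J x y \<longrightarrow> norm y \<le> C * norm x"
proof -
  obtain c C where c: "0 < c" "0 < C" "\<And>x. c * norm x \<le> supp J x" "\<And>x. supp J x \<le> C * norm x"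
    using supp_bounds by blast
  obtain c' C' where c': "0 < c'" "0 < C'" "\<And>x. c' * norm x \<le> supp K x" "\<And>x. supp K x \<le> C' * norm x"
    using dual.supp_bounds by blast
  have "norm y \<le> (C / c') * norm x" if "dual_rel K J x y" for x y
  proof -
    have "c' * norm y \<le> supp J x" using that c'(3)[of y] by (simp add: dual_rel_def)
    also have "\<dots> \<le> C * norm x" by fact
    finally show ?thesis using c'(1) by (simp add: field_simps)
  qed
  moreover have "0 < C / c'" using c(2) c'(1) by simp
  ultimately show ?thesis by blast
qed

lemma compact_dual_rel: "compact {(x, y). dual_rel K J x y \<and> norm x \<le> N}"
proof -
  obtain C where C: "C > 0" "\<And>x y. dual_rel K J x y \<Longrightarrow> norm y \<le> C * norm x"
    using dual_rel_norm_bound by blast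
  have "{(x, y). dual_rel K J x y \<and> norm x \<le> N}
      = (cball 0 N \<times> cball 0 (C * N)) \<inter> {(x, y). dual_rel K J x y}" (is "?L = ?R")
  proof (intro set_eqI iffI)
    fix p assume "p \<in> ?L"
    then obtain x y where p: "p = (x, y)" "dual_rel K J x y" "norm x \<le> N" by auto
    have "norm y \<le> C * norm x" by (rule C(2)[OF p(2)])
    also have "\<dots> \<le> C * N" using p(3) C(1) by simp
    finally show "p \<in> ?R" using p by simp
  qed auto
  then show ?thesis using closed_dual_rel by (auto intro!: compact_Int_closed compact_Times)
qed

text \<open>Points of the second space with more than one partner. Its mirror image
  \<open>dual.multi\<close> consists of the points on rays through those boundary points of
  \<open>K\<close> that have several normals.\<close>

definition multi :: "(real^'n) set" where
  "multi = {y. \<exists>x x'. x \<noteq> x' \<and> dual_rel K J x y \<and> dual_rel K J x' y}"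

text \<open>
  By monotonicity of the relation, the points with preimages on both sides of a slab \<open>p < x\<^sub>i < q\<close> meet
  each line in direction \<open>e\<^sub>i\<close> at most once.
\<close>

lemma multi_null: "multi \<in> null_sets lborel"
proof -
  define M where "M i p q N = {y. \<exists>x x'. (dual_rel K J x y \<and> norm x \<le> real N) \<and> (dual_rel K J x' y \<and> norm x' \<le> real N)
      \<and> x $ i \<le> p \<and> q \<le> x' $ i}" for i p q N
  have cM: "compact (M i p q N)" for i p q N
  proof -
    let ?A = "{(x, y). dual_rel K J x y \<and> norm x \<le> real N}"
    let ?B = "(?A \<times> ?A) \<inter> {((x, y), (x', y')). y = y' \<and> x $ i \<le> p \<and> q \<le> x' $ i}"
    have eq: "M i p q N = (\<lambda>z. snd (fst z)) ` ?B"
    proof (intro set_eqI iffI)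
      fix y assume "y \<in> M i p q N"
      then obtain x x' where "dual_rel K J x y \<and> norm x \<le> real N" "dual_rel K J x' y \<and> norm x' \<le> real N"
        "x $ i \<le> p" "q \<le> x' $ i" unfolding M_def by blast
      then show "y \<in> (\<lambda>z. snd (fst z)) ` ?B"
        by (intro image_eqI[of _ _ "((x, y), (x', y))"]) auto
    next
      fix y assume "y \<in> (\<lambda>z. snd (fst z)) ` ?B"
      then obtain x x' where "dual_rel K J x y \<and> norm x \<le> real N" "dual_rel K J x' y \<and> norm x' \<le> real N"
        "x $ i \<le> p" "q \<le> x' $ i" by auto
      then show "y \<in> M i p q N" unfolding M_def by blast
    qed
    have "closed {((x, y), (x', y')). (y::real^'n) = y' \<and> (x::real^'n) $ i \<le> p \<and> q \<le> (x'::real^'n) $ i}"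
      unfolding case_prod_unfold
      by (intro closed_Collect_conj closed_Collect_eq closed_Collect_le continuous_intros)
    then have "compact ?B" by (intro compact_Int_closed compact_Times compact_dual_rel)
    then show ?thesis unfolding eq by (intro compact_continuous_image continuous_intros)
  qed
  have M0: "emeasure lborel (M i p q N) = 0" if pq: "p < q" for i p q N
  proof (rule null_of_unique_on_lines[OF cM, where e = "axis i 1"])
    fix y t assume y: "y \<in> M i p q N" "y + t *\<^sub>R axis i 1 \<in> M i p q N"
    have pos: False if pos: "0 < t" "y \<in> M i p q N" "y + t *\<^sub>R axis i 1 \<in> M i p q N" for y t
    proof -
      obtain x where x: "dual_rel K J x (y + t *\<^sub>R axis i 1)" "x $ i \<le> p" using pos(3) unfolding M_def by blast
      obtain x' where x': "dual_rel K J x' y" "q \<le> x' $ i" using pos(2) unfolding M_def by blast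
      have "0 \<le> (x - x') \<bullet> (t *\<^sub>R axis i 1)" using dual_rel_monotone[OF x(1) x'(1)] by simp
      then have "0 \<le> t * (x $ i - x' $ i)" by (simp add: inner_axis)
      then show False using pos(1) x(2) x'(2) pq by (simp add: zero_le_mult_iff)
    qed
    show "t = 0"
      using pos[of t y] pos[of "- t" "y + t *\<^sub>R axis i 1"] y by (cases t "0::real" rule: linorder_cases) auto
  qed
  have "multi = (\<Union>i. \<Union>p\<in>\<rat>. \<Union>q\<in>\<rat> \<inter> {p<..}. \<Union>N. M i p q N)" (is "_ = ?U")
  proof (intro set_eqI iffI)
    fix y assume "y \<in> multi"
    then obtain x x' where x: "x \<noteq> x'" "dual_rel K J x y" "dual_rel K J x' y" unfolding multi_def by blast
    then obtain i where "x $ i \<noteq> x' $ i" by (auto simp: vec_eq_iff)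
    then obtain z z' where z: "dual_rel K J z y" "dual_rel K J z' y" "z $ i < z' $ i"
      using x by (meson linorder_less_linear)
    obtain p where p: "p \<in> \<rat>" "z $ i < p" "p < z' $ i" using Rats_dense_in_real[OF z(3)] by blast
    obtain q where q: "q \<in> \<rat>" "p < q" "q < z' $ i" using Rats_dense_in_real[OF p(3)] by blast
    obtain N where N: "max (norm z) (norm z') \<le> real N" using real_arch_simple by blast
    have "y \<in> M i p q N" unfolding M_def using z p q N
      by (intro CollectI exI[of _ z] exI[of _ z']) auto
    then show "y \<in> ?U" using p q by blast
  next
    fix y assume "y \<in> ?U"
    then obtain i p q N where pq: "p < q" "y \<in> M i p q N" by auto
    then obtain x x' where x: "dual_rel K J x y" "dual_rel K J x' y" "x $ i \<le> p" "q \<le> x' $ i"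
      unfolding M_def by blast
    then have "x \<noteq> x'" using pq(1) by auto
    then show "y \<in> multi" unfolding multi_def using x by blast
  qed
  moreover have "M i p q N \<in> null_sets lborel" if "p < q" for i p q N
    using M0[OF that] cM by (auto simp: null_sets_def borel_compact)
  ultimately show ?thesis
    by (simp only:) (intro null_sets_UN' countable_rat countable_Int1 countableI_type; auto)
qed

lemma multi_sets [measurable]: "multi \<in> sets borel"
  using multi_null by (auto simp: null_sets_def)

lemma multi_scale: "0 < t \<Longrightarrow> t *\<^sub>R y \<in> multi \<longleftrightarrow> y \<in> multi"
proof -
  assume t: "0 < t"
  have *: "s *\<^sub>R y \<in> multi" if ys: "y \<in> multi" "0 < s" for y and s :: real
  proof -
    obtain x x' where "x \<noteq> x'" "dual_rel K J x y" "dual_rel K J x' y" using ys(1) unfolding multi_def by blast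
    then have "s *\<^sub>R x \<noteq> s *\<^sub>R x'" "dual_rel K J (s *\<^sub>R x) (s *\<^sub>R y)" "dual_rel K J (s *\<^sub>R x') (s *\<^sub>R y)"
      using ys(2) by (auto intro: dual_rel_scale)
    then show ?thesis unfolding multi_def by blast
  qed
  show ?thesis using *[of y t] *[of "t *\<^sub>R y" "1 / t"] t by auto
qed

end

section \<open>Comparison of Hausdorff measures with densities\<close>

lemma hausdorff_pre_Un:
  assumes "0 < \<delta>"
  shows "hausdorff_pre k \<delta> (A \<union> B) \<le> hausdorff_pre k \<delta> A + hausdorff_pre k \<delta> (B :: 'a::metric_space set)"
proof -
  have "hausdorff_pre k \<delta> (\<Union>i. binaryset A B i) \<le> (\<Sum>i. hausdorff_pre k \<delta> (binaryset A B i))"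
    by (rule hausdorff_pre_subadditive)
  also have "\<dots> = hausdorff_pre k \<delta> A + hausdorff_pre k \<delta> B"
    by (rule suminf_binaryset_eq) (rule hausdorff_pre_empty[OF assms])
  finally show ?thesis by (simp add: UN_binaryset_eq)
qed

lemma hausdorff_pre_le_outer: "0 < \<delta> \<Longrightarrow> hausdorff_pre k \<delta> A \<le> hausdorff_outer k A"
  unfolding hausdorff_outer_def by (intro SUP_upper) auto

lemma hausdorff_gauge_cball:
  fixes x :: "'a::euclidean_space"
  assumes "0 \<le> r"
  shows "hausdorff_gauge k (cball x r) = ennreal (unit_ball_vol (real k) * r ^ k)"
  using assms by (simp add: hausdorff_gauge_def)

lemma hausdorff_gauge_closure:
  assumes "bounded (U :: 'a::metric_space set)"
  shows "hausdorff_gauge k (closure U) = hausdorff_gauge k U"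
  using assms by (simp add: hausdorff_gauge_def diameter_closure)

text \<open>A point is \<open>good\<close> at level \<open>m\<close> if the density bound holds for
  all closed sets around it of diameter at most \<open>1 / (m + 1)\<close>; every point of
  \<open>B\<close> is eventually good. Each level is covered by Borel sets \<open>W m\<close>, so
  measurability of the set of good points is never at issue.\<close>

lemma measure_le_hausdorff_of_upper_density:
  fixes V :: "'a::euclidean_space measure"
  assumes V: "sets V = sets borel" and B: "B \<in> sets borel" and t: "0 < t"
    and dens: "\<And>x. x \<in> B \<Longrightarrow> \<exists>\<delta>>0. \<forall>C. closed C \<and> bounded C \<and> x \<in> C \<and> diameter C \<le> \<delta>
        \<longrightarrow> emeasure V C \<le> ennreal t * hausdorff_gauge k C"
  shows "emeasure V B \<le> ennreal t * emeasure (hausdorff_measure k) B"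
proof (cases "hausdorff_outer k B = top")
  case True
  then show ?thesis using t B by (simp add: emeasure_hausdorff_measure ennreal_mult_top)
next
  case False
  define \<delta> where "\<delta> m = 1 / real (Suc m)" for m
  define good where "good m x \<longleftrightarrow> (\<forall>C. closed C \<and> bounded C \<and> x \<in> C \<and> diameter C \<le> \<delta> m
        \<longrightarrow> emeasure V C \<le> ennreal t * hausdorff_gauge k C)" for m x
  have ex: "\<exists>m. \<forall>j\<ge>m. good j x" if x: "x \<in> B" for x
  proof -
    obtain d where d: "d > 0" "\<forall>C. closed C \<and> bounded C \<and> x \<in> C \<and> diameter C \<le> d
        \<longrightarrow> emeasure V C \<le> ennreal t * hausdorff_gauge k C" using dens[OF x] by blast
    obtain m where m: "inverse (real (Suc m)) < d" using reals_Archimedean[OF d(1)] by blast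
    have "\<delta> j \<le> d" if "m \<le> j" for j
    proof -
      have "\<delta> j \<le> 1 / real (Suc m)" unfolding \<delta>_def using that by (intro divide_left_mono) auto
      then show ?thesis using m by (simp add: inverse_eq_divide)
    qed
    then have "\<forall>j\<ge>m. good j x" unfolding good_def using d(2) order_trans by blast
    then show ?thesis by blast
  qed
  have "emeasure V B \<le> ennreal t * (hausdorff_outer k B + ennreal e)" if e: "0 < e" for e
  proof -
    have "\<exists>W. W \<in> sets borel \<and> {x\<in>B. good m x} \<subseteq> W \<and> emeasure V W \<le> ennreal t * (hausdorff_outer k B + ennreal e)" for m
    proof -
      have dm: "0 < \<delta> m" by (simp add: \<delta>_def)
      have "hausdorff_pre k (\<delta> m) B \<le> hausdorff_outer k B" by (rule hausdorff_pre_le_outer[OF dm])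
      also have "\<dots> < hausdorff_outer k B + ennreal e"
        using False e ennreal_add_left_cancel_less[of "hausdorff_outer k B" 0 "ennreal e"] by simp
      finally obtain U where U: "B \<subseteq> (\<Union>i. U i)" "\<And>i::nat. bounded (U i) \<and> diameter (U i) \<le> \<delta> m"
          "(\<Sum>i. hausdorff_gauge k (U i)) < hausdorff_outer k B + ennreal e"
        unfolding hausdorff_pre_def INF_less_iff by blast
      \<comment> \<open>Members of the cover without a good point are discarded; the others are
        closed, which changes neither diameter nor gauge.\<close>
      define W where "W i = (if \<exists>x\<in>U i. good m x then closure (U i) else {})" for i
      have Wm: "W i \<in> sets borel" for i unfolding W_def by auto
      have Vi: "emeasure V (W i) \<le> ennreal t * hausdorff_gauge k (U i)" for i
      proof (cases "\<exists>x\<in>U i. good m x")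
        case True
        then obtain x where x: "x \<in> U i" "good m x" by blast
        have "emeasure V (closure (U i)) \<le> ennreal t * hausdorff_gauge k (closure (U i))"
          using x(2)[unfolded good_def, rule_format, of "closure (U i)"] U(2)[of i] closure_subset[of "U i"] x(1)
          by (auto simp: diameter_closure)
        then show ?thesis using True U(2)[of i] by (simp add: W_def hausdorff_gauge_closure)
      qed (simp add: W_def)
      have "emeasure V (\<Union>i. W i) \<le> (\<Sum>i. emeasure V (W i))"
        using Wm V by (intro emeasure_subadditive_countably) auto
      also have "\<dots> \<le> (\<Sum>i. ennreal t * hausdorff_gauge k (U i))" by (intro suminf_le Vi) auto
      also have "\<dots> = ennreal t * (\<Sum>i. hausdorff_gauge k (U i))" by (rule ennreal_suminf_cmult)
      also have "\<dots> \<le> ennreal t * (hausdorff_outer k B + ennreal e)"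
        using U(3) by (intro mult_left_mono) auto
      finally have "emeasure V (\<Union>i. W i) \<le> ennreal t * (hausdorff_outer k B + ennreal e)" .
      moreover have "{x\<in>B. good m x} \<subseteq> (\<Union>i. W i)"
      proof
        fix x assume x: "x \<in> {x\<in>B. good m x}"
        then obtain i where i: "x \<in> U i" using U(1) by auto
        then have "x \<in> W i" using x closure_subset[of "U i"] unfolding W_def by auto
        then show "x \<in> (\<Union>i. W i)" by blast
      qed
      moreover have "(\<Union>i. W i) \<in> sets borel" using Wm by blast
      ultimately show ?thesis by blast
    qed
    then obtain W where W: "\<And>m. W m \<in> sets borel" "\<And>m. {x\<in>B. good m x} \<subseteq> W m"
        "\<And>m. emeasure V (W m) \<le> ennreal t * (hausdorff_outer k B + ennreal e)" by metis
    \<comment> \<open>A point good from level \<open>m\<close> on lies in every later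
      \<open>W j\<close>. The sets \<open>Z m\<close> increase and exhaust \<open>B\<close>, while
      each keeps the bound of \<open>W m\<close>.\<close>
    define Z where "Z m = (\<Inter>j\<in>{m..}. W j)" for m
    have Zm: "Z m \<in> sets V" for m unfolding Z_def V using W(1) by (intro sets.countable_INT) auto
    have "B \<subseteq> (\<Union>m. Z m)"
    proof
      fix x assume x: "x \<in> B"
      obtain m where m: "\<forall>j\<ge>m. good j x" using ex[OF x] by blast
      have "x \<in> Z m" unfolding Z_def using W(2) x m by auto
      then show "x \<in> (\<Union>m. Z m)" by blast
    qed
    then have "emeasure V B \<le> emeasure V (\<Union>m. Z m)" using Zm by (intro emeasure_mono) auto
    also have "\<dots> = (SUP m. emeasure V (Z m))"
      using Zm by (intro SUP_emeasure_incseq[symmetric]) (auto simp: incseq_def Z_def)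
    also have "\<dots> \<le> ennreal t * (hausdorff_outer k B + ennreal e)"
    proof (rule SUP_least)
      fix m
      have "emeasure V (Z m) \<le> emeasure V (W m)" using W(1) V by (intro emeasure_mono) (auto simp: Z_def)
      then show "emeasure V (Z m) \<le> ennreal t * (hausdorff_outer k B + ennreal e)" using W(3) order_trans by blast
    qed
    finally show ?thesis .
  qed
  note * = this
  show ?thesis unfolding emeasure_hausdorff_measure[OF B]
  proof (rule ennreal_le_epsilon)
    fix e :: real assume e: "0 < e"
    have "emeasure V B \<le> ennreal t * (hausdorff_outer k B + ennreal (e / t))" using *[of "e / t"] e t by simp
    also have "\<dots> = ennreal t * hausdorff_outer k B + ennreal e"
      using t e by (simp add: distrib_left ennreal_mult[symmetric])
    finally show "emeasure V B \<le> ennreal t * hausdorff_outer k B + ennreal e" .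
  qed
qed

text \<open>\<open>W\<close> is a union of disjoint small balls inside an open set of nearly the
  measure of \<open>X\<close>. Disjointness makes \<open>measure V W\<close> control the sum of
  gauges; enlarging the balls five times covers all of \<open>X\<close>, while unenlarged they cover
  \<open>X \<inter> W\<close>.\<close>

lemma hausdorff_efficient_cover:
  fixes V :: "'a::euclidean_space measure" and X :: "'a set"
  assumes V: "sets V = sets borel" "finite_measure V" and X: "X \<in> sets borel" and t: "0 < t"
    and dens: "\<And>x. x \<in> X \<Longrightarrow> \<exists>\<delta>>0. \<forall>r. 0 < r \<and> r \<le> \<delta>
        \<longrightarrow> ennreal (t * unit_ball_vol (real k) * r ^ k) \<le> emeasure V (cball x r)"
    and \<delta>: "0 < \<delta>" and e: "0 < e"
  shows "\<exists>W\<in>sets borel. measure V W \<le> measure V X + e \<and>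
      hausdorff_pre k \<delta> X \<le> ennreal (5 ^ k / t * measure V W) \<and>
      hausdorff_pre k \<delta> (X \<inter> W) \<le> ennreal (1 / t * measure V W) \<and>
      measure V (X - W) + measure V W \<le> measure V X + e"
proof -
  interpret V: finite_measure V by fact
  have [simp]: "A \<in> sets V \<longleftrightarrow> A \<in> sets borel" for A using V by simp
  have sp: "space V = UNIV" using sets_eq_imp_space_eq[OF V(1)] by simp
  obtain G where G: "open G" "X \<subseteq> G" "measure V G \<le> measure V X + e"
  proof -
    have "emeasure V X = (INF U \<in> {U. X \<subseteq> U \<and> open U}. emeasure V U)"
      using V X by (intro outer_regular) auto
    moreover have "emeasure V X < emeasure V X + ennreal e"
      using e ennreal_add_left_cancel_less[of "emeasure V X" 0 "ennreal e"] by simp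
    ultimately have "(INF U \<in> {U. X \<subseteq> U \<and> open U}. emeasure V U) < emeasure V X + ennreal e" by simp
    then obtain U where U: "X \<subseteq> U" "open U" "emeasure V U < emeasure V X + ennreal e"
      unfolding INF_less_iff by blast
    have "ennreal (measure V U) < ennreal (measure V X + e)"
      using U(3) e by (simp add: V.emeasure_eq_measure)
    then have "measure V U \<le> measure V X + e" by (simp add: ennreal_less_iff)
    then show ?thesis using that U by blast
  qed
  \<comment> \<open>With radius at most \<open>\<delta> / 10\<close> even the ball enlarged five
    times has diameter at most \<open>\<delta>\<close>.\<close>
  define I where "I = {(x, r). x \<in> X \<and> 0 < r \<and> r \<le> \<delta> / 10 \<and> cball x r \<subseteq> G
      \<and> ennreal (t * unit_ball_vol (real k) * r ^ k) \<le> emeasure V (cball x r)}"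
  have memI: "fst i \<in> X" "0 < snd i" "snd i \<le> \<delta> / 10" "cball (fst i) (snd i) \<subseteq> G"
      "ennreal (t * unit_ball_vol (real k) * snd i ^ k) \<le> emeasure V (cball (fst i) (snd i))" if "i \<in> I" for i
    using that by (auto simp: I_def)
  have ex: "\<exists>r. (x, r) \<in> I" if x: "x \<in> X" for x
  proof -
    obtain d where d: "d > 0" "\<forall>r. 0 < r \<and> r \<le> d
        \<longrightarrow> ennreal (t * unit_ball_vol (real k) * r ^ k) \<le> emeasure V (cball x r)" using dens[OF x] by blast
    obtain g where g: "g > 0" "cball x g \<subseteq> G" using G x by (meson open_contains_cball subsetD)
    let ?r = "min d (min g (\<delta> / 10))"
    have "(x, ?r) \<in> I" unfolding I_def using x d g \<delta> subset_cball[of ?r g x] by auto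
    then show ?thesis by blast
  qed
  have cov: "X \<subseteq> (\<Union>i\<in>I. cball (fst i) (snd i))"
  proof
    fix x assume "x \<in> X"
    then obtain r where "(x, r) \<in> I" using ex by blast
    moreover then have "x \<in> cball (fst (x, r)) (snd (x, r))" by (simp add: I_def)
    ultimately show "x \<in> (\<Union>i\<in>I. cball (fst i) (snd i))" by blast
  qed
  have rI: "0 < snd i \<and> snd i \<le> \<delta> / 10" if "i \<in> I" for i using memI(2,3)[OF that] by simp
  obtain C where C: "countable C" "C \<subseteq> I"
     "pairwise (\<lambda>i j. disjnt (cball (fst i) (snd i)) (cball (fst j) (snd j))) C"
     "X \<subseteq> (\<Union>i\<in>C. cball (fst i) (5 * snd i))"
    by (rule Vitali_covering_lemma_cballs[OF cov rI]) (assumption, rule that)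
  define f where "f = to_nat_on C"
  define h where "h = from_nat_into C"
  have inj: "inj_on f C" unfolding f_def using C(1) by blast
  have hf: "h (f i) = i" if "i \<in> C" for i unfolding f_def h_def using that C(1) by simp
  \<comment> \<open>The Vitali family may be finite, so the sequence is padded with empty sets,
    whose gauge is 0.\<close>
  define U where "U j = (if j \<in> f ` C then cball (fst (h j)) (snd (h j)) else {})" for j
  define U' where "U' j = (if j \<in> f ` C then cball (fst (h j)) (5 * snd (h j)) else {})" for j
  have hC: "h j \<in> C" if "j \<in> f ` C" for j using that hf by auto
  have Um: "U j \<in> sets borel" for j by (simp add: U_def)
  have disj: "disjoint_family U"
    unfolding disjoint_family_on_def
  proof (intro ballI impI)
    fix i j :: nat assume ij: "i \<noteq> j"
    show "U i \<inter> U j = {}"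
    proof (cases "i \<in> f ` C \<and> j \<in> f ` C")
      case True
      then obtain a b where ab: "a \<in> C" "b \<in> C" "i = f a" "j = f b" by auto
      then have "a \<noteq> b" using ij by auto
      then have "disjnt (cball (fst a) (snd a)) (cball (fst b) (snd b))"
        using C(3) ab by (simp add: pairwise_def)
      then show ?thesis using ab by (simp add: U_def hf disjnt_def)
    qed (auto simp: U_def)
  qed
  define W where "W = (\<Union>j. U j)"
  have Wm: "W \<in> sets borel" unfolding W_def using Um by blast
  have sumV: "(\<Sum>j. emeasure V (U j)) = ennreal (measure V W)"
    unfolding W_def V.emeasure_eq_measure[symmetric] using disj Um
    by (intro suminf_emeasure) auto
  have gU: "ennreal t * hausdorff_gauge k (U j) \<le> emeasure V (U j)" for j
  proof (cases "j \<in> f ` C")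
    case True
    then have i: "h j \<in> I" using hC C(2) by blast
    show ?thesis using memI(2)[OF i] memI(5)[OF i] True t
      by (simp add: U_def hausdorff_gauge_cball ennreal_mult[symmetric] mult.assoc)
  qed (simp add: U_def hausdorff_gauge_def)
  have gU': "hausdorff_gauge k (U' j) = ennreal (5 ^ k) * hausdorff_gauge k (U j)" for j
  proof (cases "j \<in> f ` C")
    case True
    then have "h j \<in> I" using hC C(2) by blast
    from memI(2)[OF this] show ?thesis using True
      by (simp add: U_def U'_def hausdorff_gauge_cball ennreal_mult[symmetric] power_mult_distrib mult_ac)
  qed (simp add: U_def U'_def hausdorff_gauge_def)
  have gU2: "hausdorff_gauge k (U j) \<le> ennreal (1 / t) * emeasure V (U j)" for j
  proof -
    have "hausdorff_gauge k (U j) = ennreal (1 / t) * (ennreal t * hausdorff_gauge k (U j))"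
      using t by (simp add: mult.assoc[symmetric] ennreal_mult[symmetric])
    also have "\<dots> \<le> ennreal (1 / t) * emeasure V (U j)" using gU by (intro mult_left_mono) auto
    finally show ?thesis .
  qed
  have sumU: "(\<Sum>j. hausdorff_gauge k (U j)) \<le> ennreal (1 / t * measure V W)"
  proof -
    have "(\<Sum>j. hausdorff_gauge k (U j)) \<le> (\<Sum>j. ennreal (1 / t) * emeasure V (U j))"
      by (intro suminf_le gU2) auto
    also have "\<dots> = ennreal (1 / t) * ennreal (measure V W)" by (simp add: sumV)
    finally show ?thesis using t by (simp add: ennreal_mult[symmetric])
  qed
  have diam: "bounded (U j) \<and> diameter (U j) \<le> \<delta>" "bounded (U' j) \<and> diameter (U' j) \<le> \<delta>" for j
  proof -
    have "0 < snd (h j) \<and> snd (h j) \<le> \<delta> / 10" if "j \<in> f ` C"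
      using memI(2,3) hC[OF that] C(2) by blast
    then show "bounded (U j) \<and> diameter (U j) \<le> \<delta>" "bounded (U' j) \<and> diameter (U' j) \<le> \<delta>"
      using \<delta> by (auto simp: U_def U'_def)
  qed
  have covX: "X \<subseteq> (\<Union>j. U' j)"
  proof
    fix x assume "x \<in> X"
    then obtain i where i: "i \<in> C" "x \<in> cball (fst i) (5 * snd i)" using C(4) by blast
    then have "x \<in> U' (f i)" by (simp add: U'_def hf)
    then show "x \<in> (\<Union>j. U' j)" by blast
  qed
  have "hausdorff_pre k \<delta> X \<le> (\<Sum>j. hausdorff_gauge k (U' j))"
    using covX diam by (intro hausdorff_pre_lower) auto
  also have "\<dots> = ennreal (5 ^ k) * (\<Sum>j. hausdorff_gauge k (U j))" unfolding gU' by simp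
  also have "\<dots> \<le> ennreal (5 ^ k) * ennreal (1 / t * measure V W)" using sumU by (intro mult_left_mono) auto
  also have "\<dots> = ennreal (5 ^ k / t * measure V W)" using t by (simp add: ennreal_mult[symmetric])
  finally have 1: "hausdorff_pre k \<delta> X \<le> ennreal (5 ^ k / t * measure V W)" .
  have "hausdorff_pre k \<delta> (X \<inter> W) \<le> (\<Sum>j. hausdorff_gauge k (U j))"
    using diam by (intro hausdorff_pre_lower) (auto simp: W_def)
  also have "\<dots> \<le> ennreal (1 / t * measure V W)" by (rule sumU)
  finally have 2: "hausdorff_pre k \<delta> (X \<inter> W) \<le> ennreal (1 / t * measure V W)" .
  have WG: "W \<subseteq> G"
  proof
    fix x assume "x \<in> W"
    then obtain j where j: "j \<in> f ` C" "x \<in> cball (fst (h j)) (snd (h j))"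
      unfolding W_def U_def by (auto split: if_splits)
    then show "x \<in> G" using memI(4) hC[OF j(1)] C(2) by blast
  qed
  have "measure V (X - W) + measure V W = measure V ((X - W) \<union> W)"
    using X Wm by (intro V.finite_measure_Union[symmetric]) auto
  also have "\<dots> \<le> measure V G" using WG G by (intro V.finite_measure_mono) auto
  finally have 3: "measure V (X - W) + measure V W \<le> measure V X + e" using G(3) by simp
  then have "measure V W \<le> measure V X + e" using measure_nonneg[of V "X - W"] by linarith
  then show ?thesis using 1 2 3 Wm by blast
qed

text \<open>
  A Vitali cover first gives the inequality with the additional factor \<open>5 ^ k\<close>; applied to what the
  disjoint balls leave uncovered, this improves the constant, and the best constant is \<open>1 / t\<close>.
\<close>

lemma hausdorff_le_measure_of_lower_density:
  fixes V :: "'a::euclidean_space measure"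
  assumes V: "sets V = sets borel" "finite_measure V" and B: "B \<in> sets borel" and t: "0 < t"
    and dens: "\<And>x. x \<in> B \<Longrightarrow> \<exists>\<delta>>0. \<forall>r. 0 < r \<and> r \<le> \<delta>
        \<longrightarrow> ennreal (t * unit_ball_vol (real k) * r ^ k) \<le> emeasure V (cball x r)"
  shows "ennreal t * emeasure (hausdorff_measure k) B \<le> emeasure V B"
proof -
  interpret V: finite_measure V by fact
  \<comment> \<open>All constants that are admissible simultaneously for every Borel subset of
    \<open>B\<close>. The subsets matter because the improvement step applies a constant to the
    uncovered remainder \<open>X - W\<close>.\<close>
  define \<Theta> where "\<Theta> = {\<theta>. 0 \<le> \<theta> \<and> (\<forall>X\<in>sets borel. X \<subseteq> B \<longrightarrow> hausdorff_outer k X \<le> ennreal (\<theta> * measure V X))}"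
  have div_aux: "h \<le> c / q * m" if "h * q \<le> c * m" "1 \<le> q" for h q m c :: real
    using that by (simp add: pos_le_divide_eq)
  have mem: "\<theta> \<in> \<Theta> \<longleftrightarrow> 0 \<le> \<theta> \<and> (\<forall>X\<in>sets borel. X \<subseteq> B \<longrightarrow> hausdorff_outer k X \<le> ennreal (\<theta> * measure V X))" for \<theta>
    by (simp add: \<Theta>_def)
  have cover: "\<exists>W\<in>sets borel. measure V W \<le> measure V X + e \<and>
      hausdorff_pre k \<delta> X \<le> ennreal (5 ^ k / t * measure V W) \<and>
      hausdorff_pre k \<delta> (X \<inter> W) \<le> ennreal (1 / t * measure V W) \<and>
      measure V (X - W) + measure V W \<le> measure V X + e"
    if "X \<in> sets borel" "X \<subseteq> B" "0 < \<delta>" "0 < e" for X \<delta> e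
    using that by (intro hausdorff_efficient_cover[OF V _ t dens]) auto
  have limit: "hausdorff_outer k X \<le> ennreal (c * measure V X)"
    if c: "0 \<le> c" and *: "\<And>\<delta> e. 0 < \<delta> \<Longrightarrow> 0 < e \<Longrightarrow> hausdorff_pre k \<delta> X \<le> ennreal (c * (measure V X + e))" for c X
    unfolding hausdorff_outer_def
  proof (rule SUP_least, rule ennreal_le_epsilon)
    fix \<delta> e :: real assume \<delta>: "\<delta> \<in> {0<..}" and e: "0 < e"
    have "hausdorff_pre k \<delta> X \<le> ennreal (c * (measure V X + e / (c + 1)))" using \<delta> e c by (intro *) auto
    also have "\<dots> \<le> ennreal (c * measure V X + e)"
      using c e by (intro ennreal_leI) (simp add: distrib_left field_simps)
    also have "\<dots> = ennreal (c * measure V X) + ennreal e" using c e by simp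
    finally show "hausdorff_pre k \<delta> X \<le> ennreal (c * measure V X) + ennreal e" .
  qed
  have crude: "5 ^ k / t \<in> \<Theta>"
    unfolding mem
  proof (intro conjI ballI impI)
    show "0 \<le> 5 ^ k / t" using t by simp
    fix X assume X: "X \<in> sets borel" "X \<subseteq> B"
    show "hausdorff_outer k X \<le> ennreal (5 ^ k / t * measure V X)"
    proof (rule limit)
      fix \<delta> e :: real assume "0 < \<delta>" "0 < e"
      then obtain W where W: "measure V W \<le> measure V X + e" "hausdorff_pre k \<delta> X \<le> ennreal (5 ^ k / t * measure V W)"
        using cover[OF X] by blast
      note W(2)
      also have "ennreal (5 ^ k / t * measure V W) \<le> ennreal (5 ^ k / t * (measure V X + e))"
        using W(1) t by (intro ennreal_leI mult_left_mono) auto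
      finally show "hausdorff_pre k \<delta> X \<le> ennreal (5 ^ k / t * (measure V X + e))" .
    qed (use t in simp)
  qed
  \<comment> \<open>With \<open>h\<close> the premeasure of \<open>X\<close>, using
    \<open>1 / t\<close> on \<open>X \<inter> W\<close> and \<open>\<theta>\<close> on
    \<open>X - W\<close> gives \<open>h \<le> \<theta> * (measure V X + e) - (\<theta> - 1 / t) *
    measure V W\<close>. The crude bound says \<open>measure V W \<ge> h * t / 5 ^ k\<close>;
    solving for \<open>h\<close> produces the smaller constant.\<close>
  have improve: "\<theta> / (1 + (\<theta> - 1 / t) * (t / 5 ^ k)) \<in> \<Theta>" if \<theta>: "\<theta> \<in> \<Theta>" "1 / t \<le> \<theta>" for \<theta>
    unfolding mem
  proof (intro conjI ballI impI)
    let ?q = "1 + (\<theta> - 1 / t) * (t / 5 ^ k)"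
    have \<theta>0: "0 \<le> \<theta>" using \<theta> by (simp add: \<Theta>_def)
    have q: "1 \<le> ?q" using \<theta> t by simp
    then show "0 \<le> \<theta> / ?q" using \<theta>0 by simp
    fix X assume X: "X \<in> sets borel" "X \<subseteq> B"
    show "hausdorff_outer k X \<le> ennreal (\<theta> / ?q * measure V X)"
    proof (rule limit)
      fix \<delta> e :: real assume \<delta>: "0 < \<delta>" and e: "0 < e"
      then obtain W where W: "W \<in> sets borel" "hausdorff_pre k \<delta> X \<le> ennreal (5 ^ k / t * measure V W)"
         "hausdorff_pre k \<delta> (X \<inter> W) \<le> ennreal (1 / t * measure V W)"
         "measure V (X - W) + measure V W \<le> measure V X + e"
        using cover[OF X] by blast
      have "hausdorff_pre k \<delta> X = hausdorff_pre k \<delta> ((X \<inter> W) \<union> (X - W))" by (simp add: Int_Diff_Un)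
      also have "\<dots> \<le> hausdorff_pre k \<delta> (X \<inter> W) + hausdorff_pre k \<delta> (X - W)" by (rule hausdorff_pre_Un[OF \<delta>])
      also have "hausdorff_pre k \<delta> (X - W) \<le> hausdorff_outer k (X - W)" by (rule hausdorff_pre_le_outer[OF \<delta>])
      also have "hausdorff_outer k (X - W) \<le> ennreal (\<theta> * measure V (X - W))"
        using \<theta>(1) X W(1) unfolding \<Theta>_def by blast
      also note W(3)
      finally have "hausdorff_pre k \<delta> X \<le> ennreal (1 / t * measure V W) + ennreal (\<theta> * measure V (X - W))"
        by (simp add: add_mono)
      also have "\<dots> = ennreal (1 / t * measure V W + \<theta> * measure V (X - W))" using t \<theta>0 by simp
      finally have le: "hausdorff_pre k \<delta> X \<le> ennreal (1 / t * measure V W + \<theta> * measure V (X - W))" .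
      then obtain h where h: "hausdorff_pre k \<delta> X = ennreal h" "0 \<le> h"
        by (cases "hausdorff_pre k \<delta> X") (auto simp: top_unique)
      have h1: "h \<le> 1 / t * measure V W + \<theta> * measure V (X - W)"
        using le t \<theta>0 unfolding h(1) by (subst (asm) ennreal_le_iff) auto
      have h2: "h \<le> 5 ^ k / t * measure V W"
        using W(2) t unfolding h(1) by (subst (asm) ennreal_le_iff) auto
      have "h \<le> 1 / t * measure V W + \<theta> * (measure V X + e - measure V W)"
        using h1 mult_left_mono[OF W(4) \<theta>0] by (simp add: algebra_simps)
      also have "\<dots> = \<theta> * (measure V X + e) - (\<theta> - 1 / t) * measure V W" by (simp add: algebra_simps)
      also have "\<dots> \<le> \<theta> * (measure V X + e) - (\<theta> - 1 / t) * (h * t / 5 ^ k)"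
      proof -
        have "h * t / 5 ^ k \<le> measure V W" using h2 t by (simp add: field_simps)
        then have "(\<theta> - 1 / t) * (h * t / 5 ^ k) \<le> (\<theta> - 1 / t) * measure V W" using \<theta>(2) by (intro mult_left_mono) auto
        then show ?thesis by simp
      qed
      moreover have "h * ?q = h + (\<theta> - 1 / t) * (h * t / 5 ^ k)" by (simp add: distrib_left mult_ac)
      ultimately have "h * ?q \<le> \<theta> * (measure V X + e)" by linarith
      then have "h \<le> \<theta> / ?q * (measure V X + e)" using q by (rule div_aux)
      then show "hausdorff_pre k \<delta> X \<le> ennreal (\<theta> / ?q * (measure V X + e))" unfolding h(1) by (rule ennreal_leI)
    qed (use q \<theta>0 in simp)
  qed
  have bdd: "bdd_below \<Theta>" by (rule bdd_belowI[of _ 0]) (simp add: \<Theta>_def)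
  have ne: "\<Theta> \<noteq> {}" using crude by blast
  have inf: "Inf \<Theta> \<in> \<Theta>"
    unfolding mem
  proof (intro conjI ballI impI)
    show "0 \<le> Inf \<Theta>" using ne by (intro cInf_greatest) (auto simp: \<Theta>_def)
    fix X assume X: "X \<in> sets borel" "X \<subseteq> B"
    have le: "hausdorff_outer k X \<le> ennreal (\<theta> * measure V X)" if "\<theta> \<in> \<Theta>" for \<theta>
      using that X by (simp add: \<Theta>_def)
    have "hausdorff_outer k X < top" using le[OF crude] by (rule le_less_trans) simp
    then obtain h where h: "hausdorff_outer k X = ennreal h" "0 \<le> h"
      by (cases "hausdorff_outer k X") simp_all
    have hle: "h \<le> \<theta> * measure V X" if "\<theta> \<in> \<Theta>" for \<theta>
    proof -
      have "0 \<le> \<theta>" using that mem by blast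
      then show ?thesis using le[OF that] unfolding h(1) by (subst (asm) ennreal_le_iff) auto
    qed
    have "h \<le> Inf \<Theta> * measure V X"
    proof (cases "measure V X = 0")
      case True
      then show ?thesis using hle[OF crude] by simp
    next
      case False
      then have pos: "0 < measure V X" by (simp add: zero_less_measure_iff)
      have "h / measure V X \<le> Inf \<Theta>" using hle pos ne by (intro cInf_greatest) (auto simp: field_simps)
      then show ?thesis using pos by (simp add: field_simps)
    qed
    then show "hausdorff_outer k X \<le> ennreal (Inf \<Theta> * measure V X)" unfolding h(1) by (rule ennreal_leI)
  qed
  \<comment> \<open>The infimum is itself admissible, so if it exceeded \<open>1 / t\<close> it
    could be improved strictly.\<close>
  have "Inf \<Theta> \<le> 1 / t"
  proof (rule ccontr)
    assume "\<not> ?thesis"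
    then have gt: "1 / t < Inf \<Theta>" by simp
    let ?q = "1 + (Inf \<Theta> - 1 / t) * (t / 5 ^ k)"
    have "Inf \<Theta> \<le> Inf \<Theta> / ?q" using improve[OF inf] gt by (intro cInf_lower bdd) auto
    moreover have "1 < ?q" using gt t by simp
    moreover have "0 < Inf \<Theta>" using gt t by (meson less_trans zero_less_divide_1_iff)
    moreover have False if "x \<le> x / q" "1 < q" "0 < x" for x q :: real
      using that by (simp add: pos_le_divide_eq)
    ultimately show False by blast
  qed
  moreover have "hausdorff_outer k B \<le> ennreal (Inf \<Theta> * measure V B)"
    using inf B by (simp add: \<Theta>_def)
  ultimately have "hausdorff_outer k B \<le> ennreal (1 / t * measure V B)"
    by (meson ennreal_leI measure_nonneg mult_right_mono order_trans)
  then have "ennreal t * hausdorff_outer k B \<le> ennreal t * ennreal (1 / t * measure V B)"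
    by (rule mult_left_mono) simp
  also have "\<dots> = ennreal (measure V B)" using t by (simp add: ennreal_mult[symmetric])
  finally show ?thesis by (simp add: emeasure_hausdorff_measure[OF B] V.emeasure_eq_measure)
qed

section \<open>The cone measure\<close>

lemma emeasure_scaleR_image:
  fixes S :: "'a::euclidean_space set"
  assumes "compact S"
  shows "emeasure lborel ((*\<^sub>R) c ` S) = ennreal (\<bar>c\<bar> ^ DIM('a)) * emeasure lborel S"
proof -
  have "emeasure lborel ((*\<^sub>R) c ` S) = emeasure lebesgue ((\<lambda>x. c *\<^sub>R x + 0) ` S)"
    using compact_scaling[OF assms, of c] by (simp add: borel_compact)
  also have "\<dots> = ennreal (\<bar>c\<bar> ^ DIM('a)) * emeasure lebesgue S"
    by (subst emeasure_lebesgue_affine) simp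
  finally show ?thesis using assms by (simp add: borel_compact)
qed

context polar_pair
begin

interpretation dual: polar_pair J K
  by (rule polar_pair_sym) (rule polar_pair_axioms)

definition rad :: "real^'n \<Rightarrow> real^'n" where
  "rad x = (1 / supp J x) *\<^sub>R x"

lemma rad_measurable [measurable]: "rad \<in> borel_measurable borel"
  unfolding rad_def[abs_def] by measurable

lemma rad_frontier: "x \<noteq> 0 \<Longrightarrow> rad x \<in> frontier K"
  by (simp add: frontier_K_iff rad_def supp_scale supp_nonneg)

lemma rad_scale: "0 < t \<Longrightarrow> rad (t *\<^sub>R x) = rad x"
  by (simp add: rad_def supp_scale)

lemma rad_inverse: "supp J x *\<^sub>R rad x = x"
  by (cases "x = 0") (simp_all add: rad_def)

text \<open>The factor \<open>CARD('n)\<close> is built in, so that the density with respect to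
  surface area comes out as the support number itself. \<open>rad\<close> sends the origin to
  itself, off the boundary, but the origin is a null set.\<close>

definition cone_measure :: "(real^'n) measure" where
  "cone_measure = distr (density lborel (\<lambda>x. of_nat CARD('n) * indicator K x)) borel rad"

lemma sets_K [measurable]: "K \<in> sets borel"
  using compact_K by (rule borel_compact)

lemma emeasure_K_finite: "emeasure lborel K < \<infinity>"
  using compact_K by (rule emeasure_compact_finite)

lemma sets_cone_measure [simp, measurable_cong]: "sets cone_measure = sets borel"
  by (simp add: cone_measure_def)

lemma nn_integral_cone_measure:
  assumes [measurable]: "F \<in> borel_measurable borel"
  shows "(\<integral>\<^sup>+x. F x \<partial>cone_measure) = of_nat CARD('n) * (\<integral>\<^sup>+x. indicator K x * F (rad x) \<partial>lborel)"
proof -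
  have "(\<integral>\<^sup>+x. F x \<partial>cone_measure) = (\<integral>\<^sup>+x. F (rad x) \<partial>density lborel (\<lambda>x. of_nat CARD('n) * indicator K x))"
    unfolding cone_measure_def by (rule nn_integral_distr) measurable
  also have "\<dots> = (\<integral>\<^sup>+x. (of_nat CARD('n) * indicator K x) * F (rad x) \<partial>lborel)"
    by (rule nn_integral_density) measurable
  also have "\<dots> = (\<integral>\<^sup>+x. of_nat CARD('n) * (indicator K x * F (rad x)) \<partial>lborel)"
    by (simp add: mult.assoc)
  also have "\<dots> = of_nat CARD('n) * (\<integral>\<^sup>+x. indicator K x * F (rad x) \<partial>lborel)"
    by (rule nn_integral_cmult) measurable
  finally show ?thesis .
qed

lemma emeasure_cone_measure:
  assumes B: "B \<in> sets borel"
  shows "emeasure cone_measure B = of_nat CARD('n) * emeasure lborel {x \<in> K. rad x \<in> B}"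
proof -
  have m: "{x \<in> K. rad x \<in> B} \<in> sets lborel"
    using measurable_sets[OF rad_measurable B] by (auto simp: Collect_conj_eq vimage_def intro!: sets.Int)
  have "emeasure cone_measure B = (\<integral>\<^sup>+x. indicator B x \<partial>cone_measure)" using B by simp
  also have "\<dots> = of_nat CARD('n) * (\<integral>\<^sup>+x. indicator K x * indicator B (rad x) \<partial>lborel)"
    using B by (intro nn_integral_cone_measure) auto
  also have "(\<integral>\<^sup>+x. indicator K x * indicator B (rad x) \<partial>lborel) = (\<integral>\<^sup>+x. indicator {x \<in> K. rad x \<in> B} x \<partial>lborel)"
    by (intro nn_integral_cong) (auto simp: indicator_def)
  finally show ?thesis using m by simp
qed

lemma finite_cone_measure: "finite_measure cone_measure"
proof
  have "emeasure cone_measure (space cone_measure) = of_nat CARD('n) * emeasure lborel {x \<in> K. rad x \<in> UNIV}"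
    using emeasure_cone_measure[of UNIV] by (simp add: cone_measure_def)
  also have "\<dots> < \<infinity>" using emeasure_K_finite by (simp add: ennreal_mult_less_top of_nat_less_top)
  finally show "emeasure cone_measure (space cone_measure) \<noteq> \<infinity>" by simp
qed

text \<open>Both bounds are inclusions of solid cones. In the second the apex is exempt, since
  \<open>rad 0 = 0\<close> need not lie in \<open>C\<close>; it is put back as a null set.\<close>

lemma emeasure_cone_measure_coneset:
  assumes C: "C \<in> sets borel" and D: "compact D"
  shows "(\<And>x. x \<in> K \<Longrightarrow> rad x \<in> C \<Longrightarrow> x \<in> coneset D) \<Longrightarrow> emeasure cone_measure C \<le> of_nat CARD('n) * emeasure lborel (coneset D)"
    and "0 \<le> c \<Longrightarrow> (\<And>x. x \<noteq> 0 \<Longrightarrow> x \<in> coneset D \<Longrightarrow> c *\<^sub>R x \<in> K \<and> rad (c *\<^sub>R x) \<in> C) \<Longrightarrow>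
      of_nat CARD('n) * (ennreal (c ^ CARD('n)) * emeasure lborel (coneset D)) \<le> emeasure cone_measure C"
proof -
  have m: "{x \<in> K. rad x \<in> C} \<in> sets lborel"
    using measurable_sets[OF rad_measurable C] by (auto simp: Collect_conj_eq vimage_def intro!: sets.Int)
  have cD: "coneset D \<in> sets lborel" using compact_coneset[OF D] by (simp add: borel_compact)
  show "emeasure cone_measure C \<le> of_nat CARD('n) * emeasure lborel (coneset D)"
    if "\<And>x. x \<in> K \<Longrightarrow> rad x \<in> C \<Longrightarrow> x \<in> coneset D"
    unfolding emeasure_cone_measure[OF C] using that cD by (intro mult_left_mono emeasure_mono) auto
  show "of_nat CARD('n) * (ennreal (c ^ CARD('n)) * emeasure lborel (coneset D)) \<le> emeasure cone_measure C"
    if c: "0 \<le> c" and sub: "\<And>x. x \<noteq> 0 \<Longrightarrow> x \<in> coneset D \<Longrightarrow> c *\<^sub>R x \<in> K \<and> rad (c *\<^sub>R x) \<in> C"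
  proof -
    have "ennreal (c ^ CARD('n)) * emeasure lborel (coneset D) = emeasure lborel ((*\<^sub>R) c ` coneset D)"
      using emeasure_scaleR_image[OF compact_coneset[OF D], of c] c by simp
    also have "\<dots> \<le> emeasure lborel ({x \<in> K. rad x \<in> C} \<union> {0})"
    proof (rule emeasure_mono)
      show "(*\<^sub>R) c ` coneset D \<subseteq> {x \<in> K. rad x \<in> C} \<union> {0}"
      proof (rule image_subsetI)
        fix x assume "x \<in> coneset D"
        then show "c *\<^sub>R x \<in> {x \<in> K. rad x \<in> C} \<union> {0}" using sub[of x] by (cases "x = 0") auto
      qed
      show "{x \<in> K. rad x \<in> C} \<union> {0} \<in> sets lborel" using m by (intro sets.Un) auto
    qed
    also have "\<dots> = emeasure lborel {x \<in> K. rad x \<in> C}"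
      using m by (intro emeasure_Un_null_set) auto
    finally show ?thesis unfolding emeasure_cone_measure[OF C] by (rule mult_left_mono) simp
  qed
qed

lemma mem_sing_iff: "x \<in> dual.multi \<longleftrightarrow> (\<exists>y y'. y \<noteq> y' \<and> dual_rel K J x y \<and> dual_rel K J x y')"
  unfolding dual.multi_def by (simp add: dual_rel_sym)

text \<open>The relation has a closed graph and maps bounded sets to bounded sets, so uniqueness of
  the partner of \<open>x\<close> forces continuity at \<open>x\<close>, for any choice of partners
  nearby.\<close>

lemma dual_rel_continuous:
  assumes x: "x \<notin> dual.multi" and y: "dual_rel K J x y" and e: "0 < e"
  shows "\<exists>d>0. \<forall>x' y'. norm (x' - x) \<le> d \<and> dual_rel K J x' y' \<longrightarrow> norm (y' - y) < e"
proof -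
  let ?N = "norm x + 1"
  let ?S = "fst ` ({(x, y). dual_rel K J x y \<and> norm x \<le> ?N} \<inter> {p. e \<le> norm (snd p - y)})"
  have "closed {p :: (real^'n) \<times> (real^'n). e \<le> norm (snd p - y)}"
    by (intro closed_Collect_le continuous_intros)
  then have "compact ?S"
    by (intro compact_continuous_image compact_Int_closed compact_dual_rel continuous_intros)
  then have "open (- ?S)" by (simp add: compact_imp_closed open_Compl)
  moreover have "x \<notin> ?S"
  proof
    assume "x \<in> ?S"
    then obtain y' where "dual_rel K J x y'" "e \<le> norm (y' - y)" by auto
    moreover from this have "y' \<noteq> y" using e by auto
    ultimately show False using x y unfolding mem_sing_iff by blast
  qed
  ultimately obtain r where r: "r > 0" "cball x r \<subseteq> - ?S"
    using open_contains_cball by blast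
  have "norm (y' - y) < e" if n: "norm (x' - x) \<le> min r 1" and xy: "dual_rel K J x' y'" for x' y'
  proof (rule ccontr)
    assume "\<not> ?thesis"
    moreover have "norm x' \<le> ?N" using norm_triangle_ineq2[of x' x] n by simp
    ultimately have "x' \<in> ?S" using xy by (intro image_eqI[of _ _ "(x', y')"]) auto
    moreover have "x' \<in> cball x r" using n by (simp add: dist_norm norm_minus_commute)
    ultimately show False using r(2) by blast
  qed
  then show ?thesis using r(1) by (intro exI[of _ "min r 1"]) auto
qed

lemma dual_rel_frontier:
  assumes "x \<in> frontier K" "dual_rel K J x y"
  shows "x \<bullet> y = 1" "y \<in> J" "y \<noteq> 0" "y \<in> frontier J"
proof -
  have "supp K y = 1" "x \<bullet> y = 1" using assms by (auto simp: frontier_K_iff dual_rel_def)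
  then show "x \<bullet> y = 1" "y \<in> J" "y \<noteq> 0" "y \<in> frontier J"
    by (auto simp: dual.mem_K_iff dual.frontier_K_iff)
qed

text \<open>The set \<open>C \<inter> frontier K\<close> is projected centrally into the tangent
  plane \<open>z \<bullet> y\<^sub>0 = 1\<close>, which has distance
  \<open>1 / norm y\<^sub>0\<close> from the origin. As the normals near \<open>x\<^sub>0\<close>
  are close to \<open>y\<^sub>0\<close>, the projection barely increases diameters, and the
  isodiametric bound for cones applies to its image.\<close>

lemma cone_measure_upper_density:
  assumes x0: "x\<^sub>0 \<in> frontier K" "x\<^sub>0 \<notin> dual.multi" and y0: "dual_rel K J x\<^sub>0 y\<^sub>0"
    and t: "1 / norm y\<^sub>0 < t"
  shows "\<exists>\<delta>>0. \<forall>C. closed C \<and> bounded C \<and> x\<^sub>0 \<in> C \<and> diameter C \<le> \<delta>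
        \<longrightarrow> emeasure cone_measure C \<le> ennreal t * hausdorff_gauge (CARD('n) - 1) C"
proof -
  let ?k = "CARD('n) - 1" and ?s = "1 / norm y\<^sub>0"
  note fr = dual_rel_frontier[OF x0(1) y0]
  define M where "M = norm x\<^sub>0 + 1"
  \<comment> \<open>The Lipschitz constant of the central projection when
    \<open>x \<bullet> y\<^sub>0 \<ge> 1 - e\<close>, when this quantity varies with slope at most
    \<open>e\<close>, and when \<open>norm x \<le> M\<close>; it tends to 1 with
    \<open>e\<close>.\<close>
  define L where "L e = 1 / (1 - e) + M * e / (1 - e)\<^sup>2" for e
  have s: "0 < ?s" using fr by simp
  have "((\<lambda>e. ?s * L e ^ ?k) \<longlongrightarrow> ?s * (1 / (1 - 0) + M * 0 / (1 - 0)\<^sup>2) ^ ?k) (at_right 0)"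
    unfolding L_def by (intro tendsto_intros) auto
  then have "\<forall>\<^sub>F e in at_right 0. ?s * L e ^ ?k < t"
    by (rule order_tendstoD(2)) (use t in simp)
  then obtain b where b: "b > 0" "\<And>e. 0 < e \<Longrightarrow> e < b \<Longrightarrow> ?s * L e ^ ?k < t"
    unfolding eventually_at_right_field by auto
  define e where "e = min (b / 2) (1 / 2)"
  have e: "0 < e" "e < 1" "?s * L e ^ ?k < t" using b by (auto simp: e_def)
  have Lpos: "0 \<le> L e" using e by (simp add: L_def M_def)
  obtain d where d: "d > 0" "\<And>x' y'. norm (x' - x\<^sub>0) \<le> d \<Longrightarrow> dual_rel K J x' y' \<Longrightarrow> norm (y' - y\<^sub>0) < e"
    using dual_rel_continuous[OF x0(2) y0 e(1)] by blast
  \<comment> \<open>The last entry guarantees \<open>x \<bullet> y\<^sub>0 \<ge> 1 - e\<close>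
    throughout \<open>C\<close>, since \<open>x\<^sub>0 \<bullet> y\<^sub>0 = 1\<close>.\<close>
  define \<delta> where "\<delta> = min (min d 1) (e / norm y\<^sub>0)"
  have \<delta>: "0 < \<delta>" "\<delta> \<le> d" "\<delta> \<le> 1" "norm y\<^sub>0 * \<delta> \<le> e"
  proof -
    show "0 < \<delta>" "\<delta> \<le> d" "\<delta> \<le> 1" using d(1) e fr(3) by (auto simp: \<delta>_def)
    have "norm y\<^sub>0 * \<delta> \<le> norm y\<^sub>0 * (e / norm y\<^sub>0)" by (intro mult_left_mono) (auto simp: \<delta>_def)
    then show "norm y\<^sub>0 * \<delta> \<le> e" using fr(3) by simp
  qed
  have "emeasure cone_measure C \<le> ennreal t * hausdorff_gauge ?k C"
    if C: "closed C" "bounded C" "x\<^sub>0 \<in> C" "diameter C \<le> \<delta>" for C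
  proof -
    define C' where "C' = C \<inter> frontier K"
    have "compact C" using C(1,2) by (simp add: compact_eq_bounded_closed)
    then have cC': "compact C'" unfolding C'_def by (rule compact_Int_closed) simp
    have near: "norm (x - x\<^sub>0) \<le> \<delta>" if "x \<in> C'" for x
      using diameter_bounded_bound[OF C(2), of x x\<^sub>0] that C by (simp add: C'_def dist_norm)
    have a: "1 - e \<le> x \<bullet> y\<^sub>0" "x \<bullet> y\<^sub>0 \<le> 1" "norm x \<le> M" if x: "x \<in> C'" for x
    proof -
      have "\<bar>(x - x\<^sub>0) \<bullet> y\<^sub>0\<bar> \<le> norm (x - x\<^sub>0) * norm y\<^sub>0" by (rule Cauchy_Schwarz_ineq2)
      also have "\<dots> \<le> \<delta> * norm y\<^sub>0" using near[OF x] by (intro mult_right_mono) auto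
      also have "\<dots> \<le> e" using \<delta> by (simp add: mult.commute)
      finally show "1 - e \<le> x \<bullet> y\<^sub>0" using fr(1) by (simp add: inner_diff_left)
      have "x \<in> K" using x frontier_sub(1) by (simp add: C'_def)
      from dual.inner_le_supp[OF this, of y\<^sub>0] show "x \<bullet> y\<^sub>0 \<le> 1"
        using fr(4) by (simp add: dual.frontier_K_iff inner_commute)
      show "norm x \<le> M" using near[OF x] \<delta> norm_triangle_ineq2[of x x\<^sub>0] by (simp add: M_def)
    qed
    \<comment> \<open>If \<open>y\<close> is a partner of the boundary point \<open>z\<close>, then
      \<open>(z' - z) \<bullet> y \<le> 0\<close> for every \<open>z'\<close> in \<open>K\<close>,
      so only the small difference \<open>y\<^sub>0 - y\<close> contributes.\<close>
    have slope: "\<bar>(x - x') \<bullet> y\<^sub>0\<bar> \<le> e * norm (x - x')" if x: "x \<in> C'" and x': "x' \<in> C'" for x x'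
    proof -
      have half: "(z' - z) \<bullet> y\<^sub>0 \<le> e * norm (z' - z)" if z: "z \<in> C'" "z' \<in> C'" for z z'
      proof -
        obtain y where y: "dual_rel K J z y" using dual_rel_exists by blast
        have zf: "z \<in> frontier K" "z' \<in> K" using z frontier_sub(1) by (auto simp: C'_def)
        note fy = dual_rel_frontier[OF zf(1) y]
        have "z' \<bullet> y \<le> 1" using dual.inner_le_supp[OF zf(2), of y] fy(4)
          by (simp add: dual.frontier_K_iff inner_commute)
        then have "(z' - z) \<bullet> y\<^sub>0 \<le> (z' - z) \<bullet> (y\<^sub>0 - y)" using fy(1) by (simp add: inner_diff_left inner_diff_right)
        also have "\<dots> \<le> norm (z' - z) * norm (y\<^sub>0 - y)" by (rule norm_cauchy_schwarz)
        also have "\<dots> \<le> norm (z' - z) * e"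
          using d(2)[OF _ y] near[OF z(1)] \<delta>(2) by (intro mult_left_mono) (auto simp: norm_minus_commute)
        finally show ?thesis by (simp add: mult.commute)
      qed
      show ?thesis using half[OF x x'] half[OF x' x]
        by (simp add: abs_le_iff inner_diff_left norm_minus_commute)
    qed
    define \<pi> where "\<pi> x = (1 / (x \<bullet> y\<^sub>0)) *\<^sub>R x" for x
    have a0: "0 < x \<bullet> y\<^sub>0" if "x \<in> C'" for x using a(1)[OF that] e by linarith
    have lip: "norm (\<pi> x - \<pi> x') \<le> L e * norm (x - x')" if x: "x \<in> C'" and x': "x' \<in> C'" for x x'
    proof -
      let ?a = "x \<bullet> y\<^sub>0" and ?a' = "x' \<bullet> y\<^sub>0"
      have eq: "\<pi> x - \<pi> x' = (1 / ?a) *\<^sub>R (x - x') + ((?a' - ?a) / (?a * ?a')) *\<^sub>R x'"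
        using a0[OF x] a0[OF x'] by (simp add: \<pi>_def scaleR_diff_right diff_divide_distrib scaleR_diff_left)
      have "norm (\<pi> x - \<pi> x') \<le> norm (x - x') / ?a + \<bar>?a' - ?a\<bar> / (?a * ?a') * norm x'"
        unfolding eq using a0[OF x] a0[OF x'] norm_triangle_ineq[of "(1 / ?a) *\<^sub>R (x - x')" "((?a' - ?a) / (?a * ?a')) *\<^sub>R x'"]
        by (simp add: abs_mult)
      also have "norm (x - x') / ?a \<le> norm (x - x') / (1 - e)"
        using a(1)[OF x] e by (intro divide_left_mono) auto
      also have "\<bar>?a' - ?a\<bar> / (?a * ?a') * norm x' \<le> (e * norm (x - x')) / ((1 - e) * (1 - e)) * M"
      proof (rule mult_mono[OF frac_le])
        show "\<bar>?a' - ?a\<bar> \<le> e * norm (x - x')"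
          using slope[OF x' x] by (simp add: inner_diff_left norm_minus_commute)
        show "(1 - e) * (1 - e) \<le> ?a * ?a'" using a(1)[OF x] a(1)[OF x'] e a0[OF x] by (intro mult_mono) auto
        show "norm x' \<le> M" by (rule a(3)[OF x'])
      qed (use e in auto)
      finally have "norm (\<pi> x - \<pi> x') \<le> norm (x - x') / (1 - e) + e * norm (x - x') / ((1 - e) * (1 - e)) * M"
        by simp
      also have "\<dots> = L e * norm (x - x')"
        unfolding L_def power2_eq_square distrib_right by simp
      finally show ?thesis .
    qed
    define D where "D = \<pi> ` C'"
    have cD: "compact D" unfolding D_def \<pi>_def
      using a0 by (intro compact_continuous_image cC' continuous_intros) force
    have dm: "norm (x - x') \<le> diameter C" if "x \<in> C'" "x' \<in> C'" for x x'
      using diameter_bounded_bound[OF C(2), of x x'] that by (simp add: C'_def dist_norm)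
    have dC: "0 \<le> diameter C" by (rule diameter_ge_0[OF C(2)])
    have "emeasure lborel (coneset D) \<le> ennreal (?s * unit_ball_vol (real ?k) * (L e * diameter C / 2) ^ ?k / CARD('n))"
    proof (rule emeasure_coneset_le[OF cD, where u = "(1 / norm y\<^sub>0) *\<^sub>R y\<^sub>0"])
      show "z \<bullet> (1 / norm y\<^sub>0) *\<^sub>R y\<^sub>0 = ?s" if "z \<in> D" for z
        using that a0 unfolding D_def \<pi>_def by (auto dest!: a0)
      show "norm (y - z) \<le> L e * diameter C" if yz: "y \<in> D" "z \<in> D" for y z
      proof -
        obtain x x' where xx: "x \<in> C'" "x' \<in> C'" "y = \<pi> x" "z = \<pi> x'" using yz unfolding D_def by blast
        show ?thesis using lip[OF xx(1,2)] mult_left_mono[OF dm[OF xx(1,2)] Lpos] xx(3,4) by simp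
      qed
    qed (use fr s Lpos dC in auto)
    then have le: "of_nat CARD('n) * emeasure lborel (coneset D)
        \<le> ennreal (?s * L e ^ ?k) * ennreal (unit_ball_vol (real ?k) * (diameter C / 2) ^ ?k)"
    proof -
      assume *: "emeasure lborel (coneset D) \<le> ennreal (?s * unit_ball_vol (real ?k) * (L e * diameter C / 2) ^ ?k / CARD('n))"
      have "of_nat CARD('n) * emeasure lborel (coneset D)
        \<le> ennreal (real CARD('n)) * ennreal (?s * unit_ball_vol (real ?k) * (L e * diameter C / 2) ^ ?k / CARD('n))"
        using * by (simp add: ennreal_of_nat_eq_real_of_nat mult_left_mono)
      also have "\<dots> = ennreal (?s * unit_ball_vol (real ?k) * (L e * diameter C / 2) ^ ?k)"
        using s Lpos dC by (subst ennreal_mult[symmetric]) auto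
      also have "?s * unit_ball_vol (real ?k) * (L e * diameter C / 2) ^ ?k
          = (?s * L e ^ ?k) * (unit_ball_vol (real ?k) * (diameter C / 2) ^ ?k)"
        by (simp add: power_mult_distrib power_divide)
      also have "ennreal \<dots> = ennreal (?s * L e ^ ?k) * ennreal (unit_ball_vol (real ?k) * (diameter C / 2) ^ ?k)"
        using s Lpos dC by (intro ennreal_mult) auto
      finally show ?thesis .
    qed
    have "x\<^sub>0 \<in> C'" using C(3) x0(1) by (simp add: C'_def)
    have "emeasure cone_measure C \<le> of_nat CARD('n) * emeasure lborel (coneset D)"
    proof (rule emeasure_cone_measure_coneset(1))
      show "C \<in> sets borel" using C(1) by simp
      show "compact D" by (rule cD)
      fix x assume x: "x \<in> K" "rad x \<in> C"
      show "x \<in> coneset D"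
      proof (cases "x = 0")
        case True
        then show ?thesis using \<open>x\<^sub>0 \<in> C'\<close> unfolding coneset_def D_def
          by (intro image_eqI[of _ _ "(0, \<pi> x\<^sub>0)"]) auto
      next
        case False
        then have rx: "rad x \<in> C'" using x rad_frontier by (simp add: C'_def)
        let ?a = "rad x \<bullet> y\<^sub>0"
        \<comment> \<open>\<open>K\<close> lies on the origin's side of the tangent plane, so the
          segment from the origin to the projected point contains \<open>x\<close>.\<close>
        have "x = (supp J x * ?a) *\<^sub>R \<pi> (rad x)"
          using rad_inverse[of x] a0[OF rx] by (simp add: \<pi>_def)
        moreover have "supp J x * ?a \<le> 1 * 1"
          using x(1) a(2)[OF rx] a0[OF rx] by (intro mult_mono) (auto simp: mem_K_iff supp_nonneg)
        moreover have "0 \<le> supp J x * ?a" using a0[OF rx] by (simp add: supp_nonneg)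
        ultimately show ?thesis unfolding coneset_def D_def
          using rx by (intro image_eqI[of _ _ "(supp J x * ?a, \<pi> (rad x))"]) auto
      qed
    qed
    also note le
    also have "ennreal (?s * L e ^ ?k) * ennreal (unit_ball_vol (real ?k) * (diameter C / 2) ^ ?k)
        \<le> ennreal t * ennreal (unit_ball_vol (real ?k) * (diameter C / 2) ^ ?k)"
      using e(3) by (intro mult_right_mono ennreal_leI) auto
    also have "ennreal (unit_ball_vol (real ?k) * (diameter C / 2) ^ ?k) = hausdorff_gauge ?k C"
      using C(3) by (auto simp: hausdorff_gauge_def)
    finally show ?thesis .
  qed
  then show ?thesis using \<delta>(1) by (intro exI[of _ \<delta>]) auto
qed

text \<open>Over a disc in the tangent plane the gauge exceeds 1 by at most \<open>e\<close> times
  the distance from the centre. Shrinking the cone by \<open>1 / (1 + e)\<close> moves it into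
  \<open>K\<close>, and radial projection displaces the disc only slightly. The number
  \<open>e\<close> may be large: it tends to 0 for the sharp density and is a Lipschitz constant for
  the uniform one.\<close>

lemma cone_measure_lower_bound:
  assumes x0: "x\<^sub>0 \<in> frontier K" and y0: "dual_rel K J x\<^sub>0 y\<^sub>0" and e: "0 \<le> e"
    and slope: "\<And>z. z \<bullet> y\<^sub>0 = 1 \<Longrightarrow> norm (z - x\<^sub>0) \<le> r \<Longrightarrow> supp J z \<le> 1 + e * norm (z - x\<^sub>0)"
    and r: "0 < r" "r \<le> 1"
  shows "ennreal (1 / norm y\<^sub>0 / (1 + e) ^ CARD('n) / (1 + (norm x\<^sub>0 + 1) * e) ^ (CARD('n) - 1)
      * unit_ball_vol (real (CARD('n) - 1)) * r ^ (CARD('n) - 1)) \<le> emeasure cone_measure (cball x\<^sub>0 r)"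
proof -
  let ?k = "CARD('n) - 1" and ?s = "1 / norm y\<^sub>0" and ?u = "(1 / norm y\<^sub>0) *\<^sub>R y\<^sub>0"
  note fr = dual_rel_frontier[OF x0 y0]
  define M where "M = norm x\<^sub>0 + 1"
  have M: "1 \<le> M" by (simp add: M_def)
  \<comment> \<open>Radial projection multiplies the distance from \<open>x\<^sub>0\<close> by at
    most \<open>1 + M * e\<close>, so this disc stays within \<open>r\<close>.\<close>
  define R where "R = r / (1 + M * e)"
  have q: "1 \<le> 1 + M * e" using M e by simp
  have R: "0 < R" "R \<le> r" using r q by (auto simp: R_def divide_le_eq intro: mult_left_le)
  define c where "c = 1 / (1 + e)"
  have c: "0 < c" using e by (simp add: c_def)
  have s: "0 < ?s" using fr by simp
  define D where "D = {z. z \<bullet> ?u = ?s \<and> norm (z - x\<^sub>0) \<le> R}"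
  have D: "z \<bullet> y\<^sub>0 = 1" "norm (z - x\<^sub>0) \<le> R" if "z \<in> D" for z
    using that fr(3) by (auto simp: D_def)
  have cD: "compact D"
  proof (rule compact_eq_bounded_closed[THEN iffD2], intro conjI)
    have "D \<subseteq> cball x\<^sub>0 R" by (auto simp: D_def dist_norm norm_minus_commute)
    then show "bounded D" using bounded_cball bounded_subset by blast
    show "closed D" unfolding D_def by (intro closed_Collect_conj closed_Collect_le closed_Collect_eq continuous_intros)
  qed
  have supz: "1 \<le> supp J z" "supp J z \<le> 1 + e * norm (z - x\<^sub>0)" if "z \<in> D" for z
    using inner_le_supp[OF fr(2), of z] slope[of z] D[OF that] R by auto
  have "ennreal (?s * unit_ball_vol (real ?k) * R ^ ?k / CARD('n)) \<le> emeasure lborel (coneset D)"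
    unfolding D_def using fr s R by (intro emeasure_coneset_disc_ge) auto
  then have "of_nat CARD('n) * (ennreal (c ^ CARD('n)) * ennreal (?s * unit_ball_vol (real ?k) * R ^ ?k / CARD('n)))
      \<le> of_nat CARD('n) * (ennreal (c ^ CARD('n)) * emeasure lborel (coneset D))"
    by (intro mult_left_mono) auto
  also have "\<dots> \<le> emeasure cone_measure (cball x\<^sub>0 r)"
  proof (rule emeasure_cone_measure_coneset(2)[OF _ cD])
    show "0 \<le> c" using c by simp
    fix x assume x: "x \<noteq> 0" "x \<in> coneset D"
    then obtain t z where tz: "0 \<le> t" "t \<le> 1" "z \<in> D" "x = t *\<^sub>R z" by (auto simp: coneset_def)
    have t: "0 < t" using tz x by (cases "t = 0") auto
    note z = D[OF tz(3)] supz[OF tz(3)]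
    have nz: "norm (z - x\<^sub>0) \<le> 1" using z(2) R r by simp
    have "supp J (c *\<^sub>R x) = c * t * supp J z" using tz(4) t c by (simp add: supp_scale)
    also have "\<dots> \<le> c * 1 * (1 + e)"
    proof (intro mult_mono)
      have "e * norm (z - x\<^sub>0) \<le> e * 1" using nz e by (rule mult_left_mono)
      then show "supp J z \<le> 1 + e" using z(4) by simp
    qed (use c tz e t supp_nonneg in auto)
    also have "\<dots> = 1" using e by (simp add: c_def)
    finally have "c *\<^sub>R x \<in> K" by (simp add: mem_K_iff)
    moreover have "rad (c *\<^sub>R x) = rad z" using tz(4) t c by (simp add: rad_scale)
    moreover have "rad z \<in> cball x\<^sub>0 r"
    proof -
      have nM: "norm z \<le> M" using nz norm_triangle_ineq2[of z x\<^sub>0] by (simp add: M_def)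
      have "rad z - x\<^sub>0 = (z - x\<^sub>0) - (1 - 1 / supp J z) *\<^sub>R z" by (simp add: rad_def scaleR_diff_left)
      then have "norm (rad z - x\<^sub>0) \<le> norm (z - x\<^sub>0) + norm ((1 - 1 / supp J z) *\<^sub>R z)"
        using norm_triangle_ineq4 by metis
      also have "norm ((1 - 1 / supp J z) *\<^sub>R z) \<le> (e * norm (z - x\<^sub>0)) * M"
      proof -
        have z0: "z \<noteq> 0" using z(3) by auto
        have "1 - 1 / supp J z \<le> supp J z - 1"
        proof -
          have "supp J z - 1 - (1 - 1 / supp J z) = (supp J z - 1)\<^sup>2 / supp J z"
            using z0 by (simp add: power2_eq_square field_simps)
          also have "\<dots> \<ge> 0" using z(3) by simp
          finally show ?thesis by simp
        qed
        moreover have "0 \<le> 1 - 1 / supp J z" using z(3) z0 by simp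
        ultimately have "\<bar>1 - 1 / supp J z\<bar> \<le> e * norm (z - x\<^sub>0)" using z(4) by linarith
        then show ?thesis using nM by (simp add: mult_mono)
      qed
      also have "norm (z - x\<^sub>0) + (e * norm (z - x\<^sub>0)) * M = norm (z - x\<^sub>0) * (1 + M * e)" by (simp add: algebra_simps)
      also have "\<dots> \<le> R * (1 + M * e)" using z(2) q by (intro mult_right_mono) auto
      also have "\<dots> = r" using q by (simp add: R_def)
      finally show ?thesis by (simp add: dist_norm norm_minus_commute)
    qed
    ultimately show "c *\<^sub>R x \<in> K \<and> rad (c *\<^sub>R x) \<in> cball x\<^sub>0 r" by simp
  qed simp
  also have "of_nat CARD('n) * (ennreal (c ^ CARD('n)) * ennreal (?s * unit_ball_vol (real ?k) * R ^ ?k / CARD('n)))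
      = ennreal (real CARD('n) * (c ^ CARD('n) * (?s * unit_ball_vol (real ?k) * R ^ ?k / CARD('n))))"
  proof -
    have cn: "0 \<le> c ^ CARD('n)" and vn: "0 \<le> ?s * unit_ball_vol (real ?k) * R ^ ?k / CARD('n)"
      using c s R by auto
    show ?thesis
      by (simp only: ennreal_of_nat_eq_real_of_nat ennreal_mult[OF of_nat_0_le_iff mult_nonneg_nonneg[OF cn vn]]
          ennreal_mult[OF cn vn])
  qed
  also have "real CARD('n) * (c ^ CARD('n) * (?s * unit_ball_vol (real ?k) * R ^ ?k / CARD('n)))
      = ?s / (1 + e) ^ CARD('n) / (1 + M * e) ^ ?k * unit_ball_vol (real ?k) * r ^ ?k"
    by (simp add: c_def R_def power_divide)
  finally show ?thesis unfolding M_def .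
qed

lemma cone_measure_lower_density:
  assumes x0: "x\<^sub>0 \<in> frontier K" "x\<^sub>0 \<notin> dual.multi" and y0: "dual_rel K J x\<^sub>0 y\<^sub>0"
    and t: "t < 1 / norm y\<^sub>0"
  shows "\<exists>\<delta>>0. \<forall>r. 0 < r \<and> r \<le> \<delta>
        \<longrightarrow> ennreal (t * unit_ball_vol (real (CARD('n) - 1)) * r ^ (CARD('n) - 1)) \<le> emeasure cone_measure (cball x\<^sub>0 r)"
proof -
  let ?k = "CARD('n) - 1" and ?s = "1 / norm y\<^sub>0"
  note fr = dual_rel_frontier[OF x0(1) y0]
  let ?f = "\<lambda>e. ?s / (1 + e) ^ CARD('n) / (1 + (norm x\<^sub>0 + 1) * e) ^ ?k"
  have "(?f \<longlongrightarrow> ?s / (1 + 0) ^ CARD('n) / (1 + (norm x\<^sub>0 + 1) * 0) ^ ?k) (at_right 0)"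
    by (intro tendsto_intros) auto
  then have "\<forall>\<^sub>F e in at_right 0. t < ?f e"
    by (rule order_tendstoD(1)) (use t in simp)
  then obtain b where b: "b > 0" "\<And>e. 0 < e \<Longrightarrow> e < b \<Longrightarrow> t < ?f e"
    unfolding eventually_at_right_field by auto
  define e where "e = b / 2"
  have e: "0 < e" "e < b" using b(1) by (auto simp: e_def)
  note e = e(1) b(2)[OF e]
  obtain d where d: "d > 0" "\<And>x' y'. norm (x' - x\<^sub>0) \<le> d \<Longrightarrow> dual_rel K J x' y' \<Longrightarrow> norm (y' - y\<^sub>0) < e"
    using dual_rel_continuous[OF x0(2) y0 e(1)] by blast
  \<comment> \<open>The square of the gauge at \<open>z\<close> is \<open>z \<bullet> y\<close>. The
    displacement \<open>z - x\<^sub>0\<close> is orthogonal to \<open>y\<^sub>0\<close>, so only its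
    product with \<open>y - y\<^sub>0\<close> exceeds \<open>x\<^sub>0 \<bullet> y\<close>, which is
    at most the gauge.\<close>
  have supz: "supp J z \<le> 1 + e * norm (z - x\<^sub>0)" if z: "z \<bullet> y\<^sub>0 = 1" "norm (z - x\<^sub>0) \<le> d" for z
  proof -
    obtain y where y: "dual_rel K J z y" using dual_rel_exists by blast
    have z1: "1 \<le> supp J z" using inner_le_supp[OF fr(2), of z] z(1) by simp
    have "supp J z * supp J z = z \<bullet> y" using y by (simp add: dual_rel_def power2_eq_square)
    also have "\<dots> = x\<^sub>0 \<bullet> y + (z - x\<^sub>0) \<bullet> (y - y\<^sub>0)" using z(1) fr(1) by (simp add: inner_diff_left inner_diff_right)
    also have "x\<^sub>0 \<bullet> y \<le> supp J z"
      using inner_le_supp_mult[of x\<^sub>0 y] x0(1) y by (simp add: frontier_K_iff dual_rel_def)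
    also have "(z - x\<^sub>0) \<bullet> (y - y\<^sub>0) \<le> norm (z - x\<^sub>0) * norm (y - y\<^sub>0)" by (rule norm_cauchy_schwarz)
    also have "\<dots> \<le> norm (z - x\<^sub>0) * e" using d(2)[OF z(2) y] by (intro mult_left_mono) auto
    finally have le: "supp J z * (supp J z - 1) \<le> e * norm (z - x\<^sub>0)" by (simp add: algebra_simps)
    have "1 * (supp J z - 1) \<le> supp J z * (supp J z - 1)" using z1 by (intro mult_right_mono) auto
    then show ?thesis using le by simp
  qed
  have "ennreal (t * unit_ball_vol (real ?k) * r ^ ?k) \<le> emeasure cone_measure (cball x\<^sub>0 r)"
    if r: "0 < r" "r \<le> min d 1" for r
  proof -
    have "ennreal (t * unit_ball_vol (real ?k) * r ^ ?k) \<le> ennreal (?f e * unit_ball_vol (real ?k) * r ^ ?k)"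
      using e(2) r by (intro ennreal_leI mult_right_mono) auto
    also have "\<dots> \<le> emeasure cone_measure (cball x\<^sub>0 r)"
      by (rule cone_measure_lower_bound[OF x0(1) y0]) (use e(1) r supz in auto)
    finally show ?thesis .
  qed
  then show ?thesis using d(1) by (intro exI[of _ "min d 1"]) auto
qed

text \<open>Valid also at boundary points with several normals, with the Lipschitz constant of the
  gauge in place of a small \<open>e\<close>. It transfers null sets and finiteness from the cone
  measure to the Hausdorff measure.\<close>

lemma cone_measure_uniform_lower_density:
  "\<exists>t>0. \<forall>x\<in>frontier K. \<forall>r. 0 < r \<and> r \<le> 1
        \<longrightarrow> ennreal (t * unit_ball_vol (real (CARD('n) - 1)) * r ^ (CARD('n) - 1)) \<le> emeasure cone_measure (cball x r)"
proof -
  let ?k = "CARD('n) - 1"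
  obtain C where C: "C > 0" "\<And>x z. \<bar>supp J x - supp J z\<bar> \<le> C * norm (x - z)"
    using supp_lipschitz by blast
  obtain N where N: "N > 0" "\<And>x. x \<in> K \<Longrightarrow> norm x \<le> N" using dual.J_bound by blast
  obtain Y where Y: "Y > 0" "\<And>y. y \<in> J \<Longrightarrow> norm y \<le> Y" using J_bound by blast
  define t where "t = 1 / Y / (1 + C) ^ CARD('n) / (1 + (N + 1) * C) ^ ?k"
  have pos: "0 < 1 + C" "0 < 1 + (N + 1) * C" using C(1) N(1) by (auto intro: add_pos_nonneg)
  have "0 < t" unfolding t_def using Y(1) pos by simp
  moreover have "ennreal (t * unit_ball_vol (real ?k) * r ^ ?k) \<le> emeasure cone_measure (cball x r)"
    if x: "x \<in> frontier K" and r: "0 < r" "r \<le> 1" for x r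
  proof -
    obtain y where y: "dual_rel K J x y" using dual_rel_exists by blast
    note fr = dual_rel_frontier[OF x y]
    have "t \<le> 1 / norm y / (1 + C) ^ CARD('n) / (1 + (norm x + 1) * C) ^ ?k"
      unfolding t_def
    proof (rule frac_le)
      have "1 / Y \<le> 1 / norm y" using Y(2)[OF fr(2)] fr(3) Y(1) by (intro divide_left_mono) auto
      then show "1 / Y / (1 + C) ^ CARD('n) \<le> 1 / norm y / (1 + C) ^ CARD('n)"
        using pos by (intro divide_right_mono) auto
      show "0 \<le> 1 / norm y / (1 + C) ^ CARD('n)" using pos by simp
      show "0 < (1 + (norm x + 1) * C) ^ ?k" using C(1) by (intro zero_less_power add_pos_nonneg) auto
      have "1 + (norm x + 1) * C \<le> 1 + (N + 1) * C"
        using N(2)[OF frontier_sub(1)[OF x]] C(1) by simp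
      then show "(1 + (norm x + 1) * C) ^ ?k \<le> (1 + (N + 1) * C) ^ ?k" using C(1) by (intro power_mono) auto
    qed
    then have "ennreal (t * unit_ball_vol (real ?k) * r ^ ?k)
      \<le> ennreal (1 / norm y / (1 + C) ^ CARD('n) / (1 + (norm x + 1) * C) ^ ?k * unit_ball_vol (real ?k) * r ^ ?k)"
      using r by (intro ennreal_leI mult_right_mono) auto
    also have "\<dots> \<le> emeasure cone_measure (cball x r)"
    proof (rule cone_measure_lower_bound[OF x y])
      show "supp J z \<le> 1 + C * norm (z - x)" for z
        using C(2)[of z x] x by (simp add: frontier_K_iff abs_le_iff)
    qed (use C(1) r in auto)
    finally show ?thesis .
  qed
  ultimately show ?thesis by blast
qed

end

text \<open>\<open>B\<close> is cut into the layers where \<open>S\<close> lies between consecutive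
  multiples of \<open>e\<close>. On each layer the density integral and \<open>V\<close> agree up to
  \<open>2 * e\<close> times \<open>H\<close>; finiteness of \<open>H\<close> on \<open>A\<close>
  makes the total error vanish with \<open>e\<close>.\<close>

lemma density_eq_of_local_comparison:
  fixes H V :: "'a::topological_space measure" and S :: "'a \<Rightarrow> real"
  assumes H: "sets H = sets borel" and V: "sets V = sets borel"
    and S: "S \<in> borel_measurable borel" "\<And>x. 0 \<le> S x"
    and A: "A \<in> sets borel" "emeasure H A < \<infinity>"
    and upper: "\<And>B t. B \<in> sets borel \<Longrightarrow> B \<subseteq> A \<Longrightarrow> 0 < t \<Longrightarrow> (\<And>x. x \<in> B \<Longrightarrow> S x < t) \<Longrightarrow> emeasure V B \<le> ennreal t * emeasure H B"
    and lower: "\<And>B t. B \<in> sets borel \<Longrightarrow> B \<subseteq> A \<Longrightarrow> 0 < t \<Longrightarrow> (\<And>x. x \<in> B \<Longrightarrow> t < S x) \<Longrightarrow> ennreal t * emeasure H B \<le> emeasure V B"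
    and B: "B \<in> sets borel" "B \<subseteq> A"
  shows "emeasure (density H (\<lambda>x. ennreal (S x))) B = emeasure V B"
proof -
  let ?D = "density H (\<lambda>x. ennreal (S x))"
  note [measurable] = S(1)
  have [measurable_cong]: "sets H = sets borel" by fact
  have Sm: "(\<lambda>x. ennreal (S x)) \<in> borel_measurable H" by measurable
  have sD: "sets ?D = sets borel" using H by simp
  have finB: "emeasure H B < \<infinity>"
    using emeasure_mono[of B A H] B A H by (auto intro: le_less_trans)
  have both: "emeasure V B \<le> emeasure ?D B + ennreal e * emeasure H B \<and>
        emeasure ?D B \<le> emeasure V B + ennreal (2 * e) * emeasure H B" if e: "0 < e" for e
  proof -
    define P where "P j = {x \<in> B. real j * e \<le> S x \<and> S x < real (Suc j) * e}" for j :: nat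
    have Pm: "P j \<in> sets borel" for j
    proof -
      have "P j = B \<inter> {x. real j * e \<le> S x \<and> S x < real (Suc j) * e}" by (auto simp: P_def)
      moreover have "{x. real j * e \<le> S x \<and> S x < real (Suc j) * e} \<in> sets borel" by measurable
      ultimately show ?thesis using B by simp
    qed
    have PB: "P j \<subseteq> A" for j using B by (auto simp: P_def)
    have disj: "disjoint_family P"
      unfolding disjoint_family_on_def
    proof (intro ballI impI)
      fix i j :: nat assume ij: "i \<noteq> j"
      have False if "real i * e \<le> x" "x < real (Suc i) * e" "real j * e \<le> x" "x < real (Suc j) * e" for x
      proof -
        have "real i * e < real (Suc j) * e" "real j * e < real (Suc i) * e" using that by linarith+
        then have "i < Suc j" "j < Suc i" using e by simp_all
        then show False using ij by simp
      qed
      then show "P i \<inter> P j = {}" unfolding P_def by blast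
    qed
    have un: "(\<Union>j. P j) = B"
    proof
      show "B \<subseteq> (\<Union>j. P j)"
      proof
        fix x assume x: "x \<in> B"
        let ?j = "nat \<lfloor>S x / e\<rfloor>"
        have "real ?j = of_int \<lfloor>S x / e\<rfloor>" using S(2)[of x] e by simp
        then have "real ?j \<le> S x / e" "S x / e < real ?j + 1" by linarith+
        then have "x \<in> P ?j" using x e by (simp add: P_def field_simps)
        then show "x \<in> (\<Union>j. P j)" by blast
      qed
    qed (auto simp: P_def)
    have sum: "emeasure M B = (\<Sum>j. emeasure M (P j))" if "sets M = sets borel" for M
    proof -
      have "range P \<subseteq> sets M" using Pm that by auto
      from suminf_emeasure[OF this disj] show ?thesis using un by simp
    qed
    have D: "emeasure ?D (P j) = (\<integral>\<^sup>+x. ennreal (S x) * indicator (P j) x \<partial>H)" for j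
      by (rule emeasure_density[OF Sm]) (use Pm H in auto)
    have Dle: "emeasure ?D (P j) \<le> ennreal (real (Suc j) * e) * emeasure H (P j)" for j
    proof -
      have "emeasure ?D (P j) \<le> (\<integral>\<^sup>+x. ennreal (real (Suc j) * e) * indicator (P j) x \<partial>H)"
        unfolding D by (intro nn_integral_mono) (auto simp: P_def indicator_def intro!: ennreal_leI simp del: of_nat_Suc)
      also have "\<dots> = ennreal (real (Suc j) * e) * emeasure H (P j)"
        using Pm H by (intro nn_integral_cmult_indicator) auto
      finally show ?thesis .
    qed
    have Dge: "ennreal (real j * e) * emeasure H (P j) \<le> emeasure ?D (P j)" for j
    proof -
      have "ennreal (real j * e) * emeasure H (P j) = (\<integral>\<^sup>+x. ennreal (real j * e) * indicator (P j) x \<partial>H)"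
        using Pm H by (intro nn_integral_cmult_indicator[symmetric]) auto
      also have "\<dots> \<le> emeasure ?D (P j)"
        unfolding D by (intro nn_integral_mono) (auto simp: P_def indicator_def intro!: ennreal_leI)
      finally show ?thesis .
    qed
    have 1: "emeasure V (P j) \<le> emeasure ?D (P j) + ennreal e * emeasure H (P j)" for j
    proof -
      have "emeasure V (P j) \<le> ennreal (real (Suc j) * e) * emeasure H (P j)"
        using e by (intro upper Pm PB) (auto simp: P_def)
      also have "real (Suc j) * e = real j * e + e" by (simp add: distrib_right)
      also have "ennreal (real j * e + e) * emeasure H (P j)
          = ennreal (real j * e) * emeasure H (P j) + ennreal e * emeasure H (P j)"
        using e by (simp add: distrib_right)
      also have "\<dots> \<le> emeasure ?D (P j) + ennreal e * emeasure H (P j)" using Dge by (rule add_right_mono)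
      finally show ?thesis .
    qed
    have 2: "emeasure ?D (P j) \<le> emeasure V (P j) + ennreal (2 * e) * emeasure H (P j)" for j
    \<comment> \<open>The hypothesis \<open>lower\<close> needs a positive level strictly below
      \<open>S\<close>, so the layer \<open>j\<close> uses \<open>(j - 1) * e\<close>. In the two
      lowest layers that level is not positive, but there the integral is itself at most
      \<open>2 * e\<close> times \<open>H\<close>.\<close>
    proof (cases "j \<le> 1")
      case True
      then have "real (Suc j) * e \<le> 2 * e" using e by (intro mult_right_mono) auto
      then have "emeasure ?D (P j) \<le> ennreal (2 * e) * emeasure H (P j)"
        using Dle[of j] by (meson ennreal_leI mult_right_mono order_trans zero_le)
      then show ?thesis by (simp add: add_increasing)
    next
      case False
      then obtain i where i: "j = Suc i" "0 < i" by (cases j) auto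
      have "ennreal (real i * e) * emeasure H (P j) \<le> emeasure V (P j)"
      proof (rule lower[OF Pm PB])
        show "0 < real i * e" using i e by simp
        fix x assume "x \<in> P j"
        then have "real j * e \<le> S x" by (simp add: P_def)
        moreover have "real i * e < real j * e" using i e by simp
        ultimately show "real i * e < S x" by linarith
      qed
      moreover have "emeasure ?D (P j) \<le> ennreal (real i * e) * emeasure H (P j) + ennreal (2 * e) * emeasure H (P j)"
      proof -
        have "real (Suc j) * e = real i * e + 2 * e" using i by (simp add: algebra_simps)
        then show ?thesis using Dle[of j] e by (simp add: distrib_right add.commute)
      qed
      ultimately show ?thesis by (meson add_right_mono order_trans)
    qed
    have "emeasure V B \<le> (\<Sum>j. emeasure ?D (P j) + ennreal e * emeasure H (P j))"
      unfolding sum[OF V] by (intro suminf_le 1) auto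
    also have "\<dots> = (\<Sum>j. emeasure ?D (P j)) + (\<Sum>j. ennreal e * emeasure H (P j))"
      by (rule suminf_add[symmetric]) auto
    also have "\<dots> = emeasure ?D B + ennreal e * emeasure H B"
      unfolding sum[OF sD] sum[OF H] by simp
    finally have 3: "emeasure V B \<le> emeasure ?D B + ennreal e * emeasure H B" .
    have "emeasure ?D B \<le> (\<Sum>j. emeasure V (P j) + ennreal (2 * e) * emeasure H (P j))"
      unfolding sum[OF sD] by (intro suminf_le 2) auto
    also have "\<dots> = (\<Sum>j. emeasure V (P j)) + (\<Sum>j. ennreal (2 * e) * emeasure H (P j))"
      by (rule suminf_add[symmetric]) auto
    also have "\<dots> = emeasure V B + ennreal (2 * e) * emeasure H B"
      unfolding sum[OF V] sum[OF H] by simp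
    finally show ?thesis using 3 by blast
  qed
  obtain h where h: "emeasure H B = ennreal h" "0 \<le> h"
    using finB by (cases "emeasure H B") auto
  show ?thesis
  proof (rule antisym)
    show "emeasure ?D B \<le> emeasure V B"
    proof (rule ennreal_le_epsilon)
      fix e :: real assume e: "0 < e"
      have "ennreal (2 * (e / (2 * (h + 1)))) * emeasure H B \<le> ennreal e"
        unfolding h(1) using e h by (subst ennreal_mult[symmetric]) (auto intro!: ennreal_leI simp: field_simps)
      moreover have "emeasure ?D B \<le> emeasure V B + ennreal (2 * (e / (2 * (h + 1)))) * emeasure H B"
        using both[of "e / (2 * (h + 1))"] e h by auto
      ultimately show "emeasure ?D B \<le> emeasure V B + ennreal e" by (meson add_left_mono order_trans)
    qed
    show "emeasure V B \<le> emeasure ?D B"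
    proof (rule ennreal_le_epsilon)
      fix e :: real assume e: "0 < e"
      have "ennreal (e / (h + 1)) * emeasure H B \<le> ennreal e"
        unfolding h(1) using e h by (subst ennreal_mult[symmetric]) (auto intro!: ennreal_leI simp: field_simps)
      moreover have "emeasure V B \<le> emeasure ?D B + ennreal (e / (h + 1)) * emeasure H B"
        using both[of "e / (h + 1)"] e h by auto
      ultimately show "emeasure V B \<le> emeasure ?D B + ennreal e" by (meson add_left_mono order_trans)
    qed
  qed
qed

section \<open>The cone measure as a density of surface area\<close>

context polar_pair
begin

interpretation dual: polar_pair J K
  by (rule polar_pair_sym) (rule polar_pair_axioms)

lemma outer_normal_dual:
  assumes "x \<in> frontier K"
  shows "0 < x \<bullet> outer_normal K x" "dual_rel K J x ((1 / (x \<bullet> outer_normal K x)) *\<^sub>R outer_normal K x)"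
    and "norm ((1 / (x \<bullet> outer_normal K x)) *\<^sub>R outer_normal K x) = 1 / (x \<bullet> outer_normal K x)"
proof -
  note sp = outer_normal_spec[OF assms]
  show 1: "0 < x \<bullet> outer_normal K x" "dual_rel K J x ((1 / (x \<bullet> outer_normal K x)) *\<^sub>R outer_normal K x)"
    using outer_normal_dual_rel[OF assms sp] by auto
  show "norm ((1 / (x \<bullet> outer_normal K x)) *\<^sub>R outer_normal K x) = 1 / (x \<bullet> outer_normal K x)"
    using sp 1(1) by (simp add: is_outer_normal_def)
qed

definition smooth_boundary :: "(real^'n) set" where
  "smooth_boundary = frontier K - dual.multi"

text \<open>At a point with several normals \<open>outer_normal\<close> is an arbitrary choice.
  Cutting down to the smooth boundary leaves a function that is continuous there, hence Borel
  everywhere.\<close>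

definition support_density :: "real^'n \<Rightarrow> real" where
  "support_density x = indicator smooth_boundary x * (x \<bullet> outer_normal K x)"

lemma smooth_boundary_sets [measurable]: "smooth_boundary \<in> sets borel"
  unfolding smooth_boundary_def by (intro sets.Diff dual.multi_sets) (simp add: borel_closed)

lemma support_density_nonneg: "0 \<le> support_density x"
  using outer_normal_dual(1)[of x] by (auto simp: support_density_def smooth_boundary_def indicator_def less_imp_le)

lemma support_density_measurable [measurable]: "support_density \<in> borel_measurable borel"
proof -
  define g where "g x = (1 / (x \<bullet> outer_normal K x)) *\<^sub>R outer_normal K x" for x
  have g: "dual_rel K J x (g x)" "norm (g x) = 1 / (x \<bullet> outer_normal K x)" "0 < x \<bullet> outer_normal K x"
    if "x \<in> smooth_boundary" for x
    using that outer_normal_dual[of x] by (auto simp: g_def smooth_boundary_def)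
  have cont: "continuous_on smooth_boundary g"
    unfolding continuous_on_iff
  proof (intro ballI allI impI)
    fix x e assume x: "x \<in> smooth_boundary" and e: "0 < (e::real)"
    obtain d where d: "d > 0" "\<forall>x' y'. norm (x' - x) \<le> d \<and> dual_rel K J x' y' \<longrightarrow> norm (y' - g x) < e"
      using dual_rel_continuous[OF _ g(1)[OF x] e] x unfolding smooth_boundary_def by blast
    show "\<exists>d>0. \<forall>x'\<in>smooth_boundary. dist x' x < d \<longrightarrow> dist (g x') (g x) < e"
    proof (intro exI[of _ d] conjI ballI impI)
      fix x' assume x': "x' \<in> smooth_boundary" "dist x' x < d"
      then have "norm (x' - x) \<le> d" by (simp add: dist_norm)
      then show "dist (g x') (g x) < e" using d(2) g(1)[OF x'(1)] by (simp add: dist_norm)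
    qed (rule d(1))
  qed
  have "continuous_on smooth_boundary (\<lambda>x. 1 / norm (g x))"
    using g(2,3) by (intro continuous_on_divide continuous_on_norm cont continuous_on_const) force
  then have "(\<lambda>x. indicator smooth_boundary x *\<^sub>R (1 / norm (g x))) \<in> borel_measurable borel"
    by (rule borel_measurable_continuous_on_indicator[OF smooth_boundary_sets])
  moreover have "support_density = (\<lambda>x. indicator smooth_boundary x *\<^sub>R (1 / norm (g x)))"
    using g by (auto simp: support_density_def fun_eq_iff indicator_def)
  ultimately show ?thesis by simp
qed

lemma support_density_eq:
  assumes "x \<in> smooth_boundary"
  obtains y where "dual_rel K J x y" "support_density x = 1 / norm y"
  using assms outer_normal_dual[of x] that[of "(1 / (x \<bullet> outer_normal K x)) *\<^sub>R outer_normal K x"]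
  by (auto simp: support_density_def smooth_boundary_def)

lemma cone_measure_off_smooth: "emeasure cone_measure (- smooth_boundary) = 0"
proof -
  have "{x \<in> K. rad x \<in> - smooth_boundary} \<subseteq> dual.multi \<union> {0}"
  proof
    fix x assume x: "x \<in> {x \<in> K. rad x \<in> - smooth_boundary}"
    show "x \<in> dual.multi \<union> {0}"
    proof (cases "x = 0")
      case False
      then have "rad x \<in> dual.multi" using x rad_frontier by (auto simp: smooth_boundary_def)
      then show ?thesis using False unfolding rad_def by (subst (asm) dual.multi_scale) auto
    qed simp
  qed
  moreover have "dual.multi \<union> {0} \<in> null_sets lborel" using dual.multi_null by (intro null_sets.Un) auto
  ultimately have "emeasure lborel {x \<in> K. rad x \<in> - smooth_boundary} \<le> emeasure lborel (dual.multi \<union> {0})"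
      "emeasure lborel (dual.multi \<union> {0}) = 0"
    by (auto intro: emeasure_mono)
  then have "emeasure lborel {x \<in> K. rad x \<in> - smooth_boundary} = 0" by simp
  then show ?thesis by (subst emeasure_cone_measure) auto
qed

lemma hausdorff_le_cone_measure:
  obtains t where "0 < t" "\<And>B. B \<in> sets borel \<Longrightarrow> B \<subseteq> frontier K \<Longrightarrow>
    ennreal t * emeasure (hausdorff_measure (CARD('n) - 1)) B \<le> emeasure cone_measure B"
proof -
  obtain t where t: "0 < t" "\<forall>x\<in>frontier K. \<forall>r. 0 < r \<and> r \<le> 1
        \<longrightarrow> ennreal (t * unit_ball_vol (real (CARD('n) - 1)) * r ^ (CARD('n) - 1)) \<le> emeasure cone_measure (cball x r)"
    using cone_measure_uniform_lower_density by blast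
  show ?thesis
  proof (rule that[OF t(1)])
    fix B assume B: "B \<in> sets borel" "B \<subseteq> frontier K"
    show "ennreal t * emeasure (hausdorff_measure (CARD('n) - 1)) B \<le> emeasure cone_measure B"
    proof (rule hausdorff_le_measure_of_lower_density[OF sets_cone_measure finite_cone_measure B(1) t(1)])
      fix x assume "x \<in> B"
      then show "\<exists>\<delta>>0. \<forall>r. 0 < r \<and> r \<le> \<delta>
        \<longrightarrow> ennreal (t * unit_ball_vol (real (CARD('n) - 1)) * r ^ (CARD('n) - 1)) \<le> emeasure cone_measure (cball x r)"
        using t(2) B(2) by (intro exI[of _ 1]) auto
    qed
  qed
qed

text \<open>The rays through singular boundary points fill part of the null set
  \<open>dual.multi\<close>, so these points carry no cone measure; the uniform lower density turns
  this into a statement on Hausdorff measure.\<close>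

lemma hausdorff_singular_null:
  "AE x in surface_area_measure K. x \<in> smooth_boundary"
proof -
  let ?H = "hausdorff_measure (CARD('n) - 1) :: (real^'n) measure"
  have fr: "frontier K \<inter> space ?H \<in> sets ?H" by (simp add: borel_closed)
  obtain t where t: "0 < t" "\<And>B. B \<in> sets borel \<Longrightarrow> B \<subseteq> frontier K \<Longrightarrow>
    ennreal t * emeasure ?H B \<le> emeasure cone_measure B" by (rule hausdorff_le_cone_measure) (rule that)
  have S: "frontier K \<inter> dual.multi \<in> sets borel" by (intro sets.Int dual.multi_sets) (simp add: borel_closed)
  have "emeasure cone_measure (frontier K \<inter> dual.multi) \<le> emeasure cone_measure (- smooth_boundary)"
    by (intro emeasure_mono) (auto simp: smooth_boundary_def)
  then have "ennreal t * emeasure ?H (frontier K \<inter> dual.multi) = 0"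
    using t(2)[OF S] cone_measure_off_smooth by simp
  then have "emeasure ?H (frontier K \<inter> dual.multi) = 0" using t(1) by simp
  then have "frontier K \<inter> dual.multi \<in> null_sets ?H" using S by (auto simp: null_sets_def)
  then have "AE x in ?H. x \<notin> frontier K \<inter> dual.multi" by (rule AE_not_in)
  then show ?thesis unfolding surface_area_measure_def AE_restrict_space_iff[OF fr]
    by eventually_elim (auto simp: smooth_boundary_def)
qed

lemma density_hausdorff_eq_cone_measure:
  "density (hausdorff_measure (CARD('n) - 1)) (\<lambda>x. ennreal (support_density x)) = cone_measure" (is "?D = _")
proof (rule measure_eqI)
  let ?H = "hausdorff_measure (CARD('n) - 1) :: (real^'n) measure"
  fix B assume "B \<in> sets ?D"
  then have B: "B \<in> sets borel" by simp
  obtain t where t: "0 < t" "\<And>B. B \<in> sets borel \<Longrightarrow> B \<subseteq> frontier K \<Longrightarrow>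
    ennreal t * emeasure ?H B \<le> emeasure cone_measure B" by (rule hausdorff_le_cone_measure) (rule that)
  interpret V: finite_measure cone_measure by (rule finite_cone_measure)
  have ssub: "smooth_boundary \<subseteq> frontier K" by (auto simp: smooth_boundary_def)
  have fin: "emeasure ?H smooth_boundary < \<infinity>"
  proof (rule ccontr)
    assume "\<not> ?thesis"
    then have "emeasure ?H smooth_boundary = top" by (metis infinity_ennreal_def top.not_eq_extremum)
    then show False using t(2)[OF smooth_boundary_sets ssub] t(1) V.emeasure_finite[of smooth_boundary]
      by (simp add: ennreal_mult_top top_unique)
  qed
  have main: "emeasure ?D (B \<inter> smooth_boundary) = emeasure cone_measure (B \<inter> smooth_boundary)"
  proof (rule density_eq_of_local_comparison[OF sets_hausdorff_measure sets_cone_measure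
        support_density_measurable support_density_nonneg smooth_boundary_sets fin])
    show "B \<inter> smooth_boundary \<in> sets borel" using B by simp
    fix B' t assume B': "B' \<in> sets borel" "B' \<subseteq> smooth_boundary" "0 < (t::real)"
    show "emeasure cone_measure B' \<le> ennreal t * emeasure ?H B'" if lt: "\<And>x. x \<in> B' \<Longrightarrow> support_density x < t"
    proof (rule measure_le_hausdorff_of_upper_density[OF sets_cone_measure B'(1,3)])
      fix x assume x: "x \<in> B'"
      obtain y where y: "dual_rel K J x y" "support_density x = 1 / norm y"
        using support_density_eq[of x] x B'(2) by blast
      show "\<exists>\<delta>>0. \<forall>C. closed C \<and> bounded C \<and> x \<in> C \<and> diameter C \<le> \<delta>
        \<longrightarrow> emeasure cone_measure C \<le> ennreal t * hausdorff_gauge (CARD('n) - 1) C"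
        using x B'(2) lt[OF x] y by (intro cone_measure_upper_density[OF _ _ y(1)]) (auto simp: smooth_boundary_def)
    qed
    show "ennreal t * emeasure ?H B' \<le> emeasure cone_measure B'" if gt: "\<And>x. x \<in> B' \<Longrightarrow> t < support_density x"
    proof (rule hausdorff_le_measure_of_lower_density[OF sets_cone_measure finite_cone_measure B'(1,3)])
      fix x assume x: "x \<in> B'"
      obtain y where y: "dual_rel K J x y" "support_density x = 1 / norm y"
        using support_density_eq[of x] x B'(2) by blast
      show "\<exists>\<delta>>0. \<forall>r. 0 < r \<and> r \<le> \<delta>
        \<longrightarrow> ennreal (t * unit_ball_vol (real (CARD('n) - 1)) * r ^ (CARD('n) - 1)) \<le> emeasure cone_measure (cball x r)"
        using x B'(2) gt[OF x] y by (intro cone_measure_lower_density[OF _ _ y(1)]) (auto simp: smooth_boundary_def)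
    qed
  qed auto
  have "emeasure cone_measure (B - smooth_boundary) = 0"
    using emeasure_mono[of "B - smooth_boundary" "- smooth_boundary" cone_measure] cone_measure_off_smooth by auto
  then have 1: "emeasure cone_measure B = emeasure cone_measure (B \<inter> smooth_boundary)"
    using plus_emeasure[of "B \<inter> smooth_boundary" cone_measure "B - smooth_boundary"] B
    by (auto simp: Int_Diff_Un Int_Diff_disjoint)
  have "emeasure ?D B = emeasure ?D (B \<inter> smooth_boundary)"
  proof -
    have m: "(\<lambda>x. ennreal (support_density x)) \<in> borel_measurable ?H" by measurable
    have "B \<in> sets ?H" "B \<inter> smooth_boundary \<in> sets ?H" using B by auto
    then show ?thesis
      by (simp only: emeasure_density[OF m])
        (auto intro!: nn_integral_cong simp: indicator_def support_density_def)
  qed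
  then show "emeasure ?D B = emeasure cone_measure B" using main 1 by simp
qed simp

text \<open>Integration in polar coordinates: a surface integral weighted by the support number
  becomes a volume integral over \<open>K\<close> of a function constant along rays.\<close>

theorem surface_integral_eq:
  assumes F [measurable]: "F \<in> borel_measurable borel"
  shows "(\<integral>\<^sup>+x. F x * ennreal (x \<bullet> outer_normal K x) \<partial>surface_area_measure K)
    = of_nat CARD('n) * (\<integral>\<^sup>+x. indicator K x * F (rad x) \<partial>lborel)"
proof -
  let ?H = "hausdorff_measure (CARD('n) - 1) :: (real^'n) measure"
  have fr: "frontier K \<inter> space ?H \<in> sets ?H" by (simp add: borel_closed)
  have "(\<integral>\<^sup>+x. F x * ennreal (x \<bullet> outer_normal K x) \<partial>surface_area_measure K)
      = (\<integral>\<^sup>+x. F x * ennreal (support_density x) \<partial>surface_area_measure K)"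
    by (intro nn_integral_cong_AE eventually_mono[OF hausdorff_singular_null]) (simp add: support_density_def)
  also have "\<dots> = (\<integral>\<^sup>+x. F x * ennreal (support_density x) * indicator (frontier K) x \<partial>?H)"
    unfolding surface_area_measure_def by (rule nn_integral_restrict_space[OF fr])
  also have "\<dots> = (\<integral>\<^sup>+x. ennreal (support_density x) * F x \<partial>?H)"
    by (intro nn_integral_cong) (auto simp: support_density_def smooth_boundary_def indicator_def mult.commute)
  also have "\<dots> = (\<integral>\<^sup>+x. F x \<partial>density ?H (\<lambda>x. ennreal (support_density x)))"
    by (rule nn_integral_density[symmetric]) auto
  also have "\<dots> = (\<integral>\<^sup>+x. F x \<partial>cone_measure)" by (simp only: density_hausdorff_eq_cone_measure)
  finally show ?thesis using nn_integral_cone_measure[OF F] by simp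
qed

end

section \<open>Curvature and second-order expansions\<close>

definition symmetric_form :: "real^'n^'n \<Rightarrow> bool" where
  "symmetric_form M \<longleftrightarrow> (\<forall>v w. v \<bullet> (M *v w) = (M *v v) \<bullet> w)"

text \<open>
  Only the expansion at a single point is required, so \<open>y\<close> and \<open>M\<close> need not be derivatives of \<open>\<phi>\<close>
  near \<open>x\<close>.
\<close>

definition second_order :: "(real^'n \<Rightarrow> real) \<Rightarrow> real^'n \<Rightarrow> real^'n \<Rightarrow> real^'n^'n \<Rightarrow> bool" where
  "second_order \<phi> x y M \<longleftrightarrow> (\<forall>e>0. \<exists>d>0. \<forall>w. norm w \<le> d \<longrightarrow>
     \<bar>\<phi> (x + w) - \<phi> x - y \<bullet> w - w \<bullet> (M *v w) / 2\<bar> \<le> e * (norm w)\<^sup>2)"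

lemma symmetric_form_transpose: "transpose A = A \<Longrightarrow> symmetric_form A"
  unfolding symmetric_form_def by (metis dot_lmul_matrix transpose_matrix_vector)

lemma matrix_norm_bound: "\<exists>a>0. \<forall>v. norm ((A :: real^'n^'n) *v v) \<le> a * norm v"
proof -
  have "bounded_linear ((*v) A)" by (rule matrix_vector_mul_bounded_linear)
  then obtain a where "0 < a" "\<And>v. norm (A *v v) \<le> norm v * a" using bounded_linear.pos_bounded by blast
  then show ?thesis by (auto simp: mult.commute)
qed

lemma quadratic_difference:
  assumes A: "symmetric_form A" and a: "\<And>v. norm (A *v v) \<le> a * norm v"
  shows "\<bar>v \<bullet> (A *v v) - w \<bullet> (A *v w)\<bar> \<le> a * norm (v - w) * norm (v + w)"
proof -
  have "(A *v v) \<bullet> w = (A *v w) \<bullet> v" using A by (simp add: symmetric_form_def inner_commute)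
  then have "v \<bullet> (A *v v) - w \<bullet> (A *v w) = (A *v (v - w)) \<bullet> (v + w)"
    by (simp add: matrix_vector_mult_diff_distrib inner_add_right inner_diff_left) (simp add: inner_commute)
  also have "\<bar>\<dots>\<bar> \<le> norm (A *v (v - w)) * norm (v + w)" by (rule Cauchy_Schwarz_ineq2)
  also have "\<dots> \<le> a * norm (v - w) * norm (v + w)" by (intro mult_right_mono a) simp
  finally show ?thesis .
qed

lemma quadratic_bound:
  assumes "\<And>v. norm (A *v v) \<le> a * norm v"
  shows "\<bar>v \<bullet> (A *v v)\<bar> \<le> a * (norm v)\<^sup>2"
proof -
  have "\<bar>v \<bullet> (A *v v)\<bar> \<le> norm v * norm (A *v v)" by (rule Cauchy_Schwarz_ineq2)
  also have "\<dots> \<le> norm v * (a * norm v)" using assms by (intro mult_left_mono) auto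
  finally show ?thesis by (simp add: power2_eq_square mult_ac)
qed

context polar_pair
begin

text \<open>The definition of a curvature matrix locates only the lowest point of \<open>K\<close>
  over each small \<open>h\<close>. Convexity fills in the points above it up to a depth
  \<open>t\<^sub>0\<close>, provided that \<open>x + h - t\<^sub>0 *\<^sub>R u\<close> lies in
  \<open>K\<close> for all small \<open>h\<close>. The depth is chosen before
  \<open>e\<close>.\<close>

lemma curvature_matrix_graph:
  assumes x: "x \<in> frontier K" and A: "is_curvature_matrix K x A"
  defines "u \<equiv> outer_normal K x"
  shows "\<exists>t\<^sub>0>0. \<forall>e>0. \<exists>d>0. \<forall>h t. u \<bullet> h = 0 \<and> norm h \<le> d \<longrightarrow>
      (t < h \<bullet> (A *v h) / 2 - e * (norm h)\<^sup>2 \<longrightarrow> x + h - t *\<^sub>R u \<notin> K) \<and>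
      (h \<bullet> (A *v h) / 2 + e * (norm h)\<^sup>2 \<le> t \<and> t \<le> t\<^sub>0 \<longrightarrow> x + h - t *\<^sub>R u \<in> K)"
proof -
  let ?T = "at 0 within {h. u \<bullet> h = 0}"
  have un: "norm u = 1" and ule: "\<And>z. z \<in> K \<Longrightarrow> u \<bullet> (z - x) \<le> 0"
    using outer_normal_spec[OF x] by (auto simp: is_outer_normal_def u_def)
  have uu: "u \<bullet> u = 1" using un by (simp add: norm_eq_1)
  obtain f where ev: "\<forall>\<^sub>F h in ?T. x + h - f h *\<^sub>R u \<in> K \<and> (\<forall>t < f h. x + h - t *\<^sub>R u \<notin> K)"
    and lim: "((\<lambda>h. (f h - (A *v h) \<bullet> h / 2) / (norm h)\<^sup>2) \<longlongrightarrow> 0) ?T"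
    using A by (auto simp: is_curvature_matrix_def Let_def u_def)
  \<comment> \<open>The filter \<open>at 0 within\<close> says nothing about \<open>f 0\<close>; the
    correct value there is 0.\<close>
  define g where "g h = (if h = 0 then 0 else f h)" for h
  have graph: "\<exists>d>0. \<forall>h. u \<bullet> h = 0 \<and> norm h \<le> d \<longrightarrow>
      x + h - g h *\<^sub>R u \<in> K \<and> (\<forall>t < g h. x + h - t *\<^sub>R u \<notin> K) \<and> \<bar>g h - h \<bullet> (A *v h) / 2\<bar> \<le> e * (norm h)\<^sup>2"
    if e: "0 < e" for e
  proof -
    have "\<forall>\<^sub>F h in ?T. \<bar>(f h - (A *v h) \<bullet> h / 2) / (norm h)\<^sup>2\<bar> < e"
      using tendstoD[OF lim e] by (simp add: dist_real_def)
    with ev have "\<forall>\<^sub>F h in ?T. (x + h - f h *\<^sub>R u \<in> K \<and> (\<forall>t < f h. x + h - t *\<^sub>R u \<notin> K))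
        \<and> \<bar>(f h - (A *v h) \<bullet> h / 2) / (norm h)\<^sup>2\<bar> < e" by (rule eventually_conj)
    then obtain d where d: "d > 0" "\<And>h. u \<bullet> h = 0 \<Longrightarrow> h \<noteq> 0 \<Longrightarrow> norm h < d \<Longrightarrow>
        (x + h - f h *\<^sub>R u \<in> K \<and> (\<forall>t < f h. x + h - t *\<^sub>R u \<notin> K)) \<and> \<bar>(f h - (A *v h) \<bullet> h / 2) / (norm h)\<^sup>2\<bar> < e"
      unfolding eventually_at by auto
    have "x + h - g h *\<^sub>R u \<in> K \<and> (\<forall>t < g h. x + h - t *\<^sub>R u \<notin> K) \<and> \<bar>g h - h \<bullet> (A *v h) / 2\<bar> \<le> e * (norm h)\<^sup>2"
      if h: "u \<bullet> h = 0" "norm h \<le> d / 2" for h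
    proof (cases "h = 0")
      case True
      have "x - t *\<^sub>R u \<notin> K" if "t < 0" for t
        using ule[of "x - t *\<^sub>R u"] that uu by auto
      then show ?thesis using True frontier_sub(1)[OF x] by (simp add: g_def)
    next
      case False
      then have *: "(x + h - f h *\<^sub>R u \<in> K \<and> (\<forall>t < f h. x + h - t *\<^sub>R u \<notin> K))"
        "\<bar>(f h - (A *v h) \<bullet> h / 2) / (norm h)\<^sup>2\<bar> < e"
        using d(2)[of h] h d(1) by auto
      have "\<bar>f h - (A *v h) \<bullet> h / 2\<bar> / (norm h)\<^sup>2 < e" using *(2) by (simp add: abs_divide)
      then have "\<bar>f h - (A *v h) \<bullet> h / 2\<bar> \<le> e * (norm h)\<^sup>2" using False by (simp add: pos_divide_less_eq)
      then show ?thesis using False *(1) by (simp add: g_def inner_commute)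
    qed
    then show ?thesis using d(1) by (intro exI[of _ "d / 2"]) auto
  qed
  obtain d1 where d1: "d1 > 0" "\<And>h. u \<bullet> h = 0 \<Longrightarrow> norm h \<le> d1 \<Longrightarrow> x + h - g h *\<^sub>R u \<in> K"
    using graph[OF zero_less_one] by blast
  define s where "s = x \<bullet> u"
  have s: "0 < s" using outer_normal_dual_rel(1)[OF x outer_normal_spec[OF x]] by (simp add: s_def u_def)
  define x' where "x' = x - s *\<^sub>R u"
  have ux': "u \<bullet> x' = 0" by (simp add: x'_def inner_diff_right uu s_def inner_commute)
  \<comment> \<open>Small enough that the boundary point over \<open>k\<close> below is within the
    range \<open>d1\<close> of the graph.\<close>
  define \<beta> where "\<beta> = min (1/2) (d1 / (2 * (norm x' + 1)))"
  have \<beta>: "0 < \<beta>" "\<beta> \<le> 1 / 2" "\<beta> * norm x' / (1 - \<beta>) \<le> d1"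
  proof -
    have p: "0 < 2 * (norm x' + 1)" by (simp add: add_nonneg_pos)
    then show "0 < \<beta>" using d1(1) by (simp add: \<beta>_def)
    show "\<beta> \<le> 1 / 2" unfolding \<beta>_def by (rule min.cobounded1)
    have "\<beta> * norm x' / (1 - \<beta>) \<le> \<beta> * norm x' / (1 / 2)"
      using \<open>\<beta> \<le> 1 / 2\<close> \<open>0 < \<beta>\<close> by (intro divide_left_mono) auto
    also have "\<dots> = \<beta> * (2 * norm x')" by simp
    also have "\<dots> \<le> (d1 / (2 * (norm x' + 1))) * (2 * (norm x' + 1))"
      using \<open>0 < \<beta>\<close> d1(1) p by (intro mult_mono) (auto simp: \<beta>_def)
    also have "\<dots> = d1" using p by simp
    finally show "\<beta> * norm x' / (1 - \<beta>) \<le> d1" .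
  qed
  \<comment> \<open>A deep point is a combination of weight \<open>1 - \<beta>\<close> on the graph
    point over \<open>k\<close> and \<open>\<beta>\<close> on a ball about the origin. Moving
    towards the origin shifts \<open>x\<close> tangentially by
    \<open>- \<beta> *\<^sub>R x'\<close>, and this \<open>k\<close> compensates the shift, so the
    result lies straight below \<open>x\<close>.\<close>
  define k where "k = (\<beta> / (1 - \<beta>)) *\<^sub>R x'"
  have k: "u \<bullet> k = 0" "norm k \<le> d1" using \<beta> ux' by (auto simp: k_def)
  define p where "p = x + k - g k *\<^sub>R u"
  have p: "p \<in> K" using d1(2)[OF k] by (simp add: p_def)
  have gk: "0 \<le> g k" using ule[OF p] k(1) uu by (simp add: p_def inner_diff_right inner_add_right algebra_simps)
  define t\<^sub>0 where "t\<^sub>0 = \<beta> * s + (1 - \<beta>) * g k"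
  have t0: "0 < t\<^sub>0" using \<beta> s gk by (auto simp: t\<^sub>0_def intro!: add_pos_nonneg)
  obtain r where r: "r > 0" "cball 0 r \<subseteq> K" using interior_K by (meson mem_interior_cball)
  have deep: "x + h - t\<^sub>0 *\<^sub>R u \<in> K" if "norm h \<le> \<beta> * r" for h
  proof -
    have "(1 / \<beta>) *\<^sub>R h \<in> K" using that \<beta> r by (intro subsetD[OF r(2)]) (simp add: field_simps)
    then have "(1 - \<beta>) *\<^sub>R p + \<beta> *\<^sub>R ((1 / \<beta>) *\<^sub>R h) \<in> K"
      using convex_K p \<beta> by (intro convexD) auto
    moreover have "(1 - \<beta>) *\<^sub>R p = x - t\<^sub>0 *\<^sub>R u"
    proof -
      have "(1 - \<beta>) *\<^sub>R p = (1 - \<beta>) *\<^sub>R x + \<beta> *\<^sub>R x' - ((1 - \<beta>) * g k) *\<^sub>R u"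
        using \<beta> by (simp add: p_def k_def scaleR_add_right scaleR_diff_right)
      also have "\<dots> = x - t\<^sub>0 *\<^sub>R u" by (simp add: x'_def t\<^sub>0_def algebra_simps)
      finally show ?thesis .
    qed
    moreover have "\<beta> *\<^sub>R ((1 / \<beta>) *\<^sub>R h) = h" using \<beta> by simp
    ultimately have "x - t\<^sub>0 *\<^sub>R u + h \<in> K" by (simp only:)
    then show ?thesis by (simp add: algebra_simps)
  qed
  have "\<exists>d>0. \<forall>h t. u \<bullet> h = 0 \<and> norm h \<le> d \<longrightarrow>
      (t < h \<bullet> (A *v h) / 2 - e * (norm h)\<^sup>2 \<longrightarrow> x + h - t *\<^sub>R u \<notin> K) \<and>
      (h \<bullet> (A *v h) / 2 + e * (norm h)\<^sup>2 \<le> t \<and> t \<le> t\<^sub>0 \<longrightarrow> x + h - t *\<^sub>R u \<in> K)" if e: "0 < e" for e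
  proof -
    obtain d where d: "d > 0" "\<And>h. u \<bullet> h = 0 \<and> norm h \<le> d \<Longrightarrow>
      x + h - g h *\<^sub>R u \<in> K \<and> (\<forall>t < g h. x + h - t *\<^sub>R u \<notin> K) \<and> \<bar>g h - h \<bullet> (A *v h) / 2\<bar> \<le> e * (norm h)\<^sup>2"
      using graph[OF e] by blast
    show ?thesis
    proof (intro exI[of _ "min d (\<beta> * r)"] conjI allI impI)
      show "0 < min d (\<beta> * r)" using d \<beta> r by simp
      fix h t assume h: "u \<bullet> h = 0 \<and> norm h \<le> min d (\<beta> * r)"
      then have gh: "x + h - g h *\<^sub>R u \<in> K" "\<And>t. t < g h \<Longrightarrow> x + h - t *\<^sub>R u \<notin> K"
        "\<bar>g h - h \<bullet> (A *v h) / 2\<bar> \<le> e * (norm h)\<^sup>2" using d(2)[of h] by auto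
      show "x + h - t *\<^sub>R u \<notin> K" if "t < h \<bullet> (A *v h) / 2 - e * (norm h)\<^sup>2"
        using gh(2)[of t] gh(3) that by linarith
      show "x + h - t *\<^sub>R u \<in> K" if t: "h \<bullet> (A *v h) / 2 + e * (norm h)\<^sup>2 \<le> t \<and> t \<le> t\<^sub>0"
      proof -
        have gt: "g h \<le> t" "t \<le> t\<^sub>0" using gh(3) t by linarith+
        have dp: "x + h - t\<^sub>0 *\<^sub>R u \<in> K" using deep h by simp
        show ?thesis
        proof (cases "g h = t\<^sub>0")
          case True
          then show ?thesis using gt dp by simp
        next
          case False
          then have lt: "g h < t\<^sub>0" using gt by simp
          define \<theta> where "\<theta> = (t - g h) / (t\<^sub>0 - g h)"
          have \<theta>: "0 \<le> \<theta>" "\<theta> \<le> 1" using gt lt by (auto simp: \<theta>_def divide_le_eq)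
          have "(1 - \<theta>) *\<^sub>R (x + h - g h *\<^sub>R u) + \<theta> *\<^sub>R (x + h - t\<^sub>0 *\<^sub>R u) \<in> K"
            using convex_K gh(1) dp \<theta> by (intro convexD) auto
          moreover have "(1 - \<theta>) *\<^sub>R (x + h - g h *\<^sub>R u) + \<theta> *\<^sub>R (x + h - t\<^sub>0 *\<^sub>R u)
              = x + h - (g h + \<theta> * (t\<^sub>0 - g h)) *\<^sub>R u" by (simp add: algebra_simps)
          moreover have "g h + \<theta> * (t\<^sub>0 - g h) = t" using lt by (simp add: \<theta>_def)
          ultimately show ?thesis by simp
        qed
      qed
    qed
  qed
  then show ?thesis using t0 by blast
qed

text \<open>The gauge of \<open>x + w\<close> is compared with the expected value
  \<open>\<mu>\<close>, shifted up or down by \<open>e * (norm w)\<^sup>2\<close>: dividing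
  \<open>x + w\<close> by \<open>\<mu>\<close> gives a point \<open>x + h1 - t *\<^sub>R u\<close>
  with \<open>h1\<close> tangential, and \<open>curvature_matrix_graph\<close> decides whether it
  lies in \<open>K\<close>. The vector \<open>w - (y \<bullet> w) *\<^sub>R x\<close> is the
  projection of \<open>w\<close> to the tangent hyperplane along \<open>x\<close>.\<close>

lemma gauge_expansion:
  assumes x: "x \<in> frontier K" and A: "is_curvature_matrix K x A" and e: "0 < e"
  defines "u \<equiv> outer_normal K x" defines "s \<equiv> x \<bullet> u" defines "y \<equiv> (1 / s) *\<^sub>R u"
  shows "\<exists>d>0. \<forall>w. norm w \<le> d \<longrightarrow>
    \<bar>supp J (x + w) - 1 - y \<bullet> w - (w - (y \<bullet> w) *\<^sub>R x) \<bullet> (A *v (w - (y \<bullet> w) *\<^sub>R x)) / 2 / s\<bar> \<le> e * (norm w)\<^sup>2"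
proof -
  obtain t\<^sub>0 where t0: "t\<^sub>0 > 0" "\<And>e. 0 < e \<Longrightarrow> \<exists>d>0. \<forall>h t. u \<bullet> h = 0 \<and> norm h \<le> d \<longrightarrow>
      (t < h \<bullet> (A *v h) / 2 - e * (norm h)\<^sup>2 \<longrightarrow> x + h - t *\<^sub>R u \<notin> K) \<and>
      (h \<bullet> (A *v h) / 2 + e * (norm h)\<^sup>2 \<le> t \<and> t \<le> t\<^sub>0 \<longrightarrow> x + h - t *\<^sub>R u \<in> K)"
    using curvature_matrix_graph[OF x A] unfolding u_def by blast
  have sym: "symmetric_form A" using A by (auto simp: is_curvature_matrix_def Let_def intro: symmetric_form_transpose)
  have s: "0 < s" using outer_normal_dual_rel(1)[OF x outer_normal_spec[OF x]] by (simp add: s_def u_def)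
  have un: "norm u = 1" using outer_normal_spec[OF x] by (simp add: is_outer_normal_def u_def)
  have uu: "u \<bullet> u = 1" using un by (simp add: norm_eq_1)
  have ux: "u \<bullet> x = s" by (simp add: s_def inner_commute)
  obtain a where a: "a > 0" "\<And>v. norm (A *v v) \<le> a * norm v" using matrix_norm_bound by blast
  \<comment> \<open>With \<open>n = norm w\<close>, these constants bound: \<open>H\<close> the size
    of \<open>h'\<close> over \<open>n\<close>, \<open>T\<close> that of \<open>\<tau>\<close> over
    \<open>n\<^sup>2\<close>, \<open>B\<close> that of \<open>\<mu> - 1\<close> over
    \<open>n\<close>, \<open>D\<close> that of \<open>h1 - h'\<close> over \<open>n\<^sup>2\<close>,
    and \<open>E\<close> the remaining error over \<open>n ^ 3\<close>.\<close>
  define Y where "Y = norm y"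
  define H where "H = 1 + Y * norm x"
  define T where "T = a * H\<^sup>2 + s * e"
  define B where "B = Y + T / s"
  define D where "D = 2 * (B * H + T * (1 + norm x / s))"
  define E where "E = 2 * T * B + a * D * (2 * H + D)"
  have pos: "0 \<le> Y" "1 \<le> H" "0 < T" "0 < B" "0 < D" "0 < E"
  proof -
    show "0 \<le> Y" "1 \<le> H" by (auto simp: Y_def H_def)
    then show "0 < T" unfolding T_def using a(1) s e by (intro add_pos_pos) auto
    then show "0 < B" unfolding B_def using \<open>0 \<le> Y\<close> s by (intro add_nonneg_pos) auto
    moreover have "0 < 1 + norm x / s" using s by (intro add_pos_nonneg) auto
    ultimately have "0 < B * H" "0 < T * (1 + norm x / s)" using \<open>0 < T\<close> \<open>1 \<le> H\<close> by (auto intro: mult_pos_pos)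
    then show "0 < D" unfolding D_def by simp
    then show "0 < E" unfolding E_def using \<open>0 < T\<close> \<open>0 < B\<close> \<open>1 \<le> H\<close> a(1) by (intro add_pos_pos mult_pos_pos) auto
  qed
  \<comment> \<open>The graph error \<open>e1 * (norm h1)\<^sup>2\<close> then uses half of the
    margin \<open>s * e * n\<^sup>2\<close>; the choice of \<open>d\<close> leaves at most a quarter
    to the cubic error.\<close>
  define e1 where "e1 = s * e / (2 * (H + D)\<^sup>2)"
  have HD: "0 < H + D" using pos by linarith
  have e1: "0 < e1" using s e HD by (simp add: e1_def)
  obtain d1 where d1: "d1 > 0" "\<And>h t. u \<bullet> h = 0 \<Longrightarrow> norm h \<le> d1 \<Longrightarrow>
      (t < h \<bullet> (A *v h) / 2 - e1 * (norm h)\<^sup>2 \<longrightarrow> x + h - t *\<^sub>R u \<notin> K) \<and>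
      (h \<bullet> (A *v h) / 2 + e1 * (norm h)\<^sup>2 \<le> t \<and> t \<le> t\<^sub>0 \<longrightarrow> x + h - t *\<^sub>R u \<in> K)"
    using t0(2)[OF e1] by blast
  define d where "d = Min {1, 1 / (2 * B), d1 / (H + D), t\<^sub>0 / (2 * T), s * e / (4 * E)}"
  have d: "0 < d" "d \<le> 1" "d \<le> 1 / (2 * B)" "d \<le> d1 / (H + D)" "d \<le> t\<^sub>0 / (2 * T)" "d \<le> s * e / (4 * E)"
    unfolding d_def using pos d1(1) HD t0(1) s e by simp_all
  have main: "supp J (x + w) \<le> 1 + y \<bullet> w + (h' \<bullet> (A *v h') / 2 / s + e * (norm w)\<^sup>2) \<and>
      1 + y \<bullet> w + (h' \<bullet> (A *v h') / 2 / s - e * (norm w)\<^sup>2) \<le> supp J (x + w)"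
    if w: "norm w \<le> d" "w \<noteq> 0" and h': "h' = w - (y \<bullet> w) *\<^sub>R x" for w h'
  proof -
    let ?n = "norm w" and ?q = "\<lambda>h. h \<bullet> (A *v h) / 2"
    have n: "0 < ?n" "?n \<le> 1" using w d by auto
    have n2: "?n\<^sup>2 \<le> ?n" using n by (simp add: power2_eq_square mult_left_le)
    have uh': "u \<bullet> h' = 0" unfolding h' using s by (simp add: inner_diff_right ux y_def)
    have yw: "\<bar>y \<bullet> w\<bar> \<le> Y * ?n" unfolding Y_def by (rule Cauchy_Schwarz_ineq2)
    have nh': "norm h' \<le> H * ?n"
    proof -
      have "norm h' \<le> ?n + \<bar>y \<bullet> w\<bar> * norm x" unfolding h' using norm_triangle_ineq4[of w "(y \<bullet> w) *\<^sub>R x"] by simp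
      also have "\<dots> \<le> ?n + (Y * ?n) * norm x" using yw by (intro add_left_mono mult_right_mono) auto
      finally show ?thesis by (simp add: H_def algebra_simps)
    qed
    have qh': "\<bar>?q h'\<bar> \<le> a * H\<^sup>2 * ?n\<^sup>2"
    proof -
      have "\<bar>h' \<bullet> (A *v h')\<bar> \<le> a * (norm h')\<^sup>2" by (rule quadratic_bound[OF a(2)])
      also have "\<dots> \<le> a * (H * ?n)\<^sup>2" using nh' a(1) by (intro mult_left_mono power_mono) auto
      finally show ?thesis using a(1) by (simp add: power_mult_distrib)
    qed
    \<comment> \<open>With \<open>\<sigma> = 1\<close> the rescaled point falls inside
      \<open>K\<close>, with \<open>\<sigma> = -1\<close> outside; these are the upper and the lower
      estimate.\<close>
    have step: "\<exists>\<mu> h1 t. \<mu> = 1 + y \<bullet> w + (?q h' / s + \<sigma> * (e * ?n\<^sup>2)) \<and> 0 < \<mu> \<and> (1 / \<mu>) *\<^sub>R (x + w) = x + h1 - t *\<^sub>R u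
        \<and> u \<bullet> h1 = 0 \<and> norm h1 \<le> (H + D) * ?n \<and> \<bar>t\<bar> \<le> 2 * T * ?n\<^sup>2 \<and> \<bar>t - ?q h1 - \<sigma> * (s * e * ?n\<^sup>2)\<bar> \<le> E * ?n ^ 3"
      if \<sigma>: "\<bar>\<sigma>\<bar> = 1" for \<sigma>
    proof -
      define \<tau> where "\<tau> = ?q h' + \<sigma> * (s * e * ?n\<^sup>2)"
      define \<mu> where "\<mu> = 1 + y \<bullet> w + \<tau> / s"
      define t where "t = \<tau> / \<mu>"
      define h1 where "h1 = (1 / \<mu>) *\<^sub>R (x + w) - x + t *\<^sub>R u"
      have \<tau>: "\<bar>\<tau>\<bar> \<le> T * ?n\<^sup>2"
      proof -
        have "\<bar>\<tau>\<bar> \<le> \<bar>?q h'\<bar> + \<bar>\<sigma>\<bar> * \<bar>s * e * ?n\<^sup>2\<bar>"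
          unfolding \<tau>_def by (metis abs_mult abs_triangle_ineq)
        also have "\<dots> \<le> a * H\<^sup>2 * ?n\<^sup>2 + s * e * ?n\<^sup>2" using qh' \<sigma> s e by simp
        finally show ?thesis by (simp add: T_def distrib_right)
      qed
      have l1: "\<bar>\<mu> - 1\<bar> \<le> B * ?n"
      proof -
        have "\<bar>\<mu> - 1\<bar> \<le> \<bar>y \<bullet> w\<bar> + \<bar>\<tau>\<bar> / s" unfolding \<mu>_def using s abs_triangle_ineq[of "y \<bullet> w" "\<tau> / s"] by (simp add: abs_divide)
        also have "\<dots> \<le> Y * ?n + T * ?n\<^sup>2 / s" using yw \<tau> s by (intro add_mono divide_right_mono) auto
        also have "\<dots> \<le> Y * ?n + T * ?n / s" using n2 pos s by (intro add_left_mono divide_right_mono mult_left_mono) auto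
        finally show ?thesis by (simp add: B_def algebra_simps)
      qed
      have "B * ?n \<le> B * (1 / (2 * B))" using w d pos by (intro mult_left_mono) auto
      then have l2: "1 / 2 \<le> \<mu>" using l1 pos by simp
      then have l3: "1 / \<mu> \<le> 2" by (simp add: divide_le_eq)
      have l0: "0 < \<mu>" using l2 by simp
      have uh1: "u \<bullet> h1 = 0"
      proof -
        have uw: "u \<bullet> w = s * (y \<bullet> w)" using s by (simp add: y_def)
        have "\<mu> * (u \<bullet> h1) = s + u \<bullet> w - \<mu> * s + \<tau>"
          using l0 by (simp add: h1_def inner_add_right inner_diff_right ux uu t_def algebra_simps)
        also have "\<dots> = 0" unfolding uw \<mu>_def using s by (simp add: algebra_simps)
        finally show ?thesis using l0 by simp
      qed
      have eq: "h1 - h' = (1 / \<mu>) *\<^sub>R ((1 - \<mu>) *\<^sub>R h' + \<tau> *\<^sub>R (u - (1 / s) *\<^sub>R x))"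
      proof -
        have "\<mu> *\<^sub>R (h1 - h') = (x + w) - \<mu> *\<^sub>R x + \<tau> *\<^sub>R u - \<mu> *\<^sub>R h'"
          using l0 by (simp add: h1_def t_def scaleR_add_right scaleR_diff_right)
        also have "\<mu> *\<^sub>R x = x + (y \<bullet> w) *\<^sub>R x + (\<tau> / s) *\<^sub>R x" by (simp add: \<mu>_def scaleR_add_left)
        also have "(x + w) - (x + (y \<bullet> w) *\<^sub>R x + (\<tau> / s) *\<^sub>R x) + \<tau> *\<^sub>R u - \<mu> *\<^sub>R h'
            = (1 - \<mu>) *\<^sub>R h' + \<tau> *\<^sub>R (u - (1 / s) *\<^sub>R x)"
          by (simp add: h' algebra_simps)
        finally have "(1 / \<mu>) *\<^sub>R (\<mu> *\<^sub>R (h1 - h')) = (1 / \<mu>) *\<^sub>R ((1 - \<mu>) *\<^sub>R h' + \<tau> *\<^sub>R (u - (1 / s) *\<^sub>R x))" by simp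
        then show ?thesis using l0 by simp
      qed
      have dh: "norm (h1 - h') \<le> D * ?n\<^sup>2"
      proof -
        have "norm (h1 - h') = (1 / \<mu>) * norm ((1 - \<mu>) *\<^sub>R h' + \<tau> *\<^sub>R (u - (1 / s) *\<^sub>R x))"
          unfolding eq using l0 by simp
        also have "\<dots> \<le> 2 * (\<bar>\<mu> - 1\<bar> * norm h' + \<bar>\<tau>\<bar> * (1 + norm x / s))"
        proof (intro mult_mono l3)
          have "norm ((1 - \<mu>) *\<^sub>R h' + \<tau> *\<^sub>R (u - (1 / s) *\<^sub>R x)) \<le> \<bar>1 - \<mu>\<bar> * norm h' + \<bar>\<tau>\<bar> * norm (u - (1 / s) *\<^sub>R x)"
            using norm_triangle_ineq[of "(1 - \<mu>) *\<^sub>R h'" "\<tau> *\<^sub>R (u - (1 / s) *\<^sub>R x)"] by simp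
          also have "norm (u - (1 / s) *\<^sub>R x) \<le> 1 + norm x / s"
            using norm_triangle_ineq4[of u "(1 / s) *\<^sub>R x"] un s by simp
          finally show "norm ((1 - \<mu>) *\<^sub>R h' + \<tau> *\<^sub>R (u - (1 / s) *\<^sub>R x)) \<le> \<bar>\<mu> - 1\<bar> * norm h' + \<bar>\<tau>\<bar> * (1 + norm x / s)"
            by (simp add: abs_minus_commute mult_left_mono)
        qed auto
        also have "\<dots> \<le> 2 * ((B * ?n) * (H * ?n) + (T * ?n\<^sup>2) * (1 + norm x / s))"
          using l1 nh' \<tau> pos s n by (intro mult_left_mono add_mono mult_mono) auto
        also have "\<dots> = D * ?n\<^sup>2" by (simp add: D_def power2_eq_square algebra_simps)
        finally show ?thesis .
      qed
      have "D * ?n\<^sup>2 \<le> D * ?n" using n2 pos by (intro mult_left_mono) auto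
      then have dh': "norm (h1 - h') \<le> D * ?n" using dh by simp
      have nh1: "norm h1 \<le> (H + D) * ?n"
        using norm_triangle_ineq[of h' "h1 - h'"] nh' dh' by (simp add: distrib_right)
      have dq: "\<bar>?q h1 - ?q h'\<bar> \<le> a * D * (2 * H + D) * ?n ^ 3"
      proof -
        have "\<bar>h1 \<bullet> (A *v h1) - h' \<bullet> (A *v h')\<bar> \<le> a * norm (h1 - h') * norm (h1 + h')"
          by (rule quadratic_difference[OF sym a(2)])
        also have "\<dots> \<le> a * (D * ?n\<^sup>2) * ((2 * H + D) * ?n)"
        proof (intro mult_mono)
          show "norm (h1 + h') \<le> (2 * H + D) * ?n"
            using norm_triangle_ineq[of h1 h'] nh1 nh' by (simp add: algebra_simps)
        qed (use dh a(1) pos in auto)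
        finally have "\<bar>h1 \<bullet> (A *v h1) - h' \<bullet> (A *v h')\<bar> \<le> a * D * (2 * H + D) * ?n ^ 3"
          by (simp add: power3_eq_cube power2_eq_square mult_ac)
        then show ?thesis by linarith
      qed
      have tb: "\<bar>t\<bar> \<le> 2 * T * ?n\<^sup>2"
      proof -
        have "\<bar>t\<bar> = (1 / \<mu>) * \<bar>\<tau>\<bar>" using l0 by (simp add: t_def)
        also have "\<dots> \<le> 2 * (T * ?n\<^sup>2)" using l3 \<tau> by (intro mult_mono) auto
        finally show ?thesis by simp
      qed
      have dt: "\<bar>t - \<tau>\<bar> \<le> 2 * T * B * ?n ^ 3"
      proof -
        have "t - \<tau> = t * (1 - \<mu>)" using l0 by (simp add: t_def field_simps)
        then have "\<bar>t - \<tau>\<bar> = \<bar>t\<bar> * \<bar>\<mu> - 1\<bar>" by (simp add: abs_mult abs_minus_commute)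
        also have "\<dots> \<le> (2 * T * ?n\<^sup>2) * (B * ?n)" using tb l1 pos by (intro mult_mono) auto
        finally show ?thesis by (simp add: power3_eq_cube power2_eq_square mult_ac)
      qed
      have "\<bar>t - ?q h1 - \<sigma> * (s * e * ?n\<^sup>2)\<bar> \<le> E * ?n ^ 3"
      proof -
        have "t - ?q h1 - \<sigma> * (s * e * ?n\<^sup>2) = (t - \<tau>) - (?q h1 - ?q h')" by (simp add: \<tau>_def)
        also have "\<bar>\<dots>\<bar> \<le> 2 * T * B * ?n ^ 3 + a * D * (2 * H + D) * ?n ^ 3"
          using dt dq by linarith
        finally show ?thesis by (simp add: E_def distrib_right)
      qed
      moreover have "(1 / \<mu>) *\<^sub>R (x + w) = x + h1 - t *\<^sub>R u" by (simp add: h1_def)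
      moreover have "\<mu> = 1 + y \<bullet> w + (?q h' / s + \<sigma> * (e * ?n\<^sup>2))"
        using s by (simp add: \<mu>_def \<tau>_def add_divide_distrib)
      ultimately show ?thesis using l0 uh1 nh1 tb by blast
    qed
    have E3: "E * ?n ^ 3 \<le> (s * e * ?n\<^sup>2) / 4"
    proof -
      have "E * ?n \<le> E * (s * e / (4 * E))" using w d pos by (intro mult_left_mono) auto
      then have "E * ?n \<le> s * e / 4" using pos by simp
      then have "(E * ?n) * ?n\<^sup>2 \<le> s * e / 4 * ?n\<^sup>2" by (rule mult_right_mono) simp
      then show ?thesis by (simp add: power3_eq_cube power2_eq_square mult_ac)
    qed
    have small: "norm h1 \<le> d1" "e1 * (norm h1)\<^sup>2 \<le> (s * e * ?n\<^sup>2) / 2" if "norm h1 \<le> (H + D) * ?n" for h1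
    proof -
      have "(H + D) * ?n \<le> (H + D) * (d1 / (H + D))" using w d HD by (intro mult_left_mono) auto
      then show "norm h1 \<le> d1" using that HD by simp
      have "e1 * (norm h1)\<^sup>2 \<le> e1 * ((H + D) * ?n)\<^sup>2" using that e1 by (intro mult_left_mono power_mono) auto
      also have "\<dots> = (s * e * ?n\<^sup>2) / 2" using HD by (simp add: e1_def power_mult_distrib)
      finally show "e1 * (norm h1)\<^sup>2 \<le> (s * e * ?n\<^sup>2) / 2" .
    qed
    have sn: "0 < s * e * ?n\<^sup>2" using s e n by simp
    have up: "supp J (x + w) \<le> 1 + y \<bullet> w + (?q h' / s + e * ?n\<^sup>2)"
    proof -
      obtain \<mu> h1 t where st: "\<mu> = 1 + y \<bullet> w + (?q h' / s + 1 * (e * ?n\<^sup>2))" "0 < \<mu>" "(1 / \<mu>) *\<^sub>R (x + w) = x + h1 - t *\<^sub>R u"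
        "u \<bullet> h1 = 0" "norm h1 \<le> (H + D) * ?n" "\<bar>t\<bar> \<le> 2 * T * ?n\<^sup>2" "\<bar>t - ?q h1 - 1 * (s * e * ?n\<^sup>2)\<bar> \<le> E * ?n ^ 3"
        using step[of 1] by auto
      have "2 * T * ?n\<^sup>2 \<le> 2 * T * (t\<^sub>0 / (2 * T))" using n2 w d pos by (intro mult_left_mono) auto
      then have tt: "t \<le> t\<^sub>0" using st(6) pos by simp
      have "?q h1 + e1 * (norm h1)\<^sup>2 \<le> t" using st(7) E3 small(2)[OF st(5)] sn by linarith
      then have "x + h1 - t *\<^sub>R u \<in> K" using d1(2)[OF st(4) small(1)[OF st(5)]] tt by blast
      then have "supp J ((1 / \<mu>) *\<^sub>R (x + w)) \<le> 1" unfolding st(3) by (simp add: mem_K_iff)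
      then have "supp J (x + w) \<le> \<mu>" using st(2) by (simp add: supp_scale pos_divide_le_eq)
      then show ?thesis using st(1) by simp
    qed
    have "1 + y \<bullet> w + (?q h' / s - e * ?n\<^sup>2) \<le> supp J (x + w)"
    proof -
      obtain \<mu> h1 t where st: "\<mu> = 1 + y \<bullet> w + (?q h' / s + (-1) * (e * ?n\<^sup>2))" "0 < \<mu>" "(1 / \<mu>) *\<^sub>R (x + w) = x + h1 - t *\<^sub>R u"
        "u \<bullet> h1 = 0" "norm h1 \<le> (H + D) * ?n" "\<bar>t\<bar> \<le> 2 * T * ?n\<^sup>2" "\<bar>t - ?q h1 - (-1) * (s * e * ?n\<^sup>2)\<bar> \<le> E * ?n ^ 3"
        using step[of "-1"] by auto
      have "t < ?q h1 - e1 * (norm h1)\<^sup>2" using st(7) E3 small(2)[OF st(5)] sn by linarith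
      then have "x + h1 - t *\<^sub>R u \<notin> K" using d1(2)[OF st(4) small(1)[OF st(5)]] by blast
      then have "1 < supp J ((1 / \<mu>) *\<^sub>R (x + w))" unfolding st(3) by (simp add: mem_K_iff)
      then have "\<mu> < supp J (x + w)" using st(2) by (simp add: supp_scale pos_less_divide_eq)
      then show ?thesis using st(1) by simp
    qed
    with up show ?thesis by simp
  qed
  have x1: "supp J x = 1" using x by (simp add: frontier_K_iff)
  have "\<bar>supp J (x + w) - 1 - y \<bullet> w - (w - (y \<bullet> w) *\<^sub>R x) \<bullet> (A *v (w - (y \<bullet> w) *\<^sub>R x)) / 2 / s\<bar> \<le> e * (norm w)\<^sup>2"
    if "norm w \<le> d" for w
  proof (cases "w = 0")
    case False
    from main[OF that False refl] show ?thesis by (simp add: abs_le_iff)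
  qed (simp add: x1)
  then show ?thesis using d(1) by blast
qed

end

section \<open>Uniqueness and positivity of second-order expansions, and their relation to
  curvature\<close>

lemma symmetric_form_eqI:
  fixes M M' :: "real^'n^'n"
  assumes M: "symmetric_form M" and M': "symmetric_form M'"
    and eq: "\<And>w. w \<bullet> (M *v w) = w \<bullet> (M' *v w)"
  shows "M = M'"
proof -
  have "v \<bullet> (M *v w) = v \<bullet> (M' *v w)" for v w
  proof -
    have pol: "v \<bullet> (N *v w) = ((v + w) \<bullet> (N *v (v + w)) - v \<bullet> (N *v v) - w \<bullet> (N *v w)) / 2"
      if "symmetric_form N" for N :: "real^'n^'n"
    proof -
      have "w \<bullet> (N *v v) = v \<bullet> (N *v w)" using that by (simp add: symmetric_form_def inner_commute)
      then show ?thesis by (simp add: matrix_vector_right_distrib inner_add_left inner_add_right)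
    qed
    show ?thesis unfolding pol[OF M] pol[OF M'] by (simp only: eq)
  qed
  then have "M *v w = M' *v w" for w by (rule vector_eq_ldot[THEN iffD1, rule_format])
  then show ?thesis by (simp add: matrix_eq)
qed

lemma second_order_scaled:
  assumes "second_order \<phi> x y M" and e: "0 < e"
  shows "\<exists>d>0. \<forall>t. 0 < t \<and> t \<le> d \<longrightarrow> \<bar>\<phi> (x + t *\<^sub>R w) - \<phi> x - t * (y \<bullet> w) - t\<^sup>2 * (w \<bullet> (M *v w)) / 2\<bar> \<le> e * t\<^sup>2"
proof -
  define n where "n = norm w + 1"
  have n: "0 < n" "norm w \<le> n" by (auto simp: n_def add_nonneg_pos)
  have "0 < e / n\<^sup>2" using e n by simp
  then obtain d where d: "d > 0" "\<And>v. norm v \<le> d \<Longrightarrow>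
      \<bar>\<phi> (x + v) - \<phi> x - y \<bullet> v - v \<bullet> (M *v v) / 2\<bar> \<le> (e / n\<^sup>2) * (norm v)\<^sup>2"
    using assms(1) unfolding second_order_def by blast
  show ?thesis
  proof (intro exI[of _ "d / n"] conjI allI impI)
    show "0 < d / n" using d n by simp
    fix t assume t: "0 < t \<and> t \<le> d / n"
    have "norm (t *\<^sub>R w) \<le> t * n" using t n by simp
    also have "\<dots> \<le> d" using t n by (simp add: pos_le_divide_eq)
    finally have "\<bar>\<phi> (x + t *\<^sub>R w) - \<phi> x - y \<bullet> (t *\<^sub>R w) - (t *\<^sub>R w) \<bullet> (M *v (t *\<^sub>R w)) / 2\<bar> \<le> (e / n\<^sup>2) * (norm (t *\<^sub>R w))\<^sup>2"
      by (rule d(2))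
    also have "\<dots> \<le> (e / n\<^sup>2) * (t * n)\<^sup>2" using t n e by (intro mult_left_mono power_mono) auto
    also have "\<dots> = e * t\<^sup>2" using n by (simp add: power_mult_distrib)
    finally show "\<bar>\<phi> (x + t *\<^sub>R w) - \<phi> x - t * (y \<bullet> w) - t\<^sup>2 * (w \<bullet> (M *v w)) / 2\<bar> \<le> e * t\<^sup>2"
      by (simp add: matrix_vector_mult_scaleR power2_eq_square mult_ac)
  qed
qed

lemma second_order_unique:
  assumes M: "symmetric_form M" "second_order \<phi> x y M" and M': "symmetric_form M'" "second_order \<phi> x y M'"
  shows "M = M'"
proof (rule symmetric_form_eqI[OF M(1) M'(1)])
  fix w
  have "\<bar>w \<bullet> (M *v w) - w \<bullet> (M' *v w)\<bar> \<le> 4 * e" if e: "0 < e" for e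
  proof -
    obtain d where d: "d > 0" "\<And>t. 0 < t \<Longrightarrow> t \<le> d \<Longrightarrow> \<bar>\<phi> (x + t *\<^sub>R w) - \<phi> x - t * (y \<bullet> w) - t\<^sup>2 * (w \<bullet> (M *v w)) / 2\<bar> \<le> e * t\<^sup>2"
      using second_order_scaled[OF M(2) e] by blast
    obtain d' where d': "d' > 0" "\<And>t. 0 < t \<Longrightarrow> t \<le> d' \<Longrightarrow> \<bar>\<phi> (x + t *\<^sub>R w) - \<phi> x - t * (y \<bullet> w) - t\<^sup>2 * (w \<bullet> (M' *v w)) / 2\<bar> \<le> e * t\<^sup>2"
      using second_order_scaled[OF M'(2) e] by blast
    let ?t = "min d d'"
    have t: "0 < ?t" using d(1) d'(1) by simp
    have "\<bar>?t\<^sup>2 * (w \<bullet> (M *v w)) / 2 - ?t\<^sup>2 * (w \<bullet> (M' *v w)) / 2\<bar> \<le> 2 * (e * ?t\<^sup>2)"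
      using d(2)[of ?t] d'(2)[of ?t] t by linarith
    also have "?t\<^sup>2 * (w \<bullet> (M *v w)) / 2 - ?t\<^sup>2 * (w \<bullet> (M' *v w)) / 2 = ?t\<^sup>2 * ((w \<bullet> (M *v w) - w \<bullet> (M' *v w)) / 2)"
      by (simp add: algebra_simps)
    finally have "?t\<^sup>2 * \<bar>(w \<bullet> (M *v w) - w \<bullet> (M' *v w)) / 2\<bar> \<le> ?t\<^sup>2 * (2 * e)"
      by (simp add: abs_mult mult_ac)
    then have "\<bar>(w \<bullet> (M *v w) - w \<bullet> (M' *v w)) / 2\<bar> \<le> 2 * e" using t by simp
    then show ?thesis by (simp add: abs_divide)
  qed
  from this[of "e / 4" for e] have "\<bar>w \<bullet> (M *v w) - w \<bullet> (M' *v w)\<bar> \<le> 0 + e" if "0 < e" for e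
    using that by simp
  then have "\<bar>w \<bullet> (M *v w) - w \<bullet> (M' *v w)\<bar> \<le> 0" by (rule field_le_epsilon)
  then show "w \<bullet> (M *v w) = w \<bullet> (M' *v w)" by simp
qed

lemma matrix_scaled_identity: "matrix ((*\<^sub>R) c) *v w = c *\<^sub>R (w :: real^'n)"
proof -
  have "linear ((*\<^sub>R) c :: real^'n \<Rightarrow> real^'n)" by (intro linearI) (auto simp: scaleR_add_right)
  then show ?thesis by (simp add: matrix_works)
qed

lemma positive_definite_det_nonzero:
  fixes M :: "real^'n^'n"
  assumes "\<And>w. w \<noteq> 0 \<Longrightarrow> 0 < w \<bullet> (M *v w)"
  shows "det M \<noteq> 0"
proof
  assume "det M = 0"
  then have "\<not> invertible M" by (simp add: invertible_det_nz)
  then obtain w where w: "w \<noteq> 0" "M *v w = 0"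
    unfolding invertible_left_inverse matrix_left_invertible_ker by blast
  then show False using assms[of w] by simp
qed

text \<open>On the segment from \<open>M\<close> to the identity every matrix but possibly
  \<open>M\<close> is positive definite, so the determinant has no zero on the way from the value 1
  and cannot end up negative.\<close>

lemma det_nonneg_of_psd:
  fixes M :: "real^'n^'n"
  assumes psd: "\<And>w. 0 \<le> w \<bullet> (M *v w)"
  shows "0 \<le> det M"
proof -
  define P where "P t = (1 - t) *\<^sub>R M + t *\<^sub>R mat 1" for t :: real
  have Pw: "P t *v w = (1 - t) *\<^sub>R (M *v w) + t *\<^sub>R w" for t w
    by (simp add: P_def matrix_vector_mult_add_rdistrib scaleR_matrix_vector_assoc[symmetric])
  have nz: "det (P t) \<noteq> 0" if "0 < t" "t \<le> 1" for t
  proof (rule positive_definite_det_nonzero)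
    fix w :: "real^'n" assume "w \<noteq> 0"
    have "0 < t * (w \<bullet> w)" using that \<open>w \<noteq> 0\<close> by simp
    moreover have "0 \<le> (1 - t) * (w \<bullet> (M *v w))" using that psd by simp
    ultimately show "0 < w \<bullet> (P t *v w)" by (simp add: Pw inner_add_right)
  qed
  have cont: "continuous_on {0..1} (\<lambda>t. det (P t))"
    unfolding det_def P_def by (intro continuous_intros)
  show ?thesis
  proof (rule ccontr)
    assume "\<not> 0 \<le> det M"
    then have "det (P 0) \<le> 0" by (simp add: P_def)
    moreover have "0 \<le> det (P 1)" by (simp add: P_def)
    ultimately obtain t where t: "0 \<le> t" "t \<le> 1" "det (P t) = 0"
      using IVT'[of "\<lambda>t. det (P t)" 0 0 1] cont by auto
    then have "t = 0" using nz[of t] by linarith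
    then show False using t(3) \<open>\<not> 0 \<le> det M\<close> by (simp add: P_def)
  qed
qed

text \<open>If a semidefinite symmetric form vanishes at \<open>w\<close>, then \<open>w\<close>
  minimises it and lies in the kernel; nonzero determinant excludes this. Compactness of the sphere
  makes positivity uniform.\<close>

lemma positive_definite_bound:
  fixes M :: "real^'n^'n"
  assumes sym: "symmetric_form M" and psd: "\<And>w. 0 \<le> w \<bullet> (M *v w)" and det: "det M \<noteq> 0"
  shows "\<exists>c>0. \<forall>w. c * (norm w)\<^sup>2 \<le> w \<bullet> (M *v w)"
proof -
  have pd: "0 < w \<bullet> (M *v w)" if w: "w \<noteq> 0" for w
  proof (rule ccontr)
    assume "\<not> ?thesis"
    then have w0: "w \<bullet> (M *v w) = 0" using psd[of w] by simp
    let ?v = "M *v w"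
    have "M *v w \<noteq> 0"
    proof
      assume "M *v w = 0"
      moreover have "invertible M" using det by (simp add: invertible_det_nz)
      ultimately show False using w unfolding invertible_left_inverse matrix_left_invertible_ker by blast
    qed
    then have vv: "0 < ?v \<bullet> ?v" by simp
    have wv: "w \<bullet> (M *v ?v) = ?v \<bullet> ?v" using sym by (simp add: symmetric_form_def)
    define b where "b = ?v \<bullet> (M *v ?v)"
    have b0: "0 \<le> b" unfolding b_def by (rule psd)
    \<comment> \<open>A step in direction \<open>- (M *v w)\<close> small enough that the quadratic
      term stays below the linear decrease.\<close>
    define t where "t = (?v \<bullet> ?v) / (b + 1)"
    have t: "0 < t" using vv b0 by (simp add: t_def)
    have "0 \<le> (w - t *\<^sub>R ?v) \<bullet> (M *v (w - t *\<^sub>R ?v))" by (rule psd)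
    also have "\<dots> = t * (t * b - 2 * (?v \<bullet> ?v))"
      using w0 wv by (simp add: matrix_vector_mult_diff_distrib matrix_vector_mult_scaleR inner_diff_left inner_diff_right b_def algebra_simps)
    finally have "0 \<le> t * b - 2 * (?v \<bullet> ?v)" using t by (simp add: zero_le_mult_iff)
    moreover have "t * b \<le> ?v \<bullet> ?v"
    proof -
      have "t * b \<le> t * (b + 1)" using t by simp
      also have "\<dots> = ?v \<bullet> ?v" using b0 by (simp add: t_def)
      finally show ?thesis .
    qed
    ultimately show False using vv by linarith
  qed
  have c: "compact (sphere (0 :: real^'n) 1)" by (rule compact_sphere)
  have "axis undefined 1 \<in> sphere (0 :: real^'n) 1" by simp
  then have ne: "sphere (0 :: real^'n) 1 \<noteq> {}" by blast
  have "continuous_on (sphere 0 1) (\<lambda>w. w \<bullet> (M *v w))"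
    by (intro continuous_on_inner continuous_on_id matrix_vector_mult_linear_continuous_on)
  from continuous_attains_inf[OF c ne this]
  obtain w0 where w0: "w0 \<in> sphere 0 1" "\<And>w. w \<in> sphere 0 1 \<Longrightarrow> w0 \<bullet> (M *v w0) \<le> w \<bullet> (M *v w)" by blast
  let ?c = "w0 \<bullet> (M *v w0)"
  have "0 < ?c" using w0(1) by (intro pd) auto
  moreover have "?c * (norm w)\<^sup>2 \<le> w \<bullet> (M *v w)" for w
  proof (cases "w = 0")
    case False
    have "?c \<le> ((1 / norm w) *\<^sub>R w) \<bullet> (M *v ((1 / norm w) *\<^sub>R w))" using False by (intro w0(2)) simp
    also have "\<dots> = (w \<bullet> (M *v w)) / (norm w)\<^sup>2" by (simp add: matrix_vector_mult_scaleR power2_eq_square)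
    finally show ?thesis using False by (simp add: pos_le_divide_eq)
  qed simp
  ultimately show ?thesis by blast
qed

context polar_pair
begin

definition energy :: "real^'n \<Rightarrow> real" where
  "energy x = (supp J x)\<^sup>2 / 2"

lemma energy_subgradient: "dual_rel K J x y \<Longrightarrow> energy x + y \<bullet> w \<le> energy (x + w)"
  using dual_rel_subgradient[of x y "x + w"] by (simp add: energy_def)

text \<open>Along \<open>y' - y\<close> the subgradient \<open>y'\<close> would force a linear
  excess over an expansion whose error is quadratic. Hence a point with an expansion has a single
  partner.\<close>

lemma second_order_gradient_unique:
  assumes M: "second_order energy x y M" and y': "dual_rel K J x y'"
  shows "y' = y"
proof (rule ccontr)
  assume ne: "y' \<noteq> y"
  let ?w = "y' - y"
  let ?b = "?w \<bullet> (M *v ?w)"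
  obtain d where d: "d > 0" "\<And>t. 0 < t \<Longrightarrow> t \<le> d \<Longrightarrow>
     \<bar>energy (x + t *\<^sub>R ?w) - energy x - t * (y \<bullet> ?w) - t\<^sup>2 * ?b / 2\<bar> \<le> 1 * t\<^sup>2"
    using second_order_scaled[OF M zero_less_one] by blast
  have ww: "0 < ?w \<bullet> ?w" using ne by simp
  define c where "c = \<bar>?b\<bar> + 1"
  define t where "t = min d ((?w \<bullet> ?w) / (2 * c))"
  have p: "0 < c" by (simp add: c_def add_nonneg_pos)
  have t: "0 < t" "t \<le> d" using d(1) ww p by (auto simp: t_def)
  have "energy x + y' \<bullet> (t *\<^sub>R ?w) \<le> energy (x + t *\<^sub>R ?w)" by (rule energy_subgradient[OF y'])
  then have "t * (y' \<bullet> ?w) \<le> t * (y \<bullet> ?w) + t\<^sup>2 * ?b / 2 + t\<^sup>2" using d(2)[OF t] by simp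
  then have "t * (?w \<bullet> ?w) \<le> t * (t * (?b / 2 + 1))"
    by (simp add: inner_diff_left power2_eq_square algebra_simps)
  then have "?w \<bullet> ?w \<le> t * (?b / 2 + 1)" using t by simp
  also have "\<dots> \<le> t * c" using t by (intro mult_left_mono) (auto simp: c_def)
  also have "\<dots> \<le> (?w \<bullet> ?w) / (2 * c) * c" using p by (intro mult_right_mono) (auto simp: t_def)
  also have "\<dots> = (?w \<bullet> ?w) / 2" using p by simp
  finally show False using ww by simp
qed

lemma second_order_psd:
  assumes M: "second_order energy x y M" and y: "dual_rel K J x y"
  shows "0 \<le> w \<bullet> (M *v w)"
proof -
  have "- (w \<bullet> (M *v w)) \<le> 0 + e" if e: "0 < e" for e
  proof -
    obtain d where d: "d > 0" "\<And>t. 0 < t \<Longrightarrow> t \<le> d \<Longrightarrow>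
       \<bar>energy (x + t *\<^sub>R w) - energy x - t * (y \<bullet> w) - t\<^sup>2 * (w \<bullet> (M *v w)) / 2\<bar> \<le> (e / 2) * t\<^sup>2"
      using second_order_scaled[OF M half_gt_zero[OF e]] by blast
    have "energy x + d * (y \<bullet> w) \<le> energy (x + d *\<^sub>R w)"
      using energy_subgradient[OF y, of "d *\<^sub>R w"] by simp
    then have "0 \<le> d\<^sup>2 * (w \<bullet> (M *v w)) / 2 + (e / 2) * d\<^sup>2"
      using abs_le_D1[OF d(2)[OF d(1) order_refl]] by linarith
    then have "0 \<le> d\<^sup>2 * (w \<bullet> (M *v w) + e)" by (simp add: algebra_simps)
    then show ?thesis using d(1) by (simp add: zero_le_mult_iff)
  qed
  then have "- (w \<bullet> (M *v w)) \<le> 0" by (rule field_le_epsilon)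
  then show ?thesis by simp
qed

text \<open>Squaring the gauge expansion adds the square of its linear part, so the Hessian of
  \<open>energy\<close> is the form \<open>A / s\<close> on the tangential part of \<open>w\<close>
  plus \<open>(y \<bullet> w)\<^sup>2\<close>. As this is a congruence of \<open>A\<close> by
  \<open>N\<close> followed by scaling with \<open>1 / s\<close>, its determinant is
  explicit.\<close>

lemma curvature_matrix_second_order:
  assumes x: "x \<in> frontier K" and A: "is_curvature_matrix K x A"
  defines "u \<equiv> outer_normal K x" defines "s \<equiv> x \<bullet> u" defines "y \<equiv> (1 / s) *\<^sub>R u"
  shows "\<exists>M. symmetric_form M \<and> second_order energy x y M \<and> det M = det A / s ^ (CARD('n) + 1) \<and>
    (\<forall>h. u \<bullet> h = 0 \<longrightarrow> h \<bullet> (M *v h) = h \<bullet> (A *v h) / s)"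
proof -
  have sym: "symmetric_form A" and Au: "A *v u = u"
    using A by (auto simp: is_curvature_matrix_def Let_def u_def intro: symmetric_form_transpose)
  have s: "0 < s" using outer_normal_dual_rel(1)[OF x outer_normal_spec[OF x]] by (simp add: s_def u_def)
  have un: "norm u = 1" using outer_normal_spec[OF x] by (simp add: is_outer_normal_def u_def)
  have uu: "u \<bullet> u = 1" using un by (simp add: norm_eq_1)
  have ux: "u \<bullet> x = s" by (simp add: s_def inner_commute)
  \<comment> \<open>Since \<open>A *v u = u\<close>, the component
    \<open>sqrt s * (y \<bullet> w)\<close> of \<open>N *v w\<close> along \<open>u\<close>
    contributes \<open>s * (y \<bullet> w)\<^sup>2\<close>, which after division by \<open>s\<close>
    is the required square. Consequently \<open>det N = 1 / sqrt s\<close>.\<close>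
  define a where "a = sqrt s *\<^sub>R u - x"
  define N where "N = (\<chi> i j. (if i = j then 1 else 0) + a $ i * y $ j)"
  define C where "C = matrix ((*\<^sub>R) (1 / s) :: real^'n \<Rightarrow> real^'n)"
  define M where "M = transpose N ** A ** N ** C"
  have Nw: "N *v w = (w - (y \<bullet> w) *\<^sub>R x) + (sqrt s * (y \<bullet> w)) *\<^sub>R u" for w
    unfolding N_def outer_matrix_vector a_def by (simp add: algebra_simps)
  have form: "v \<bullet> (M *v w) = (N *v v) \<bullet> (A *v (N *v w)) / s" for v w
  proof -
    have "M *v w = transpose N *v (A *v (N *v ((1 / s) *\<^sub>R w)))"
      unfolding M_def C_def by (simp only: matrix_vector_mul_assoc[symmetric] matrix_scaled_identity)
    then show ?thesis
      by (simp add: matrix_vector_mult_scaleR dot_lmul_matrix inner_commute[of v])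
        (simp add: inner_commute)
  qed
  have Msym: "symmetric_form M"
    unfolding symmetric_form_def
  proof (intro allI)
    fix v w
    have "(N *v v) \<bullet> (A *v (N *v w)) = (N *v w) \<bullet> (A *v (N *v v))"
      using sym by (simp add: symmetric_form_def inner_commute)
    then show "v \<bullet> (M *v w) = (M *v v) \<bullet> w" using form[of v w] form[of w v] by (simp add: inner_commute)
  qed
  have quad: "w \<bullet> (M *v w) = (w - (y \<bullet> w) *\<^sub>R x) \<bullet> (A *v (w - (y \<bullet> w) *\<^sub>R x)) / s + (y \<bullet> w)\<^sup>2" for w
  proof -
    let ?h = "w - (y \<bullet> w) *\<^sub>R x"
    have uh: "u \<bullet> ?h = 0" using s by (simp add: inner_diff_right ux y_def)
    have "?h \<bullet> (A *v u) = 0" using uh Au by (simp add: inner_commute)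
    moreover have "u \<bullet> (A *v ?h) = 0" using sym uh Au by (simp add: symmetric_form_def)
    ultimately have "(N *v w) \<bullet> (A *v (N *v w)) = ?h \<bullet> (A *v ?h) + s * (y \<bullet> w)\<^sup>2"
      unfolding Nw using s Au uu
      by (simp add: matrix_vector_right_distrib matrix_vector_mult_scaleR inner_add_left inner_add_right power2_eq_square)
    then show ?thesis unfolding form using s by (simp add: add_divide_distrib)
  qed
  have detM: "det M = det A / s ^ (CARD('n) + 1)"
  proof -
    have "a \<bullet> y = sqrt s / s - 1" using s by (simp add: a_def y_def inner_diff_left uu s_def diff_divide_distrib)
    then have "det N = sqrt s / s" unfolding N_def det_matrix_one_plus_outer by simp
    moreover have "det C = (1 / s) ^ CARD('n)" unfolding C_def by (rule det_matrix_scaleR)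
    ultimately have "det M = (sqrt s / s) * det A * (sqrt s / s) * (1 / s) ^ CARD('n)"
      by (simp add: M_def det_mul)
    also have "\<dots> = (sqrt s * sqrt s) / s * (1 / s) * det A * (1 / s) ^ CARD('n)" by simp
    also have "\<dots> = det A / s ^ (CARD('n) + 1)" using s by (simp add: power_one_over divide_simps)
    finally show ?thesis .
  qed
  have "second_order energy x y M"
    unfolding second_order_def
  proof (intro allI impI)
    fix e :: real assume e: "0 < e"
    obtain k where k: "k > 0" "\<And>v. norm (A *v v) \<le> k * norm v" using matrix_norm_bound by blast
    obtain d1 where d1: "d1 > 0" "\<And>w. norm w \<le> d1 \<Longrightarrow>
      \<bar>supp J (x + w) - 1 - y \<bullet> w - (w - (y \<bullet> w) *\<^sub>R x) \<bullet> (A *v (w - (y \<bullet> w) *\<^sub>R x)) / 2 / s\<bar> \<le> min 1 (e / 4) * (norm w)\<^sup>2"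
      using gauge_expansion[OF x A, of "min 1 (e / 4)"] e unfolding u_def s_def y_def by auto
    define Y where "Y = norm y"
    define H where "H = 1 + Y * norm x"
    define b where "b = k * H\<^sup>2 / (2 * s) + 1"
    have Y0: "0 \<le> Y" by (simp add: Y_def)
    have b: "0 < b" unfolding b_def using k(1) s by (intro add_nonneg_pos) auto
    \<comment> \<open>Squaring leaves the product of the linear part with the quadratic one and the
      square of the latter, both of third order; \<open>Y\<close> bounds the linear part and
      \<open>b\<close> the quadratic part with its error.\<close>
    define E where "E = Y * b + b\<^sup>2"
    have E0: "0 < E" using Y0 b by (simp add: E_def add_nonneg_pos)
    define d where "d = Min {d1, 1, 1 / (Y + 1), e / (4 * E)}"
    have d: "0 < d" "d \<le> d1" "d \<le> 1" "d \<le> 1 / (Y + 1)" "d \<le> e / (4 * E)"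
      unfolding d_def using d1(1) Y0 e E0 by simp_all
    have "\<bar>energy (x + w) - energy x - y \<bullet> w - w \<bullet> (M *v w) / 2\<bar> \<le> e * (norm w)\<^sup>2" if w: "norm w \<le> d" for w
    proof -
      let ?n = "norm w" and ?h = "w - (y \<bullet> w) *\<^sub>R x" and ?a = "y \<bullet> w"
      let ?q = "?h \<bullet> (A *v ?h) / 2 / s"
      define r where "r = supp J (x + w) - 1 - ?a - ?q"
      have r: "\<bar>r\<bar> \<le> min 1 (e / 4) * ?n\<^sup>2" unfolding r_def using d1(2) w d by simp
      have a: "\<bar>?a\<bar> \<le> Y * ?n" unfolding Y_def by (rule Cauchy_Schwarz_ineq2)
      have nh: "norm ?h \<le> H * ?n"
      proof -
        have "norm ?h \<le> ?n + \<bar>?a\<bar> * norm x" using norm_triangle_ineq4[of w "?a *\<^sub>R x"] by simp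
        also have "\<dots> \<le> ?n + (Y * ?n) * norm x" using a by (intro add_left_mono mult_right_mono) auto
        finally show ?thesis by (simp add: H_def algebra_simps)
      qed
      have q: "\<bar>?q\<bar> \<le> k * H\<^sup>2 / (2 * s) * ?n\<^sup>2"
      proof -
        have "\<bar>?h \<bullet> (A *v ?h)\<bar> \<le> k * (norm ?h)\<^sup>2" by (rule quadratic_bound[OF k(2)])
        also have "\<dots> \<le> k * (H * ?n)\<^sup>2" using nh k(1) by (intro mult_left_mono power_mono) auto
        finally have "\<bar>?h \<bullet> (A *v ?h)\<bar> / (2 * s) \<le> k * H\<^sup>2 * ?n\<^sup>2 / (2 * s)"
          using s by (intro divide_right_mono) (auto simp: power_mult_distrib mult_ac)
        then show ?thesis using s by (simp add: abs_divide)
      qed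
      have qr: "\<bar>?q + r\<bar> \<le> b * ?n\<^sup>2"
      proof -
        have "\<bar>r\<bar> \<le> 1 * ?n\<^sup>2" using r by (rule order_trans) (intro mult_right_mono, auto)
        then have "\<bar>?q + r\<bar> \<le> k * H\<^sup>2 / (2 * s) * ?n\<^sup>2 + 1 * ?n\<^sup>2" using q by linarith
        then show ?thesis by (simp add: b_def distrib_right)
      qed
      have n1: "?n \<le> 1" using w d by simp
      have sp: "supp J (x + w) = 1 + ?a + (?q + r)" by (simp add: r_def)
      have en: "energy x = 1 / 2" using x by (simp add: energy_def frontier_K_iff)
      have "energy (x + w) - energy x - ?a - w \<bullet> (M *v w) / 2 = r + (?a * (?q + r) + (?q + r)\<^sup>2 / 2)"
      proof -
        have "w \<bullet> (M *v w) = 2 * ?q + ?a\<^sup>2" unfolding quad by simp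
        moreover have "(1 + a + (q + r))\<^sup>2 / 2 - 1 / 2 - a - (2 * q + a\<^sup>2) / 2 = r + (a * (q + r) + (q + r)\<^sup>2 / 2)"
          for a q r :: real by (simp add: power2_eq_square field_simps)
        ultimately show ?thesis unfolding energy_def[of "x + w"] sp en by (simp only:)
      qed
      also have "\<bar>\<dots>\<bar> \<le> \<bar>r\<bar> + (\<bar>?a\<bar> * \<bar>?q + r\<bar> + \<bar>?q + r\<bar>\<^sup>2 / 2)"
        using abs_triangle_ineq[of r "?a * (?q + r) + (?q + r)\<^sup>2 / 2"]
          abs_triangle_ineq[of "?a * (?q + r)" "(?q + r)\<^sup>2 / 2"] by (simp add: abs_mult)
      also have "\<dots> \<le> (e / 4) * ?n\<^sup>2 + (E * ?n) * ?n\<^sup>2"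
      proof (rule add_mono)
        show "\<bar>r\<bar> \<le> (e / 4) * ?n\<^sup>2" using r by (rule order_trans) (intro mult_right_mono, auto)
        have "\<bar>?a\<bar> * \<bar>?q + r\<bar> \<le> (Y * ?n) * (b * ?n\<^sup>2)" using a qr Y0 by (intro mult_mono) auto
        moreover have "\<bar>?q + r\<bar>\<^sup>2 / 2 \<le> b\<^sup>2 * ?n * ?n\<^sup>2"
        proof -
          have "\<bar>?q + r\<bar>\<^sup>2 \<le> (b * ?n\<^sup>2)\<^sup>2" using qr by (intro power_mono) auto
          also have "\<dots> = b\<^sup>2 * ?n\<^sup>2 * ?n\<^sup>2" by (simp add: power2_eq_square mult_ac)
          also have "\<dots> \<le> b\<^sup>2 * ?n * ?n\<^sup>2"
          proof -
            have "?n\<^sup>2 \<le> ?n" using n1 by (simp add: power2_eq_square mult_left_le)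
            then show ?thesis by (intro mult_right_mono mult_left_mono) auto
          qed
          finally have "\<bar>?q + r\<bar>\<^sup>2 \<le> b\<^sup>2 * ?n * ?n\<^sup>2" .
          moreover have "0 \<le> \<bar>?q + r\<bar>\<^sup>2" by (rule zero_le_power2)
          ultimately show ?thesis by linarith
        qed
        ultimately show "\<bar>?a\<bar> * \<bar>?q + r\<bar> + \<bar>?q + r\<bar>\<^sup>2 / 2 \<le> (E * ?n) * ?n\<^sup>2"
          by (simp add: E_def algebra_simps)
      qed
      also have "(E * ?n) * ?n\<^sup>2 \<le> (e / 4) * ?n\<^sup>2"
      proof (rule mult_right_mono)
        have "E * ?n \<le> E * (e / (4 * E))" using w d E0 by (intro mult_left_mono) auto
        then show "E * ?n \<le> e / 4" using E0 by simp
      qed simp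
      also have "(e / 4) * ?n\<^sup>2 + (e / 4) * ?n\<^sup>2 \<le> e * ?n\<^sup>2" using e by simp
      finally show ?thesis by simp
    qed
    then show "\<exists>d>0. \<forall>w. norm w \<le> d \<longrightarrow> \<bar>energy (x + w) - energy x - y \<bullet> w - w \<bullet> (M *v w) / 2\<bar> \<le> e * (norm w)\<^sup>2"
      using d(1) by blast
  qed
  moreover have "h \<bullet> (M *v h) = h \<bullet> (A *v h) / s" if "u \<bullet> h = 0" for h
    using quad[of h] that by (simp add: y_def)
  ultimately show ?thesis using Msym detM by blast
qed

text \<open>Two curvature matrices yield expansions of \<open>energy\<close> with the same gradient,
  hence the same Hessian, hence agree on the tangent hyperplane; on \<open>u\<close> both are the
  identity. This gives the description operator in \<open>gauss_curvature\<close> its value.\<close>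

lemma curvature_matrix_unique:
  assumes x: "x \<in> frontier K" and A: "is_curvature_matrix K x A" and B: "is_curvature_matrix K x B"
  shows "A = B"
proof -
  let ?u = "outer_normal K x"
  let ?s = "x \<bullet> ?u"
  have s: "0 < ?s" using outer_normal_dual_rel(1)[OF x outer_normal_spec[OF x]] .
  have uu: "?u \<bullet> ?u = 1" using outer_normal_spec[OF x] by (simp add: is_outer_normal_def norm_eq_1)
  have sA: "symmetric_form A" "A *v ?u = ?u" and sB: "symmetric_form B" "B *v ?u = ?u"
    using A B by (auto simp: is_curvature_matrix_def Let_def intro: symmetric_form_transpose)
  obtain M where M: "symmetric_form M" "second_order energy x ((1 / ?s) *\<^sub>R ?u) M"
      "\<And>h. ?u \<bullet> h = 0 \<Longrightarrow> h \<bullet> (M *v h) = h \<bullet> (A *v h) / ?s"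
    using curvature_matrix_second_order[OF x A] by blast
  obtain M' where M': "symmetric_form M'" "second_order energy x ((1 / ?s) *\<^sub>R ?u) M'"
      "\<And>h. ?u \<bullet> h = 0 \<Longrightarrow> h \<bullet> (M' *v h) = h \<bullet> (B *v h) / ?s"
    using curvature_matrix_second_order[OF x B] by blast
  have "M = M'" by (rule second_order_unique[OF M(1,2) M'(1,2)])
  then have tang: "h \<bullet> (A *v h) = h \<bullet> (B *v h)" if "?u \<bullet> h = 0" for h
    using M(3)[OF that] M'(3)[OF that] s by simp
  have dec: "w \<bullet> (N *v w) = (w - (?u \<bullet> w) *\<^sub>R ?u) \<bullet> (N *v (w - (?u \<bullet> w) *\<^sub>R ?u)) + (?u \<bullet> w)\<^sup>2"
    if N: "symmetric_form N" "N *v ?u = ?u" for N :: "real^'n^'n" and w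
  proof -
    have "?u \<bullet> (N *v w) = ?u \<bullet> w" using N unfolding symmetric_form_def by metis
    then show ?thesis using N(2) uu
      by (simp add: matrix_vector_mult_diff_distrib matrix_vector_mult_scaleR inner_diff_left inner_diff_right
          power2_eq_square inner_commute)
  qed
  show ?thesis
  proof (rule symmetric_form_eqI[OF sA(1) sB(1)])
    fix w
    have "?u \<bullet> (w - (?u \<bullet> w) *\<^sub>R ?u) = 0" using uu by (simp add: inner_diff_right)
    then show "w \<bullet> (A *v w) = w \<bullet> (B *v w)"
      unfolding dec[OF sA, of w] dec[OF sB, of w] using tang by simp
  qed
qed

lemma gauss_curvature_eq:
  assumes "x \<in> frontier K" "is_curvature_matrix K x A"
  shows "gauss_curvature K x = det A"
  using assms curvature_matrix_unique unfolding gauss_curvature_def by (metis the_equality)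

definition curvature_density :: "real^'n \<Rightarrow> real" where
  "curvature_density x = gauss_curvature K x / (x \<bullet> outer_normal K x) ^ (CARD('n) + 1)"

lemma curvature_density_second_order:
  assumes x: "x \<in> frontier K" and ex: "\<exists>A. is_curvature_matrix K x A"
  shows "\<exists>M y. symmetric_form M \<and> dual_rel K J x y \<and> second_order energy x y M \<and> det M = curvature_density x"
proof -
  obtain A where A: "is_curvature_matrix K x A" using ex by blast
  from curvature_matrix_second_order[OF x A] obtain M where
    "symmetric_form M" "second_order energy x ((1 / (x \<bullet> outer_normal K x)) *\<^sub>R outer_normal K x) M"
    "det M = det A / (x \<bullet> outer_normal K x) ^ (CARD('n) + 1)" by blast
  then show ?thesis
    using outer_normal_dual(2)[OF x] gauss_curvature_eq[OF x A] unfolding curvature_density_def by metis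
qed

lemma curvature_density_cases:
  assumes x: "x \<in> frontier K"
  shows "curvature_density x = 0 \<or>
    (\<exists>M y. symmetric_form M \<and> dual_rel K J x y \<and> second_order energy x y M \<and> det M = curvature_density x)"
  using curvature_density_second_order[OF x] by (auto simp: curvature_density_def gauss_curvature_def)

lemma curvature_density_nonneg:
  assumes x: "x \<in> frontier K" shows "0 \<le> curvature_density x"
  using curvature_density_cases[OF x] det_nonneg_of_psd second_order_psd by (metis order_refl)

end

context polar_pair
begin

interpretation dual: polar_pair J K
  by (rule polar_pair_sym) (rule polar_pair_axioms)

section \<open>Upper bound for the total curvature density\<close>

lemma convex_on_energy: "convex_on UNIV energy"
proof (rule convex_onI)
  fix t :: real and x z :: "real^'n" assume t: "0 < t" "t < 1"
  let ?p = "(1 - t) *\<^sub>R x + t *\<^sub>R z"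
  obtain y where y: "dual_rel K J ?p y" using dual_rel_exists by blast
  have "energy ?p + y \<bullet> (x - ?p) \<le> energy x" "energy ?p + y \<bullet> (z - ?p) \<le> energy z"
    using energy_subgradient[OF y, of "x - ?p"] energy_subgradient[OF y, of "z - ?p"] by simp_all
  then have "(1 - t) * (energy ?p + y \<bullet> (x - ?p)) + t * (energy ?p + y \<bullet> (z - ?p)) \<le> (1 - t) * energy x + t * energy z"
    using t by (intro add_mono mult_left_mono) auto
  moreover have "(1 - t) * (energy ?p + y \<bullet> (x - ?p)) + t * (energy ?p + y \<bullet> (z - ?p))
      = energy ?p + y \<bullet> ((1 - t) *\<^sub>R (x - ?p) + t *\<^sub>R (z - ?p))"
    by (simp add: inner_add_right algebra_simps)
  moreover have "(1 - t) *\<^sub>R (x - ?p) + t *\<^sub>R (z - ?p) = 0" by (simp add: algebra_simps)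
  ultimately show "energy ?p \<le> (1 - t) * energy x + t * energy z" by simp
qed simp

lemma continuous_on_energy: "continuous_on S energy"
  unfolding energy_def[abs_def] by (intro continuous_intros) simp

text \<open>
  For \<open>v = y\<^sub>0 + M w\<close> the function \<open>energy z - v \<bullet> z\<close> has a minimum over the ball of radius \<open>r\<close>
  about \<open>x\<close> in the interior, since by the expansion it is larger on the sphere than at \<open>x + w\<close>; by
  convexity \<open>v\<close> is a subgradient there.
\<close>

lemma dual_image_contains_ellipsoid:
  assumes M: "symmetric_form M" "second_order energy x y\<^sub>0 M" and y0: "dual_rel K J x y\<^sub>0"
    and det: "det M \<noteq> 0" and \<epsilon>: "0 < \<epsilon>" "\<epsilon> < 1"
  shows "\<exists>r\<^sub>0>0. \<forall>r. 0 < r \<and> r \<le> r\<^sub>0 \<longrightarrow> (\<forall>w. norm w \<le> (1 - \<epsilon>) * r \<longrightarrow>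
    (\<exists>z. norm (z - x) < r \<and> dual_rel K J z (y\<^sub>0 + M *v w)))"
proof -
  obtain c where c: "c > 0" "\<And>w. c * (norm w)\<^sup>2 \<le> w \<bullet> (M *v w)"
    using positive_definite_bound[OF M(1) second_order_psd[OF M(2) y0] det] by blast
  \<comment> \<open>The two expansion errors then total at most an eighth of
    \<open>c * (\<epsilon> * r)\<^sup>2\<close>, whereas positive definiteness supplies half of it
    for a minimiser on the sphere.\<close>
  define e where "e = c * \<epsilon>\<^sup>2 / 16"
  have e: "0 < e" using c(1) \<epsilon> by (simp add: e_def)
  obtain d where d: "d > 0" "\<And>w. norm w \<le> d \<Longrightarrow>
      \<bar>energy (x + w) - energy x - y\<^sub>0 \<bullet> w - w \<bullet> (M *v w) / 2\<bar> \<le> e * (norm w)\<^sup>2"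
    using M(2) e unfolding second_order_def by blast
  have "\<exists>z. norm (z - x) < r \<and> dual_rel K J z (y\<^sub>0 + M *v w)"
    if r: "0 < r" "r \<le> d" and w: "norm w \<le> (1 - \<epsilon>) * r" for r w
  proof -
    define v where "v = y\<^sub>0 + M *v w"
    define \<psi> where "\<psi> z = energy z - v \<bullet> z" for z
    have cont: "continuous_on (cball x r) \<psi>"
      unfolding \<psi>_def[abs_def] by (intro continuous_intros continuous_on_energy)
    have cp: "compact (cball x r)" by (rule compact_cball)
    have ne: "cball x r \<noteq> {}" using r by simp
    obtain z where z: "z \<in> cball x r" "\<And>z'. z' \<in> cball x r \<Longrightarrow> \<psi> z \<le> \<psi> z'"
      using continuous_attains_inf[OF cp ne cont] by blast
    have wr: "norm w \<le> r"
    proof -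
      have "(1 - \<epsilon>) * r \<le> 1 * r" using \<epsilon> r by (intro mult_right_mono) auto
      then show ?thesis using w by simp
    qed
    have "norm (z - x) \<noteq> r"
    proof
      assume nr: "norm (z - x) = r"
      define h where "h = z - x"
      have h: "norm h = r" "z = x + h" using nr by (auto simp: h_def)
      have "x + w \<in> cball x r" using wr by (simp add: dist_norm)
      then have le: "\<psi> (x + h) \<le> \<psi> (x + w)" using z(2) h(2) by simp
      have nh: "norm h \<le> d" and nw: "norm w \<le> d" using h(1) wr r by auto
      have 1: "energy x + y\<^sub>0 \<bullet> h + h \<bullet> (M *v h) / 2 - e * r\<^sup>2 \<le> energy (x + h)"
        using abs_le_D2[OF d(2)[OF nh]] h(1) by simp
      have "e * (norm w)\<^sup>2 \<le> e * r\<^sup>2" using wr e by (intro mult_left_mono power_mono) auto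
      then have 2: "energy (x + w) \<le> energy x + y\<^sub>0 \<bullet> w + w \<bullet> (M *v w) / 2 + e * r\<^sup>2"
        using abs_le_D1[OF d(2)[OF nw]] by linarith
      have sym: "h \<bullet> (M *v w) = w \<bullet> (M *v h)" using M(1) by (simp add: symmetric_form_def inner_commute)
      have 3: "(h - w) \<bullet> (M *v (h - w)) = h \<bullet> (M *v h) - 2 * (h \<bullet> (M *v w)) + w \<bullet> (M *v w)"
        using sym by (simp add: matrix_vector_mult_diff_distrib inner_diff_left inner_diff_right)
      have "v \<bullet> (x + h) = v \<bullet> x + y\<^sub>0 \<bullet> h + h \<bullet> (M *v w)" "v \<bullet> (x + w) = v \<bullet> x + y\<^sub>0 \<bullet> w + w \<bullet> (M *v w)"
        by (simp_all add: v_def inner_add_left inner_add_right inner_commute)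
      moreover have "(hh - 2 * hw + ww) / 2 \<le> 2 * q"
        if "eh - vh \<le> ew - vw" "e0 + yh + hh / 2 - q \<le> eh" "ew \<le> e0 + yw + ww / 2 + q"
          "vh = vx + yh + hw" "vw = vx + yw + ww" for hh hw ww eh ew vh vw e0 yh yw vx q :: real
        using that by argo
      ultimately have "(h - w) \<bullet> (M *v (h - w)) / 2 \<le> 2 * (e * r\<^sup>2)"
        using le 1 2 unfolding \<psi>_def 3 by blast
      moreover have "\<epsilon> * r \<le> norm (h - w)" using norm_triangle_ineq2[of h w] h(1) w by (simp add: algebra_simps)
      then have "c * (\<epsilon> * r)\<^sup>2 \<le> c * (norm (h - w))\<^sup>2" using c(1) \<epsilon> r by (intro mult_left_mono power_mono) auto
      then have "c * (\<epsilon> * r)\<^sup>2 \<le> (h - w) \<bullet> (M *v (h - w))" using c(2)[of "h - w"] by linarith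
      moreover have "2 * (e * r\<^sup>2) = c * (\<epsilon> * r)\<^sup>2 / 8" by (simp add: e_def power_mult_distrib)
      moreover have "0 < c * (\<epsilon> * r)\<^sup>2" using c(1) \<epsilon> r by simp
      ultimately show False by linarith
    qed
    then have zr: "norm (z - x) < r" using z(1) by (simp add: dist_norm norm_minus_commute)
    have conv: "convex_on UNIV \<psi>"
    proof (rule convex_onI)
      fix t :: real and a b :: "real^'n" assume t: "0 < t" "t < 1"
      have "energy ((1 - t) *\<^sub>R a + t *\<^sub>R b) \<le> (1 - t) * energy a + t * energy b"
        using convex_onD[OF convex_on_energy, of t a b] t by simp
      then show "\<psi> ((1 - t) *\<^sub>R a + t *\<^sub>R b) \<le> (1 - t) * \<psi> a + t * \<psi> b"
        by (simp add: \<psi>_def inner_add_right algebra_simps)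
    qed simp
    have "\<forall>z'\<in>ball z (r - norm (z - x)). \<psi> z \<le> \<psi> z'"
    proof
      fix z' assume "z' \<in> ball z (r - norm (z - x))"
      then have "norm (z' - z) < r - norm (z - x)" by (simp add: dist_norm norm_minus_commute)
      then have "norm (z' - x) \<le> r" using norm_triangle_ineq[of "z' - z" "z - x"] by simp
      then show "\<psi> z \<le> \<psi> z'" using z(2) by (simp add: dist_norm norm_minus_commute)
    qed
    then have "\<forall>z'\<in>UNIV. \<psi> z \<le> \<psi> z'"
      using zr by (intro convex_local_global_minimum[OF _ conv]) auto
    then have "dual_rel K J z v"
      by (intro subgradient_dual_rel) (simp add: \<psi>_def energy_def inner_diff_right algebra_simps)
    then show ?thesis using zr unfolding v_def by blast
  qed
  then show ?thesis using d(1) by blast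
qed

text \<open>Points in the image of a small ball about \<open>x\<close>. Its radius is proportional
  to the gauge of \<open>x\<close>, so the relation is homogeneous and the volume ratios built from
  it are constant along rays.\<close>

definition near_rel :: "nat \<Rightarrow> (real^'n) \<Rightarrow> (real^'n) \<Rightarrow> bool" where
  "near_rel k x y \<longleftrightarrow> (\<exists>z. norm (z - x) < supp J x / real k \<and> dual_rel K J z y)"

text \<open>The strict inequality is exhausted by slacks \<open>1 / (m + 1)\<close> and the space by
  balls, which exhibits the relation as a countable union of projections of compact sets.\<close>

lemma near_rel_sets [measurable]: "{(x, y). near_rel k x y} \<in> sets borel"
proof -
  define C where "C m N = {(x, (z, y)). norm x \<le> real N \<and> (dual_rel K J z y \<and> norm z \<le> real N)
      \<and> norm (z - x) + 1 / real (Suc m) \<le> supp J x / real k}" for m N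
  have cC: "compact (C m N)" for m N
  proof -
    have "C m N = (cball 0 (real N) \<times> {(z, y). dual_rel K J z y \<and> norm z \<le> real N})
        \<inter> {p. norm (fst (snd p) - fst p) + 1 / real (Suc m) \<le> supp J (fst p) / real k}"
      by (auto simp: C_def)
    moreover have "closed {p :: (real^'n) \<times> (real^'n) \<times> (real^'n).
        norm (fst (snd p) - fst p) + 1 / real (Suc m) \<le> supp J (fst p) * (1 / real k)}"
      by (intro closed_Collect_le continuous_intros)
    ultimately show ?thesis
      by (simp add: compact_Int_closed compact_Times compact_dual_rel)
  qed
  have "{(x, y). near_rel k x y} = (\<Union>m. \<Union>N. (\<lambda>p. (fst p, snd (snd p))) ` C m N)" (is "?L = ?R")
  proof (intro set_eqI iffI)
    fix p assume "p \<in> ?L"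
    then obtain x y z where p: "p = (x, y)" "norm (z - x) < supp J x / real k" "dual_rel K J z y"
      unfolding near_rel_def by auto
    obtain m where m: "inverse (real (Suc m)) < supp J x / real k - norm (z - x)"
      using reals_Archimedean[of "supp J x / real k - norm (z - x)"] p(2) by auto
    obtain N where N: "max (norm x) (norm z) \<le> real N" using real_arch_simple by blast
    have "(x, (z, y)) \<in> C m N" using p m N by (simp add: C_def inverse_eq_divide)
    then have "(fst (x, (z, y)), snd (snd (x, (z, y)))) \<in> (\<lambda>p. (fst p, snd (snd p))) ` C m N" by (rule imageI)
    then show "p \<in> ?R" using p(1) by auto
  next
    fix p assume "p \<in> ?R"
    then obtain m N q where q: "q \<in> C m N" "p = (fst q, snd (snd q))" by auto
    then have "norm (fst (snd q) - fst q) + 1 / real (Suc m) \<le> supp J (fst q) / real k" "dual_rel K J (fst (snd q)) (snd (snd q))"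
      by (auto simp: C_def)
    moreover have "0 < 1 / real (Suc m)" by simp
    ultimately have "norm (fst (snd q) - fst q) < supp J (fst q) / real k" by linarith
    then show "p \<in> ?L" using q(2) \<open>dual_rel K J _ _\<close> unfolding near_rel_def by auto
  qed
  moreover have "(\<lambda>p. (fst p, snd (snd p))) ` C m N \<in> sets borel" for m N
    by (intro borel_compact compact_continuous_image cC continuous_intros)
  then have "?R \<in> sets borel" by (intro sets.countable_UN image_subsetI)
  ultimately show ?thesis by simp
qed

definition ball_weight :: "nat \<Rightarrow> real^'n \<Rightarrow> real" where
  "ball_weight k x = 1 / (unit_ball_vol (real CARD('n)) * (supp J x / real k) ^ CARD('n))"

text \<open>Volume of the image of a ball divided by the volume of the ball, a Jacobian at scale
  \<open>1 / k\<close>. It is written as an integral over \<open>y\<close> so that Fubini can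
  exchange the two points.\<close>

definition image_ratio :: "nat \<Rightarrow> real^'n \<Rightarrow> ennreal" where
  "image_ratio k x = (\<integral>\<^sup>+y. ennreal (ball_weight k x) * indicator {(x, y). near_rel k x y} (x, y) \<partial>lborel)"

lemma ball_weight_nonneg: "0 \<le> ball_weight k x"
  by (simp add: ball_weight_def supp_nonneg)

lemma ball_weight_measurable [measurable]: "ball_weight k \<in> borel_measurable borel"
  unfolding ball_weight_def[abs_def] by measurable

lemma near_rel_indicator_measurable [measurable]:
  "(\<lambda>p. indicator {(x, y). near_rel k x y} p :: ennreal) \<in> borel_measurable (lborel \<Otimes>\<^sub>M lborel)"
proof (rule borel_measurable_indicator)
  have "sets (lborel \<Otimes>\<^sub>M lborel) = sets (borel \<Otimes>\<^sub>M borel :: ((real^'n) \<times> (real^'n)) measure)"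
    by (rule sets_pair_measure_cong) simp_all
  also have "\<dots> = sets borel" by (simp only: borel_prod)
  finally have "sets (lborel \<Otimes>\<^sub>M lborel) = sets (borel :: ((real^'n) \<times> (real^'n)) measure)" .
  then show "{(x, y). near_rel k x y} \<in> sets (lborel \<Otimes>\<^sub>M lborel)" using near_rel_sets by simp
qed

lemma near_rel_section_sets: "{y. near_rel k x y} \<in> sets borel"
proof -
  have "{(x, y). near_rel k x y} \<in> sets (borel \<Otimes>\<^sub>M borel)" using near_rel_sets by (simp only: borel_prod)
  from sets_Pair1[OF this, of x] show ?thesis by (simp add: vimage_def)
qed

lemma image_ratio_eq: "image_ratio k x = ennreal (ball_weight k x) * emeasure lborel {y. near_rel k x y}"
proof -
  have "image_ratio k x = (\<integral>\<^sup>+y. ennreal (ball_weight k x) * indicator {y. near_rel k x y} y \<partial>lborel)"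
    unfolding image_ratio_def by (intro nn_integral_cong) (simp add: indicator_def)
  also have "\<dots> = ennreal (ball_weight k x) * emeasure lborel {y. near_rel k x y}"
    using near_rel_section_sets by (intro nn_integral_cmult_indicator) simp
  finally show ?thesis .
qed

lemma image_ratio_measurable [measurable]: "image_ratio k \<in> borel_measurable borel"
proof -
  have "(\<lambda>p. ennreal (ball_weight k (fst p)) * indicator {(x, y). near_rel k x y} p) \<in> borel_measurable (lborel \<Otimes>\<^sub>M lborel)"
    by measurable
  from lborel.borel_measurable_nn_integral_fst[OF this] show ?thesis
    by (simp add: image_ratio_def[abs_def])
qed

lemma near_rel_scale:
  assumes t: "0 < t" shows "near_rel k (t *\<^sub>R x) (t *\<^sub>R y) \<longleftrightarrow> near_rel k x y"
proof -
  have *: "near_rel k (t *\<^sub>R x) (t *\<^sub>R y)" if "near_rel k x y" "0 < t" for x y t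
  proof -
    obtain z where z: "norm (z - x) < supp J x / real k" "dual_rel K J z y"
      using \<open>near_rel k x y\<close> unfolding near_rel_def by blast
    have "norm (t *\<^sub>R z - t *\<^sub>R x) = t * norm (z - x)" using \<open>0 < t\<close> by (simp add: scaleR_diff_right[symmetric])
    also have "\<dots> < t * (supp J x / real k)" using z(1) \<open>0 < t\<close> by (rule mult_strict_left_mono)
    finally show ?thesis unfolding near_rel_def using dual_rel_scale[OF z(2), of t] \<open>0 < t\<close>
      by (intro exI[of _ "t *\<^sub>R z"]) (simp add: supp_scale)
  qed
  show ?thesis using *[of x y t] *[of "t *\<^sub>R x" "t *\<^sub>R y" "1 / t"] t by auto
qed

lemma image_ratio_rad:
  assumes "x \<noteq> 0" shows "image_ratio k (rad x) = image_ratio k x"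
proof -
  let ?t = "1 / supp J x"
  have t: "0 < ?t" using assms by simp
  have eq: "{y. near_rel k (rad x) y} = (\<lambda>y. ?t *\<^sub>R y + 0) ` {y. near_rel k x y}"
  proof (intro set_eqI iffI)
    fix y assume "y \<in> {y. near_rel k (rad x) y}"
    then have "near_rel k (?t *\<^sub>R x) (?t *\<^sub>R (supp J x *\<^sub>R y))" using assms by (simp add: rad_def)
    then have "supp J x *\<^sub>R y \<in> {y. near_rel k x y}" by (simp only: near_rel_scale[OF t] mem_Collect_eq)
    then show "y \<in> (\<lambda>y. ?t *\<^sub>R y + 0) ` {y. near_rel k x y}" using assms by (intro image_eqI) auto
  next
    fix y assume "y \<in> (\<lambda>y. ?t *\<^sub>R y + 0) ` {y. near_rel k x y}"
    then obtain y' where y': "y = ?t *\<^sub>R y'" "near_rel k x y'" by auto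
    then show "y \<in> {y. near_rel k (rad x) y}" using near_rel_scale[OF t] by (simp add: rad_def)
  qed
  have "emeasure lborel {y. near_rel k (rad x) y} = emeasure lebesgue ((\<lambda>y. ?t *\<^sub>R y + 0) ` {y. near_rel k x y})"
    unfolding eq[symmetric] using near_rel_section_sets by simp
  also have "\<dots> = ennreal (?t ^ CARD('n)) * emeasure lborel {y. near_rel k x y}"
    using near_rel_section_sets t by (subst emeasure_lebesgue_affine) (simp add: supp_nonneg)
  finally have 1: "emeasure lborel {y. near_rel k (rad x) y} = ennreal (?t ^ CARD('n)) * emeasure lborel {y. near_rel k x y}" .
  have "ball_weight k (rad x) * ?t ^ CARD('n) = ball_weight k x"
  proof -
    have "supp J (rad x) = 1" using rad_frontier[OF assms] by (simp only: frontier_K_iff)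
    then show ?thesis unfolding ball_weight_def by (simp only:) (simp add: power_divide)
  qed
  then have "ennreal (ball_weight k (rad x)) * ennreal (?t ^ CARD('n)) = ennreal (ball_weight k x)"
    using supp_nonneg ball_weight_nonneg by (simp add: ennreal_mult[symmetric])
  then show ?thesis unfolding image_ratio_eq 1 by (simp add: mult.assoc[symmetric])
qed

text \<open>The radius depends on the centre \<open>x\<close>. To integrate over \<open>x\<close>
  for a fixed \<open>z\<close>, it is compared with radii determined by \<open>z\<close>, at the
  cost of replacing \<open>k\<close> by \<open>k + C\<close> or \<open>k - C\<close>.\<close>

lemma near_rel_bounds:
  assumes C: "0 < C" "\<And>x z. \<bar>supp J x - supp J z\<bar> \<le> C * norm (x - z)"
    and k: "C < real k" and nr: "norm (z - x) < supp J x / real k"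
  shows "supp J z \<le> supp J x * (1 + C / real k)" "supp J z / (real k + C) \<le> supp J x / real k"
    "norm (z - x) < supp J z / (real k - C)"
proof -
  have k0: "0 < real k" using C k by linarith
  have a: "\<bar>supp J x - supp J z\<bar> \<le> C * (supp J x / real k)"
  proof -
    have "C * norm (x - z) \<le> C * (supp J x / real k)"
      using C(1) nr by (intro mult_left_mono) (auto simp: norm_minus_commute)
    then show ?thesis using C(2)[of x z] by linarith
  qed
  then show 1: "supp J z \<le> supp J x * (1 + C / real k)"
    by (simp add: algebra_simps)
  have kz: "real k * supp J z \<le> supp J x * (real k + C)"
    using 1 k0 by (simp add: field_simps)
  then show "supp J z / (real k + C) \<le> supp J x / real k"
    using k0 C(1) by (simp add: divide_simps mult.commute)
  have "supp J x - C * (supp J x / real k) \<le> supp J z" using a by linarith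
  then have "supp J x * (real k - C) \<le> real k * supp J z"
    using k0 by (simp add: field_simps)
  then have "supp J x / real k \<le> supp J z / (real k - C)"
    using k0 k by (simp add: divide_simps mult.commute)
  then show "norm (z - x) < supp J z / (real k - C)" using nr by linarith
qed

text \<open>A point \<open>y\<close> with a single partner \<open>z\<close> is counted only for
  centres \<open>x\<close> close to \<open>z\<close>. Those fill at most a ball about
  \<open>z\<close>, whose volume nearly cancels the weight, so each \<open>y\<close> is counted
  about once.\<close>

lemma image_ratio_section:
  assumes C: "0 < C" "\<And>x z. \<bar>supp J x - supp J z\<bar> \<le> C * norm (x - z)"
    and k: "C < real k" and y: "y \<notin> multi"
  shows "(\<integral>\<^sup>+x. indicator K x * (ennreal (ball_weight k x) * indicator {(x, y). near_rel k x y} (x, y)) \<partial>lborel)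
    \<le> ennreal (((real k + C) / (real k - C)) ^ CARD('n)) * indicator {y. supp K y \<le> 1 + C / real k} y"
proof -
  let ?n = "CARD('n)"
  obtain z where "dual_rel J K y z" using dual.dual_rel_exists by blast
  then have z: "dual_rel K J z y" by (simp only: dual_rel_sym)
  have zu: "z' = z" if "dual_rel K J z' y" for z' using that z y unfolding multi_def by blast
  have sz: "supp K y = supp J z" using z by (simp add: dual_rel_def)
  define r where "r = supp J z / (real k - C)"
  define q where "q = 1 / (unit_ball_vol (real ?n) * (supp J z / (real k + C)) ^ ?n)"
  define I :: ennreal where "I = indicator {y. supp K y \<le> 1 + C / real k} y"
  have k0: "0 < real k" using C k by linarith
  have q0: "0 \<le> q" using k0 C by (simp add: q_def supp_nonneg)
  have r0: "0 \<le> r" using k by (simp add: r_def supp_nonneg)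
  have pw: "indicator K x * (ennreal (ball_weight k x) * indicator {(x, y). near_rel k x y} (x, y))
      \<le> (ennreal q * I) * indicator (ball z r) x" for x
  proof (cases "x \<in> K \<and> near_rel k x y")
    case True
    then have nr: "norm (z - x) < supp J x / real k" using zu unfolding near_rel_def by blast
    note b = near_rel_bounds[OF C k nr]
    have "supp J x \<le> 1" using True mem_K_iff by blast
    then have "supp J x * (1 + C / real k) \<le> 1 * (1 + C / real k)" using k0 C(1) by (intro mult_right_mono) auto
    then have "supp K y \<le> 1 + C / real k" using b(1) sz by simp
    then have I: "I = 1" by (simp add: I_def)
    have "x \<in> ball z r" using b(3) by (simp add: r_def dist_norm)
    have z0: "z \<noteq> 0"
    proof
      assume "z = 0"
      then show False using b(3) norm_ge_zero[of "z - x"] by simp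
    qed
    have "0 < supp J z / (real k + C)" using z0 k0 C(1) by (simp add: divide_pos_pos)
    then have "ball_weight k x \<le> q"
      unfolding ball_weight_def q_def using b(2) z0
      by (intro divide_left_mono mult_left_mono power_mono mult_pos_pos zero_less_power) auto
    then show ?thesis using True \<open>x \<in> ball z r\<close> I by (simp add: ennreal_leI)
  qed (auto simp: indicator_def)
  have "(\<integral>\<^sup>+x. indicator K x * (ennreal (ball_weight k x) * indicator {(x, y). near_rel k x y} (x, y)) \<partial>lborel)
    \<le> (\<integral>\<^sup>+x. (ennreal q * I) * indicator (ball z r) x \<partial>lborel)"
    by (intro nn_integral_mono pw)
  also have "\<dots> = ennreal q * I * ennreal (unit_ball_vol (real ?n) * r ^ ?n)"
    using r0 by (subst nn_integral_cmult_indicator) (auto simp: emeasure_ball)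
  also have "\<dots> = I * ennreal (q * (unit_ball_vol (real ?n) * r ^ ?n))"
    using q0 r0 by (simp add: ennreal_mult mult_ac)
  also have "q * (unit_ball_vol (real ?n) * r ^ ?n) \<le> ((real k + C) / (real k - C)) ^ ?n"
  proof (cases "z = 0")
    case True
    then show ?thesis using k k0 C(1) by (simp add: r_def zero_power)
  next
    case False
    then have s: "0 < supp J z" by simp
    have u: "0 < unit_ball_vol (real ?n)" by simp
    show ?thesis unfolding q_def r_def power_divide using s u k k0 C(1) by (simp add: divide_simps)
  qed
  then have "I * ennreal (q * (unit_ball_vol (real ?n) * r ^ ?n)) \<le> I * ennreal (((real k + C) / (real k - C)) ^ ?n)"
    by (intro mult_left_mono ennreal_leI) auto
  finally show ?thesis by (simp add: I_def mult.commute)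
qed

lemma image_ratio_integral_le:
  assumes C: "0 < C" "\<And>x z. \<bar>supp J x - supp J z\<bar> \<le> C * norm (x - z)"
    and k: "C < real k"
  shows "(\<integral>\<^sup>+x. indicator K x * image_ratio k x \<partial>lborel)
    \<le> ennreal (((real k + C) / (real k - C) * (1 + C / real k)) ^ CARD('n)) * emeasure lborel J"
proof -
  let ?f = "\<lambda>x y. indicator K x * (ennreal (ball_weight k x) * indicator {(x, y). near_rel k x y} (x, y))"
  define s where "s = 1 + C / real k"
  have k0: "0 < real k" using C k by linarith
  have s: "0 < s" using k0 C(1) by (simp add: s_def add_pos_pos)
  have meas: "case_prod ?f \<in> borel_measurable (lborel \<Otimes>\<^sub>M lborel)"
  proof -
    have "(\<lambda>p. indicator K (fst p) * (ennreal (ball_weight k (fst p)) * indicator {(x, y). near_rel k x y} p)) \<in> borel_measurable (lborel \<Otimes>\<^sub>M lborel)"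
      by measurable
    then show ?thesis by (simp add: case_prod_unfold)
  qed
  have "(\<integral>\<^sup>+x. indicator K x * image_ratio k x \<partial>lborel) = (\<integral>\<^sup>+x. (\<integral>\<^sup>+y. ?f x y \<partial>lborel) \<partial>lborel)"
    unfolding image_ratio_def
  proof (intro nn_integral_cong nn_integral_cmult[symmetric])
    fix x
    have "(\<lambda>p. ennreal (ball_weight k (fst p)) * indicator {(x, y). near_rel k x y} p) \<in> borel_measurable (lborel \<Otimes>\<^sub>M lborel)"
      by measurable
    from measurable_compose_Pair1[OF _ this, of x]
    show "(\<lambda>y. ennreal (ball_weight k x) * indicator {(x, y). near_rel k x y} (x, y)) \<in> borel_measurable lborel" by simp
  qed
  also have "\<dots> = (\<integral>\<^sup>+y. (\<integral>\<^sup>+x. ?f x y \<partial>lborel) \<partial>lborel)"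
    using lborel_pair.Fubini'[OF meas] by simp
  also have "\<dots> \<le> (\<integral>\<^sup>+y. ennreal (((real k + C) / (real k - C)) ^ CARD('n)) * indicator {y. supp K y \<le> s} y \<partial>lborel)"
  proof (rule nn_integral_mono_AE)
    have "AE y in lborel. y \<notin> multi" by (rule AE_not_in) (rule multi_null)
    then show "AE y in lborel. (\<integral>\<^sup>+x. ?f x y \<partial>lborel) \<le> ennreal (((real k + C) / (real k - C)) ^ CARD('n)) * indicator {y. supp K y \<le> s} y"
      unfolding s_def by (rule AE_mp) (intro AE_I2 impI image_ratio_section[OF C k])
  qed
  also have "\<dots> = ennreal (((real k + C) / (real k - C)) ^ CARD('n)) * emeasure lborel {y. supp K y \<le> s}"
  proof (rule nn_integral_cmult_indicator)
    have "{y. supp K y \<le> s} \<in> sets borel" by measurable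
    then show "{y. supp K y \<le> s} \<in> sets lborel" by simp
  qed
  also have "{y. supp K y \<le> s} = (*\<^sub>R) s ` J"
  proof (intro set_eqI iffI)
    fix y assume "y \<in> {y. supp K y \<le> s}"
    then have "(1 / s) *\<^sub>R y \<in> J" using s by (simp add: dual.mem_K_iff dual.supp_scale)
    then have "s *\<^sub>R ((1 / s) *\<^sub>R y) \<in> (*\<^sub>R) s ` J" by (rule imageI)
    then show "y \<in> (*\<^sub>R) s ` J" using s by simp
  next
    fix y assume "y \<in> (*\<^sub>R) s ` J"
    then obtain z where z: "z \<in> J" "y = s *\<^sub>R z" by blast
    have "supp K z \<le> 1" using z(1) by (simp only: dual.mem_K_iff)
    then have "s * supp K z \<le> s * 1" using s by (intro mult_left_mono) auto
    then show "y \<in> {y. supp K y \<le> s}" using s z(2) by (simp add: dual.supp_scale)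
  qed
  also have "emeasure lborel ((*\<^sub>R) s ` J) = ennreal (s ^ CARD('n)) * emeasure lborel J"
    using s by (subst emeasure_scaleR_image[OF compact_J]) simp
  also have "ennreal (((real k + C) / (real k - C)) ^ CARD('n)) * (ennreal (s ^ CARD('n)) * emeasure lborel J)
    = ennreal (((real k + C) / (real k - C) * s) ^ CARD('n)) * emeasure lborel J"
  proof -
    have "0 \<le> (real k + C) / (real k - C)" using k k0 C(1) by simp
    then show ?thesis unfolding power_mult_distrib using s by (subst ennreal_mult) (auto simp: mult.assoc)
  qed
  finally show ?thesis unfolding s_def .
qed

text \<open>
  A Borel majorant of the curvature density, which spares a proof that the latter is measurable.
\<close>

definition lower_image_ratio :: "real^'n \<Rightarrow> ennreal" where
  "lower_image_ratio x = liminf (\<lambda>k. image_ratio k x)"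

lemma lower_image_ratio_measurable [measurable]: "lower_image_ratio \<in> borel_measurable borel"
  unfolding lower_image_ratio_def[abs_def] by measurable

lemma lower_image_ratio_rad: "x \<noteq> 0 \<Longrightarrow> lower_image_ratio (rad x) = lower_image_ratio x"
  by (simp add: lower_image_ratio_def image_ratio_rad)

text \<open>Fatou's lemma passes the bounds at finite scale to the limit, where the factor of
  \<open>image_ratio_integral_le\<close> tends to 1. At finite scale the images overshoot
  \<open>J\<close> slightly, which that factor includes.\<close>

lemma lower_image_ratio_integral_le:
  "(\<integral>\<^sup>+x. indicator K x * lower_image_ratio (rad x) \<partial>lborel) \<le> emeasure lborel J"
proof -
  obtain C where C: "C > 0" "\<And>x z. \<bar>supp J x - supp J z\<bar> \<le> C * norm (x - z)" using supp_lipschitz by blast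
  have m[measurable]: "(\<lambda>x. indicator K x * image_ratio k x) \<in> borel_measurable lborel" for k by measurable
  have "(\<integral>\<^sup>+x. indicator K x * lower_image_ratio (rad x) \<partial>lborel) = (\<integral>\<^sup>+x. indicator K x * lower_image_ratio x \<partial>lborel)"
  proof (rule nn_integral_cong_AE)
    have "AE x in lborel. x \<notin> {0 :: real^'n}" by (rule AE_not_in) (simp add: null_sets_def)
    then show "AE x in lborel. indicator K x * lower_image_ratio (rad x) = indicator K x * lower_image_ratio x"
      by (rule AE_mp) (intro AE_I2, simp add: lower_image_ratio_rad)
  qed
  also have "\<dots> = (\<integral>\<^sup>+x. liminf (\<lambda>k. indicator K x * image_ratio k x) \<partial>lborel)"
    by (intro nn_integral_cong) (auto simp: lower_image_ratio_def indicator_def Liminf_const)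
  also have "\<dots> \<le> liminf (\<lambda>k. \<integral>\<^sup>+x. indicator K x * image_ratio k x \<partial>lborel)"
    by (rule nn_integral_liminf) (rule m)
  also have "\<dots> \<le> liminf (\<lambda>k. ennreal (((real k + C) / (real k - C) * (1 + C / real k)) ^ CARD('n)) * emeasure lborel J)"
  proof (rule Liminf_mono)
    have "eventually (\<lambda>k. C < real k) sequentially" by real_asymp
    then show "eventually (\<lambda>k. (\<integral>\<^sup>+x. indicator K x * image_ratio k x \<partial>lborel)
      \<le> ennreal (((real k + C) / (real k - C) * (1 + C / real k)) ^ CARD('n)) * emeasure lborel J) sequentially"
      by (rule eventually_mono) (rule image_ratio_integral_le[OF C])
  qed
  also have "\<dots> = emeasure lborel J"
  proof (rule lim_imp_Liminf)
    have "(\<lambda>k. (real k + C) / (real k - C) * (1 + C / real k)) \<longlonglongrightarrow> 1" using C(1) by real_asymp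
    then have "(\<lambda>k. ((real k + C) / (real k - C) * (1 + C / real k)) ^ CARD('n)) \<longlonglongrightarrow> 1 ^ CARD('n)"
      by (rule tendsto_power)
    then have "(\<lambda>k. ennreal (((real k + C) / (real k - C) * (1 + C / real k)) ^ CARD('n))) \<longlonglongrightarrow> ennreal (1 ^ CARD('n))"
      by (rule tendsto_ennrealI)
    then have "(\<lambda>k. ennreal (((real k + C) / (real k - C) * (1 + C / real k)) ^ CARD('n)) * emeasure lborel J)
        \<longlonglongrightarrow> ennreal (1 ^ CARD('n)) * emeasure lborel J"
      by (rule tendsto_mult_ennreal) (auto simp: dual.emeasure_K_finite less_imp_neq)
    then show "(\<lambda>k. ennreal (((real k + C) / (real k - C) * (1 + C / real k)) ^ CARD('n)) * emeasure lborel J)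
        \<longlonglongrightarrow> emeasure lborel J" by simp
  qed simp
  finally show ?thesis .
qed

text \<open>If the Hessian \<open>M\<close> is invertible, the image of the ball of radius
  \<open>1 / k\<close> about \<open>x\<close> contains the ellipsoid that \<open>M\<close> makes of
  a ball with radius smaller by the factor \<open>1 - \<epsilon>\<close>, so the ratio is at least
  \<open>(1 - \<epsilon>) ^ n * det M\<close>.\<close>

lemma curvature_density_le_lower_image_ratio:
  assumes x: "x \<in> frontier K"
  shows "ennreal (curvature_density x) \<le> lower_image_ratio x"
proof (cases "curvature_density x = 0")
  case False
  then obtain M y where M: "symmetric_form M" "second_order energy x y M" "dual_rel K J x y" "det M = curvature_density x"
    using curvature_density_cases[OF x] by blast
  have det: "det M \<noteq> 0" using M(4) False by simp
  have det0: "0 \<le> det M" using M(4) curvature_density_nonneg[OF x] by simp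
  have sx: "supp J x = 1" using x by (simp only: frontier_K_iff)
  let ?n = "CARD('n)"
  have step: "ennreal ((1 - \<epsilon>) ^ ?n * det M) \<le> lower_image_ratio x" if \<epsilon>: "0 < \<epsilon>" "\<epsilon> < 1" for \<epsilon> :: real
  proof -
    obtain r0 where r0: "r0 > 0" "\<And>r w. 0 < r \<Longrightarrow> r \<le> r0 \<Longrightarrow> norm w \<le> (1 - \<epsilon>) * r \<Longrightarrow>
        \<exists>z. norm (z - x) < r \<and> dual_rel K J z (y + M *v w)"
      using dual_image_contains_ellipsoid[OF M(1,2,3) det \<epsilon>] by blast
    have ev: "eventually (\<lambda>k. 0 < 1 / real k \<and> 1 / real k \<le> r0) sequentially"
      by (intro eventually_conj; use r0(1) in real_asymp)
    show ?thesis unfolding lower_image_ratio_def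
    proof (rule Liminf_bounded, rule eventually_mono[OF ev])
      fix k assume k: "0 < 1 / real k \<and> 1 / real k \<le> r0"
      let ?r = "(1 - \<epsilon>) * (1 / real k)"
      have r: "0 < ?r" using k \<epsilon> by (intro mult_pos_pos) auto
      have sub: "(+) y ` ((*v) M ` cball 0 ?r) \<subseteq> {y. near_rel k x y}"
      proof
        fix v assume "v \<in> (+) y ` ((*v) M ` cball 0 ?r)"
        then obtain w where w: "norm w \<le> ?r" "v = y + M *v w" by auto
        obtain z where "norm (z - x) < 1 / real k" "dual_rel K J z v"
          using r0(2)[of "1 / real k" w] w k by blast
        then show "v \<in> {y. near_rel k x y}" unfolding near_rel_def using sx by auto
      qed
      have cM: "compact ((*v) M ` cball 0 ?r)"
        by (intro compact_continuous_image linear_continuous_on) (auto simp: linear_linear)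
      have "ennreal (det M * (unit_ball_vol (real ?n) * ?r ^ ?n)) = ennreal \<bar>det M\<bar> * emeasure lborel (cball (0 :: real^'n) ?r)"
        using r det0 by (subst emeasure_cball) (simp_all add: ennreal_mult)
      also have "\<dots> = emeasure lborel ((*v) M ` cball 0 ?r)"
        by (rule emeasure_matrix_image[symmetric]) simp
      also have "\<dots> = emeasure lborel ((+) y ` ((*v) M ` cball 0 ?r))"
        using emeasure_lebesgue_affine[of 1 y "(*v) M ` cball 0 ?r"] cM
          compact_translation[OF cM, of y] by (simp add: borel_compact add.commute)
      also have "\<dots> \<le> emeasure lborel {y. near_rel k x y}"
        using near_rel_section_sets by (intro emeasure_mono[OF sub]) simp
      finally have "ennreal (ball_weight k x) * ennreal (det M * (unit_ball_vol (real ?n) * ?r ^ ?n)) \<le> image_ratio k x"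
        unfolding image_ratio_eq by (rule mult_left_mono) simp
      also have "ennreal (ball_weight k x) * ennreal (det M * (unit_ball_vol (real ?n) * ?r ^ ?n))
          = ennreal (ball_weight k x * (det M * (unit_ball_vol (real ?n) * ?r ^ ?n)))"
        using det0 r ball_weight_nonneg by (intro ennreal_mult[symmetric] mult_nonneg_nonneg) auto
      also have "ball_weight k x * (det M * (unit_ball_vol (real ?n) * ?r ^ ?n)) = (1 - \<epsilon>) ^ ?n * det M"
      proof -
        have u: "unit_ball_vol (real ?n) \<noteq> 0" by (simp add: less_imp_neq[symmetric])
        have c: "0 < real k" using k by (simp add: zero_less_divide_iff)
        show ?thesis unfolding ball_weight_def sx power_mult_distrib power_divide using u c by (simp add: divide_simps)
      qed
      finally show "ennreal ((1 - \<epsilon>) ^ ?n * det M) \<le> image_ratio k x" .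
    qed
  qed
  have "ennreal (det M) \<le> lower_image_ratio x"
  proof (rule LIMSEQ_le_const2)
    have "(\<lambda>k. (1 - 1 / (real k + 2)) ^ ?n * det M) \<longlonglongrightarrow> (1 ^ ?n) * det M"
      by (intro tendsto_mult tendsto_power tendsto_const) real_asymp
    then show "(\<lambda>k. ennreal ((1 - 1 / (real k + 2)) ^ ?n * det M)) \<longlonglongrightarrow> ennreal (det M)"
      by (intro tendsto_ennrealI) simp
    show "\<exists>N. \<forall>k\<ge>N. ennreal ((1 - 1 / (real k + 2)) ^ ?n * det M) \<le> lower_image_ratio x"
      by (intro exI[of _ 0] allI impI step) (simp_all add: divide_simps)
  qed
  then show ?thesis using M(4) by simp
qed simp

end

section \<open>Bodies with positive curvature\<close>

lemma transpose_of_symmetric_form: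
  assumes "symmetric_form A" shows "transpose A = A"
proof -
  have "transpose A *v w = A *v w" for w
  proof (subst vector_eq_ldot[symmetric], rule allI)
    fix v
    have "v \<bullet> (transpose A *v w) = (w v* A) \<bullet> v" by (simp add: inner_commute)
    also have "\<dots> = w \<bullet> (A *v v)" by (rule dot_lmul_matrix)
    also have "\<dots> = v \<bullet> (A *v w)" using assms by (simp add: symmetric_form_def inner_commute)
    finally show "v \<bullet> (transpose A *v w) = v \<bullet> (A *v w)" .
  qed
  then show ?thesis by (simp add: matrix_eq)
qed

context polar_pair
begin

interpretation dual: polar_pair J K
  by (rule polar_pair_sym) (rule polar_pair_axioms)

text \<open>\<open>energy\<close> is homogeneous of degree 2, so its gradient scales linearly and
  its Hessian is constant along rays; this extends expansions from the boundary to all nonzero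
  points.\<close>

lemma second_order_energy_scale:
  assumes M: "second_order energy x y M" and t: "0 < t"
  shows "second_order energy (t *\<^sub>R x) (t *\<^sub>R y) M"
  unfolding second_order_def
proof (intro allI impI)
  fix e :: real assume "0 < e"
  then obtain d where d: "d > 0" "\<And>w. norm w \<le> d \<Longrightarrow> \<bar>energy (x + w) - energy x - y \<bullet> w - w \<bullet> (M *v w) / 2\<bar> \<le> e * (norm w)\<^sup>2"
    using M unfolding second_order_def by blast
  have sc: "energy (t *\<^sub>R v) = t\<^sup>2 * energy v" for v
    using t by (simp add: energy_def supp_scale power_mult_distrib)
  have "\<bar>energy (t *\<^sub>R x + w) - energy (t *\<^sub>R x) - (t *\<^sub>R y) \<bullet> w - w \<bullet> (M *v w) / 2\<bar> \<le> e * (norm w)\<^sup>2"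
    if w: "norm w \<le> t * d" for w
  proof -
    define v where "v = (1 / t) *\<^sub>R w"
    have wv: "w = t *\<^sub>R v" using t by (simp add: v_def)
    have "norm v \<le> d" using w t by (simp add: wv)
    then have "t\<^sup>2 * \<bar>energy (x + v) - energy x - y \<bullet> v - v \<bullet> (M *v v) / 2\<bar> \<le> t\<^sup>2 * (e * (norm v)\<^sup>2)"
      by (intro mult_left_mono d(2)) auto
    moreover have "\<bar>energy (t *\<^sub>R x + w) - energy (t *\<^sub>R x) - (t *\<^sub>R y) \<bullet> w - w \<bullet> (M *v w) / 2\<bar>
        = \<bar>t\<^sup>2 * (energy (x + v) - energy x - y \<bullet> v - v \<bullet> (M *v v) / 2)\<bar>"
    proof -
      have "t *\<^sub>R x + w = t *\<^sub>R (x + v)" by (simp add: wv scaleR_add_right)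
      then have "energy (t *\<^sub>R x + w) = t\<^sup>2 * energy (x + v)" by (simp only: sc)
      then show ?thesis by (simp add: sc) (simp add: wv matrix_vector_mult_scaleR power2_eq_square algebra_simps)
    qed
    ultimately show ?thesis using t by (simp add: abs_mult wv power_mult_distrib mult_ac)
  qed
  then show "\<exists>d>0. \<forall>w. norm w \<le> d \<longrightarrow>
      \<bar>energy (t *\<^sub>R x + w) - energy (t *\<^sub>R x) - (t *\<^sub>R y) \<bullet> w - w \<bullet> (M *v w) / 2\<bar> \<le> e * (norm w)\<^sup>2"
    using t d(1) by (intro exI[of _ "t * d"]) auto
qed

lemma energy_fenchel: "x \<bullet> y \<le> energy x + dual.energy y"
  using fenchel_young by (simp add: energy_def dual.energy_def)

lemma energy_fenchel_eq: "dual_rel K J x y \<Longrightarrow> x \<bullet> y = energy x + dual.energy y"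
  by (simp only: dual_rel_iff_fenchel energy_def dual.energy_def)

text \<open>
  The energy of \<open>J\<close> is the Legendre transform of the energy of \<open>K\<close>: testing with \<open>x + N v\<close>, where \<open>N\<close> inverts \<open>M\<close>, gives the
  lower bound, and the upper bound needs the maximiser for \<open>y + v\<close> to be within \<open>O(|v|)\<close> of \<open>x\<close>.
\<close>

lemma second_order_dual:
  assumes M: "symmetric_form M" "second_order energy x y M" "dual_rel K J x y" and det: "det M \<noteq> 0"
  shows "\<exists>N. symmetric_form N \<and> second_order dual.energy y x N"
proof -
  obtain N where N: "M ** N = mat 1" "N ** M = mat 1"
    using det unfolding invertible_det_nz[symmetric] invertible_def by blast
  have MN: "M *v (N *v v) = v" for v using N(1) by (simp add: matrix_vector_mul_assoc)
  have NM: "N *v (M *v v) = v" for v using N(2) by (simp add: matrix_vector_mul_assoc)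
  have sym: "symmetric_form N"
    unfolding symmetric_form_def
  proof (intro allI)
    fix v w
    have "(N *v v) \<bullet> (M *v (N *v w)) = (M *v (N *v v)) \<bullet> (N *v w)"
      using M(1) unfolding symmetric_form_def by blast
    then show "v \<bullet> (N *v w) = (N *v v) \<bullet> w" by (simp add: MN)
  qed
  \<comment> \<open>With \<open>\<epsilon> = 1/2\<close> the partner of \<open>y + M *v w\<close> is
    found within \<open>2 * norm w\<close> of \<open>x\<close>, the linear control needed for the
    upper bound.\<close>
  obtain r0 where r0: "r0 > 0" "\<And>r w. 0 < r \<Longrightarrow> r \<le> r0 \<Longrightarrow> norm w \<le> (1 - 1/2) * r \<Longrightarrow>
        \<exists>z. norm (z - x) < r \<and> dual_rel K J z (y + M *v w)"
    using dual_image_contains_ellipsoid[OF M det, of "1/2"] by auto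
  obtain b where b: "b > 0" "\<And>v. norm (N *v v) \<le> b * norm v" using matrix_norm_bound by blast
  have "\<exists>d>0. \<forall>v. norm v \<le> d \<longrightarrow>
      \<bar>dual.energy (y + v) - dual.energy y - x \<bullet> v - v \<bullet> (N *v v) / 2\<bar> \<le> e * (norm v)\<^sup>2" if e: "0 < e" for e
  proof -
    \<comment> \<open>The displacements used are at most \<open>2 * norm w\<close>, hence at most
      \<open>2 * b * norm v\<close>, so the primal error becomes
      \<open>e * (norm v)\<^sup>2\<close>.\<close>
    define e' where "e' = e / (4 * b\<^sup>2)"
    have e': "0 < e'" using e b by (simp add: e'_def)
    obtain d0 where d0: "d0 > 0" "\<And>w. norm w \<le> d0 \<Longrightarrow> \<bar>energy (x + w) - energy x - y \<bullet> w - w \<bullet> (M *v w) / 2\<bar> \<le> e' * (norm w)\<^sup>2"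
      using M(2) e' unfolding second_order_def by blast
    define d where "d = min d0 r0 / (2 * b)"
    have d: "0 < d" using d0(1) r0(1) b(1) by (simp add: d_def)
    have "\<bar>dual.energy (y + v) - dual.energy y - x \<bullet> v - v \<bullet> (N *v v) / 2\<bar> \<le> e * (norm v)\<^sup>2"
      if v: "norm v \<le> d" for v
    proof (cases "v = 0")
      case False
      define w where "w = N *v v"
      have Mw: "M *v w = v" by (simp add: w_def MN)
      have "w \<noteq> 0" using False Mw by auto
      have nw: "norm w \<le> b * norm v" using b(2) by (simp add: w_def)
      also have "\<dots> \<le> b * d" using v b(1) by (intro mult_left_mono) auto
      finally have nwd: "2 * norm w \<le> min d0 r0" using b(1) by (simp add: d_def)
      have sq: "4 * (e' * (norm w)\<^sup>2) \<le> e * (norm v)\<^sup>2"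
      proof -
        have "(norm w)\<^sup>2 \<le> (b * norm v)\<^sup>2" using nw by (intro power_mono) auto
        then have "4 * (e' * (norm w)\<^sup>2) \<le> 4 * (e' * (b * norm v)\<^sup>2)" using e' by (intro mult_left_mono) auto
        also have "\<dots> = e * (norm v)\<^sup>2" using b(1) by (simp add: e'_def power_mult_distrib)
        finally show ?thesis .
      qed
      have fe: "x \<bullet> y = energy x + dual.energy y" by (rule energy_fenchel_eq[OF M(3)])
      have "norm w \<le> d0" using nwd norm_ge_zero[of w] by linarith
      note 1 = abs_le_D1[OF d0(2)[OF this]]
      have "(x + w) \<bullet> (y + v) \<le> energy (x + w) + dual.energy (y + v)" by (rule energy_fenchel)
      moreover have "(x + w) \<bullet> (y + v) = x \<bullet> y + x \<bullet> v + y \<bullet> w + v \<bullet> w"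
        by (simp add: inner_add_left inner_add_right inner_commute)
      moreover have "w \<bullet> (M *v w) = v \<bullet> w" by (simp add: Mw inner_commute)
      moreover have "0 \<le> e' * (norm w)\<^sup>2" using e' by simp
      ultimately have low: "- (e * (norm v)\<^sup>2) \<le> dual.energy (y + v) - dual.energy y - x \<bullet> v - v \<bullet> w / 2"
        using 1 fe sq by linarith
      have "0 < 2 * norm w" "2 * norm w \<le> r0" "norm w \<le> (1 - 1/2) * (2 * norm w)"
        using \<open>w \<noteq> 0\<close> nwd by auto
      from r0(2)[OF this] obtain z where z: "norm (z - x) < 2 * norm w" "dual_rel K J z (y + M *v w)" by blast
      define u where "u = z - x"
      have zu: "z = x + u" by (simp add: u_def)
      have nu: "norm u < 2 * norm w" using z(1) by (simp add: u_def)
      have "norm u \<le> d0" using nu nwd by linarith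
      note 2 = abs_le_D2[OF d0(2)[OF this]]
      have "(norm u)\<^sup>2 \<le> (2 * norm w)\<^sup>2" using nu by (intro power_mono) auto
      then have "e' * (norm u)\<^sup>2 \<le> e' * (2 * norm w)\<^sup>2" using e' by (intro mult_left_mono) auto
      then have ue: "e' * (norm u)\<^sup>2 \<le> e * (norm v)\<^sup>2" using sq by (simp add: power_mult_distrib)
      have "(x + u) \<bullet> (y + v) = energy (x + u) + dual.energy (y + v)"
        using energy_fenchel_eq[OF z(2)] by (simp add: zu Mw)
      moreover have "(x + u) \<bullet> (y + v) = x \<bullet> y + x \<bullet> v + y \<bullet> u + v \<bullet> u"
        by (simp add: inner_add_left inner_add_right inner_commute)
      \<comment> \<open>Completing the square: \<open>v \<bullet> u\<close> minus half the form at
        \<open>u\<close> is at most \<open>v \<bullet> w / 2\<close>, with equality at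
        \<open>u = w\<close>.\<close>
      moreover have "0 \<le> (u - w) \<bullet> (M *v (u - w))" by (rule second_order_psd[OF M(2,3)])
      moreover have "(u - w) \<bullet> (M *v (u - w)) = u \<bullet> (M *v u) - 2 * (v \<bullet> u) + v \<bullet> w"
      proof -
        have "w \<bullet> (M *v u) = (M *v w) \<bullet> u" using M(1) unfolding symmetric_form_def by blast
        then show ?thesis by (simp add: matrix_vector_mult_diff_distrib inner_diff_left inner_diff_right Mw inner_commute)
      qed
      ultimately have "dual.energy (y + v) - dual.energy y - x \<bullet> v - v \<bullet> w / 2 \<le> e * (norm v)\<^sup>2"
        using 2 fe ue by linarith
      then show ?thesis using low unfolding w_def by (simp add: abs_le_iff)
    qed simp
    then show ?thesis using d by blast
  qed
  then show ?thesis using sym unfolding second_order_def by blast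
qed

text \<open>Converse of \<open>curvature_matrix_second_order\<close>. \<open>K\<close> is the
  sublevel set of \<open>energy\<close> at \<open>1 / 2\<close>, and along
  \<open>x + h - t *\<^sub>R u\<close> the energy is
  \<open>1 / 2 - t / s + h \<bullet> (M *v h) / 2\<close> up to small terms. The boundary therefore
  sits at depth \<open>s\<close> times half the form.\<close>

lemma curvature_matrix_exists:
  assumes x: "x \<in> frontier K" and M: "symmetric_form M" "second_order energy x y M" "dual_rel K J x y"
  shows "\<exists>A. is_curvature_matrix K x A"
proof -
  define u where "u = outer_normal K x"
  define s where "s = x \<bullet> u"
  have s: "0 < s" using outer_normal_dual(1)[OF x] by (simp add: s_def u_def)
  have "is_outer_normal K x u" using outer_normal_spec[OF x] by (simp add: u_def)
  then have nu: "norm u = 1" and un: "\<And>z. z \<in> K \<Longrightarrow> u \<bullet> (z - x) \<le> 0" by (auto simp: is_outer_normal_def)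
  have uu: "u \<bullet> u = 1" using nu by (simp add: dot_square_norm)
  have y: "y = (1 / s) *\<^sub>R u"
    using second_order_gradient_unique[OF M(2) outer_normal_dual(2)[OF x]] by (simp add: s_def u_def)
  define P where "P v = v - (u \<bullet> v) *\<^sub>R u" for v
  \<comment> \<open>The tangential compression of \<open>M\<close>, multiplied by \<open>s\<close>
    and extended by the identity on the line of \<open>u\<close>, as a curvature matrix
    requires.\<close>
  define A where "A = matrix (\<lambda>v. s *\<^sub>R P (M *v P v) + (u \<bullet> v) *\<^sub>R u)"
  have Padd: "P (v + w) = P v + P w" and Psc: "P (c *\<^sub>R v) = c *\<^sub>R P v" for v w and c :: real
    by (simp_all add: P_def inner_add_right algebra_simps)
  have lin: "linear (\<lambda>v. s *\<^sub>R P (M *v P v) + (u \<bullet> v) *\<^sub>R u)"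
    by (intro linearI) (simp_all add: Padd Psc matrix_vector_right_distrib matrix_vector_mult_scaleR
        inner_add_right algebra_simps)
  have Av: "A *v v = s *\<^sub>R P (M *v P v) + (u \<bullet> v) *\<^sub>R u" for v
    unfolding A_def using lin by (simp add: matrix_works)
  have Psym: "P v \<bullet> w = v \<bullet> P w" for v w
    by (simp add: P_def inner_diff_left inner_diff_right inner_commute)
  have "symmetric_form A"
    unfolding symmetric_form_def
  proof (intro allI)
    fix v w
    have "P v \<bullet> (M *v P w) = (M *v P v) \<bullet> P w" using M(1) unfolding symmetric_form_def by blast
    then show "v \<bullet> (A *v w) = (A *v v) \<bullet> w"
      by (simp add: Av inner_add_left inner_add_right Psym[symmetric]) (simp add: Psym inner_commute)
  qed
  then have tA: "transpose A = A" by (rule transpose_of_symmetric_form)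
  have Pu: "P u = 0" by (simp add: P_def uu)
  have Au: "A *v u = u" by (simp add: Av Pu uu P_def)
  have Ah: "(A *v h) \<bullet> h = s * (h \<bullet> (M *v h))" if "u \<bullet> h = 0" for h
  proof -
    have "P h = h" using that by (simp add: P_def)
    then show ?thesis using that Psym[of "M *v h" h] by (simp add: Av inner_commute)
  qed
  define T where "T h = {t. x + h - t *\<^sub>R u \<in> K}" for h
  \<comment> \<open>A junk value where \<open>T h\<close> is empty; \<open>key\<close> shows that
    this does not happen for small tangential \<open>h\<close>. The infimum is attained because
    \<open>T h\<close> is closed and bounded below by 0.\<close>
  define f where "f h = Inf (T h)" for h
  have T0: "0 \<le> t" if "t \<in> T h" "u \<bullet> h = 0" for t h
    using un[of "x + h - t *\<^sub>R u"] that by (simp add: T_def inner_diff_right inner_add_right uu)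
  have clT: "closed (T h)" for h
  proof -
    have "T h = (\<lambda>t. x + h - t *\<^sub>R u) -` K" by (auto simp: T_def)
    moreover have "continuous_on UNIV (\<lambda>t. x + h - t *\<^sub>R u)" by (intro continuous_intros)
    ultimately show ?thesis using compact_imp_closed[OF compact_K] continuous_closed_vimage
      by (metis continuous_on_eq_continuous_at open_UNIV UNIV_I)
  qed
  have inK: "z \<in> K \<longleftrightarrow> energy z \<le> 1 / 2" for z
  proof -
    have "(supp J z)\<^sup>2 \<le> 1\<^sup>2 \<longleftrightarrow> supp J z \<le> 1" using supp_nonneg[of z] by (subst power_mono_iff) auto
    then show ?thesis by (simp add: mem_K_iff energy_def)
  qed
  have ex: "energy x = 1 / 2" using x by (simp add: frontier_K_iff energy_def)
  have key: "\<exists>d>0. \<forall>h. u \<bullet> h = 0 \<and> norm h \<le> d \<longrightarrow> T h \<noteq> {} \<and> \<bar>f h - (A *v h) \<bullet> h / 2\<bar> \<le> e * (norm h)\<^sup>2"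
    if e: "0 < e" for e
  proof -
    obtain a where a: "a > 0" "\<And>v. norm (M *v v) \<le> a * norm v" using matrix_norm_bound by blast
    have bil: "\<bar>v \<bullet> (M *v w)\<bar> \<le> a * norm v * norm w" for v w
    proof -
      have "\<bar>v \<bullet> (M *v w)\<bar> \<le> norm v * norm (M *v w)" by (rule Cauchy_Schwarz_ineq2)
      also have "\<dots> \<le> norm v * (a * norm w)" by (intro mult_left_mono a) auto
      finally show ?thesis by (simp add: mult_ac)
    qed
    \<comment> \<open>Covers every relevant depth: \<open>s * q + e * n2\<close> is at most
      \<open>B * n2\<close>.\<close>
    define B where "B = s * a / 2 + e"
    have B: "0 < B" using s a e by (simp add: B_def add_pos_pos)
    define e1 where "e1 = e / (16 * s)"
    have e1: "0 < e1" using e s by (simp add: e1_def)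
    obtain d1 where d1: "d1 > 0" "\<And>w. norm w \<le> d1 \<Longrightarrow> \<bar>energy (x + w) - energy x - y \<bullet> w - w \<bullet> (M *v w) / 2\<bar> \<le> e1 * (norm w)\<^sup>2"
      using M(2) e1 unfolding second_order_def by blast
    \<comment> \<open>The second entry yields \<open>t \<le> norm h\<close>; the third keeps the
      effect on the quadratic form of replacing \<open>h\<close> by \<open>h - t *\<^sub>R u\<close>
      below \<open>e / (2 * s) * (norm h)\<^sup>2\<close>.\<close>
    define d where "d = min (d1 / 2) (min (1 / B) (e / (6 * s * a * B)))"
    have d: "0 < d" "d \<le> d1 / 2" "d \<le> 1 / B" "d \<le> e / (6 * s * a * B)"
      unfolding d_def using d1(1) B e s a(1) by simp_all
    have main: "\<bar>energy (x + h - t *\<^sub>R u) - (1 / 2 - t / s + h \<bullet> (M *v h) / 2)\<bar> \<le> e / (2 * s) * (norm h)\<^sup>2"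
      if h: "u \<bullet> h = 0" "norm h \<le> d" and t: "0 \<le> t" "t \<le> B * (norm h)\<^sup>2" for h t
    proof -
      define n where "n = norm h"
      have n: "0 \<le> n" "n \<le> d" using h(2) by (auto simp: n_def)
      have "n \<le> 1 / B" using n(2) d(3) by linarith
      then have Bn: "B * n \<le> 1" using B by (simp add: field_simps)
      have tn: "t \<le> n"
      proof -
        have "B * n\<^sup>2 = (B * n) * n" by (simp add: power2_eq_square)
        also have "\<dots> \<le> 1 * n" using Bn n by (intro mult_right_mono) auto
        finally show ?thesis using t(2) by (simp add: n_def)
      qed
      define w where "w = h - t *\<^sub>R u"
      have nw: "norm w \<le> 2 * n"
        using norm_triangle_ineq4[of h "t *\<^sub>R u"] tn t(1) nu by (simp add: w_def n_def)
      have "norm w \<le> d1" using nw n(2) d(2) by linarith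
      from d1(2)[OF this] have 1: "\<bar>energy (x + w) - 1/2 - y \<bullet> w - w \<bullet> (M *v w) / 2\<bar> \<le> e1 * (norm w)\<^sup>2" by (simp add: ex)
      have "(norm w)\<^sup>2 \<le> (2 * n)\<^sup>2" using nw by (intro power_mono) auto
      then have "e1 * (norm w)\<^sup>2 \<le> e1 * (2 * n)\<^sup>2" using e1 by (intro mult_left_mono) auto
      then have 2: "e1 * (norm w)\<^sup>2 \<le> e / (4 * s) * n\<^sup>2" using s by (simp add: e1_def power_mult_distrib)
      have yw: "y \<bullet> w = - t / s" by (simp add: y w_def inner_diff_right h(1) uu)
      have "h \<bullet> (M *v u) = (M *v h) \<bullet> u" using M(1) unfolding symmetric_form_def by blast
      then have "w \<bullet> (M *v w) - h \<bullet> (M *v h) = t\<^sup>2 * (u \<bullet> (M *v u)) - 2 * (t * (h \<bullet> (M *v u)))"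
        by (simp add: w_def matrix_vector_mult_diff_distrib matrix_vector_mult_scaleR inner_diff_left inner_diff_right
            power2_eq_square inner_commute algebra_simps)
      also have "\<bar>\<dots>\<bar> \<le> t\<^sup>2 * a + 2 * (t * (a * n))"
      proof -
        have "\<bar>t\<^sup>2 * (u \<bullet> (M *v u))\<bar> \<le> t\<^sup>2 * a" using bil[of u u] nu by (simp add: abs_mult mult_left_mono)
        moreover have "\<bar>t * (h \<bullet> (M *v u))\<bar> \<le> t * (a * n)" using bil[of h u] nu t(1) by (simp add: abs_mult mult_left_mono n_def)
        ultimately show ?thesis by linarith
      qed
      also have "\<dots> \<le> 3 * (t * (a * n))"
      proof -
        have "t * t * a \<le> t * n * a" using tn t(1) a(1) by (intro mult_right_mono mult_left_mono) auto
        then show ?thesis by (simp add: power2_eq_square mult_ac)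
      qed
      also have "\<dots> \<le> 3 * ((B * n\<^sup>2) * (a * n))" using t(2) a(1) n(1) by (intro mult_left_mono mult_right_mono) (auto simp: n_def)
      also have "\<dots> = (3 * B * a * n) * n\<^sup>2" by (simp add: mult_ac)
      also have "\<dots> \<le> (e / (2 * s)) * n\<^sup>2"
      proof (rule mult_right_mono)
        have "3 * B * a * n \<le> 3 * B * a * (e / (6 * s * a * B))" using n(2) d(4) B a(1) by (intro mult_left_mono) auto
        also have "\<dots> = e / (2 * s)" using s a(1) B by (simp add: field_simps)
        finally show "3 * B * a * n \<le> e / (2 * s)" .
      qed simp
      finally have 3: "\<bar>w \<bullet> (M *v w) - h \<bullet> (M *v h)\<bar> \<le> e / (2 * s) * n\<^sup>2" .
      have "x + w = x + h - t *\<^sub>R u" by (simp add: w_def)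
      moreover have "e / (4 * s) * n\<^sup>2 + (e / (2 * s) * n\<^sup>2) / 2 = e / (2 * s) * n\<^sup>2" using s by (simp add: field_simps)
      moreover have "\<bar>E - (1 / 2 + - ts + hh / 2)\<bar> \<le> q2"
        if "\<bar>E - 1/2 - - ts - ww / 2\<bar> \<le> p" "p \<le> q1" "\<bar>ww - hh\<bar> \<le> q2" "q1 + q2 / 2 = q2" for E ts hh ww p q1 q2 :: real
        using that by argo
      ultimately have "\<bar>energy (x + w) - (1 / 2 + - (t / s) + h \<bullet> (M *v h) / 2)\<bar> \<le> e / (2 * s) * n\<^sup>2"
        using 1 2 3 unfolding yw minus_divide_left[symmetric] by blast
      then show ?thesis using \<open>x + w = _\<close> by (simp add: n_def)
    qed
    have "T h \<noteq> {} \<and> \<bar>f h - (A *v h) \<bullet> h / 2\<bar> \<le> e * (norm h)\<^sup>2" if h: "u \<bullet> h = 0" "norm h \<le> d" for h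
    proof -
      define n2 where "n2 = (norm h)\<^sup>2"
      define q where "q = h \<bullet> (M *v h) / 2"
      have n2: "0 \<le> n2" by (simp add: n2_def)
      have q0: "0 \<le> q" using second_order_psd[OF M(2,3)] by (simp add: q_def)
      have q1: "q \<le> a / 2 * n2" using bil[of h h] by (simp add: q_def n2_def power2_eq_square)
      have sq: "s * q \<le> s * (a / 2 * n2)" using q1 s by (intro mult_left_mono) auto
      define t1 where "t1 = s * q + e * n2"
      have t1: "0 \<le> t1" "t1 \<le> B * n2" using q0 s e n2 sq by (simp_all add: t1_def B_def algebra_simps)
      have c: "e / (2 * s) * n2 * s = e * n2 / 2" using s by simp
      have "energy (x + h - t1 *\<^sub>R u) \<le> 1 / 2 - t1 / s + q + e / (2 * s) * n2"
        using abs_le_D1[OF main[OF h t1[unfolded n2_def]]] by (simp add: q_def n2_def)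
      also have "\<dots> = 1 / 2 - e * n2 / (2 * s)" using s by (simp add: t1_def field_simps)
      also have "\<dots> \<le> 1 / 2" using s e n2 by simp
      finally have t1T: "t1 \<in> T h" by (simp add: T_def inK)
      have low: "s * q - e * n2 \<le> t" if t: "t \<in> T h" for t
      proof (rule ccontr)
        assume lt: "\<not> ?thesis"
        have t0: "0 \<le> t" using T0[OF t h(1)] .
        have "t \<le> B * n2" using lt t1(2) e n2 mult_nonneg_nonneg[of e n2] unfolding t1_def by linarith
        from abs_le_D2[OF main[OF h t0 this[unfolded n2_def]]]
        have "1 / 2 - t / s + q - e / (2 * s) * n2 \<le> energy (x + h - t *\<^sub>R u)" by (simp add: q_def n2_def)
        also have "\<dots> \<le> 1 / 2" using t by (simp add: T_def inK)
        finally have "q - e / (2 * s) * n2 \<le> t / s" by linarith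
        then have "(q - e / (2 * s) * n2) * s \<le> t / s * s" using s by (intro mult_right_mono) auto
        then have "q * s - e / (2 * s) * n2 * s \<le> t" using s unfolding left_diff_distrib by simp
        then have "0 \<le> - (e * n2 / 2)" "q * s - e * n2 \<noteq> t" using lt unfolding c by (simp_all add: mult.commute)
        moreover have "0 \<le> e * n2" using e n2 by simp
        ultimately show False using lt \<open>q * s - _ \<le> t\<close> unfolding c by (simp add: mult.commute)
      qed
      have "bdd_below (T h)" using low by (rule bdd_belowI)
      then have "f h \<le> t1" unfolding f_def using t1T by (intro cInf_lower)
      moreover have "s * q - e * n2 \<le> f h" unfolding f_def using t1T low by (intro cInf_greatest) auto
      moreover have "(A *v h) \<bullet> h / 2 = s * q" using Ah[OF h(1)] by (simp add: q_def)
      ultimately show ?thesis using t1T unfolding t1_def n2_def by (auto simp: abs_le_iff)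
    qed
    then show ?thesis using d(1) by blast
  qed
  let ?T = "at 0 within {h. u \<bullet> h = 0}"
  have "eventually (\<lambda>h. x + h - f h *\<^sub>R u \<in> K \<and> (\<forall>t < f h. x + h - t *\<^sub>R u \<notin> K)) ?T"
  proof -
    obtain d where d: "d > 0" "\<And>h. u \<bullet> h = 0 \<Longrightarrow> norm h \<le> d \<Longrightarrow> T h \<noteq> {}" using key[of 1] by auto
    have "x + h - f h *\<^sub>R u \<in> K \<and> (\<forall>t < f h. x + h - t *\<^sub>R u \<notin> K)" if h: "u \<bullet> h = 0" "norm h \<le> d" for h
    proof -
      have bb: "bdd_below (T h)" using T0 h(1) by (intro bdd_belowI[of _ 0])
      have "f h \<in> T h" unfolding f_def using d(2)[OF h] bb clT by (rule closed_contains_Inf)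
      moreover have "t \<notin> T h" if "t < f h" for t using that cInf_lower[OF _ bb, of t] unfolding f_def by force
      ultimately show ?thesis unfolding T_def by blast
    qed
    then show ?thesis unfolding eventually_at using d(1) by (intro exI[of _ d]) (auto simp: dist_norm)
  qed
  moreover have "((\<lambda>h. (f h - (A *v h) \<bullet> h / 2) / (norm h)\<^sup>2) \<longlongrightarrow> 0) ?T"
  proof (rule tendstoI)
    fix e :: real assume e: "0 < e"
    obtain d where d: "d > 0" "\<And>h. u \<bullet> h = 0 \<Longrightarrow> norm h \<le> d \<Longrightarrow> \<bar>f h - (A *v h) \<bullet> h / 2\<bar> \<le> e / 2 * (norm h)\<^sup>2"
      using key[of "e / 2"] e by auto
    have "dist ((f h - (A *v h) \<bullet> h / 2) / (norm h)\<^sup>2) 0 < e" if h: "u \<bullet> h = 0" "norm h \<le> d" "h \<noteq> 0" for h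
    proof -
      have "0 < (norm h)\<^sup>2" using h(3) by simp
      then have "\<bar>f h - (A *v h) \<bullet> h / 2\<bar> / (norm h)\<^sup>2 \<le> e / 2" using d(2)[OF h(1,2)] by (simp only: pos_divide_le_eq)
      also have "\<dots> < e" using e by simp
      finally show ?thesis by simp
    qed
    then show "eventually (\<lambda>h. dist ((f h - (A *v h) \<bullet> h / 2) / (norm h)\<^sup>2) 0 < e) ?T"
      unfolding eventually_at using d(1) by (intro exI[of _ d]) (auto simp: dist_norm)
  qed
  ultimately have "is_curvature_matrix K x A"
    using tA Au unfolding is_curvature_matrix_def Let_def u_def[symmetric] by blast
  then show ?thesis by blast
qed

end

section \<open>The gradient map when curvature matrices exist everywhere\<close>

context polar_pair
begin

interpretation dual: polar_pair J K
  by (rule polar_pair_sym) (rule polar_pair_axioms)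

text \<open>The regularity assumption concerns \<open>K\<close> alone. Positive curvature at the
  partner \<open>x\<close> makes the Hessian there invertible, so the Legendre transform has an
  expansion at \<open>y\<close>, and this is turned back into a curvature matrix of
  \<open>J\<close>.\<close>

lemma curvature_matrix_exists_dual:
  assumes pos: "\<And>x. x \<in> frontier K \<Longrightarrow> gauss_curvature K x > 0" and y: "y \<in> frontier J"
  shows "\<exists>A. is_curvature_matrix J y A"
proof -
  obtain x where "dual_rel J K y x" using dual.dual_rel_exists by blast
  then have xy: "dual_rel K J x y" by (simp only: dual_rel_sym)
  have "supp K y = 1" using y by (simp only: dual.frontier_K_iff)
  then have x: "x \<in> frontier K" using xy by (simp add: frontier_K_iff dual_rel_def)
  have "\<exists>A. is_curvature_matrix K x A" using pos[OF x] by (auto simp: gauss_curvature_def split: if_splits)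
  from curvature_density_second_order[OF x this] obtain M y' where
    M: "symmetric_form M" "dual_rel K J x y'" "second_order energy x y' M" "det M = curvature_density x" by blast
  have y': "y = y'" using second_order_gradient_unique[OF M(3) xy] .
  have "0 < curvature_density x" using pos[OF x] outer_normal_dual(1)[OF x] by (simp add: curvature_density_def)
  then have "det M \<noteq> 0" using M(4) by simp
  then obtain N where "symmetric_form N" "second_order dual.energy y x N"
    using second_order_dual[OF M(1) M(3) M(2)] y' by blast
  then show ?thesis using dual.curvature_matrix_exists[OF y _ _ \<open>dual_rel J K y x\<close>] by blast
qed

text \<open>For \<open>|k| = \<eta> |w|\<close>, comparing the subgradient inequality at \<open>x + w\<close> with the expansion of
  the energy at \<open>x\<close> bounds the gradient increment in the direction \<open>k\<close>.\<close>

lemma gradient_increment: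
  assumes M: "symmetric_form M" "second_order energy x y M" and e: "0 < e"
  shows "\<exists>d>0. \<forall>w z. norm w \<le> d \<and> dual_rel K J (x + w) z \<longrightarrow> norm (z - y - M *v w) \<le> e * norm w"
proof -
  obtain a where a: "a > 0" "\<And>v. norm (M *v v) \<le> a * norm v" using matrix_norm_bound by blast
  \<comment> \<open>Makes the form at \<open>k\<close> at most
    \<open>e * \<eta> * (norm w)\<^sup>2\<close>, while \<open>norm k \<le> norm w\<close> keeps
    \<open>w + k\<close> in the range of the expansion.\<close>
  define \<eta> where "\<eta> = min 1 (e / a)"
  have \<eta>: "0 < \<eta>" "\<eta> \<le> 1" "a * \<eta> \<le> e" using e a(1) by (auto simp: \<eta>_def min_def field_simps)
  \<comment> \<open>The errors at \<open>w\<close> and \<open>w + k\<close> add up to at most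
    \<open>5 * e1 * (norm w)\<^sup>2\<close>, half of the allowance.\<close>
  define e1 where "e1 = e * \<eta> / 10"
  have e1: "0 < e1" using e \<eta> by (simp add: e1_def)
  obtain d1 where d1: "d1 > 0" "\<And>w. norm w \<le> d1 \<Longrightarrow> \<bar>energy (x + w) - energy x - y \<bullet> w - w \<bullet> (M *v w) / 2\<bar> \<le> e1 * (norm w)\<^sup>2"
    using M(2) e1 unfolding second_order_def by blast
  have "norm (z - y - M *v w) \<le> e * norm w" if w: "norm w \<le> d1 / 2" and z: "dual_rel K J (x + w) z" for w z
  proof -
    define p where "p = z - y - M *v w"
    define n where "n = norm w"
    show ?thesis
    proof (cases "p = 0 \<or> w = 0")
      case True
      show ?thesis
      proof (cases "p = 0")
        case True
        then show ?thesis using e by (simp add: p_def)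
      next
        case False
        then have "w = 0" using True by blast
        then show ?thesis using second_order_gradient_unique[OF M(2), of z] z by simp
      qed
    next
      case False
      then have np: "0 < norm p" and n: "0 < n" by (auto simp: n_def)
      define k where "k = (\<eta> * n / norm p) *\<^sub>R p"
      have nk: "norm k = \<eta> * n" using np n \<eta> by (simp add: k_def)
      have pk: "p \<bullet> k = \<eta> * n * norm p" using np by (simp add: k_def dot_square_norm power2_eq_square)
      have nk1: "norm k \<le> n" using nk \<eta> n by (simp add: mult_le_cancel_right1)
      have nwk: "norm (w + k) \<le> 2 * n" using norm_triangle_ineq[of w k] nk1 by (simp add: n_def)
      have "norm w \<le> d1" "norm (w + k) \<le> d1" using w nwk n d1(1) by (auto simp: n_def)
      note 1 = abs_le_D2[OF d1(2)[OF this(1)]] and 2 = abs_le_D1[OF d1(2)[OF this(2)]]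
      have 3: "energy (x + w) + z \<bullet> k \<le> energy (x + (w + k))"
        using energy_subgradient[OF z, of k] by (simp add: add.assoc)
      have zk: "z \<bullet> k = p \<bullet> k + y \<bullet> k + (M *v w) \<bullet> k" by (simp add: p_def inner_diff_left)
      have "w \<bullet> (M *v k) = (M *v w) \<bullet> k" using M(1) unfolding symmetric_form_def by blast
      then have 4: "(w + k) \<bullet> (M *v (w + k)) = w \<bullet> (M *v w) + 2 * ((M *v w) \<bullet> k) + k \<bullet> (M *v k)"
        by (simp add: matrix_vector_right_distrib inner_add_left inner_add_right inner_commute)
      have "k \<bullet> (M *v k) \<le> norm k * norm (M *v k)" by (rule norm_cauchy_schwarz)
      also have "\<dots> \<le> norm k * (a * norm k)" by (intro mult_left_mono a) auto
      also have "\<dots> = (a * \<eta>) * \<eta> * n\<^sup>2" by (simp add: nk power2_eq_square)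
      also have "\<dots> \<le> e * \<eta> * n\<^sup>2" using \<eta> by (intro mult_right_mono) auto
      finally have 5: "k \<bullet> (M *v k) \<le> e * \<eta> * n\<^sup>2" .
      have "(norm (w + k))\<^sup>2 \<le> (2 * n)\<^sup>2" using nwk by (intro power_mono) auto
      then have "e1 * (norm (w + k))\<^sup>2 \<le> e1 * (2 * n)\<^sup>2" using e1 by (intro mult_left_mono) auto
      then have 6: "e1 * (norm (w + k))\<^sup>2 + e1 * n\<^sup>2 \<le> e * \<eta> * n\<^sup>2 / 2"
        by (simp add: e1_def power_mult_distrib) (simp add: mult_ac)
      have "pk \<le> Q"
        if "- (ew - e0 - yw - ww / 2) \<le> q1" "ewk - e0 - (yw + yk) - (ww + 2 * wk + kk) / 2 \<le> q2"
          "ew + (pk + yk + wk) \<le> ewk" "kk \<le> Q" "q2 + q1 \<le> Q / 2" for ew e0 yw ww q1 ewk yk wk kk q2 pk Q :: real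
        using that by argo
      then have "p \<bullet> k \<le> e * \<eta> * n\<^sup>2"
        using 1 2 3 5 6 unfolding zk 4 inner_add_right n_def[symmetric] by blast
      then have "\<eta> * n * norm p \<le> \<eta> * n * (e * n)" by (simp add: pk power2_eq_square mult_ac)
      then have "norm p \<le> e * n" using \<eta>(1) n by (simp add: mult_le_cancel_left_pos)
      then show ?thesis by (simp add: p_def n_def)
    qed
  qed
  then show ?thesis using d1(1) by (intro exI[of _ "d1 / 2"]) auto
qed

text \<open>Expansions at every nonzero point make the partner unique, and by
  \<open>gradient_increment\<close> the resulting map \<open>G\<close> is differentiable with
  derivative \<open>M x\<close>. It carries \<open>K - {0}\<close> onto \<open>J - {0}\<close>, so
  the volume of \<open>J\<close> is at most the integral of the Jacobian.\<close>

lemma polar_volume_le_curvature_integral: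
  assumes ex: "\<And>x. x \<in> frontier K \<Longrightarrow> \<exists>A. is_curvature_matrix K x A"
  shows "\<exists>D. D \<in> borel_measurable borel \<and> (\<forall>x\<in>frontier K. D x = curvature_density x) \<and>
    emeasure lborel J \<le> (\<integral>\<^sup>+x. indicator K x * ennreal (D (rad x)) \<partial>lborel)"
proof -
  have "\<exists>M y. symmetric_form M \<and> dual_rel K J x y \<and> second_order energy x y M \<and> det M = curvature_density (rad x)"
    if x: "x \<noteq> 0" for x
  proof -
    have r: "rad x \<in> frontier K" using x by (rule rad_frontier)
    obtain M y where M: "symmetric_form M" "dual_rel K J (rad x) y" "second_order energy (rad x) y M" "det M = curvature_density (rad x)"
      using curvature_density_second_order[OF r ex[OF r]] by blast
    have t: "0 < supp J x" using x by simp
    have "dual_rel K J x (supp J x *\<^sub>R y)" "second_order energy x (supp J x *\<^sub>R y) M"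
      using dual_rel_scale[OF M(2), of "supp J x"] second_order_energy_scale[OF M(3) t] t
      unfolding rad_inverse by auto
    then show ?thesis using M(1,4) by blast
  qed
  then have "\<forall>x. \<exists>M. x \<noteq> 0 \<longrightarrow> (\<exists>y. symmetric_form M \<and> dual_rel K J x y \<and> second_order energy x y M \<and> det M = curvature_density (rad x))"
    by blast
  then obtain M where "\<forall>x. x \<noteq> 0 \<longrightarrow> (\<exists>y. symmetric_form (M x) \<and> dual_rel K J x y \<and> second_order energy x y (M x) \<and> det (M x) = curvature_density (rad x))"
    by (rule choice[THEN exE])
  then have M0: "\<And>x. x \<noteq> 0 \<Longrightarrow> \<exists>y. symmetric_form (M x) \<and> dual_rel K J x y \<and> second_order energy x y (M x) \<and> det (M x) = curvature_density (rad x)"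
    by blast
  obtain G where G: "\<And>x. dual_rel K J x (G x)" using dual_rel_exists by metis
  have Gu: "z = G x" if "dual_rel K J x z" for x z
  proof (cases "x = 0")
    case True
    then show ?thesis using that G[of x] by (simp add: dual_rel_zero)
  next
    case False
    then obtain y where "second_order energy x y (M x)" using M0 by blast
    then show ?thesis using second_order_gradient_unique that G by blast
  qed
  have M: "symmetric_form (M x)" "second_order energy x (G x) (M x)" "det (M x) = curvature_density (rad x)" if "x \<noteq> 0" for x
    using M0[OF that] Gu[of x] by auto
  have deriv: "(G has_derivative (*v) (M x)) (at x)" if x: "x \<noteq> 0" for x
    unfolding has_derivative_at_alt
  proof (intro conjI allI impI)
    show "bounded_linear ((*v) (M x))" by (simp add: matrix_vector_mul_bounded_linear)
    fix e :: real assume "0 < e"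
    then obtain d where d: "d > 0" "\<And>w z. norm w \<le> d \<Longrightarrow> dual_rel K J (x + w) z \<Longrightarrow> norm (z - G x - M x *v w) \<le> e * norm w"
      using gradient_increment[OF M(1,2)[OF x]] by blast
    have "norm (G v - G x - M x *v (v - x)) \<le> e * norm (v - x)" if "norm (v - x) < d" for v
      using d(2)[of "v - x" "G v"] that G[of v] by simp
    then show "\<exists>d>0. \<forall>v. norm (v - x) < d \<longrightarrow> norm (G v - G x - M x *v (v - x)) \<le> e * norm (v - x)"
      using d(1) by blast
  qed
  have "isCont G x" for x
  proof (cases "x = 0")
    case True
    have G0: "G 0 = 0" using G[of 0] by (simp add: dual_rel_zero)
    obtain C where C: "C > 0" "\<And>x y. dual_rel K J x y \<Longrightarrow> norm y \<le> C * norm x" using dual_rel_norm_bound by blast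
    have "(G \<longlongrightarrow> 0) (at 0)"
    proof (rule Lim_null_comparison)
      show "eventually (\<lambda>x. norm (G x) \<le> C * norm x) (at 0)" using C(2)[OF G] by simp
      have "((\<lambda>x :: real^'n. C * norm x) \<longlongrightarrow> C * norm (0 :: real^'n)) (at 0)" by (intro tendsto_intros)
      then show "((\<lambda>x :: real^'n. C * norm x) \<longlongrightarrow> 0) (at 0)" by simp
    qed
    then show ?thesis using True G0 by (simp add: isCont_def)
  qed (use deriv has_derivative_continuous in blast)
  then have "continuous_on UNIV G" by (simp add: continuous_on_eq_continuous_at)
  then have Gm [measurable]: "G \<in> borel_measurable borel" by (rule borel_measurable_continuous_onI)
  \<comment> \<open>\<open>M\<close> comes from the axiom of choice, but its entries are limits of
    difference quotients of the continuous map \<open>G\<close>.\<close>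
  have entry [measurable]: "(\<lambda>x. if x = 0 then 0 else M x $ i $ j) \<in> borel_measurable borel" for i j
  proof (rule borel_measurable_LIMSEQ_real)
    let ?q = "\<lambda>k x. if x = 0 then 0 else real k * ((G (x + (1 / real k) *\<^sub>R axis j 1) - G x) $ i)"
    have [measurable]: "Measurable.pred borel (\<lambda>x :: real^'n. x = 0)" by (simp add: pred_def)
    have [measurable]: "(\<lambda>v :: real^'n. v $ i) \<in> borel_measurable borel"
      by (intro borel_measurable_continuous_onI continuous_intros)
    show "?q k \<in> borel_measurable borel" for k by measurable
    fix x :: "real^'n"
    show "(\<lambda>k. ?q k x) \<longlonglongrightarrow> (if x = 0 then 0 else M x $ i $ j)"
    proof (cases "x = 0")
      case False
      have "(\<lambda>k. real k * ((G (x + (1 / real k) *\<^sub>R axis j 1) - G x) $ i)) \<longlonglongrightarrow> M x $ i $ j"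
      proof (rule LIMSEQ_I)
        fix r :: real assume r: "0 < r"
        then have "0 < r / 2" by simp
        from gradient_increment[OF M(1,2)[OF False] this] obtain d where
          d: "d > 0" "\<And>w z. norm w \<le> d \<Longrightarrow> dual_rel K J (x + w) z \<Longrightarrow> norm (z - G x - M x *v w) \<le> r / 2 * norm w" by blast
        obtain k0 where k0: "1 / d < real k0" using reals_Archimedean2 by blast
        show "\<exists>k0. \<forall>k\<ge>k0. norm (real k * ((G (x + (1 / real k) *\<^sub>R axis j 1) - G x) $ i) - M x $ i $ j) < r"
        proof (intro exI[of _ k0] allI impI)
          fix k assume "k0 \<le> k"
          then have kd: "1 / d < real k" using k0 by linarith
          have "0 < 1 / d" using d(1) by simp
          then have k: "0 < real k" using kd by linarith
          define w where "w = (1 / real k) *\<^sub>R (axis j 1 :: real^'n)"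
          have nw: "norm w = 1 / real k" using k by (simp add: w_def norm_axis_1)
          have "norm w \<le> d" unfolding nw using kd k d(1) by (simp add: field_simps)
          from d(2)[OF this G] have "norm (G (x + w) - G x - M x *v w) \<le> r / 2 * (1 / real k)" by (simp add: nw)
          then have "\<bar>(G (x + w) - G x - M x *v w) $ i\<bar> \<le> r / 2 * (1 / real k)"
            using component_le_norm_cart order_trans by blast
          then have "real k * \<bar>(G (x + w) - G x - M x *v w) $ i\<bar> \<le> real k * (r / 2 * (1 / real k))"
            using k by (intro mult_left_mono) auto
          also have "\<dots> < r" using k r by simp
          finally have "\<bar>real k * ((G (x + w) - G x - M x *v w) $ i)\<bar> < r" using k by (simp add: abs_mult)
          moreover have "(M x *v w) $ i = M x $ i $ j / real k"
            by (simp add: w_def matrix_vector_mult_scaleR matrix_vector_mult_basis column_def)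
          ultimately show "norm (real k * ((G (x + (1 / real k) *\<^sub>R axis j 1) - G x) $ i) - M x $ i $ j) < r"
            using k by (simp add: w_def[symmetric] right_diff_distrib)
        qed
      qed
      then show ?thesis using False by simp
    qed simp
  qed
  \<comment> \<open>A Borel extension of the curvature density from the boundary, constant along
    rays off the origin.\<close>
  define D where "D x = (if x = 0 then 0 else det (M x))" for x
  have "D = (\<lambda>x. if x = 0 then 0 else (\<Sum>p\<in>{p. p permutes UNIV}. of_int (sign p) * (\<Prod>i\<in>UNIV. if x = 0 then 0 else M x $ i $ p i)))"
    by (simp add: D_def det_def fun_eq_iff)
  also have "\<dots> \<in> borel_measurable borel" by measurable
  finally have Dm [measurable]: "D \<in> borel_measurable borel" .
  have Drad: "D x = curvature_density (rad x)" if "x \<noteq> 0" for x using M(3)[OF that] that by (simp add: D_def)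
  have radf: "rad x = x" if "x \<in> frontier K" for x using that by (simp add: rad_def frontier_K_iff)
  have D: "D x = curvature_density x" if "x \<in> frontier K" for x
    using Drad[of x] radf[OF that] frontier_sub(2)[OF that] by simp
  have im: "G ` (K - {0}) = J - {0}"
  proof (intro set_eqI iffI)
    fix y assume "y \<in> G ` (K - {0})"
    then obtain x where x: "x \<in> K" "x \<noteq> 0" "y = G x" by blast
    have "supp K y = supp J x" using G[of x] x(3) by (simp add: dual_rel_def)
    moreover have "y \<noteq> 0" using G[of x] x dual_rel_zero(2) by metis
    ultimately show "y \<in> J - {0}" using x(1) by (simp add: mem_K_iff dual.mem_K_iff)
  next
    fix y assume y: "y \<in> J - {0}"
    obtain x where "dual_rel J K y x" using dual.dual_rel_exists by blast
    then have x: "dual_rel K J x y" by (simp only: dual_rel_sym)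
    have "supp J x = supp K y" using x by (simp add: dual_rel_def)
    then have "x \<in> K" using y by (simp add: mem_K_iff dual.mem_K_iff)
    moreover have "x \<noteq> 0" using x y dual_rel_zero(1) by auto
    ultimately show "y \<in> G ` (K - {0})" using Gu[OF x] by blast
  qed
  have "emeasure lborel J = emeasure lborel (J - {0})"
    by (rule emeasure_Diff_null_set[symmetric]) (simp_all add: null_sets_def)
  also have "\<dots> = emeasure lborel (G ` (K - {0}))" by (simp only: im)
  also have "\<dots> \<le> (\<integral>\<^sup>+x. indicator (K - {0}) x * ennreal \<bar>det (matrix ((*v) (M x)))\<bar> \<partial>lborel)"
  proof (rule emeasure_differentiable_image)
    show "K - {0} \<in> sets borel" by measurable
    show "(G has_derivative (*v) (M x)) (at x)" if "x \<in> K - {0}" for x using deriv that by blast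
    have "(\<lambda>x. indicator (K - {0}) x * D x) \<in> borel_measurable borel" by measurable
    also have "(\<lambda>x. indicator (K - {0}) x * D x) = (\<lambda>x. indicator (K - {0}) x * det (matrix ((*v) (M x))))"
      by (auto simp: D_def fun_eq_iff indicator_def)
    finally show "(\<lambda>x. indicator (K - {0}) x * det (matrix ((*v) (M x)))) \<in> borel_measurable borel" .
    show "G ` (K - {0}) \<in> sets borel" unfolding im by (rule sets.Diff) simp_all
  qed
  also have "\<dots> \<le> (\<integral>\<^sup>+x. indicator K x * ennreal (D (rad x)) \<partial>lborel)"
  proof (rule nn_integral_mono)
    fix x
    show "indicator (K - {0}) x * ennreal \<bar>det (matrix ((*v) (M x)))\<bar> \<le> indicator K x * ennreal (D (rad x))"
    proof (cases "x \<in> K - {0}")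
      case True
      have r: "rad x \<in> frontier K" using True by (intro rad_frontier) blast
      have "det (M x) = D (rad x)" using True M(3)[of x] D[OF r] by simp
      moreover have "0 \<le> det (M x)" using True M(3)[of x] curvature_density_nonneg[OF r] by simp
      ultimately show ?thesis using True by simp
    qed simp
  qed
  finally show ?thesis using Dm D by blast
qed

end

section \<open>Affine surface area\<close>

text \<open>Young's inequality with weights \<open>a\<close> and \<open>1 - a\<close> for
  \<open>f\<close> and \<open>c\<close>, divided by \<open>c powr (1 - a)\<close>.\<close>

lemma powr_le_tangent:
  assumes f: "0 < f" and c: "0 < c" and a: "0 \<le> a" "a \<le> (1 :: real)"
  shows "f powr a \<le> (1 - a) * c powr a + a * c powr (a - 1) * f"
proof -
  have "f powr a * c powr (1 - a) \<le> a * f + (1 - a) * c"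
    using a f c by (intro Youngs_inequality_0) auto
  then have "f powr a * c powr (1 - a) * c powr (a - 1) \<le> (a * f + (1 - a) * c) * c powr (a - 1)"
    by (rule mult_right_mono) simp
  moreover have "c powr (1 - a) * c powr (a - 1) = 1" using c by (simp add: powr_add[symmetric])
  moreover have "c * c powr (a - 1) = c powr a" using c by (simp add: powr_mult_base)
  ultimately show ?thesis by (simp add: algebra_simps)
qed

lemma tangent_le_powr:
  assumes f: "0 < f" and c: "0 < c" and a: "a < 0 \<or> (1 :: real) < a"
  shows "(1 - a) * c powr a + a * c powr (a - 1) * f \<le> f powr a"
  using a
proof
  assume a: "1 < a"
  have "(f powr a) powr (1 / a) * (c powr a) powr (1 - 1 / a) \<le> 1 / a * f powr a + (1 - 1 / a) * c powr a"
    using a f c by (intro Youngs_inequality_0) auto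
  moreover have "(f powr a) powr (1 / a) = f" using a f by (simp add: powr_powr)
  moreover have "a * (1 - 1 / a) = a - 1" using a by (simp add: field_simps)
  then have "(c powr a) powr (1 - 1 / a) = c powr (a - 1)" by (simp only: powr_powr)
  ultimately have "a * (f * c powr (a - 1)) \<le> a * (1 / a * f powr a + (1 - 1 / a) * c powr a)"
    using a by (intro mult_left_mono) auto
  also have "\<dots> = f powr a + (a - 1) * c powr a" using a by (simp add: field_simps)
  finally show ?thesis by (simp add: algebra_simps)
next
  assume a: "a < 0"
  \<comment> \<open>Young's inequality is applied to \<open>f powr a\<close> and
    \<open>f * c powr (a - 1)\<close> with weights \<open>w\<close> and \<open>1 - w\<close>; this
    weight makes the powers of \<open>f\<close> cancel on the left.\<close>
  define w where "w = 1 / (1 - a)"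
  have w: "0 \<le> w" "w \<le> 1" using a by (auto simp: w_def)
  have aw: "a * w + (1 - w) = 0" "(a - 1) * (1 - w) = a" "(1 - a) * w = 1" "(1 - a) * (1 - w) = - a"
    using a by (auto simp: w_def field_simps)
  have "(f powr a) powr w * (f * c powr (a - 1)) powr (1 - w) \<le> w * f powr a + (1 - w) * (f * c powr (a - 1))"
    using w f c by (intro Youngs_inequality_0) auto
  moreover have "(f powr a) powr w * (f * c powr (a - 1)) powr (1 - w) = f powr (a * w + (1 - w)) * c powr ((a - 1) * (1 - w))"
    using f c by (simp add: powr_mult powr_powr powr_add)
  then have "(f powr a) powr w * (f * c powr (a - 1)) powr (1 - w) = c powr a"
    using f unfolding aw by simp
  ultimately have "(1 - a) * c powr a \<le> (1 - a) * (w * f powr a + (1 - w) * (f * c powr (a - 1)))"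
    using a by (intro mult_left_mono) auto
  also have "\<dots> = ((1 - a) * w) * f powr a + ((1 - a) * (1 - w)) * (f * c powr (a - 1))" by (simp only: distrib_left mult.assoc)
  also have "\<dots> = f powr a - a * (f * c powr (a - 1))" unfolding aw by simp
  finally show ?thesis by (simp add: algebra_simps)
qed

lemma epowr_pos: "0 < x \<Longrightarrow> epowr x a = ennreal (x powr a)"
  by (simp add: epowr_def)

lemma epowr_quotient:
  assumes f: "0 \<le> f" and s: "0 < s" and a: "real (n + 1) * a - b = 1"
  shows "epowr (f * s ^ (n + 1)) a / epowr s b = epowr f a * ennreal s"
\<comment> \<open>For \<open>f = 0\<close> both sides are infinite if \<open>a < 0\<close> and 0 if
  \<open>a > 0\<close>. For \<open>a = 0\<close> the hypothesis gives \<open>b = -1\<close>, and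
  both sides are \<open>s\<close> because the zeroth power of 0 is 1.\<close>
proof (cases "f = 0")
  case True
  have "0 < s powr b" using s by simp
  moreover have "1 / ennreal (s powr b) = ennreal s" if "a = 0"
  proof -
    have "b = -1" using a that by simp
    then show ?thesis using s by (simp add: powr_minus_divide divide_ennreal flip: ennreal_1)
  qed
  ultimately show ?thesis using s True by (auto simp: epowr_def ennreal_top_divide ennreal_top_mult)
next
  case False
  then have fp: "0 < f" using f by simp
  have "(f * s ^ (n + 1)) powr a / s powr b = f powr a * (s powr (real (n + 1) * a) / s powr b)"
    using fp s by (simp only: powr_mult powr_powr powr_realpow[symmetric]) simp
  also have "s powr (real (n + 1) * a) / s powr b = s powr 1" by (simp only: powr_diff[symmetric] a)
  finally have "(f * s ^ (n + 1)) powr a / s powr b = f powr a * s" using s by simp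
  moreover have "0 < f * s ^ (n + 1)" using fp s by simp
  ultimately show ?thesis using fp s
    by (simp add: epowr_pos divide_ennreal ennreal_mult[symmetric] del: power_Suc)
qed

lemma le_of_add_le_ennreal:
  fixes I X :: ennreal
  assumes "ennreal y \<le> I + X" "X \<le> ennreal x" "0 \<le> x"
  shows "ennreal (y - x) \<le> I"
proof -
  have "ennreal y - ennreal x \<le> I"
  proof -
    have "ennreal y \<le> ennreal x + I"
      using assms(1,2) by (metis add.commute add_left_mono order_trans)
    then show ?thesis by (simp add: ennreal_minus_le_iff)
  qed
  then show ?thesis using assms(3) by (simp add: ennreal_minus)
qed

text \<open>Otherwise a hyperplane through the origin has \<open>K\<close> on one side. The
  nonnegative function \<open>a \<bullet> x\<close> then has integral 0 over \<open>K\<close>, so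
  almost all of \<open>K\<close> lies in the hyperplane, against positive volume.\<close>

lemma centroid_zero_interior:
  fixes K :: "(real^'n) set"
  assumes K: "convex_body K" and 0: "centroid K = 0"
  shows "0 \<in> interior K"
proof (rule ccontr)
  assume n0: "0 \<notin> interior K"
  have cK: "compact K" "convex K" and iK: "interior K \<noteq> {}" using K by (auto simp: convex_body_def)
  obtain a where a: "a \<noteq> 0" "\<And>x. x \<in> interior K \<Longrightarrow> 0 \<le> a \<bullet> x"
    using separating_hyperplane_set_0[OF convex_interior[OF cK(2)] n0] by blast
  have "closure (interior K) \<subseteq> {x. 0 \<le> a \<bullet> x}"
    using a(2) by (intro closure_minimal) (auto simp: closed_halfspace_ge)
  then have aK: "0 \<le> a \<bullet> x" if "x \<in> K" for x
    using that convex_closure_interior[OF cK(2) iK] closure_subset[of K] by blast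
  have eK: "emeasure lborel K \<noteq> 0"
  proof
    assume "emeasure lborel K = 0"
    then have "K \<in> null_sets lborel" using cK(1) by (auto simp: null_sets_def borel_compact)
    then have "negligible K" using negligible_iff_null_sets null_sets_completionI by blast
    then show False using negligible_imp_measure0 iK negligible_subset open_not_negligible[OF open_interior iK] interior_subset by metis
  qed
  have fin: "emeasure lborel K < \<infinity>" using compact_imp_bounded[OF cK(1)] by (rule emeasure_bounded_finite)
  then have mK: "measure lborel K \<noteq> 0" using eK by (simp add: measure_def enn2real_eq_0_iff)
  have int: "integrable lborel (\<lambda>x. indicator K x *\<^sub>R x)"
    using cK(1) by (rule borel_integrable_compact) (rule continuous_on_id)
  have "(\<integral>x. indicator K x *\<^sub>R x \<partial>lborel) = 0"
    using 0 mK unfolding centroid_def set_lebesgue_integral_def by simp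
  then have "(\<integral>x. a \<bullet> (indicator K x *\<^sub>R x) \<partial>lborel) = 0" by (subst integral_inner_right) (auto simp: int)
  moreover have "integrable lborel (\<lambda>x. a \<bullet> (indicator K x *\<^sub>R x))" using int by (intro integrable_inner_right) auto
  moreover have "AE x in lborel. 0 \<le> a \<bullet> (indicator K x *\<^sub>R x)" using aK by (auto simp: indicator_def)
  ultimately have "AE x in lborel. a \<bullet> (indicator K x *\<^sub>R x) = 0"
    using integral_nonneg_eq_0_iff_AE by blast
  moreover have "AE x in lborel. x \<notin> {x. a \<bullet> x = 0}"
  proof (rule AE_not_in)
    have "negligible {x. a \<bullet> x = 0}" using a(1) by (intro negligible_hyperplane) auto
    moreover have "{x. a \<bullet> x = 0} \<in> sets borel" using closed_hyperplane by (rule borel_closed)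
    ultimately show "{x. a \<bullet> x = 0} \<in> null_sets lborel"
      by (simp add: negligible_iff_null_sets null_sets_completion_iff)
  qed
  ultimately have "AE x in lborel. x \<notin> K" by eventually_elim (auto simp: indicator_def)
  then have "emeasure lborel K = 0" using cK(1) AE_iff_measurable[of K lborel "\<lambda>x. x \<notin> K"] by (simp add: borel_compact)
  then show False using eK by simp
qed

context polar_pair
begin

lemma affine_surface_area_eq:
  assumes p: "p \<noteq> - real CARD('n)"
  shows "affine_surface_area p K = (\<integral>\<^sup>+x. epowr (curvature_density x) (p / (real CARD('n) + p)) *
    ennreal (x \<bullet> outer_normal K x) \<partial>surface_area_measure K)"
  unfolding affine_surface_area_def Let_def
proof (rule nn_integral_cong)
  fix x assume "x \<in> space (surface_area_measure K)"
  then have x: "x \<in> frontier K" by (simp add: surface_area_measure_def space_restrict_space)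
  let ?n = "real CARD('n)" and ?s = "x \<bullet> outer_normal K x"
  have s: "0 < ?s" by (rule outer_normal_dual(1)[OF x])
  have e: "real (CARD('n) + 1) * (p / (?n + p)) - ?n * (p - 1) / (?n + p) = 1"
  proof -
    have "real (CARD('n) + 1) * p - ?n * (p - 1) = ?n + p" by (simp add: algebra_simps)
    moreover have "?n + p \<noteq> 0" using p by linarith
    ultimately show ?thesis by (simp add: diff_divide_distrib[symmetric])
  qed
  have "gauss_curvature K x = curvature_density x * ?s ^ (CARD('n) + 1)"
    using s by (simp add: curvature_density_def del: power_Suc)
  then show "epowr (gauss_curvature K x) (p / (?n + p)) / epowr ?s (?n * (p - 1) / (?n + p))
      = epowr (curvature_density x) (p / (?n + p)) * ennreal ?s"
    by (simp only: epowr_quotient[OF curvature_density_nonneg[OF x] s e])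
qed

text \<open>\<open>surface_integral_eq\<close> applies to Borel functions, and measurability of
  \<open>curvature_density\<close> is not established. Monotonicity of the nonnegative integral
  needs none, so it suffices to dominate the power by a Borel function on the boundary.\<close>

lemma affine_surface_area_le:
  assumes "F \<in> borel_measurable borel" "p \<noteq> - real CARD('n)"
    and "\<And>x. x \<in> frontier K \<Longrightarrow> epowr (curvature_density x) (p / (real CARD('n) + p)) \<le> F x"
  shows "affine_surface_area p K \<le> of_nat CARD('n) * (\<integral>\<^sup>+x. indicator K x * F (rad x) \<partial>lborel)"
  unfolding affine_surface_area_eq[OF assms(2)] surface_integral_eq[OF assms(1), symmetric]
  by (intro nn_integral_mono mult_right_mono assms(3)) (auto simp: surface_area_measure_def space_restrict_space)

lemma affine_surface_area_ge:
  assumes "F \<in> borel_measurable borel" "p \<noteq> - real CARD('n)"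
    and "\<And>x. x \<in> frontier K \<Longrightarrow> F x \<le> epowr (curvature_density x) (p / (real CARD('n) + p))"
  shows "of_nat CARD('n) * (\<integral>\<^sup>+x. indicator K x * F (rad x) \<partial>lborel) \<le> affine_surface_area p K"
  unfolding affine_surface_area_eq[OF assms(2)] surface_integral_eq[OF assms(1), symmetric]
  by (intro nn_integral_mono mult_right_mono assms(3)) (auto simp: surface_area_measure_def space_restrict_space)

definition volume_ratio :: real where
  "volume_ratio = measure lborel J / measure lborel K"

lemma emeasure_K_eq: "emeasure lborel K = ennreal (measure lborel K)"
  using emeasure_K_finite by (intro emeasure_eq_ennreal_measure) auto

lemma measure_K_pos: "0 < measure lborel K"
proof -
  obtain e where e: "e > 0" "ball 0 e \<subseteq> K" using interior_K by (meson mem_interior)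
  have "0 < emeasure lborel (ball (0 :: real^'n) e)" using e(1) by (simp add: emeasure_ball)
  also have "\<dots> \<le> emeasure lborel K" using e(2) by (intro emeasure_mono) auto
  finally show ?thesis by (simp add: emeasure_K_eq)
qed

end

context polar_pair
begin

interpretation dual: polar_pair J K
  by (rule polar_pair_sym) (rule polar_pair_axioms)

lemma volume_ratio_pos: "0 < volume_ratio"
  unfolding volume_ratio_def by (intro divide_pos_pos measure_K_pos dual.measure_K_pos)

text \<open>The reason for touching at \<open>volume_ratio\<close>: the linear term of the tangent
  integrates to the same multiple of the volume of \<open>K\<close> as its value at the point of
  contact, so the two coefficients add up to 1.\<close>

lemma volume_ratio_powr: "volume_ratio powr (a - 1) * measure lborel J = volume_ratio powr a * measure lborel K"
proof -
  have "measure lborel J = volume_ratio * measure lborel K" using measure_K_pos by (simp add: volume_ratio_def)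
  moreover have "volume_ratio powr (a - 1) * volume_ratio = volume_ratio powr a"
    using volume_ratio_pos by (simp add: powr_mult_base mult.commute)
  ultimately show ?thesis by (simp add: mult.assoc[symmetric])
qed

lemma nn_integral_K_const: "(\<integral>\<^sup>+x. indicator K x * c \<partial>lborel) = c * emeasure lborel K"
  by (subst mult.commute) (simp add: nn_integral_cmult_indicator)

lemma nn_integral_K_cmult:
  "F \<in> borel_measurable borel \<Longrightarrow>
    (\<integral>\<^sup>+x. indicator K x * (c * F (rad x)) \<partial>lborel) = c * (\<integral>\<^sup>+x. indicator K x * F (rad x) \<partial>lborel)"
  by (subst mult.left_commute) (simp add: nn_integral_cmult)

lemma affine_surface_area_upper:
  assumes p: "0 \<le> p"
  shows "affine_surface_area p K
    \<le> ennreal (real CARD('n) * (volume_ratio powr (p / (real CARD('n) + p)) * measure lborel K))"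
proof -
  let ?n = "real CARD('n)" and ?c = volume_ratio and ?V = "measure lborel K" and ?W = "measure lborel J"
  define a where "a = p / (?n + p)"
  have n: "0 < ?n" by simp
  have a: "0 \<le> a" "a \<le> 1" using p n by (auto simp: a_def divide_le_eq)
  define F where "F x = ennreal ((1 - a) * ?c powr a) + ennreal (a * ?c powr (a - 1)) * lower_image_ratio x" for x
  have [measurable]: "F \<in> borel_measurable borel" unfolding F_def[abs_def] by measurable
  have "affine_surface_area p K \<le> of_nat CARD('n) * (\<integral>\<^sup>+x. indicator K x * F (rad x) \<partial>lborel)"
  proof (rule affine_surface_area_le)
    show "p \<noteq> - ?n" using p n by linarith
    fix x assume x: "x \<in> frontier K"
    have "epowr (curvature_density x) a \<le> ennreal ((1 - a) * ?c powr a + a * ?c powr (a - 1) * curvature_density x)"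
    \<comment> \<open>At zero curvature the power is 0, unless \<open>a = 0\<close>, when it is 1
      and the tangent is the constant 1.\<close>
    proof (cases "curvature_density x = 0")
      case True
      then show ?thesis using a volume_ratio_pos by (auto simp: epowr_def)
    next
      case False
      then have "0 < curvature_density x" using curvature_density_nonneg[OF x] by simp
      then show ?thesis using powr_le_tangent[OF _ volume_ratio_pos a] by (simp add: epowr_pos ennreal_leI)
    qed
    also have "\<dots> = ennreal ((1 - a) * ?c powr a) + ennreal (a * ?c powr (a - 1)) * ennreal (curvature_density x)"
      using a curvature_density_nonneg[OF x] by (simp add: ennreal_mult)
    also have "\<dots> \<le> F x" unfolding F_def
      by (intro add_left_mono mult_left_mono curvature_density_le_lower_image_ratio x) simp
    finally show "epowr (curvature_density x) (p / (?n + p)) \<le> F x" by (simp add: a_def)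
  qed simp
  also have "(\<integral>\<^sup>+x. indicator K x * F (rad x) \<partial>lborel) =
      ennreal ((1 - a) * ?c powr a) * emeasure lborel K +
      ennreal (a * ?c powr (a - 1)) * (\<integral>\<^sup>+x. indicator K x * lower_image_ratio (rad x) \<partial>lborel)"
    unfolding F_def distrib_left by (subst nn_integral_add) (simp_all add: nn_integral_K_const nn_integral_K_cmult)
  also have "\<dots> \<le> ennreal ((1 - a) * ?c powr a) * ennreal ?V + ennreal (a * ?c powr (a - 1)) * ennreal ?W"
    unfolding emeasure_K_eq dual.emeasure_K_eq[symmetric]
    by (intro add_left_mono mult_left_mono lower_image_ratio_integral_le) simp
  also have "\<dots> = ennreal ((1 - a) * ?c powr a * ?V + a * ?c powr (a - 1) * ?W)"
    using a by (simp add: ennreal_mult)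
  also have "(1 - a) * ?c powr a * ?V + a * ?c powr (a - 1) * ?W = ?c powr a * ?V"
    by (simp only: mult.assoc volume_ratio_powr) (simp add: algebra_simps)
  finally show ?thesis
    by (simp add: a_def mult_left_mono ennreal_mult ennreal_of_nat_eq_real_of_nat)
qed

text \<open>One coefficient of the tangent is negative in each lower bound, which extended
  nonnegative numbers cannot express. The negative term is therefore moved across as
  \<open>X\<close>, and truncated subtraction \<open>A x - X x\<close> recovers the minorant.
  Finiteness of \<open>A\<close> keeps that subtraction faithful.\<close>

lemma affine_surface_area_lower_of_tangent:
  assumes p: "p \<noteq> - real CARD('n)" and a: "a = p / (real CARD('n) + p)"
    and m [measurable]: "A \<in> borel_measurable borel" "X \<in> borel_measurable borel"
    and AX: "\<And>x. x \<in> frontier K \<Longrightarrow> A x \<le> X x + epowr (curvature_density x) a"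
    and A: "\<And>x. A x < top"
    and y: "ennreal y \<le> (\<integral>\<^sup>+x. indicator K x * A (rad x) \<partial>lborel)"
    and x: "(\<integral>\<^sup>+x. indicator K x * X (rad x) \<partial>lborel) \<le> ennreal x" "0 \<le> x"
  shows "ennreal (real CARD('n) * (y - x)) \<le> affine_surface_area p K"
proof -
  let ?F = "\<lambda>x. A x - X x"
  have "ennreal y \<le> (\<integral>\<^sup>+x. indicator K x * ?F (rad x) + indicator K x * X (rad x) \<partial>lborel)"
    using y by (rule order_trans)
      (intro nn_integral_mono, use ennreal_minus_le_iff in \<open>auto simp: indicator_def add.commute\<close>)
  also have "\<dots> = (\<integral>\<^sup>+x. indicator K x * ?F (rad x) \<partial>lborel) + (\<integral>\<^sup>+x. indicator K x * X (rad x) \<partial>lborel)"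
    by (rule nn_integral_add) measurable
  finally have "ennreal (y - x) \<le> (\<integral>\<^sup>+x. indicator K x * ?F (rad x) \<partial>lborel)"
    using x by (rule le_of_add_le_ennreal)
  then have "of_nat CARD('n) * ennreal (y - x) \<le> of_nat CARD('n) * (\<integral>\<^sup>+x. indicator K x * ?F (rad x) \<partial>lborel)"
    by (rule mult_left_mono) simp
  also have "\<dots> \<le> affine_surface_area p K"
  proof (rule affine_surface_area_ge[OF _ p])
    fix z assume "z \<in> frontier K"
    then show "A z - X z \<le> epowr (curvature_density z) (p / (real CARD('n) + p))"
      using AX[of z] A[of z] unfolding a by (auto simp: ennreal_minus_le_iff)
  qed simp
  finally show ?thesis by (simp add: ennreal_mult' ennreal_of_nat_eq_real_of_nat)
qed

text \<open>Here \<open>a < 0\<close>, so the curvature enters the tangent with a negative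
  coefficient and may be replaced by its majorant \<open>lower_image_ratio\<close>, exactly as in
  the upper bound.\<close>

lemma affine_surface_area_lower:
  assumes p: "- real CARD('n) < p" "p < 0"
  shows "ennreal (real CARD('n) * (volume_ratio powr (p / (real CARD('n) + p)) * measure lborel K)) \<le> affine_surface_area p K"
proof -
  let ?n = "real CARD('n)" and ?c = volume_ratio and ?V = "measure lborel K" and ?W = "measure lborel J"
  define a where "a = p / (?n + p)"
  have a: "a < 0" using p by (auto simp: a_def divide_neg_pos)
  have "ennreal (?n * ((1 - a) * ?c powr a * ?V - (- a) * ?c powr (a - 1) * ?W)) \<le> affine_surface_area p K"
  proof (rule affine_surface_area_lower_of_tangent[where a = a
        and A = "\<lambda>_. ennreal ((1 - a) * ?c powr a)"
        and X = "\<lambda>x. ennreal (- a * ?c powr (a - 1)) * lower_image_ratio x"])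
    show "p \<noteq> - ?n" using p by linarith
    show "(\<lambda>x. ennreal (- a * ?c powr (a - 1)) * lower_image_ratio x) \<in> borel_measurable borel" by measurable
    fix x assume x: "x \<in> frontier K"
    show "ennreal ((1 - a) * ?c powr a) \<le> ennreal (- a * ?c powr (a - 1)) * lower_image_ratio x + epowr (curvature_density x) a"
    \<comment> \<open>At zero curvature the power is infinite, so the bound is trivial
      there.\<close>
    proof (cases "curvature_density x = 0")
      case True
      then show ?thesis using a by (simp add: epowr_def)
    next
      case False
      then have f: "0 < curvature_density x" using curvature_density_nonneg[OF x] by simp
      have "ennreal ((1 - a) * ?c powr a) \<le> ennreal (- a * ?c powr (a - 1) * curvature_density x + curvature_density x powr a)"
        using tangent_le_powr[OF f volume_ratio_pos, of a] a by (intro ennreal_leI) simp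
      also have "\<dots> = ennreal (- a * ?c powr (a - 1)) * ennreal (curvature_density x) + ennreal (curvature_density x powr a)"
      proof -
        have "0 \<le> - a * ?c powr (a - 1)" using a by (intro mult_nonneg_nonneg) auto
        then show ?thesis using f by (subst ennreal_plus) (simp_all only: ennreal_mult less_imp_le mult_nonneg_nonneg powr_ge_zero)
      qed
      also have "\<dots> \<le> ennreal (- a * ?c powr (a - 1)) * lower_image_ratio x + epowr (curvature_density x) a"
        using f by (intro add_mono mult_left_mono curvature_density_le_lower_image_ratio x) (auto simp: epowr_pos)
      finally show ?thesis .
    qed
  next
    show "ennreal ((1 - a) * ?c powr a * ?V) \<le> (\<integral>\<^sup>+x. indicator K x * ennreal ((1 - a) * ?c powr a) \<partial>lborel)"
      unfolding nn_integral_K_const emeasure_K_eq using a by (simp add: ennreal_mult)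
    have "(\<integral>\<^sup>+x. indicator K x * (ennreal (- a * ?c powr (a - 1)) * lower_image_ratio (rad x)) \<partial>lborel)
      \<le> ennreal (- a * ?c powr (a - 1)) * emeasure lborel J"
      unfolding nn_integral_K_cmult[OF lower_image_ratio_measurable]
      by (intro mult_left_mono lower_image_ratio_integral_le) simp
    also have "\<dots> = ennreal (- a * ?c powr (a - 1) * ?W)"
      unfolding dual.emeasure_K_eq by (rule ennreal_mult''[symmetric]) simp
    finally show "(\<integral>\<^sup>+x. indicator K x * (ennreal (- a * ?c powr (a - 1)) * lower_image_ratio (rad x)) \<partial>lborel)
      \<le> ennreal (- a * ?c powr (a - 1) * ?W)" .
    show "0 \<le> - a * ?c powr (a - 1) * ?W" using a by (intro mult_nonneg_nonneg) auto
  qed (simp_all add: a_def)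
  also have "(1 - a) * ?c powr a * ?V - (- a) * ?c powr (a - 1) * ?W = ?c powr a * ?V"
    by (simp only: mult.assoc volume_ratio_powr) (simp add: algebra_simps)
  finally show ?thesis by (simp add: a_def)
qed

text \<open>Here \<open>a > 1\<close>, so the curvature enters with a positive coefficient and its
  integral must be bounded from below by the volume of \<open>J\<close>; the constant term of the
  tangent is the negative one.\<close>

lemma affine_surface_area_lower_smooth:
  assumes p: "p < - real CARD('n)" and ex: "\<And>x. x \<in> frontier K \<Longrightarrow> \<exists>A. is_curvature_matrix K x A"
  shows "ennreal (real CARD('n) * (volume_ratio powr (p / (real CARD('n) + p)) * measure lborel K)) \<le> affine_surface_area p K"
proof -
  let ?n = "real CARD('n)" and ?c = volume_ratio and ?V = "measure lborel K" and ?W = "measure lborel J"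
  define a where "a = p / (?n + p)"
  have n: "0 < ?n" by simp
  have a: "1 < a" using p n by (simp add: a_def less_divide_eq)
  obtain D where D: "D \<in> borel_measurable borel" "\<And>x. x \<in> frontier K \<Longrightarrow> D x = curvature_density x"
    "emeasure lborel J \<le> (\<integral>\<^sup>+x. indicator K x * ennreal (D (rad x)) \<partial>lborel)"
    using polar_volume_le_curvature_integral[OF ex] by blast
  note D(1)[measurable]
  have "ennreal (?n * (a * ?c powr (a - 1) * ?W - (a - 1) * ?c powr a * ?V)) \<le> affine_surface_area p K"
  proof (rule affine_surface_area_lower_of_tangent[where a = a
        and A = "\<lambda>x. ennreal (a * ?c powr (a - 1)) * ennreal (D x)"
        and X = "\<lambda>_. ennreal ((a - 1) * ?c powr a)"])
    show "p \<noteq> - ?n" using p by linarith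
    show "(\<lambda>x. ennreal (a * ?c powr (a - 1)) * ennreal (D x)) \<in> borel_measurable borel" by measurable
    fix x assume x: "x \<in> frontier K"
    have "ennreal (a * ?c powr (a - 1)) * ennreal (D x) = ennreal (a * ?c powr (a - 1) * curvature_density x)"
      using a curvature_density_nonneg[OF x] D(2)[OF x] by (simp add: ennreal_mult)
    also have "\<dots> \<le> ennreal ((a - 1) * ?c powr a) + epowr (curvature_density x) a"
    proof (cases "curvature_density x = 0")
      case False
      then have f: "0 < curvature_density x" using curvature_density_nonneg[OF x] by simp
      have "ennreal (a * ?c powr (a - 1) * curvature_density x) \<le> ennreal ((a - 1) * ?c powr a + curvature_density x powr a)"
        using tangent_le_powr[OF f volume_ratio_pos, of a] a by (intro ennreal_leI) (simp add: algebra_simps)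
      also have "\<dots> = ennreal ((a - 1) * ?c powr a) + epowr (curvature_density x) a"
        using f a by (simp add: epowr_pos)
      finally show ?thesis .
    qed simp
    finally show "ennreal (a * ?c powr (a - 1)) * ennreal (D x) \<le> ennreal ((a - 1) * ?c powr a) + epowr (curvature_density x) a" .
  next
    have "ennreal (a * ?c powr (a - 1) * ?W) = ennreal (a * ?c powr (a - 1)) * emeasure lborel J"
      unfolding dual.emeasure_K_eq by (rule ennreal_mult'') simp
    also have "\<dots> \<le> ennreal (a * ?c powr (a - 1)) * (\<integral>\<^sup>+x. indicator K x * ennreal (D (rad x)) \<partial>lborel)"
      by (intro mult_left_mono D(3)) simp
    also have "\<dots> = (\<integral>\<^sup>+x. indicator K x * (ennreal (a * ?c powr (a - 1)) * ennreal (D (rad x))) \<partial>lborel)"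
      by (rule nn_integral_K_cmult[symmetric]) measurable
    finally show "ennreal (a * ?c powr (a - 1) * ?W) \<le> (\<integral>\<^sup>+x. indicator K x * (ennreal (a * ?c powr (a - 1)) * ennreal (D (rad x))) \<partial>lborel)" .
    show "(\<integral>\<^sup>+x. indicator K x * ennreal ((a - 1) * ?c powr a) \<partial>lborel) \<le> ennreal ((a - 1) * ?c powr a * ?V)"
      unfolding nn_integral_K_const emeasure_K_eq using a by (simp add: ennreal_mult)
    show "0 \<le> (a - 1) * ?c powr a * ?V" using a by (intro mult_nonneg_nonneg) auto
  qed (simp_all add: a_def ennreal_mult_less_top)
  also have "a * ?c powr (a - 1) * ?W - (a - 1) * ?c powr a * ?V = ?c powr a * ?V"
    by (simp only: mult.assoc volume_ratio_powr) (simp add: algebra_simps)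
  finally show ?thesis by (simp add: a_def)
qed

end

context polar_pair
begin

interpretation dual: polar_pair J K
  by (rule polar_pair_sym) (rule polar_pair_axioms)

lemma bounds_product:
  "ennreal (real CARD('n) * (volume_ratio powr a * measure lborel K)) *
    ennreal (real CARD('n) * (dual.volume_ratio powr a * measure lborel J))
   = of_nat (CARD('n)\<^sup>2) * emeasure lborel K * emeasure lborel J"
proof -
  let ?n = "real CARD('n)" and ?V = "measure lborel K" and ?W = "measure lborel J"
  have "volume_ratio * dual.volume_ratio = 1"
    using measure_K_pos dual.measure_K_pos by (simp add: volume_ratio_def dual.volume_ratio_def)
  then have "volume_ratio powr a * dual.volume_ratio powr a = 1"
    using volume_ratio_pos dual.volume_ratio_pos by (simp add: powr_mult[symmetric])
  then have "(?n * (volume_ratio powr a * ?V)) * (?n * (dual.volume_ratio powr a * ?W)) = ?n\<^sup>2 * ?V * ?W"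
    by (simp add: power2_eq_square algebra_simps)
  then have "ennreal ((?n * (volume_ratio powr a * ?V)) * (?n * (dual.volume_ratio powr a * ?W))) = ennreal (?n\<^sup>2 * ?V * ?W)"
    by simp
  then show ?thesis
    unfolding emeasure_K_eq dual.emeasure_K_eq
    by (simp add: ennreal_mult ennreal_of_nat_eq_real_of_nat[of "CARD('n)\<^sup>2"] del: of_nat_power ennreal_of_nat_eq_real_of_nat) (simp add: ennreal_mult)
qed

end

theorem corollary4p1:
  fixes K :: "(real^'n) set"
  assumes "CARD('n) \<ge> 2" and "convex_body K" and "centroid K = 0"
  shows "(\<forall>p\<ge>0. affine_surface_area p K * affine_surface_area p (polar_body K)
                  \<le> of_nat (CARD('n)\<^sup>2) * emeasure lborel K * emeasure lborel (polar_body K))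
       \<and> (\<forall>p. - real CARD('n) < p \<and> p < 0 \<longrightarrow>
              affine_surface_area p K * affine_surface_area p (polar_body K)
                  \<ge> of_nat (CARD('n)\<^sup>2) * emeasure lborel K * emeasure lborel (polar_body K))
       \<and> (C2_plus K \<longrightarrow> (\<forall>p. p < - real CARD('n) \<longrightarrow>
              affine_surface_area p K * affine_surface_area p (polar_body K)
                  \<ge> of_nat (CARD('n)\<^sup>2) * emeasure lborel K * emeasure lborel (polar_body K)))"
proof -
  define J where "J = polar_body K"
  interpret polar_pair K J
    unfolding J_def by (rule polar_pair_polar_body[OF assms(2) centroid_zero_interior[OF assms(2,3)]])
  interpret dual: polar_pair J K
    by (rule polar_pair_sym) (rule polar_pair_axioms)
  have "affine_surface_area p K * affine_surface_area p J
      \<le> of_nat (CARD('n)\<^sup>2) * emeasure lborel K * emeasure lborel J" if "0 \<le> p" for p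
    unfolding bounds_product[of "p / (real CARD('n) + p)", symmetric]
    by (intro mult_mono affine_surface_area_upper dual.affine_surface_area_upper that) auto
  moreover have "of_nat (CARD('n)\<^sup>2) * emeasure lborel K * emeasure lborel J
      \<le> affine_surface_area p K * affine_surface_area p J" if "- real CARD('n) < p" "p < 0" for p
    unfolding bounds_product[of "p / (real CARD('n) + p)", symmetric]
    by (intro mult_mono affine_surface_area_lower dual.affine_surface_area_lower that) auto
  moreover have "of_nat (CARD('n)\<^sup>2) * emeasure lborel K * emeasure lborel J
      \<le> affine_surface_area p K * affine_surface_area p J" if C: "C2_plus K" and p: "p < - real CARD('n)" for p
  proof -
    have pos: "gauss_curvature K x > 0" if "x \<in> frontier K" for x
      using C that unfolding C2_plus_def by blast
    have ex: "\<exists>A. is_curvature_matrix K x A" if "x \<in> frontier K" for x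
      using pos[OF that] by (auto simp: gauss_curvature_def split: if_splits)
    \<comment> \<open>The bound for \<open>J\<close> requires curvature matrices on its boundary,
      while \<open>C2_plus\<close> speaks of \<open>K\<close>; duality supplies them.\<close>
    have ex': "\<exists>A. is_curvature_matrix J x A" if "x \<in> frontier J" for x
      using curvature_matrix_exists_dual pos that by blast
    show ?thesis
      unfolding bounds_product[of "p / (real CARD('n) + p)", symmetric]
      by (intro mult_mono affine_surface_area_lower_smooth dual.affine_surface_area_lower_smooth p ex ex') auto
  qed
  ultimately show ?thesis unfolding J_def by blast
qed

end
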